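(* Let $T>0$, $a,b>0$, $p>1$ and $\alpha\in(1/p,1]$ be constants, let $f\in C([0,T]\times\mathbb{R},\mathbb{R})$, and set $F(t,x)=\int_0^x f(t,s)\,ds$. Suppose that: (i) there exist a constant $1<r_1<p^2$ and a function $d\in L^1([0,T],\mathbb{R}^+)$ such that $|f(t,x)|\le r_1 d(t)|x|^{r_1-1}$ for all $(t,x)\in[0,T]\times\mathbb{R}$; (ii) there exist a (nonempty) open interval $\mathbb{I}\subset[0,T]$ and three constants $\eta,\delta>0$, $1<r_2<p$ such that $F(t,x)\ge\eta|x|^{r_2}$ for all $(t,x)\in\mathbb{I}\times[-\delta,\delta]$; (iii) $f(t,x)=-f(t,-x)$ for all $(t,x)\in[0,T]\times\mathbb{R}$. Then the Kirchhoff-type fractional $p$-Laplacian Dirichlet problem $$\left(a+b\int_0^T|{}_0D_t^\alpha u(t)|^p\,dt\right)^{p-1}{}_tD_T^\alpha\,\phi_p({}_0D_t^\alpha u(t))=f(t,u(t)),\quad t\in(0,T),\qquad u(0)=u(T)=0,$$ possesses infinitely many nontrivial (i.e. nonzero) weak solutions.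
   Context: $\phi_p:\mathbb{R}\to\mathbb{R}$ is defined by $\phi_p(s)=|s|^{p-2}s$ for $s\neq 0$ and $\phi_p(0)=0$. Fractional derivatives. For $\gamma>0$ the left and right Riemann-Liouville integrals on $[0,T]$ are ${}_0I_t^\gamma u(t)=\frac1{\Gamma(\gamma)}\int_0^t(t-s)^{\gamma-1}u(s)\,ds$ and ${}_tI_T^\gamma u(t)=\frac1{\Gamma(\gamma)}\int_t^T(s-t)^{\gamma-1}u(s)\,ds$. For $0<\alpha<1$, ${}_0D_t^\alpha u=\frac{d}{dt}\,{}_0I_t^{1-\alpha}u$ and ${}_tD_T^\alpha u=-\frac{d}{dt}\,{}_tI_T^{1-\alpha}u$; for $\alpha=1$, ${}_0D_t^1u=u'$ and ${}_tD_T^1u=-u'$. Function space. $E_0^{\alpha,p}$ is the closure of $C_0^\infty([0,T],\mathbb{R})$ (smooth functions on $[0,T]$ vanishing at $0$ and $T$; using smooth functions compactly supported in $(0,T)$ gives the same space for $1/p<\alpha\le 1$) with respect to the norm $(\|u\|_{L^p}^p+\|{}_0D_t^\alpha u\|_{L^p}^p)^{1/p}$; for $u$ in the closure, ${}_0D_t^\alpha u\in L^p([0,T],\mathbb{R})$ is the $L^p$-limit of the derivatives of an approximating sequence. The space is equipped with the equivalent norm $\|u\|_{E^{\alpha,p}}=\|{}_0D_t^\alpha u\|_{L^p}$. Since $\alpha>1/p$, its elements are continuous functions on $[0,T]$ with $u(0)=u(T)=0$. Weak solutions. A weak solution of the Dirichlet problem is a critical point $u\in E_0^{\alpha,p}$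 of the $C^1$ functional $$I(u)=\frac{1}{bp^2}\left(a+b\|u\|_{E^{\alpha,p}}^p\right)^p-\int_0^TF(t,u(t))\,dt-\frac{a^p}{bp^2},\qquad u\in E_0^{\alpha,p},$$ equivalently $u\in E_0^{\alpha,p}$ such that for all $v\in E_0^{\alpha,p}$ $$(a+b\|u\|_{E^{\alpha,p}}^p)^{p-1}\int_0^T\phi_p({}_0D_t^\alpha u(t))\,{}_0D_t^\alpha v(t)\,dt=\int_0^Tf(t,u(t))v(t)\,dt.$$ *)

theory Defs
  imports "HOL-Analysis.Analysis"
begin

subsection \<open>The Lebesgue spaces of the interval [0,T]\<close>

definition Lp :: "real \<Rightarrow> real \<Rightarrow> (real \<Rightarrow> real) set" where
  "Lp T p = {g \<in> borel_measurable (lebesgue_on {0..T}).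
               integrable (lebesgue_on {0..T}) (\<lambda>t. \<bar>g t\<bar> powr p)}"

definition Lp_norm :: "real \<Rightarrow> real \<Rightarrow> (real \<Rightarrow> real) \<Rightarrow> real" where
  "Lp_norm T p g = (\<integral>t. \<bar>g t\<bar> powr p \<partial>lebesgue_on {0..T}) powr (1 / p)"

definition Lp_converges :: "real \<Rightarrow> real \<Rightarrow> (nat \<Rightarrow> real \<Rightarrow> real) \<Rightarrow> (real \<Rightarrow> real) \<Rightarrow> bool" where
  "Lp_converges T p g h \<longleftrightarrow>
     (\<forall>n. g n \<in> Lp T p) \<and> h \<in> Lp T p \<and>
     (\<lambda>n. Lp_norm T p (\<lambda>t. g n t - h t)) \<longlonglongrightarrow> 0"

subsection \<open>Riemann--Liouville fractional calculus\<close>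

definition left_RL_integral :: "real \<Rightarrow> (real \<Rightarrow> real) \<Rightarrow> real \<Rightarrow> real" where
  "left_RL_integral \<gamma> u t =
     1 / Gamma \<gamma> * (LINT s:{0..t}|lebesgue. (t - s) powr (\<gamma> - 1) * u s)"

text \<open>The derivative is taken within [0,T], i.e. it is one-sided at the endpoints, so that
  only the values of the function on [0,T] matter.\<close>

definition left_RL_deriv :: "real \<Rightarrow> real \<Rightarrow> (real \<Rightarrow> real) \<Rightarrow> real \<Rightarrow> real" where
  "left_RL_deriv T \<alpha> u t =
     (if \<alpha> = 1 then vector_derivative u (at t within {0..T})
      else vector_derivative (left_RL_integral (1 - \<alpha>) u) (at t within {0..T}))"

subsection \<open>The fractional derivative space\<close>

text \<open>Smooth functions on [0,T] (the functions \<open>g n\<close> are the successive derivatives)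
  vanishing at both endpoints.\<close>

definition C0_infinity :: "real \<Rightarrow> (real \<Rightarrow> real) set" where
  "C0_infinity T = {\<phi>.
     (\<exists>g :: nat \<Rightarrow> real \<Rightarrow> real. g 0 = \<phi> \<and>
        (\<forall>n. \<forall>t\<in>{0..T}. (g n has_real_derivative g (Suc n) t) (at t within {0..T}))) \<and>
     \<phi> 0 = 0 \<and> \<phi> T = 0}"

text \<open>\<open>is_frac_deriv T \<alpha> p u w\<close>: the pair \<open>(u, w)\<close> lies in the closure, in the product of two
  copies of the p-th Lebesgue space, of the graph of the fractional derivative on smooth functions.
  For given \<open>u\<close> the function \<open>w\<close> is unique up to null sets.\<close>

definition is_frac_deriv ::
  "real \<Rightarrow> real \<Rightarrow> real \<Rightarrow> (real \<Rightarrow> real) \<Rightarrow> (real \<Rightarrow> real) \<Rightarrow> bool" where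
  "is_frac_deriv T \<alpha> p u w \<longleftrightarrow>
     (\<exists>\<phi>. (\<forall>n. \<phi> n \<in> C0_infinity T) \<and>
          Lp_converges T p \<phi> u \<and>
          Lp_converges T p (\<lambda>n. left_RL_deriv T \<alpha> (\<phi> n)) w)"

text \<open>Each element (an equivalence class modulo null sets) is represented by its continuous
  representative on [0,T], extended by 0 outside [0,T]. Thus distinct functions below are distinct
  elements of the space. The continuous representative exists, and vanishes at 0 and T, when
  \<open>1 / p < \<alpha>\<close>.\<close>

definition E_space :: "real \<Rightarrow> real \<Rightarrow> real \<Rightarrow> (real \<Rightarrow> real) set" where
  "E_space T \<alpha> p = {u. continuous_on {0..T} u \<and> (\<forall>t. t \<notin> {0..T} \<longrightarrow> u t = 0) \<and>
                         (\<exists>w. is_frac_deriv T \<alpha> p u w)}"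

definition frac_deriv :: "real \<Rightarrow> real \<Rightarrow> real \<Rightarrow> (real \<Rightarrow> real) \<Rightarrow> real \<Rightarrow> real" where
  "frac_deriv T \<alpha> p u = (SOME w. is_frac_deriv T \<alpha> p u w)"

definition E_norm :: "real \<Rightarrow> real \<Rightarrow> real \<Rightarrow> (real \<Rightarrow> real) \<Rightarrow> real" where
  "E_norm T \<alpha> p u = Lp_norm T p (frac_deriv T \<alpha> p u)"

subsection \<open>The energy functional and weak solutions\<close>

text \<open>The interval integral is oriented, as needed for negative \<open>x\<close>.\<close>

definition primitive :: "(real \<Rightarrow> real \<Rightarrow> real) \<Rightarrow> real \<Rightarrow> real \<Rightarrow> real" where
  "primitive f t x = (LBINT s=0..x. f t s)"

definition energy ::
  "real \<Rightarrow> real \<Rightarrow> real \<Rightarrow> real \<Rightarrow> real \<Rightarrow> (real \<Rightarrow> real \<Rightarrow> real) \<Rightarrow> (real \<Rightarrow> real) \<Rightarrow> real" where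
  "energy T a b p \<alpha> f u =
     1 / (b * p\<^sup>2) * (a + b * E_norm T \<alpha> p u powr p) powr p
     - (LINT t:{0..T}|lebesgue. primitive f t (u t))
     - a powr p / (b * p\<^sup>2)"

text \<open>On a linear space \<open>V\<close> of functions with norm \<open>N\<close>, the functional \<open>J\<close> is Frechet
  differentiable at \<open>u\<close> with derivative 0.\<close>

definition critical_point ::
  "(real \<Rightarrow> real) set \<Rightarrow> ((real \<Rightarrow> real) \<Rightarrow> real) \<Rightarrow> ((real \<Rightarrow> real) \<Rightarrow> real) \<Rightarrow> (real \<Rightarrow> real) \<Rightarrow> bool"
  where
  "critical_point V N J u \<longleftrightarrow> u \<in> V \<and>
     (\<forall>\<epsilon>>0. \<exists>\<delta>>0. \<forall>v\<in>V. N v < \<delta> \<longrightarrow> \<bar>J (\<lambda>t. u t + v t) - J u\<bar> \<le> \<epsilon> * N v)"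

text \<open>Weak solutions of the Dirichlet problem for the Kirchhoff-type fractional p-Laplacian
  equation with right-hand side \<open>f\<close>. The boundary conditions are contained in membership in
  \<^const>\<open>E_space\<close>.\<close>

definition weak_solution ::
  "real \<Rightarrow> real \<Rightarrow> real \<Rightarrow> real \<Rightarrow> real \<Rightarrow> (real \<Rightarrow> real \<Rightarrow> real) \<Rightarrow> (real \<Rightarrow> real) \<Rightarrow> bool" where
  "weak_solution T a b p \<alpha> f u \<longleftrightarrow>
     critical_point (E_space T \<alpha> p) (E_norm T \<alpha> p) (energy T a b p \<alpha> f) u"

end

theory Submission
  imports Defs "HOL-Library.Z2" "HOL-Computational_Algebra.Polynomial" "HOL-Complex_Analysis.Great_Picard"
begin

text \<open>The energy is \<open>\<Phi> - \<psi>\<close>, where \<open>\<Phi>\<close> is an even, strictly convex function of the norm and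
  \<open>\<psi> u = \<integral> F(t, u(t)) dt\<close> is even and continuous for uniform convergence; it is coercive because
  \<open>r1 < p^2\<close>. For a negative \<open>c\<close> the flow of Clark's theorem is replaced by the odd map \<open>K\<close> that sends
  \<open>u\<close> to the minimizer of the convex functional \<open>\<Phi> v - \<psi>' u v\<close>: its fixed points are the critical points,
  and the energy decreases along the segment from \<open>u\<close> to \<open>K u\<close>. Let \<open>c n\<close> be the infimum of the maximal
  energy over odd continuous images of an n-sphere. It is negative by (ii), applied to combinations of
  \<open>n + 1\<close> bumps with disjoint supports, and it is a critical value because otherwise \<open>K\<close> would push a
  nearly optimal sphere below it. By Borsuk--Ulam every such image contains a function vanishing at \<open>n\<close>
  equidistant points; such functions of bounded energy are uniformly small since the space embeds into a
  Hoelder space, so \<open>c n\<close> tends to 0 and there are infinitely many critical values. Borsuk--Ulam itself is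
  derived from Tucker's lemma on the Freudenthal triangulation of the cube.\<close>

section \<open>Tucker's lemma and the Borsuk--Ulam theorem\<close>

text \<open>A gradient flow would need a locally Lipschitz vector field, which a merely
  \<open>C^1\<close> functional does not provide. The map \<open>K\<close> rests only on strict
  convexity and on compactness of the sublevel sets of \<open>\<Phi>\<close>, and it is continuous
  for pointwise convergence on bounded sets. This weak continuity suffices: Borsuk--Ulam sees a
  sphere only through its values at finitely many points, and on the sphere the energy is bounded
  only from above. Convexity controls \<open>\<Phi>\<close> along a segment, while the Taylor
  remainder of \<open>\<psi>\<close> is small uniformly on bounded sets, so one step length serves
  the whole sphere. No formula for the derivative of \<open>\<Phi>\<close> enters: a fixed point of
  \<open>K\<close> provides an affine function that supports \<open>\<Phi>\<close>, and an estimate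
  of symmetric second differences turns this into differentiability. The bound \<open>p^2\<close>
  for \<open>r1\<close> is the growth order of \<open>\<Phi>\<close>, a p-th power of a p-th power
  of the norm. The combinatorial part is Ky Fan's parity count of alternating simplices in the field
  \<open>bit\<close>, taken over boundary faces of the cube, where the labelling is odd.\<close>

fun alternating :: "bool \<Rightarrow> int list \<Rightarrow> bool" where
  "alternating s [] = True"
| "alternating s (a # L) \<longleftrightarrow> (0 < a \<longleftrightarrow> s) \<and> (\<forall>b\<in>set L. \<bar>a\<bar> < \<bar>b\<bar>) \<and> alternating (\<not> s) L"

definition alternating_mset :: "bool \<Rightarrow> int multiset \<Rightarrow> bool" where
  "alternating_mset s M \<longleftrightarrow> (\<exists>L. mset L = M \<and> alternating s L)"

text \<open>The case \<open>a = b\<close> excludes the label 0 as well.\<close>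

definition complement_free :: "int set \<Rightarrow> bool" where
  "complement_free A \<longleftrightarrow> (\<forall>a\<in>A. \<forall>b\<in>A. a \<noteq> - b)"

lemma complement_free_subset: "complement_free A \<Longrightarrow> B \<subseteq> A \<Longrightarrow> complement_free B"
  by (auto simp: complement_free_def)

lemma complement_free_abs_eq: "complement_free A \<Longrightarrow> a \<in> A \<Longrightarrow> b \<in> A \<Longrightarrow> \<bar>a\<bar> = \<bar>b\<bar> \<Longrightarrow> a = b"
  by (auto simp: complement_free_def abs_eq_iff)

lemma alternating_sorted: "alternating s L \<Longrightarrow> sorted (map abs L) \<and> distinct (map abs L)"
  by (induction s L rule: alternating.induct) fastforce+

text \<open>For complement-free labels the absolute value determines the label, so sorting by
  absolute value is the only arrangement that can alternate.\<close>

lemma alternating_mset_sorted: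
  assumes "complement_free (set L)" "sorted (map abs L)"
  shows "alternating_mset s (mset L) \<longleftrightarrow> alternating s L"
proof
  assume "alternating_mset s (mset L)"
  then obtain L' where L': "mset L' = mset L" "alternating s L'"
    by (auto simp: alternating_mset_def)
  have set: "set L' = set L" using L'(1) by (metis set_mset_mset)
  have inj: "inj_on abs (set L')"
    using complement_free_abs_eq[OF assms(1)] set by (auto intro!: inj_onI)
  have "map abs L' = map abs L"
    using L' assms(2) alternating_sorted[of s L']
    by (metis mset_map properties_for_sort)
  then have "L' = L"
    using inj set by (simp add: inj_on_map_eq_map)
  then show "alternating s L" using L' by simp
qed (auto simp: alternating_mset_def)

definition remove_nth :: "nat \<Rightarrow> 'a list \<Rightarrow> 'a list" where
  "remove_nth j L = take j L @ drop (Suc j) L"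

lemma remove_nth_Cons [simp]:
  "remove_nth 0 (a # L) = L" "remove_nth (Suc j) (a # L) = a # remove_nth j L"
  by (auto simp: remove_nth_def)

lemma mset_remove_nth: "j < length L \<Longrightarrow> mset (remove_nth j L) = mset L - {#L ! j#}"
proof (induction L arbitrary: j)
  case (Cons a L)
  show ?case
  proof (cases j)
    case (Suc i)
    then have i: "i < length L" using Cons.prems by simp
    then have "L ! i \<in># mset L" by simp
    then have "add_mset a (mset L - {#L ! i#}) = add_mset a (mset L) - {#L ! i#}"
      by (simp only: diff_union_swap2 add_mset_remove_trivial_If)
    then show ?thesis using Cons.IH[OF i] Suc by simp
  qed simp
qed simp

lemma set_remove_nth: "set (remove_nth j L) \<subseteq> set L"
  by (auto simp: remove_nth_def dest: in_set_takeD in_set_dropD)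

lemma sorted_remove_nth: "sorted (map f L) \<Longrightarrow> sorted (map f (remove_nth j L))"
proof (induction L arbitrary: j)
  case (Cons a L)
  then show ?case
    using set_remove_nth by (cases j) fastforce+
qed (simp add: remove_nth_def)

lemma sum_lessThan_Cons:
  "(\<Sum>j<length (a # L). g j) = (g 0 :: 'b::comm_monoid_add) + (\<Sum>j<length L. g (Suc j))"
  using sum.lessThan_Suc_shift[of g "length L"] by (simp only: length_Cons)

lemma of_bool_bit_add_self [simp]: "(x::bit) + x = 0"
  by (cases x) auto

lemma alternating_facets_list:
  assumes "complement_free (set L)" "sorted (map abs L)" "L \<noteq> []"
  shows "(\<Sum>j<length L. of_bool (alternating s (remove_nth j L)) :: bit)
           = of_bool (alternating s L) + of_bool (alternating (\<not> s) L)"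
  using assms
proof (induction L arbitrary: s)
  case (Cons a L)
    show ?case
  proof (cases L)
    case Nil
    then show ?thesis by auto
  next
    case L: (Cons b K)
    have cf: "complement_free (set L)" and srt: "sorted (map abs L)"
      using Cons.prems complement_free_subset[of "set (a # L)" "set L"] by auto
    have ab: "\<bar>a\<bar> \<le> \<bar>b\<bar>" using Cons.prems L by auto
    have less_all: "\<forall>c\<in>set L. \<bar>a\<bar> < \<bar>c\<bar>" if "\<bar>a\<bar> < \<bar>b\<bar>"
      using srt L that by fastforce
    have IH: "(\<Sum>j<length L. of_bool (alternating s' (remove_nth j L)) :: bit)
       = of_bool (alternating s' L) + of_bool (alternating (\<not> s') L)" for s'
      using Cons.IH[OF cf srt] L by simp
    show ?thesis
    proof (cases "\<bar>a\<bar> < \<bar>b\<bar>")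
      case True
      note la = less_all[OF True]
      then have "\<forall>c\<in>set (remove_nth j L). \<bar>a\<bar> < \<bar>c\<bar>" for j
        using set_remove_nth[of j L] by blast
      then have "(\<Sum>j<length (a # L). of_bool (alternating s (remove_nth j (a # L))) :: bit)
          = of_bool (alternating s L) +
            (\<Sum>j<length L. of_bool ((0 < a \<longleftrightarrow> s) \<and> alternating (\<not> s) (remove_nth j L)))"
        by (simp only: sum_lessThan_Cons remove_nth_Cons alternating.simps) simp
      also have "\<dots> = of_bool (alternating s (a # L)) + of_bool (alternating (\<not> s) (a # L))"
      proof (cases "0 < a \<longleftrightarrow> s")
        case True
        then show ?thesis using IH[of "\<not> s"] la by (simp add: add.left_commute)
      next
        case False
        then have "(0 < a \<longleftrightarrow> \<not> s)" by blast
        then show ?thesis using False la by simp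
      qed
      finally show ?thesis .
    next
      case False
      \<comment> \<open>The least absolute value occurs twice: deleting either copy leaves the same
        list, so these two terms cancel, and every other deletion keeps both copies.\<close>
      then have "a = b" using ab complement_free_abs_eq[OF Cons.prems(1), of a b] L by auto
      have "\<not> (\<forall>c\<in>set (remove_nth (Suc j) L). \<bar>a\<bar> < \<bar>c\<bar>)" for j
        using L \<open>a = b\<close> by simp
      then have "(\<Sum>j<length (a # L). of_bool (alternating s (remove_nth j (a # L))) :: bit)
          = of_bool (alternating s L) + of_bool (alternating s (a # K))"
        unfolding L by (simp only: sum_lessThan_Cons remove_nth_Cons alternating.simps) simp
      also have "\<dots> = 0" using L \<open>a = b\<close> by simp
      also have "\<dots> = of_bool (alternating s (a # L)) + of_bool (alternating (\<not> s) (a # L))"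
        using L \<open>a = b\<close> by simp
      finally show ?thesis .
    qed
  qed
qed simp

lemma alternating_facets:
  assumes cf: "complement_free (set_mset M)" and "M \<noteq> {#}"
  shows "(\<Sum>x\<in>#M. of_bool (alternating_mset s (M - {#x#})) :: bit)
           = of_bool (alternating_mset s M) + of_bool (alternating_mset (\<not> s) M)"
proof -
  obtain K where K: "mset K = M" using ex_mset by blast
  define L where "L = sort_key abs K"
  have L: "mset L = M" "sorted (map abs L)" using K by (auto simp: L_def)
  have set: "set L = set_mset M" using L by auto
  have cfL: "complement_free (set L)" using cf set by simp
  have ne: "L \<noteq> []" using assms(2) L by auto
  have "(\<Sum>x\<in>#M. of_bool (alternating_mset s (M - {#x#})) :: bit)
      = (\<Sum>x\<leftarrow>L. of_bool (alternating_mset s (M - {#x#})))"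
    by (metis (mono_tags, lifting) L(1) mset_map sum_mset_sum_list)
  also have "\<dots> = (\<Sum>j<length L. of_bool (alternating_mset s (M - {#L ! j#})))"
    by (simp add: sum_list_sum_nth atLeast0LessThan)
  also have "\<dots> = (\<Sum>j<length L. of_bool (alternating s (remove_nth j L)))"
  proof (rule sum.cong)
    fix j assume "j \<in> {..<length L}"
    then have "alternating_mset s (M - {#L ! j#}) = alternating_mset s (mset (remove_nth j L))"
      by (simp add: mset_remove_nth L)
    also have "\<dots> = alternating s (remove_nth j L)"
      by (intro alternating_mset_sorted sorted_remove_nth L complement_free_subset[OF cfL set_remove_nth])
    finally show "of_bool (alternating_mset s (M - {#L ! j#})) =
        (of_bool (alternating s (remove_nth j L)) :: bit)" by simp
  qed simp
  also have "\<dots> = of_bool (alternating s L) + of_bool (alternating (\<not> s) L)"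
    by (rule alternating_facets_list[OF cfL L(2) ne])
  also have "\<dots> = of_bool (alternating_mset s M) + of_bool (alternating_mset (\<not> s) M)"
    using alternating_mset_sorted[OF cfL L(2)] L(1) by simp
  finally show ?thesis .
qed

lemma alternating_uminus:
  "0 \<notin> set L \<Longrightarrow> alternating s (map uminus L) \<longleftrightarrow> alternating (\<not> s) L"
  by (induction L arbitrary: s) (auto)

lemma alternating_mset_uminus:
  assumes "0 \<notin># M"
  shows "alternating_mset s (image_mset uminus M) \<longleftrightarrow> alternating_mset (\<not> s) M"
proof -
  have *: "alternating_mset (\<not> s) M \<Longrightarrow> alternating_mset s (image_mset uminus M)"
    if "0 \<notin># M" for s and M :: "int multiset"
  proof -
    assume "alternating_mset (\<not> s) M"
    then obtain L where "mset L = M" "alternating (\<not> s) L" by (auto simp: alternating_mset_def)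
    then show ?thesis using alternating_uminus[of L s] that
      unfolding alternating_mset_def by (intro exI[of _ "map uminus L"]) auto
  qed
  have "image_mset uminus (image_mset uminus M) = M" by (simp add: image_mset.compositionality comp_def)
  moreover have "0 \<notin># image_mset uminus M" using assms by auto
  ultimately show ?thesis using *[of M s] *[of "image_mset uminus M" "\<not> s"] assms by (metis (full_types))
qed

section \<open>Facets of the Freudenthal triangulation, counted modulo 2\<close>

lemma sum_fixpoint_free_involution:
  fixes g :: "'a \<Rightarrow> bit"
  assumes "finite A" and "\<And>x. x \<in> A \<Longrightarrow> i x \<in> A" and "\<And>x. x \<in> A \<Longrightarrow> i (i x) = x"
    and "\<And>x. x \<in> A \<Longrightarrow> i x \<noteq> x" and "\<And>x. x \<in> A \<Longrightarrow> g (i x) = g x"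
  shows "sum g A = 0"
  using assms
proof (induction "card A" arbitrary: A rule: less_induct)
  case less
  show ?case
  proof (cases "A = {}")
    case False
    then obtain x where x: "x \<in> A" by auto
    define B where "B = A - {x, i x}"
    have ix: "i x \<in> A" "i x \<noteq> x" using less.prems x by auto
    have B: "i y \<in> B" if "y \<in> B" for y
      using that less.prems(2,3) x ix by (auto simp: B_def) metis+
    have "sum g B = 0"
    proof (rule less.hyps)
      show "card B < card A" unfolding B_def using less.prems(1) x
        by (intro psubset_card_mono) auto
      show "\<And>y. y \<in> B \<Longrightarrow> i y \<in> B" by (rule B)
      show "finite B" using less.prems(1) by (simp add: B_def)
    qed (use less.prems in \<open>auto simp: B_def\<close>)
    moreover have "A = insert x (insert (i x) B)" using x ix by (auto simp: B_def)
    moreover have "x \<notin> insert (i x) B" "i x \<notin> B" "finite B"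
      using ix less.prems(1) by (auto simp: B_def)
    ultimately show ?thesis using less.prems(5)[OF x]
      by (simp add: ac_simps flip: add.assoc)
  qed simp
qed

text \<open>Simplices of the Freudenthal triangulation of the grid: \<open>(x, is)\<close> stands for the path that
  starts at \<open>x\<close> and increases the coordinates \<open>is\<close> one after the other.\<close>

definition grid_vertex :: "(nat \<Rightarrow> int) \<Rightarrow> nat list \<Rightarrow> nat \<Rightarrow> nat \<Rightarrow> int" where
  "grid_vertex x is j = (\<lambda>i. x i + of_bool (i \<in> set (take j is)))"

text \<open>A face of the cube \<open>[-N, N]^n\<close> is encoded by the set \<open>S\<close> of signed coordinates that are fixed:
  \<open>i + 1 \<in> S\<close> means that coordinate \<open>i\<close> equals \<open>N\<close>, \<open>- (i + 1) \<in> S\<close> that it equals \<open>- N\<close>.\<close>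

definition free_coords :: "nat \<Rightarrow> int set \<Rightarrow> nat set" where
  "free_coords n S = {i. i < n \<and> int (Suc i) \<notin> S \<and> - int (Suc i) \<notin> S}"

text \<open>In a free direction \<open>x\<close> is the lower corner of a unit cube, hence the
  strict bound \<open>x i < N\<close>. Fixing the coordinates from \<open>n\<close> on to 0 makes
  the encoding unique and the set finite.\<close>

definition face_simplices :: "nat \<Rightarrow> int \<Rightarrow> int set \<Rightarrow> ((nat \<Rightarrow> int) \<times> nat list) set" where
  "face_simplices n N S = {(x, is). distinct is \<and> set is = free_coords n S \<and>
     (\<forall>i\<in>free_coords n S. - N \<le> x i \<and> x i < N) \<and>
     (\<forall>i<n. int (Suc i) \<in> S \<longrightarrow> x i = N) \<and> (\<forall>i<n. - int (Suc i) \<in> S \<longrightarrow> x i = - N) \<and>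
     (\<forall>i\<ge>n. x i = 0)}"

text \<open>The index set \<open>J\<close> lets one function describe a simplex, with
  \<open>{0..length is}\<close>, and its facets, with one index removed.\<close>

definition simplex_labels :: "((nat \<Rightarrow> int) \<Rightarrow> int) \<Rightarrow> (nat \<Rightarrow> int) \<Rightarrow> nat list \<Rightarrow> nat set \<Rightarrow> int multiset" where
  "simplex_labels lab x is J = image_mset (\<lambda>j. lab (grid_vertex x is j)) (mset_set J)"

definition count_alternating :: "((nat \<Rightarrow> int) \<Rightarrow> int) \<Rightarrow> nat \<Rightarrow> int \<Rightarrow> bool \<Rightarrow> int set \<Rightarrow> bit" where
  "count_alternating lab n N s S =
     (\<Sum>(x, is)\<in>face_simplices n N S. of_bool (alternating_mset s (simplex_labels lab x is {0..length is})))"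

lemma finite_free_coords [simp]: "finite (free_coords n S)"
  by (simp add: free_coords_def)

lemma finite_face_simplices: "finite (face_simplices n N S)"
proof -
  let ?X = "{x. \<forall>i. (i \<in> {..<n} \<longrightarrow> x i \<in> {-\<bar>N\<bar>..\<bar>N\<bar>}) \<and> (i \<notin> {..<n} \<longrightarrow> x i = 0)}"
  have "finite ?X" by (intro finite_set_of_finite_funs) auto
  moreover have "finite {is. set is \<subseteq> {..<n} \<and> length is \<le> n}"
    by (intro finite_lists_length_le) auto
  moreover have *: "x \<in> ?X \<and> set is \<subseteq> {..<n} \<and> length is \<le> n" if "(x, is) \<in> face_simplices n N S" for x "is"
  proof (intro conjI)
    have s: "distinct is" "set is = free_coords n S" "\<And>i. i \<in> free_coords n S \<Longrightarrow> - N \<le> x i \<and> x i < N"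
     "\<And>i. i < n \<Longrightarrow> int (Suc i) \<in> S \<Longrightarrow> x i = N" "\<And>i. i < n \<Longrightarrow> - int (Suc i) \<in> S \<Longrightarrow> x i = - N"
     "\<And>i. i \<ge> n \<Longrightarrow> x i = 0"
      using that by (auto simp: face_simplices_def)
    show "x \<in> ?X"
    proof (intro CollectI allI conjI impI)
      fix i assume "i \<in> {..<n}"
      then have "i \<in> free_coords n S \<or> x i = N \<or> x i = - N"
        using s(4)[of i] s(5)[of i] unfolding free_coords_def by blast
      then show "x i \<in> {-\<bar>N\<bar>..\<bar>N\<bar>}" using s(3)[of i] by auto
    qed (use s(6) in auto)
    show "set is \<subseteq> {..<n}" using s(2) by (auto simp: free_coords_def)
    have "length is = card (free_coords n S)" using s(1,2) by (metis distinct_card)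
    also have "\<dots> \<le> card {..<n}" by (intro card_mono) (auto simp: free_coords_def)
    finally show "length is \<le> n" by simp
  qed
  have "face_simplices n N S \<subseteq> ?X \<times> {is. set is \<subseteq> {..<n} \<and> length is \<le> n}"
    using * by (intro subrelI, unfold mem_Times_iff fst_conv snd_conv mem_Collect_eq) blast
  ultimately show ?thesis by (meson finite_SigmaI finite_subset)
qed

lemma length_face_simplex: "(x, is) \<in> face_simplices n N S \<Longrightarrow> length is = card (free_coords n S)"
  by (auto simp: face_simplices_def distinct_card[symmetric])

text \<open>The two orders of the steps visit the same vertices except the one with index
  \<open>j\<close>.\<close>

lemma facet_labels_swap:
  assumes "0 < j" "j < length is"
  shows "simplex_labels lab x (is[j - 1 := is ! j, j := is ! (j - 1)]) ({0..length is} - {j})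
       = simplex_labels lab x is ({0..length is} - {j})"
  unfolding simplex_labels_def
proof (rule image_mset_cong)
  fix m assume "m \<in># mset_set ({0..length is} - {j})"
  then have m: "m \<le> length is" "m \<noteq> j" by auto
  let ?k = "is[j - 1 := is ! j, j := is ! (j - 1)]"
  have "set (take m ?k) = set (take m is)"
  proof (cases "m < j")
    case True
    then show ?thesis by (simp add: take_update_cancel)
  next
    case False
    then have "j < m" using m by simp
    then have "take m ?k = (take m is)[j - 1 := take m is ! j, j := take m is ! (j - 1)]"
      by (simp add: take_update_swap)
    moreover have "set ((take m is)[j - 1 := take m is ! j, j := take m is ! (j - 1)]) = set (take m is)"
      using \<open>j < m\<close> assms m by (intro set_swap) auto
    ultimately show ?thesis by simp
  qed
  then show "lab (grid_vertex x ?k m) = lab (grid_vertex x is m)"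
    by (simp add: grid_vertex_def)
qed

lemma grid_vertex_upd:
  assumes "i \<notin> set is" "j \<le> length is"
  shows "grid_vertex x (i # is) (Suc j) = grid_vertex (x(i := x i + 1)) (is @ ks) j"
  using assms by (auto simp: grid_vertex_def fun_eq_iff dest: in_set_takeD)

text \<open>Forgetting the starting vertex leaves a path that begins at the second vertex. The tail
  \<open>ks\<close> covers two situations: \<open>[i]\<close> gives the neighbouring simplex,
  \<open>[]\<close> gives the facet as a simplex of a boundary face.\<close>

lemma facet_labels_rotate:
  assumes "i \<notin> set is"
  shows "simplex_labels lab x (i # is) ({0..Suc (length is)} - {0})
       = simplex_labels lab (x(i := x i + 1)) (is @ ks) {0..length is}"
proof -
  have "{0..Suc (length is)} - {0} = Suc ` {0..length is}"
    by auto
  then have *: "mset_set ({0..Suc (length is)} - {0}) = image_mset Suc (mset_set {0..length is})"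
    by (simp add: image_mset_mset_set)
  show ?thesis
    unfolding simplex_labels_def * image_mset.compositionality comp_def
  proof (rule image_mset_cong)
    fix j assume "j \<in># mset_set {0..length is}"
    then show "lab (grid_vertex x (i # is) (Suc j)) = lab (grid_vertex (x(i := x i + 1)) (is @ ks) j)"
      using grid_vertex_upd[OF assms, of j x ks] by simp
  qed
qed

lemma facet_labels_last:
  "simplex_labels lab x (is @ ks) {0..length is} = simplex_labels lab x is {0..length is}"
  unfolding simplex_labels_def by (intro image_mset_cong) (auto simp: grid_vertex_def)

text \<open>The facet of a simplex opposite to an inner vertex of the path belongs to exactly one other
  simplex (swap two consecutive steps); for the first and last vertex the neighbour is obtained by
  rotating the path, unless the facet lies on the boundary of the cube.\<close>

definition neighbour :: "((nat \<Rightarrow> int) \<times> nat list) \<times> nat \<Rightarrow> ((nat \<Rightarrow> int) \<times> nat list) \<times> nat" where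
  "neighbour = (\<lambda>((x, is), j).
     if j = 0 then ((x(hd is := x (hd is) + 1), tl is @ [hd is]), length is)
     else if j = length is then ((x(last is := x (last is) - 1), last is # butlast is), 0)
     else ((x, is[j - 1 := is ! j, j := is ! (j - 1)]), j))"

definition facet_is_upper :: "int \<Rightarrow> ((nat \<Rightarrow> int) \<times> nat list) \<times> nat \<Rightarrow> bool" where
  "facet_is_upper N = (\<lambda>((x, is), j). j = 0 \<and> x (hd is) + 1 = N)"

definition facet_is_lower :: "int \<Rightarrow> ((nat \<Rightarrow> int) \<times> nat list) \<times> nat \<Rightarrow> bool" where
  "facet_is_lower N = (\<lambda>((x, is), j). j = length is \<and> x (last is) = - N)"

definition facet_alternating :: "((nat \<Rightarrow> int) \<Rightarrow> int) \<Rightarrow> ((nat \<Rightarrow> int) \<times> nat list) \<times> nat \<Rightarrow> bit" where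
  "facet_alternating lab = (\<lambda>((x, is), j).
     of_bool (alternating_mset True (simplex_labels lab x is ({0..length is} - {j}))))"

lemma inner_facets_cancel:
  assumes "free_coords n S \<noteq> {}"
  shows "sum (facet_alternating lab) {(\<sigma>, j) \<in> face_simplices n N S \<times> {0..card (free_coords n S)}.
      \<not> facet_is_upper N (\<sigma>, j) \<and> \<not> facet_is_lower N (\<sigma>, j)} = 0" (is "sum _ ?A = 0")
proof (rule sum_fixpoint_free_involution[where i = neighbour])
  have ne: "is \<noteq> []" if "(x, is) \<in> face_simplices n N S" for x "is"
    using that assms(1) by (auto simp: face_simplices_def)
  show "finite ?A"
    by (rule finite_subset[of _ "face_simplices n N S \<times> {0..card (free_coords n S)}"])
      (auto simp: finite_face_simplices)
  fix a assume "a \<in> ?A"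
  then obtain x "is" j where a': "a = ((x, is), j)" "(x, is) \<in> face_simplices n N S"
      "j \<le> card (free_coords n S)" "\<not> facet_is_upper N ((x, is), j)" "\<not> facet_is_lower N ((x, is), j)"
    by (cases a) auto
  then have a: "a = ((x, is), j)" "(x, is) \<in> face_simplices n N S" "j \<le> length is"
      "\<not> (j = 0 \<and> x (hd is) + 1 = N)" "\<not> (j = length is \<and> x (last is) = - N)"
    by (simp_all add: facet_is_upper_def facet_is_lower_def length_face_simplex[OF a'(2)])
  note isne = ne[OF a(2)]
  have len: "length is = card (free_coords n S)" using a(2) length_face_simplex by blast
  have fs: "distinct is" "set is = free_coords n S" "\<And>i. i \<in> set is \<Longrightarrow> - N \<le> x i \<and> x i < N"
     "\<And>i. i < n \<Longrightarrow> int (Suc i) \<in> S \<Longrightarrow> x i = N" "\<And>i. i < n \<Longrightarrow> - int (Suc i) \<in> S \<Longrightarrow> x i = - N" "\<And>i. i \<ge> n \<Longrightarrow> x i = 0"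
    using a(2) by (auto simp: face_simplices_def)
  consider (first) "j = 0" | (last) "j = length is" | (mid) "0 < j" "j < length is"
    using a(3) by linarith
  then have "neighbour a \<in> ?A \<and> neighbour (neighbour a) = a \<and> neighbour a \<noteq> a \<and>
      facet_alternating lab (neighbour a) = facet_alternating lab a"
  proof cases
    case first
    obtain i k where ik: "is = i # k" using isne by (cases "is") auto
    have i: "i \<in> free_coords n S" using fs ik by auto
    have i': "i < n" "int (Suc i) \<notin> S" "- int (Suc i) \<notin> S" using i by (auto simp: free_coords_def)
    \<comment> \<open>Here the facets in the face where coordinate \<open>i\<close> equals
      \<open>N\<close> have to be excluded, because the rotated simplex starts at
      \<open>x i + 1\<close>.\<close>
    have xi: "x i + 1 < N" "- N \<le> x i + 1" using a(4) first ik fs(3)[of i] by auto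
    have nb: "neighbour a = ((x(i := x i + 1), k @ [i]), length is)"
      using a(1) first ik by (simp add: neighbour_def)
    have mem: "(x(i := x i + 1), k @ [i]) \<in> face_simplices n N S"
      using fs ik i' xi unfolding face_simplices_def by (auto simp: )
    have "neighbour a \<in> ?A" unfolding nb using mem len ik fs(3)[of i] isne
      by (auto simp: facet_is_upper_def facet_is_lower_def)
    moreover have "neighbour (neighbour a) = a"
      unfolding nb using a(1) first ik by (simp add: neighbour_def)
    moreover have "neighbour a \<noteq> a" unfolding nb using a(1) first ik by simp
    moreover have "facet_alternating lab (neighbour a) = facet_alternating lab a"
    proof -
      have "{0..length is} - {length is} = {0..length k}" using ik by auto
      then show ?thesis unfolding nb using a(1) first ik fs(1)
        facet_labels_rotate[of i k lab x "[i]"]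
        by (simp add: facet_alternating_def)
    qed
    ultimately show ?thesis by blast
  next
    case last
    obtain i k where ik: "is = k @ [i]" using isne by (metis append_butlast_last_id)
    have i: "i \<in> free_coords n S" using fs ik by auto
    have i': "i < n" "int (Suc i) \<notin> S" "- int (Suc i) \<notin> S" using i by (auto simp: free_coords_def)
    have xi: "x i > - N" "x i - 1 < N" using a(5) last ik fs(3)[of i] by auto
    have nb: "neighbour a = ((x(i := x i - 1), i # k), 0)"
      using a(1) last ik by (simp add: neighbour_def)
    have mem: "(x(i := x i - 1), i # k) \<in> face_simplices n N S"
      using fs ik i' xi unfolding face_simplices_def by (auto simp: )
    have "neighbour a \<in> ?A" unfolding nb using mem len ik fs(3)[of i] isne
      by (auto simp: facet_is_upper_def facet_is_lower_def)
    moreover have "neighbour (neighbour a) = a"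
      unfolding nb using a(1) last ik by (simp add: neighbour_def)
    moreover have "neighbour a \<noteq> a" unfolding nb using a(1) last ik by simp
    moreover have "facet_alternating lab (neighbour a) = facet_alternating lab a"
    proof -
      have "{0..length is} - {length is} = {0..length k}" using ik by auto
      then show ?thesis unfolding nb using a(1) last ik fs(1)
        facet_labels_rotate[of i k lab "x(i := x i - 1)" "[i]"]
        by (simp add: facet_alternating_def)
    qed
    ultimately show ?thesis by blast
  next
    case mid
    let ?k = "is[j - 1 := is ! j, j := is ! (j - 1)]"
    have nb: "neighbour a = ((x, ?k), j)"
      using a(1) mid by (simp add: neighbour_def)
    have mem: "(x, ?k) \<in> face_simplices n N S"
      using fs mid unfolding face_simplices_def by (auto simp: set_swap distinct_swap)
    have "neighbour a \<in> ?A" unfolding nb using mem len mid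
      by (auto simp: facet_is_upper_def facet_is_lower_def)
    moreover have "neighbour (neighbour a) = a"
      unfolding nb using a(1) mid
      by (auto simp: neighbour_def list_eq_iff_nth_eq nth_list_update)
    moreover have "neighbour a \<noteq> a"
    proof
      assume "neighbour a = a"
      then have "?k ! j = is ! j" using a(1) nb by simp
      then have "is ! (j - 1) = is ! j" using mid by simp
      then show False using fs(1) mid by (simp add: nth_eq_iff_index_eq)
    qed
    moreover have "facet_alternating lab (neighbour a) = facet_alternating lab a"
      unfolding nb using a(1) facet_labels_swap[OF mid, of lab x]
      by (simp add: facet_alternating_def)
    ultimately show ?thesis by blast
  qed
  then show "neighbour a \<in> ?A" "neighbour (neighbour a) = a" "neighbour a \<noteq> a"
      "facet_alternating lab (neighbour a) = facet_alternating lab a" by auto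
qed

lemma free_coords_insert:
  "free_coords n (insert (int (Suc i)) S) = free_coords n S - {i}"
  "free_coords n (insert (- int (Suc i)) S) = free_coords n S - {i}"
  by (auto simp: free_coords_def)

text \<open>A facet in the face where coordinate \<open>i\<close> equals \<open>N\<close> omits
  exactly the starting vertex, and the simplex is recovered from it by one step back in direction
  \<open>i\<close>.\<close>

lemma upper_facets:
  assumes "free_coords n S \<noteq> {}" "N > 0"
  shows "sum (facet_alternating lab) {(\<sigma>, j) \<in> face_simplices n N S \<times> {0..card (free_coords n S)}.
           facet_is_upper N (\<sigma>, j)}
       = (\<Sum>i\<in>free_coords n S. count_alternating lab n N True (insert (int (Suc i)) S))"
    (is "sum _ ?A = _")
proof -
  let ?B = "SIGMA i:free_coords n S. face_simplices n N (insert (int (Suc i)) S)"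
  let ?i = "\<lambda>(i, x :: nat \<Rightarrow> int, is). ((x(i := x i - 1), i # is), 0::nat)"
  let ?j = "\<lambda>((x :: nat \<Rightarrow> int, is), j :: nat). (hd is :: nat, x(hd is := x (hd is) + 1), tl is)"
  let ?h = "\<lambda>(i :: nat, x, is). of_bool (alternating_mset True (simplex_labels lab x is {0..length is})) :: bit"
  have "sum (facet_alternating lab) ?A = sum ?h ?B"
  proof (rule sum.reindex_bij_witness[where i = ?i and j = ?j])
    fix a assume "a \<in> ?A"
    then obtain x "is" where a: "a = ((x, is), 0)" "(x, is) \<in> face_simplices n N S" "x (hd is) + 1 = N"
      by (auto simp: facet_is_upper_def)
    then obtain i k where ik: "is = i # k" using assms by (cases "is") (auto simp: face_simplices_def)
    show "?i (?j a) = a" using a ik by auto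
    have i: "i \<in> free_coords n S" using a ik by (auto simp: face_simplices_def)
    then have i': "i < n" "int (Suc i) \<notin> S" "- int (Suc i) \<notin> S" by (auto simp: free_coords_def)
    show "?j a \<in> ?B"
      using a i i' ik by (auto simp: face_simplices_def free_coords_insert[simplified])
    show "?h (?j a) = facet_alternating lab a"
      using a ik facet_labels_rotate[of i k lab x "[]"]
      by (auto simp: facet_alternating_def face_simplices_def)
  next
    fix b assume "b \<in> ?B"
    then obtain i x "is" where b: "b = (i, x, is)" "i \<in> free_coords n S"
       "(x, is) \<in> face_simplices n N (insert (int (Suc i)) S)" by auto
    then have i': "i < n" "int (Suc i) \<notin> S" "- int (Suc i) \<notin> S" by (auto simp: free_coords_def)
    have xi: "x i = N" using b i' by (auto simp: face_simplices_def)
    show "?j (?i b) = b" using b by auto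
    have card: "length is + 1 = card (free_coords n S)"
      using length_face_simplex[OF b(3)] b(2) card_gt_0_iff[of "free_coords n S"]
      by (auto simp: free_coords_insert[simplified])
    show "?i b \<in> ?A"
      using b i' xi card assms(2)
      by (auto simp: face_simplices_def facet_is_upper_def free_coords_insert[simplified])
  qed
  also have "\<dots> = (\<Sum>i\<in>free_coords n S. count_alternating lab n N True (insert (int (Suc i)) S))"
    unfolding count_alternating_def by (subst sum.Sigma) (auto simp: finite_face_simplices)
  finally show ?thesis .
qed

text \<open>Mirror image of \<open>upper_facets\<close>: the omitted vertex is the last one, so the
  step in direction \<open>i\<close> is appended to the path.\<close>

lemma lower_facets:
  assumes "free_coords n S \<noteq> {}" "N > 0"
  shows "sum (facet_alternating lab) {(\<sigma>, j) \<in> face_simplices n N S \<times> {0..card (free_coords n S)}.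
           facet_is_lower N (\<sigma>, j)}
       = (\<Sum>i\<in>free_coords n S. count_alternating lab n N True (insert (- int (Suc i)) S))"
    (is "sum _ ?A = _")
proof -
  let ?B = "SIGMA i:free_coords n S. face_simplices n N (insert (- int (Suc i)) S)"
  let ?i = "\<lambda>(i :: nat, x :: nat \<Rightarrow> int, is). ((x, is @ [i]), Suc (length is))"
  let ?j = "\<lambda>((x :: nat \<Rightarrow> int, is), j :: nat). (last is :: nat, x, butlast is)"
  let ?h = "\<lambda>(i :: nat, x, is). of_bool (alternating_mset True (simplex_labels lab x is {0..length is})) :: bit"
  have "sum (facet_alternating lab) ?A = sum ?h ?B"
  proof (rule sum.reindex_bij_witness[where i = ?i and j = ?j])
    fix a assume "a \<in> ?A"
    then obtain x "is" where a: "a = ((x, is), length is)" "(x, is) \<in> face_simplices n N S" "x (last is) = - N"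
      by (auto simp: facet_is_lower_def)
    then have "is \<noteq> []" using assms by (auto simp: face_simplices_def)
    then obtain i k where ik: "is = k @ [i]" by (metis append_butlast_last_id)
    show "?i (?j a) = a" using a ik by auto
    have i: "i \<in> free_coords n S" using a ik by (auto simp: face_simplices_def)
    then have i': "i < n" "int (Suc i) \<notin> S" "- int (Suc i) \<notin> S" by (auto simp: free_coords_def)
    show "?j a \<in> ?B"
      using a i i' ik by (auto simp: face_simplices_def free_coords_insert[simplified])
    have "{0..length is} - {length is} = {0..length k}" using ik by auto
    then show "?h (?j a) = facet_alternating lab a"
      using a ik facet_labels_last[of lab x k "[i]"]
      by (auto simp: facet_alternating_def face_simplices_def)
  next
    fix b assume "b \<in> ?B"
    then obtain i x "is" where b: "b = (i, x, is)" "i \<in> free_coords n S"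
       "(x, is) \<in> face_simplices n N (insert (- int (Suc i)) S)" by auto
    then have i': "i < n" "int (Suc i) \<notin> S" "- int (Suc i) \<notin> S" by (auto simp: free_coords_def)
    have xi: "x i = - N" using b i' by (auto simp: face_simplices_def)
    show "?j (?i b) = b" using b by auto
    have card: "length is + 1 = card (free_coords n S)"
      using length_face_simplex[OF b(3)] b(2) card_gt_0_iff[of "free_coords n S"]
      by (auto simp: free_coords_insert[simplified])
    show "?i b \<in> ?A"
      using b i' xi card assms(2)
      by (auto simp: face_simplices_def facet_is_lower_def free_coords_insert[simplified])
  qed
  also have "\<dots> = (\<Sum>i\<in>free_coords n S. count_alternating lab n N True (insert (- int (Suc i)) S))"
    unfolding count_alternating_def by (subst sum.Sigma) (auto simp: finite_face_simplices)
  finally show ?thesis .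
qed

text \<open>Double counting of pairs of a simplex and an alternating facet: for each simplex by
  \<open>alternating_facets\<close>, for each facet by \<open>inner_facets_cancel\<close>, which
  leaves only the facets in the boundary of the face.\<close>

lemma count_alternating_boundary:
  assumes fc: "free_coords n S \<noteq> {}" and "N > 0"
    and cf: "\<And>x is. (x, is) \<in> face_simplices n N S \<Longrightarrow> complement_free ((\<lambda>j. lab (grid_vertex x is j)) ` {0..length is})"
  shows "count_alternating lab n N True S + count_alternating lab n N False S
       = (\<Sum>i\<in>free_coords n S. count_alternating lab n N True (insert (int (Suc i)) S)
            + count_alternating lab n N True (insert (- int (Suc i)) S))"
proof -
  let ?F = "face_simplices n N S" and ?k = "card (free_coords n S)"
  let ?P = "?F \<times> {0..?k}"
  have k: "?k > 0" using fc by (simp add: card_gt_0_iff)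
  have facets: "of_bool (alternating_mset True (simplex_labels lab x is {0..length is}))
      + of_bool (alternating_mset False (simplex_labels lab x is {0..length is}))
      = (\<Sum>j\<in>{0..?k}. facet_alternating lab ((x, is), j))" if \<sigma>: "(x, is) \<in> ?F" for x "is"
  proof -
    let ?M = "simplex_labels lab x is {0..length is}"
    have set: "set_mset ?M = (\<lambda>j. lab (grid_vertex x is j)) ` {0..length is}"
      by (simp add: simplex_labels_def)
    have "of_bool (alternating_mset True ?M) + of_bool (alternating_mset False ?M)
      = (\<Sum>y\<in>#?M. of_bool (alternating_mset True (?M - {#y#})) :: bit)"
    proof (rule alternating_facets[of ?M True, simplified not_True_eq_False, symmetric])
      show "complement_free (set_mset ?M)" using cf[OF \<sigma>] set by simp
      show "?M \<noteq> {#}" using set by (metis atLeastatMost_empty_iff2 bot_nat_0.extremum image_is_empty set_mset_empty)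
    qed
    also have "\<dots> = (\<Sum>j\<in>{0..length is}. of_bool (alternating_mset True (?M - {#lab (grid_vertex x is j)#})))"
      unfolding simplex_labels_def
      by (simp add: image_mset.compositionality comp_def sum_unfold_sum_mset)
    also have "\<dots> = (\<Sum>j\<in>{0..length is}. facet_alternating lab ((x, is), j))"
    proof (rule sum.cong)
      fix j assume "j \<in> {0..length is}"
      then have "?M - {#lab (grid_vertex x is j)#} = simplex_labels lab x is ({0..length is} - {j})"
        unfolding simplex_labels_def by (subst mset_set.remove[of _ j]) auto
      then show "of_bool (alternating_mset True (?M - {#lab (grid_vertex x is j)#})) = facet_alternating lab ((x, is), j)"
        by (simp add: facet_alternating_def)
    qed simp
    finally show ?thesis using length_face_simplex[OF \<sigma>] by simp
  qed
  have "count_alternating lab n N True S + count_alternating lab n N False S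
      = (\<Sum>\<sigma>\<in>?F. \<Sum>j\<in>{0..?k}. facet_alternating lab (\<sigma>, j))"
    unfolding count_alternating_def sum.distrib[symmetric]
  proof (intro sum.cong refl)
    fix \<sigma> assume "\<sigma> \<in> ?F"
    then show "(case \<sigma> of (x, is) \<Rightarrow> of_bool (alternating_mset True (simplex_labels lab x is {0..length is})))
        + (case \<sigma> of (x, is) \<Rightarrow> of_bool (alternating_mset False (simplex_labels lab x is {0..length is})))
        = (\<Sum>j\<in>{0..?k}. facet_alternating lab (\<sigma>, j))"
      using facets[of "fst \<sigma>" "snd \<sigma>"] by (simp only: case_prod_beta prod.collapse)
  qed
  also have "\<dots> = sum (facet_alternating lab) ?P"
    by (simp add: sum.cartesian_product)
  also have "?P = {(\<sigma>, j) \<in> ?P. \<not> facet_is_upper N (\<sigma>, j) \<and> \<not> facet_is_lower N (\<sigma>, j)} \<union>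
      ({(\<sigma>, j) \<in> ?P. facet_is_upper N (\<sigma>, j)} \<union> {(\<sigma>, j) \<in> ?P. facet_is_lower N (\<sigma>, j)})"
    by auto
  also have "sum (facet_alternating lab) \<dots> =
      sum (facet_alternating lab) {(\<sigma>, j) \<in> ?P. \<not> facet_is_upper N (\<sigma>, j) \<and> \<not> facet_is_lower N (\<sigma>, j)}
      + sum (facet_alternating lab) ({(\<sigma>, j) \<in> ?P. facet_is_upper N (\<sigma>, j)} \<union> {(\<sigma>, j) \<in> ?P. facet_is_lower N (\<sigma>, j)})"
    by (rule sum.union_disjoint)
      (auto intro: finite_subset[of _ ?P] simp: finite_face_simplices)
  also have "\<dots> = sum (facet_alternating lab) {(\<sigma>, j) \<in> ?P. facet_is_upper N (\<sigma>, j)}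
      + sum (facet_alternating lab) {(\<sigma>, j) \<in> ?P. facet_is_lower N (\<sigma>, j)}"
    unfolding inner_facets_cancel[OF fc] add_0_left
  proof (rule sum.union_disjoint)
    show "{(\<sigma>, j) \<in> ?P. facet_is_upper N (\<sigma>, j)} \<inter> {(\<sigma>, j) \<in> ?P. facet_is_lower N (\<sigma>, j)} = {}"
      using k by (auto simp: facet_is_upper_def facet_is_lower_def dest: length_face_simplex)
  qed (auto intro: finite_subset[of _ ?P] simp: finite_face_simplices)
  also have "\<dots> = (\<Sum>i\<in>free_coords n S. count_alternating lab n N True (insert (int (Suc i)) S)
            + count_alternating lab n N True (insert (- int (Suc i)) S))"
    unfolding upper_facets[OF fc \<open>N > 0\<close>] lower_facets[OF fc \<open>N > 0\<close>] by (rule sum.distrib[symmetric])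
  finally show ?thesis .
qed

text \<open>Negation reverses the path: the antipodal simplex starts at the negative of the last
  vertex and takes the same steps in the opposite order.\<close>

lemma antipodal_vertex:
  assumes "distinct is" "j \<le> length is"
  shows "grid_vertex (\<lambda>i. - x i - of_bool (i \<in> set is)) (rev is) j = (\<lambda>i. - grid_vertex x is (length is - j) i)"
proof
  fix i
  have "set is = set (take (length is - j) is) \<union> set (drop (length is - j) is)"
    by (metis append_take_drop_id set_append)
  moreover have "set (take (length is - j) is) \<inter> set (drop (length is - j) is) = {}"
    using assms(1) by (simp add: set_take_disj_set_drop_if_distinct)
  moreover have "set (take j (rev is)) = set (drop (length is - j) is)"
    using assms by (simp add: take_rev)
  ultimately show "grid_vertex (\<lambda>i. - x i - of_bool (i \<in> set is)) (rev is) j i = - grid_vertex x is (length is - j) i"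
    by (auto simp: grid_vertex_def)
qed

lemma vertex_fixed_coord:
  assumes "(x, is) \<in> face_simplices n N S" "i < n"
  shows "int (Suc i) \<in> S \<Longrightarrow> grid_vertex x is j i = N" "- int (Suc i) \<in> S \<Longrightarrow> grid_vertex x is j i = - N"
proof -
  have *: "i \<notin> set (take j is)" if "int (Suc i) \<in> S \<or> - int (Suc i) \<in> S"
    using that assms in_set_takeD[of i j "is"] by (auto simp: face_simplices_def free_coords_def)
  show "int (Suc i) \<in> S \<Longrightarrow> grid_vertex x is j i = N" "- int (Suc i) \<in> S \<Longrightarrow> grid_vertex x is j i = - N"
    using * assms by (auto simp: grid_vertex_def face_simplices_def)
qed

lemma vertex_in_grid:
  assumes "(x, is) \<in> face_simplices n N S" "N > 0"
  shows "\<bar>grid_vertex x is j i\<bar> \<le> N" "i \<ge> n \<Longrightarrow> grid_vertex x is j i = 0"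
proof -
  show "i \<ge> n \<Longrightarrow> grid_vertex x is j i = 0"
    using assms in_set_takeD[of i j "is"] by (auto simp: grid_vertex_def face_simplices_def free_coords_def)
  show "\<bar>grid_vertex x is j i\<bar> \<le> N"
  proof (cases "i \<in> free_coords n S")
    case True
    then show ?thesis using assms by (auto simp: grid_vertex_def face_simplices_def)
  next
    case False
    then consider "i \<ge> n" | "i < n" "int (Suc i) \<in> S" | "i < n" "- int (Suc i) \<in> S"
      by (force simp: free_coords_def)
    then show ?thesis
      using vertex_fixed_coord[OF assms(1), of i j] assms \<open>i \<ge> n \<Longrightarrow> _\<close>
      by cases auto
  qed
qed

section \<open>Antipodal symmetry on the boundary of the cube\<close>

definition signed_coords :: "nat \<Rightarrow> int set" where
  "signed_coords n = {a. a \<noteq> 0 \<and> \<bar>a\<bar> \<le> int n}"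

definition grid_boundary :: "nat \<Rightarrow> int \<Rightarrow> (nat \<Rightarrow> int) set" where
  "grid_boundary n N = {x. (\<forall>i. \<bar>x i\<bar> \<le> N) \<and> (\<forall>i\<ge>n. x i = 0) \<and> (\<exists>i<n. \<bar>x i\<bar> = N)}"

lemma signed_coords_cases:
  assumes "a \<in> signed_coords n"
  obtains i where "i < n" "a = int (Suc i)" | i where "i < n" "a = - int (Suc i)"
proof (cases "a > 0")
  case True
  then show thesis using assms that(1)[of "nat a - 1"] by (auto simp: signed_coords_def)
next
  case False
  then show thesis using assms that(2)[of "nat (- a) - 1"] by (auto simp: signed_coords_def)
qed

lemma vertex_in_boundary:
  assumes "(x, is) \<in> face_simplices n N S" "N > 0" "S \<subseteq> signed_coords n" "S \<noteq> {}"
  shows "grid_vertex x is j \<in> grid_boundary n N"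
proof -
  obtain a where "a \<in> S" "a \<in> signed_coords n" using assms by auto
  then obtain i where "i < n" "int (Suc i) \<in> S \<or> - int (Suc i) \<in> S"
    by (metis signed_coords_cases)
  then show ?thesis
    using vertex_in_grid[OF assms(1,2)] vertex_fixed_coord[OF assms(1), of i j] assms(2)
    by (auto simp: grid_boundary_def intro!: exI[of _ i])
qed

lemma vertices_close: "\<bar>grid_vertex x is j i - grid_vertex x is k i\<bar> \<le> 1"
  by (auto simp: grid_vertex_def)

lemma free_coords_uminus: "free_coords n (uminus ` S) = free_coords n S"
  unfolding free_coords_def
  by (intro Collect_cong) (metis (no_types, opaque_lifting) image_iff minus_minus)

lemma antipodal_simplex:
  assumes "(x, is) \<in> face_simplices n N S"
  shows "(\<lambda>i. - x i - of_bool (i \<in> set is), rev is) \<in> face_simplices n N (uminus ` S)"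
proof -
  have *: "int (Suc i) \<in> uminus ` S \<longleftrightarrow> - int (Suc i) \<in> S" "- int (Suc i) \<in> uminus ` S \<longleftrightarrow> int (Suc i) \<in> S" for i
    by (metis (no_types, opaque_lifting) image_iff minus_minus)+
  have fs: "distinct is" "set is = free_coords n S" "\<And>i. i \<in> free_coords n S \<Longrightarrow> - N \<le> x i \<and> x i < N"
     "\<And>i. i < n \<Longrightarrow> int (Suc i) \<in> S \<Longrightarrow> x i = N" "\<And>i. i < n \<Longrightarrow> - int (Suc i) \<in> S \<Longrightarrow> x i = - N" "\<And>i. i \<ge> n \<Longrightarrow> x i = 0"
    using assms by (auto simp: face_simplices_def)
  show ?thesis
    unfolding face_simplices_def mem_Collect_eq prod.case free_coords_uminus *
    using fs(1) fs(4-6) fs(2,3) by (fastforce simp: free_coords_def)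
qed

lemma count_alternating_uminus:
  assumes S: "S \<subseteq> signed_coords n" "S \<noteq> {}" and N: "N > 0"
    and odd: "\<And>x. x \<in> grid_boundary n N \<Longrightarrow> lab (\<lambda>i. - x i) = - lab x"
    and nz: "\<And>x. x \<in> grid_boundary n N \<Longrightarrow> lab x \<noteq> 0"
  shows "count_alternating lab n N s (uminus ` S) = count_alternating lab n N (\<not> s) S"
proof -
  let ?a = "\<lambda>(x :: nat \<Rightarrow> int, is :: nat list). (\<lambda>i. - x i - of_bool (i \<in> set is), rev is)"
  have mm: "uminus ` uminus ` S = S" by (auto simp: image_image)
  have invol: "?a (?a \<sigma>) = \<sigma>" for \<sigma>
    by (cases \<sigma>) (auto simp: fun_eq_iff)
  have "count_alternating lab n N (\<not> s) S
     = (\<Sum>(x, is)\<in>face_simplices n N (uminus ` S). of_bool (alternating_mset s (simplex_labels lab x is {0..length is})))"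
    unfolding count_alternating_def
  proof (rule sum.reindex_bij_witness[where i = ?a and j = ?a])
    show "?a (?a \<sigma>) = \<sigma>" for \<sigma> by (rule invol)
    show "?a (?a \<sigma>) = \<sigma>" for \<sigma> by (rule invol)
    show "?a \<sigma> \<in> face_simplices n N (uminus ` S)" if "\<sigma> \<in> face_simplices n N S" for \<sigma>
      using antipodal_simplex[of "fst \<sigma>" "snd \<sigma>" n N S] that by (auto simp: case_prod_beta)
    show "?a \<sigma> \<in> face_simplices n N S" if "\<sigma> \<in> face_simplices n N (uminus ` S)" for \<sigma>
      using antipodal_simplex[of "fst \<sigma>" "snd \<sigma>" n N "uminus ` S"] that mm by (auto simp: case_prod_beta)
  next
    fix \<sigma> assume "\<sigma> \<in> face_simplices n N S"
    then obtain x "is" where \<sigma>: "\<sigma> = (x, is)" "(x, is) \<in> face_simplices n N S" by (cases \<sigma>) auto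
    then have "distinct is" by (auto simp: face_simplices_def)
    let ?x = "\<lambda>i. - x i - of_bool (i \<in> set is)"
    let ?f = "\<lambda>j. length is - j"
    have bd: "grid_vertex x is j \<in> grid_boundary n N" for j
      by (rule vertex_in_boundary[OF \<sigma>(2) N S])
    have "image_mset ?f (mset_set {0..length is}) = mset_set (?f ` {0..length is})"
      by (intro image_mset_mset_set inj_onI) auto
    also have "?f ` {0..length is} = {0..length is}"
    proof (intro equalityI subsetI)
      fix j assume "j \<in> {0..length is}"
      then show "j \<in> ?f ` {0..length is}" by (intro image_eqI[of _ _ "length is - j"]) auto
    qed auto
    finally have rv: "mset_set {0..length is} = image_mset ?f (mset_set {0..length is})"
      by (rule sym)
    have "simplex_labels lab ?x (rev is) {0..length (rev is)}
        = image_mset (\<lambda>j. - lab (grid_vertex x is (?f j))) (mset_set {0..length is})"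
      unfolding simplex_labels_def length_rev
    proof (rule image_mset_cong)
      fix j assume "j \<in># mset_set {0..length is}"
      then have "j \<le> length is" by simp
      then show "lab (grid_vertex ?x (rev is) j) = - lab (grid_vertex x is (?f j))"
        using antipodal_vertex[OF \<open>distinct is\<close>, of j x] odd[OF bd, of "?f j"] by simp
    qed
    also have "\<dots> = image_mset uminus (simplex_labels lab x is {0..length is})"
      unfolding simplex_labels_def by (subst (2) rv) (simp add: image_mset.compositionality comp_def)
    finally have eq: "simplex_labels lab ?x (rev is) {0..length (rev is)}
      = image_mset uminus (simplex_labels lab x is {0..length is})" .
    have "0 \<notin># simplex_labels lab x is {0..length is}"
      using nz[OF bd] by (auto simp: simplex_labels_def)
    then show "(case ?a \<sigma> of (x, is) \<Rightarrow> of_bool (alternating_mset s (simplex_labels lab x is {0..length is})))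
        = ((case \<sigma> of (x, is) \<Rightarrow> of_bool (alternating_mset (\<not> s) (simplex_labels lab x is {0..length is}))) :: bit)"
      unfolding \<sigma>(1) prod.case eq by (simp add: alternating_mset_uminus)
  qed
  then show ?thesis unfolding count_alternating_def by simp
qed

section \<open>Descent through the alternating faces and Tucker's lemma\<close>

lemma alternating_complement_free: "alternating s L \<Longrightarrow> 0 \<notin> set L \<Longrightarrow> complement_free (set L)"
proof (induction L arbitrary: s)
  case (Cons a L)
  then have "\<forall>b\<in>set L. \<bar>a\<bar> < \<bar>b\<bar>" "complement_free (set L)" by auto
  then show ?case using Cons.prems by (fastforce simp: complement_free_def)
qed (simp add: complement_free_def)

lemma alternating_set_complement_free:
  "finite S \<Longrightarrow> S \<subseteq> signed_coords n \<Longrightarrow> alternating_mset s (mset_set S) \<Longrightarrow> complement_free S"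
  unfolding alternating_mset_def
  using alternating_complement_free by (auto simp: signed_coords_def)
     (metis (mono_tags, lifting) finite_set_mset_mset_set mem_Collect_eq set_mset_mset subset_iff)

lemma finite_signed_coords [simp]: "finite (signed_coords n)"
  by (rule finite_subset[of _ "{- int n..int n}"]) (auto simp: signed_coords_def)

text \<open>Alternation here concerns the signed coordinates that describe a face, not the labels of
  its vertices. For \<open>k > 0\<close> the sign \<open>True\<close> selects one face out of each
  antipodal pair of alternating faces.\<close>

definition alternating_faces :: "nat \<Rightarrow> nat \<Rightarrow> int set set" where
  "alternating_faces n k = {S. S \<subseteq> signed_coords n \<and> card S = k \<and> alternating_mset True (mset_set S)}"

lemma free_coords_nonempty:
  assumes "S \<subseteq> signed_coords n" "card S < n"
  shows "free_coords n S \<noteq> {}"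
proof
  assume e: "free_coords n S = {}"
  have "{..<n} \<subseteq> (\<lambda>a. nat \<bar>a\<bar> - 1) ` S"
  proof
    fix i assume "i \<in> {..<n}"
    then have "int (Suc i) \<in> S \<or> - int (Suc i) \<in> S" using e by (auto simp: free_coords_def)
    then show "i \<in> (\<lambda>a. nat \<bar>a\<bar> - 1) ` S" by force
  qed
  then have "n \<le> card S"
    using card_mono[of "(\<lambda>a. nat \<bar>a\<bar> - 1) ` S" "{..<n}"] card_image_le[of S "\<lambda>a. nat \<bar>a\<bar> - 1"]
      assms(1) finite_subset[OF assms(1)] by auto
  then show False using assms(2) by simp
qed

lemma sum_of_bool_mult_filter:
  "finite A \<Longrightarrow> (\<Sum>x\<in>A. of_bool (P x) * g x) = sum (g :: 'a \<Rightarrow> 'b::semiring_1) {x \<in> A. P x}"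
  by (simp add: sum.inter_filter of_bool_def if_distrib[of "\<lambda>c. c * _"] cong: if_cong)

text \<open>Passing from the alternating faces of codimension \<open>k\<close> to those of codimension \<open>k + 1\<close> uses
  \<open>alternating_facets\<close> twice: once for the labels of the simplices and once for the
  signs of the fixed coordinates.\<close>

lemma alternating_faces_step:
  assumes k: "0 < k" "k < n" and N: "N > 0"
    and odd: "\<And>x. x \<in> grid_boundary n N \<Longrightarrow> lab (\<lambda>i. - x i) = - lab x"
    and nz: "\<And>x. x \<in> grid_boundary n N \<Longrightarrow> lab x \<noteq> 0"
    and nc: "\<And>x y. x \<in> grid_boundary n N \<Longrightarrow> y \<in> grid_boundary n N \<Longrightarrow> \<forall>i. \<bar>x i - y i\<bar> \<le> 1 \<Longrightarrow> lab x \<noteq> - lab y"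
  shows "(\<Sum>S\<in>alternating_faces n k. count_alternating lab n N True S + count_alternating lab n N False S)
       = (\<Sum>S\<in>alternating_faces n (Suc k). count_alternating lab n N True S + count_alternating lab n N False S)"
proof -
  let ?c = "count_alternating lab n N"
  let ?E = "\<lambda>S. {a \<in> signed_coords n. a \<notin> S \<and> - a \<notin> S}"
  define V where "V = {S. S \<subseteq> signed_coords n \<and> complement_free S \<and> card S = Suc k}"
  have finV: "finite V"
    by (rule finite_subset[of _ "Pow (signed_coords n)"]) (auto simp: V_def)
  have finAF: "finite (alternating_faces n j)" for j
    by (rule finite_subset[of _ "Pow (signed_coords n)"]) (auto simp: alternating_faces_def)
  have finS: "finite S" if "S \<subseteq> signed_coords n" for S
    using that finite_subset by (metis finite_signed_coords)
  have cf: "complement_free ((\<lambda>j. lab (grid_vertex x is j)) ` {0..length is})"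
    if "(x, is) \<in> face_simplices n N S" "S \<subseteq> signed_coords n" "S \<noteq> {}" for x "is" S
    unfolding complement_free_def
  proof (intro ballI)
    fix a b assume "a \<in> (\<lambda>j. lab (grid_vertex x is j)) ` {0..length is}" "b \<in> (\<lambda>j. lab (grid_vertex x is j)) ` {0..length is}"
    then obtain j k where "a = lab (grid_vertex x is j)" "b = lab (grid_vertex x is k)" by blast
    then show "a \<noteq> - b"
      using nc[of "grid_vertex x is j" "grid_vertex x is k"] vertices_close[of x "is"]
        vertex_in_boundary[OF that(1) N that(2,3)] by simp
  qed
  have step1: "?c True S + ?c False S = (\<Sum>a\<in>?E S. ?c True (insert a S))" if "S \<in> alternating_faces n k" for S
  proof -
    have S: "S \<subseteq> signed_coords n" "card S = k" using that by (auto simp: alternating_faces_def)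
    then have ne: "S \<noteq> {}" using k by auto
    let ?F = "free_coords n S"
    have E: "?E S = (\<lambda>i. int (Suc i)) ` ?F \<union> (\<lambda>i. - int (Suc i)) ` ?F"
    proof (intro set_eqI iffI)
      fix a assume a: "a \<in> ?E S"
      then have "a \<in> signed_coords n" by simp
      then show "a \<in> (\<lambda>i. int (Suc i)) ` ?F \<union> (\<lambda>i. - int (Suc i)) ` ?F"
      proof (cases rule: signed_coords_cases)
        case (1 i)
        then have "i \<in> ?F" using a unfolding free_coords_def by blast
        then show ?thesis using 1 by blast
      next
        case (2 i)
        then have "i \<in> ?F" using a unfolding free_coords_def by (metis (mono_tags, lifting) mem_Collect_eq minus_minus)
        then show ?thesis using 2 by blast
      qed
    qed (auto simp: free_coords_def signed_coords_def add.commute)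
    have "?c True S + ?c False S
       = (\<Sum>i\<in>?F. ?c True (insert (int (Suc i)) S) + ?c True (insert (- int (Suc i)) S))"
      using S k by (intro count_alternating_boundary free_coords_nonempty N cf ne) auto
    also have "\<dots> = (\<Sum>i\<in>?F. ?c True (insert (int (Suc i)) S)) + (\<Sum>i\<in>?F. ?c True (insert (- int (Suc i)) S))"
      by (rule sum.distrib)
    also have "(\<Sum>i\<in>?F. ?c True (insert (int (Suc i)) S)) = (\<Sum>a\<in>(\<lambda>i. int (Suc i)) ` ?F. ?c True (insert a S))"
      by (subst sum.reindex) (auto simp: inj_on_def)
    also have "(\<Sum>i\<in>?F. ?c True (insert (- int (Suc i)) S)) = (\<Sum>a\<in>(\<lambda>i. - int (Suc i)) ` ?F. ?c True (insert a S))"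
      by (subst sum.reindex) (auto simp: inj_on_def)
    also have "(\<Sum>a\<in>(\<lambda>i. int (Suc i)) ` ?F. ?c True (insert a S)) + (\<Sum>a\<in>(\<lambda>i. - int (Suc i)) ` ?F. ?c True (insert a S))
      = (\<Sum>a\<in>?E S. ?c True (insert a S))"
      unfolding E by (rule sum.union_disjoint[symmetric]) auto
    finally show ?thesis .
  qed
  have "(\<Sum>S\<in>alternating_faces n k. ?c True S + ?c False S)
      = (\<Sum>S\<in>alternating_faces n k. \<Sum>a\<in>?E S. ?c True (insert a S))"
    by (intro sum.cong refl step1)
  also have "\<dots> = (\<Sum>(S, a)\<in>(SIGMA S:alternating_faces n k. ?E S). ?c True (insert a S))"
    by (rule sum.Sigma) (auto simp: finAF)
  \<comment> \<open>Regrouping by the enlarged set: it occurs once for every element whose removal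
    leaves an alternating set, and \<open>alternating_facets\<close> gives that number modulo
    2.\<close>
  also have "\<dots> = (\<Sum>(S, a)\<in>(SIGMA S:V. {a \<in> S. alternating_mset True (mset_set (S - {a}))}). ?c True S)"
  proof (rule sum.reindex_bij_witness[where i = "\<lambda>(S, a). (S - {a}, a)" and j = "\<lambda>(S, a). (insert a S, a)"])
    fix p assume "p \<in> (SIGMA S:alternating_faces n k. ?E S)"
    then obtain S a where p: "p = (S, a)" "S \<subseteq> signed_coords n" "card S = k" "alternating_mset True (mset_set S)"
      "a \<in> signed_coords n" "a \<notin> S" "- a \<notin> S" by (auto simp: alternating_faces_def)
    have "complement_free S" using alternating_set_complement_free[OF finS p(2,4)] p by auto
    then have "complement_free (insert a S)"
      using p(5-7) by (auto simp: complement_free_def signed_coords_def)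
    then show "(case p of (S, a) \<Rightarrow> (insert a S, a)) \<in> (SIGMA S:V. {a \<in> S. alternating_mset True (mset_set (S - {a}))})"
      using p finS[OF p(2)] by (auto simp: V_def)
  next
    fix p assume "p \<in> (SIGMA S:V. {a \<in> S. alternating_mset True (mset_set (S - {a}))})"
    then obtain S a where p: "p = (S, a)" "S \<subseteq> signed_coords n" "complement_free S" "card S = Suc k"
      "a \<in> S" "alternating_mset True (mset_set (S - {a}))" by (auto simp: V_def)
    have "- a \<notin> S" using p(3,5) by (metis complement_free_def minus_minus)
    then show "(case p of (S, a) \<Rightarrow> (S - {a}, a)) \<in> (SIGMA S:alternating_faces n k. ?E S)"
      using p finS[OF p(2)] by (auto simp: alternating_faces_def)
  qed (auto simp: alternating_faces_def insert_absorb)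
  also have "\<dots> = (\<Sum>S\<in>V. \<Sum>a\<in>{a \<in> S. alternating_mset True (mset_set (S - {a}))}. ?c True S)"
    by (rule sum.Sigma[symmetric]) (auto simp: finV V_def intro: finite_subset[OF _ finS])
  also have "\<dots> = (\<Sum>S\<in>V. of_bool (alternating_mset True (mset_set S)) * ?c True S
        + of_bool (alternating_mset False (mset_set S)) * ?c True S)"
  proof (rule sum.cong[OF refl])
    fix S assume "S \<in> V"
    then have S: "S \<subseteq> signed_coords n" "complement_free S" "card S = Suc k" "finite S"
      using finS by (auto simp: V_def)
    have "(\<Sum>a\<in>{a \<in> S. alternating_mset True (mset_set (S - {a}))}. ?c True S)
        = (\<Sum>a\<in>S. of_bool (alternating_mset True (mset_set (S - {a}))) * ?c True S)"
      by (rule sum_of_bool_mult_filter[OF S(4), symmetric])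
    also have "\<dots> = (\<Sum>a\<in>S. of_bool (alternating_mset True (mset_set (S - {a})))) * ?c True S"
      by (rule sum_distrib_right[symmetric])
    also have "(\<Sum>a\<in>S. of_bool (alternating_mset True (mset_set (S - {a}))) :: bit)
        = (\<Sum>a\<in>#mset_set S. of_bool (alternating_mset True (mset_set S - {#a#})))"
      unfolding sum_unfold_sum_mset using S(4)
      by (intro arg_cong[of _ _ sum_mset] image_mset_cong) (simp add: mset_set_Diff)
    also have "\<dots> = of_bool (alternating_mset True (mset_set S)) + of_bool (alternating_mset (\<not> True) (mset_set S))"
      using S by (intro alternating_facets) (auto simp: mset_set_empty_iff)
    finally show "(\<Sum>a\<in>{a \<in> S. alternating_mset True (mset_set (S - {a}))}. ?c True S) =
       of_bool (alternating_mset True (mset_set S)) * ?c True S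
        + of_bool (alternating_mset False (mset_set S)) * ?c True S"
      by (simp only: distrib_right not_True_eq_False)
  qed
  also have "\<dots> = sum (?c True) {S \<in> V. alternating_mset True (mset_set S)}
      + sum (?c True) {S \<in> V. alternating_mset False (mset_set S)}"
    unfolding sum.distrib by (simp only: sum_of_bool_mult_filter[OF finV])
  also have "{S \<in> V. alternating_mset True (mset_set S)} = alternating_faces n (Suc k)"
    using alternating_set_complement_free finS by (auto simp: V_def alternating_faces_def)
  \<comment> \<open>The antipodal map turns faces of starting sign \<open>False\<close> into faces
    of sign \<open>True\<close> and exchanges the two counts of simplices.\<close>
  also have "sum (?c True) {S \<in> V. alternating_mset False (mset_set S)} = sum (?c False) (alternating_faces n (Suc k))"
  proof (rule sum.reindex_bij_witness[where i = "image uminus" and j = "image uminus"])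
    have um: "alternating_mset s (mset_set (uminus ` S)) = alternating_mset (\<not> s) (mset_set S)"
       "uminus ` S \<subseteq> signed_coords n" "card (uminus ` S) = card S" if "S \<subseteq> signed_coords n" for S s
    proof -
      have "mset_set (uminus ` S) = image_mset uminus (mset_set S)"
        by (simp add: image_mset_mset_set)
      moreover have "0 \<notin># mset_set S" using that finS[OF that] by (auto simp: signed_coords_def)
      ultimately show "alternating_mset s (mset_set (uminus ` S)) = alternating_mset (\<not> s) (mset_set S)"
        by (simp add: alternating_mset_uminus)
    qed (use that in \<open>auto simp: signed_coords_def card_image\<close>)
    fix S assume "S \<in> {S \<in> V. alternating_mset False (mset_set S)}"
    then have S: "S \<subseteq> signed_coords n" "complement_free S" "card S = Suc k" "alternating_mset False (mset_set S)"
      by (auto simp: V_def)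
    show "uminus ` S \<in> alternating_faces n (Suc k)" using um[OF S(1)] S by (simp add: alternating_faces_def)
    show "?c False (uminus ` S) = ?c True S"
    proof -
      have "S \<noteq> {}" using S(3) by auto
      from count_alternating_uminus[OF S(1) this N, of lab False] odd nz show ?thesis by simp
    qed
  next
    have um: "alternating_mset s (mset_set (uminus ` S)) = alternating_mset (\<not> s) (mset_set S)"
       "uminus ` S \<subseteq> signed_coords n" "card (uminus ` S) = card S" if "S \<subseteq> signed_coords n" for S s
    proof -
      have "mset_set (uminus ` S) = image_mset uminus (mset_set S)"
        by (simp add: image_mset_mset_set)
      moreover have "0 \<notin># mset_set S" using that finS[OF that] by (auto simp: signed_coords_def)
      ultimately show "alternating_mset s (mset_set (uminus ` S)) = alternating_mset (\<not> s) (mset_set S)"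
        by (simp add: alternating_mset_uminus)
    qed (use that in \<open>auto simp: signed_coords_def card_image\<close>)
    fix S assume "S \<in> alternating_faces n (Suc k)"
    then have S: "S \<subseteq> signed_coords n" "card S = Suc k" "alternating_mset True (mset_set S)"
      by (auto simp: alternating_faces_def)
    have "alternating_mset False (mset_set (uminus ` S))" using um(1)[OF S(1)] S(3) by simp
    then show "uminus ` S \<in> {S \<in> V. alternating_mset False (mset_set S)}"
      using um(2,3)[OF S(1)] S alternating_set_complement_free[OF finS, of "uminus ` S" n False]
      by (simp add: V_def)
  qed (auto simp: image_image)
  finally show ?thesis by (simp only: sum.distrib)
qed

lemma alternating_determined:
  "alternating s L \<Longrightarrow> alternating s L' \<Longrightarrow> map abs L = map abs L' \<Longrightarrow> L = L'"
proof (induction L arbitrary: L' s)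
  case (Cons a L)
  then obtain b K where L': "L' = b # K" by (cases L') auto
  have "(0 < a) = s" "(0 < b) = s" "\<bar>a\<bar> = \<bar>b\<bar>" using Cons.prems L' by simp_all
  then have "a = b" by (cases s) auto
  moreover have "alternating (\<not> s) L" "alternating (\<not> s) K" "map abs L = map abs K"
    using Cons.prems L' by simp_all
  ultimately show ?case using Cons.IH L' by blast
qed simp

lemma alternating_exists:
  "sorted ks \<Longrightarrow> distinct ks \<Longrightarrow> \<forall>a\<in>set ks. a > (0::int) \<Longrightarrow> \<exists>L. alternating s L \<and> map abs L = ks"
proof (induction ks arbitrary: s)
  case (Cons a ks)
  obtain L where L: "alternating (\<not> s) L" "map abs L = ks"
    using Cons.IH[of "\<not> s"] Cons.prems by auto
  define b where "b = (if s then a else - a)"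
  have "\<bar>b\<bar> = a" "0 < b \<longleftrightarrow> s" using Cons.prems by (auto simp: b_def)
  moreover have "\<forall>c\<in>set L. a < \<bar>c\<bar>"
    using Cons.prems L(2)[symmetric] by (auto simp: order_less_le)
  ultimately show ?case using L by (intro exI[of _ "b # L"]) auto
qed auto

lemma alternating_abs_bound:
  assumes "alternating s L" "set L \<subseteq> signed_coords n"
  shows "length L \<le> n" "length L = n \<Longrightarrow> map abs L = [1..int n]"
proof -
  have srt: "sorted (map abs L)" "distinct (map abs L)" using alternating_sorted[OF assms(1)] by auto
  have sub: "set (map abs L) \<subseteq> {1..int n}" using assms(2) by (auto simp: signed_coords_def)
  have card: "card (set (map abs L)) = length L" using distinct_card[OF srt(2)] by simp
  show "length L \<le> n" using card_mono[OF _ sub] card by simp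
  assume "length L = n"
  then have "set (map abs L) = {1..int n}" using sub card by (intro card_subset_eq) auto
  then show "map abs L = [1..int n]"
    using srt by (intro sorted_distinct_set_unique) auto
qed

lemma card_top_alternating_faces: "\<exists>S. alternating_faces n n = {S}"
proof -
  obtain L where L: "alternating True L" "map abs L = [1..int n]"
    using alternating_exists[of "[1..int n]" True] by auto
  have "set (map abs L) = {1..int n}" using L(2) by simp
  then have sc: "set L \<subseteq> signed_coords n" by (force simp: signed_coords_def)
  have dist: "distinct L" using alternating_sorted[OF L(1)] by (auto simp: distinct_map)
  have len: "length L = n" using L(2) by (metis length_map length_upto diff_add_cancel nat_int)
  have "set L \<in> alternating_faces n n"
    using L(1) sc dist len distinct_card[OF dist]
    by (auto simp: alternating_faces_def alternating_mset_def mset_set_set intro!: exI[of _ L])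
  moreover have "S = set L" if "S \<in> alternating_faces n n" for S
  proof -
    have S: "S \<subseteq> signed_coords n" "card S = n" "alternating_mset True (mset_set S)"
      using that by (auto simp: alternating_faces_def)
    then have fin: "finite S" using finite_subset finite_signed_coords by metis
    obtain K where K: "mset K = mset_set S" "alternating True K" using S(3) by (auto simp: alternating_mset_def)
    have set: "set K = S" using K(1) fin by (metis finite_set_mset_mset_set set_mset_mset)
    have "length K = n" using K(1) S(2) by (metis size_mset size_mset_set)
    then have "map abs K = map abs L" using alternating_abs_bound[OF K(2), of n] S(1) set L(2) by simp
    then show ?thesis using alternating_determined[OF K(2) L(1)] set by simp
  qed
  ultimately show ?thesis by blast
qed

text \<open>The only alternating face of codimension \<open>n\<close> is a single vertex. Its label
  is nonzero and therefore alternates for exactly one of the two starting signs.\<close>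

lemma alternating_faces_top_count:
  assumes "n > 0" "N > 0" and nz: "\<And>x. x \<in> grid_boundary n N \<Longrightarrow> lab x \<noteq> 0"
  shows "(\<Sum>S\<in>alternating_faces n n. count_alternating lab n N True S + count_alternating lab n N False S) = 1"
proof -
  obtain S where S: "alternating_faces n n = {S}" using card_top_alternating_faces by blast
  then have S': "S \<subseteq> signed_coords n" "card S = n" "alternating_mset True (mset_set S)"
    by (auto simp: alternating_faces_def set_eq_iff)
  have fin: "finite S" using S' finite_subset finite_signed_coords by metis
  have cf: "complement_free S" using alternating_set_complement_free[OF fin S'(1,3)] .
  have ne: "S \<noteq> {}" using S'(2) assms(1) by auto
  have "card (abs ` S) = n" using S'(2) complement_free_abs_eq[OF cf]
    by (subst card_image) (auto intro: inj_onI)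
  moreover have "abs ` S \<subseteq> {1..int n}" using S'(1) by (auto simp: signed_coords_def)
  ultimately have abs: "abs ` S = {1..int n}" by (intro card_subset_eq) auto
  have fixed: "int (Suc i) \<in> S \<or> - int (Suc i) \<in> S" if "i < n" for i
  proof -
    have "int (Suc i) \<in> abs ` S" unfolding abs using that by auto
    then obtain a where "a \<in> S" "int (Suc i) = \<bar>a\<bar>" by auto
    then show ?thesis by (cases "a \<ge> 0") auto
  qed
  have free: "free_coords n S = {}" using fixed by (auto simp: free_coords_def)
  define x where "x = (\<lambda>i. if i \<ge> n then 0 else if int (Suc i) \<in> S then N else - N)"
  have notboth: "\<not> (int (Suc i) \<in> S \<and> - int (Suc i) \<in> S)" for i
    using cf by (metis complement_free_def minus_minus)
  have "face_simplices n N S = {(x, [])}"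
  proof (intro set_eqI iffI)
    fix \<sigma> assume "\<sigma> \<in> face_simplices n N S"
    then obtain y where y: "\<sigma> = (y, [])" "\<forall>i<n. int (Suc i) \<in> S \<longrightarrow> y i = N"
      "\<forall>i<n. - int (Suc i) \<in> S \<longrightarrow> y i = - N" "\<forall>i\<ge>n. y i = 0"
      by (cases \<sigma>) (simp add: face_simplices_def free)
    have "y = x" using y(2-4) fixed by (fastforce simp: x_def fun_eq_iff not_le)
    then show "\<sigma> \<in> {(x, [])}" using y by simp
  next
    fix \<sigma> assume "\<sigma> \<in> {(x, [] :: nat list)}"
    then show "\<sigma> \<in> face_simplices n N S"
      using notboth by (auto simp: face_simplices_def free x_def)
  qed
  moreover have "lab (grid_vertex x [] 0) \<noteq> 0"
    using vertex_in_boundary[of x "[]" n N S 0] calculation S' ne assms by auto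
  moreover have "alternating_mset s {#a#} \<longleftrightarrow> (0 < a \<longleftrightarrow> s)" for s a
    by (auto simp: alternating_mset_def)
  ultimately show ?thesis
    unfolding S by (auto simp: count_alternating_def simplex_labels_def)
qed

text \<open>Without a complementary edge the parity sum would be the same in all codimensions. It is
  1 for vertices of the cube, but 0 for its facets: their simplices have \<open>n\<close> vertices,
  and labels of absolute value below \<open>n\<close> cannot have \<open>n\<close> distinct absolute
  values.\<close>

theorem tucker:
  assumes n: "n > 0" and N: "N > 0"
    and odd: "\<And>x. x \<in> grid_boundary n N \<Longrightarrow> lab (\<lambda>i. - x i) = - lab x"
    and range: "\<And>x. x \<in> grid_boundary n N \<Longrightarrow> lab x \<noteq> 0 \<and> \<bar>lab x\<bar> < int n"
  shows "\<exists>x\<in>grid_boundary n N. \<exists>y\<in>grid_boundary n N. (\<forall>i. \<bar>x i - y i\<bar> \<le> 1) \<and> lab x = - lab y"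
proof (rule ccontr)
  assume "\<not> ?thesis"
  then have nc: "lab x \<noteq> - lab y"
    if "x \<in> grid_boundary n N" "y \<in> grid_boundary n N" "\<forall>i. \<bar>x i - y i\<bar> \<le> 1" for x y
    using that by blast
  let ?s = "\<lambda>k. \<Sum>S\<in>alternating_faces n k. count_alternating lab n N True S + count_alternating lab n N False S"
  have "?s 1 = ?s n"
  proof (rule inc_induct[of 1 n "\<lambda>k. ?s k = ?s n"])
    fix k assume "1 \<le> k" "k < n" "?s (Suc k) = ?s n"
    then show "?s k = ?s n"
      using alternating_faces_step[of k n N lab] N odd range nc by (metis less_eq_Suc_le One_nat_def)
  qed (use n in auto)
  also have "?s n = 1" using range by (intro alternating_faces_top_count n N) auto
  finally have one: "?s 1 = 1" .
  have "count_alternating lab n N s S = 0" if "S \<in> alternating_faces n 1" for s S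
    unfolding count_alternating_def
  proof (rule sum.neutral, clarify)
    fix x "is" assume \<sigma>: "(x, is) \<in> face_simplices n N S"
    have S: "S \<subseteq> signed_coords n" "card S = 1" using that by (auto simp: alternating_faces_def)
    obtain a where "S = {a}" using S(2) card_1_singletonE by blast
    moreover obtain i where "i < n" "a = int (Suc i) \<or> a = - int (Suc i)"
      using S(1) \<open>S = {a}\<close> signed_coords_cases[of a n] by auto
    ultimately have "free_coords n S = {..<n} - {i}" by (auto simp: free_coords_def)
    then have len: "length is = n - 1"
      using length_face_simplex[OF \<sigma>] \<open>i < n\<close> by simp
    have lab: "\<bar>lab (grid_vertex x is j)\<bar> < int n \<and> lab (grid_vertex x is j) \<noteq> 0" for j
      using range[OF vertex_in_boundary[OF \<sigma> N S(1)]] \<open>S = {a}\<close> by simp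
    have "\<not> alternating_mset s (simplex_labels lab x is {0..length is})"
    proof
      assume "alternating_mset s (simplex_labels lab x is {0..length is})"
      then obtain L where L: "mset L = simplex_labels lab x is {0..length is}" "alternating s L"
        by (auto simp: alternating_mset_def)
      have "set L = (\<lambda>j. lab (grid_vertex x is j)) ` {0..length is}"
        unfolding set_mset_mset[symmetric] L(1) by (simp add: simplex_labels_def)
      then have "set L \<subseteq> signed_coords (n - 1)"
        using lab n by (force simp: signed_coords_def)
      then have "length L \<le> n - 1" by (rule alternating_abs_bound(1)[OF L(2)])
      moreover have "length L = n"
        using arg_cong[OF L(1), of size] len n by (simp add: simplex_labels_def)
      ultimately show False using n by simp
    qed
    then show "(of_bool (alternating_mset s (simplex_labels lab x is {0..length is})) :: bit) = 0" by simp
  qed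
  then have "?s 1 = 0" by (intro sum.neutral) simp
  then show False using one by simp
qed

section \<open>From Tucker's lemma to Borsuk--Ulam by refining the grid\<close>

lemma bounded_coords_convergent_subseq:
  fixes x :: "nat \<Rightarrow> nat \<Rightarrow> real"
  assumes "\<And>k i. \<bar>x k i\<bar> \<le> B"
  shows "\<exists>r. strict_mono r \<and> (\<forall>i<m. convergent (\<lambda>k. x (r k) i))"
proof (induction m)
  case 0
  show ?case by (intro exI[of _ id]) (auto simp: strict_mono_def)
next
  case (Suc m)
  then obtain r where r: "strict_mono r" "\<forall>i<m. convergent (\<lambda>k. x (r k) i)" by auto
  have "bounded (range (\<lambda>k. x (r k) m))"
    using assms by (auto simp: bounded_iff)
  then obtain l q where q: "strict_mono q" "((\<lambda>k. x (r k) m) \<circ> q) \<longlonglongrightarrow> l"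
    using bounded_imp_convergent_subsequence by blast
  have "convergent (\<lambda>k. x ((r \<circ> q) k) i)" if "i < Suc m" for i
  proof (cases "i = m")
    case True
    then show ?thesis using q(2) by (auto simp: convergent_def comp_def)
  next
    case False
    then have "convergent ((\<lambda>k. x (r k) i) \<circ> q)"
      using r(2) that q(1) by (intro convergent_subseq_convergent) auto
    then show ?thesis by (simp add: comp_def)
  qed
  then show ?case using strict_mono_o[OF r(1) q(1)] by blast
qed

text \<open>The boundary of the cube of dimension \<open>n + 1\<close> serves as the n-sphere,
  because the grids of Tucker's lemma subdivide it. Sequences that vanish beyond index
  \<open>n\<close> allow the dimension to vary within a proof.\<close>

definition cube_sphere :: "nat \<Rightarrow> (nat \<Rightarrow> real) set" where
  "cube_sphere n = {x. (\<forall>i. \<bar>x i\<bar> \<le> 1) \<and> (\<forall>i>n. x i = 0) \<and> (\<exists>i\<le>n. \<bar>x i\<bar> = 1)}"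

lemma cube_sphere_closed:
  assumes "\<And>k. x k \<in> cube_sphere n" "\<And>i. (\<lambda>k. x k i) \<longlonglongrightarrow> l i"
  shows "l \<in> cube_sphere n"
proof -
  have "\<bar>l i\<bar> \<le> 1" for i
    using assms(1) by (intro tendsto_upperbound[OF tendsto_rabs[OF assms(2)]]) (auto simp: cube_sphere_def)
  moreover have "l i = 0" if "i > n" for i
  proof -
    have "(\<lambda>k. x k i) = (\<lambda>k. 0)" using assms(1) that by (auto simp: cube_sphere_def)
    then show ?thesis using assms(2)[of i] by (simp add: LIMSEQ_const_iff)
  qed
  moreover have "\<exists>i\<le>n. \<bar>l i\<bar> = 1"
  proof (rule ccontr)
    assume "\<not> ?thesis"
    then have "\<bar>l i\<bar> < 1" if "i \<le> n" for i using \<open>\<And>i. \<bar>l i\<bar> \<le> 1\<close>[of i] that by force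
    then have "\<forall>i\<in>{..n}. eventually (\<lambda>k. \<bar>x k i\<bar> < 1) sequentially"
      by (auto intro!: order_tendstoD(2)[OF tendsto_rabs[OF assms(2)]])
    then have "eventually (\<lambda>k. \<forall>i\<in>{..n}. \<bar>x k i\<bar> < 1) sequentially"
      by (rule eventually_ball_finite[OF finite_atMost])
    then obtain k where "\<forall>i\<le>n. \<bar>x k i\<bar> < 1" by (auto simp: eventually_sequentially)
    then show False using assms(1)[of k] by (force simp: cube_sphere_def)
  qed
  ultimately show ?thesis by (auto simp: cube_sphere_def)
qed

text \<open>A grid point is labelled by the coordinate of \<open>g\<close> that is largest in
  absolute value, together with its sign. Complementary labels at nearby points force this
  coordinate to vanish in the limit, and by maximality all of \<open>g\<close> vanishes
  there.\<close>

theorem borsuk_ulam: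
  fixes g :: "(nat \<Rightarrow> real) \<Rightarrow> nat \<Rightarrow> real"
  assumes odd: "\<And>x i. x \<in> cube_sphere n \<Longrightarrow> i < n \<Longrightarrow> g (\<lambda>j. - x j) i = - g x i"
    and cont: "\<And>xs x i. (\<And>k. xs k \<in> cube_sphere n) \<Longrightarrow> x \<in> cube_sphere n \<Longrightarrow>
        (\<And>j. (\<lambda>k. xs k j) \<longlonglongrightarrow> x j) \<Longrightarrow> i < n \<Longrightarrow> (\<lambda>k. g (xs k) i) \<longlonglongrightarrow> g x i"
  shows "\<exists>x\<in>cube_sphere n. \<forall>i<n. g x i = 0"
proof (rule ccontr)
  assume neg: "\<not> ?thesis"
  define M where "M x = Max ((\<lambda>i. \<bar>g x i\<bar>) ` {..<n})" for x
  \<comment> \<open>The least index settles ties. It depends only on absolute values, so it agrees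
    at antipodal points.\<close>
  define c where "c x = (LEAST i. i < n \<and> \<bar>g x i\<bar> = M x)" for x
  have "(\<lambda>i. of_bool (i = 0)) \<in> cube_sphere n" by (auto simp: cube_sphere_def)
  then have n: "n > 0" using neg by (metis not_gr_zero not_less_zero)
  have M: "\<bar>g x i\<bar> \<le> M x" if "i < n" for x i
    unfolding M_def using that by (intro Max_ge) auto
  have c: "c x < n \<and> \<bar>g x (c x)\<bar> = M x" for x
  proof -
    have "M x \<in> (\<lambda>i. \<bar>g x i\<bar>) ` {..<n}" unfolding M_def using n by (intro Max_in) auto
    then obtain i where "i < n \<and> \<bar>g x i\<bar> = M x" by auto
    then show ?thesis unfolding c_def by (rule LeastI)
  qed
  have Mpos: "M x > 0" if "x \<in> cube_sphere n" for x
    using neg that M by (metis abs_ge_zero abs_le_zero_iff dual_order.trans leI order_antisym_conv)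
  have Modd: "M (\<lambda>j. - x j) = M x" if "x \<in> cube_sphere n" for x
    unfolding M_def using odd[OF that] by (intro arg_cong[of _ _ Max] image_cong) auto
  have codd: "c (\<lambda>j. - x j) = c x" if "x \<in> cube_sphere n" for x
    unfolding c_def Modd[OF that] using odd[OF that] by (intro arg_cong[of _ _ Least] ext) auto
  define sc where "sc N X = (\<lambda>i. real_of_int (X i) / real_of_int N)" for N :: int and X :: "nat \<Rightarrow> int"
  have sc: "sc N X \<in> cube_sphere n" if "X \<in> grid_boundary (Suc n) N" "N > 0" for N X
  proof -
    have X: "\<And>i. \<bar>X i\<bar> \<le> N" "\<And>i. i \<ge> Suc n \<Longrightarrow> X i = 0" and "\<exists>i<Suc n. \<bar>X i\<bar> = N"
      using that(1) by (simp_all add: grid_boundary_def)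
    then obtain i where i: "i < Suc n" "\<bar>X i\<bar> = N" by metis
    have "\<bar>sc N X j\<bar> = real_of_int \<bar>X j\<bar> / real_of_int N" for j
      using that(2) by (simp add: sc_def)
    moreover have "real_of_int \<bar>X j\<bar> \<le> real_of_int N" for j using X(1)[of j] by linarith
    ultimately have "\<bar>sc N X j\<bar> \<le> 1" "\<bar>sc N X i\<bar> = 1" for j
      using that(2) i(2) by (simp_all add: divide_le_eq)
    moreover have "sc N X j = 0" if "j > n" for j using X(2)[of j] that by (simp add: sc_def)
    ultimately show ?thesis using i(1) by (auto simp: cube_sphere_def less_Suc_eq_le)
  qed
  \<comment> \<open>The index is shifted by one to avoid the label 0. Labels then have absolute
    value at most \<open>n\<close>, which is below the dimension \<open>Suc n\<close> of the
    cube.\<close>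
  define lab where "lab N X = (if g (sc N X) (c (sc N X)) > 0 then 1 else -1) * (int (c (sc N X)) + 1)" for N X
  have "\<exists>x y. x \<in> cube_sphere n \<and> y \<in> cube_sphere n \<and> (\<forall>i. \<bar>x i - y i\<bar> \<le> 1 / real (Suc k)) \<and>
      c x = c y \<and> g x (c x) * g y (c x) \<le> 0" for k
  proof -
    let ?N = "int (Suc k)"
    have "\<exists>x\<in>grid_boundary (Suc n) ?N. \<exists>y\<in>grid_boundary (Suc n) ?N. (\<forall>i. \<bar>x i - y i\<bar> \<le> 1) \<and> lab ?N x = - lab ?N y"
    proof (rule tucker)
      fix X assume X: "X \<in> grid_boundary (Suc n) ?N"
      note s = sc[OF X]
      have "sc ?N (\<lambda>i. - X i) = (\<lambda>i. - sc ?N X i)" by (auto simp: sc_def)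
      moreover have "g (sc ?N X) (c (sc ?N X)) \<noteq> 0" using Mpos[OF s] c[of "sc ?N X"] by auto
      ultimately show "lab ?N (\<lambda>i. - X i) = - lab ?N X"
        unfolding lab_def using codd[OF s] odd[OF s, of "c (sc ?N X)"] c[of "sc ?N X"] by auto
      show "lab ?N X \<noteq> 0 \<and> \<bar>lab ?N X\<bar> < int (Suc n)"
        unfolding lab_def using c[of "sc ?N X"] by auto
    qed auto
    then obtain X Y where XY: "X \<in> grid_boundary (Suc n) ?N" "Y \<in> grid_boundary (Suc n) ?N"
      "\<And>i. \<bar>X i - Y i\<bar> \<le> 1" "lab ?N X = - lab ?N Y" by blast
    have "\<bar>sc ?N X i - sc ?N Y i\<bar> \<le> 1 / real (Suc k)" for i
    proof -
      have "sc ?N X i - sc ?N Y i = real_of_int (X i - Y i) / real (Suc k)"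
        by (simp add: sc_def diff_divide_distrib)
      moreover have "\<bar>real_of_int (X i - Y i)\<bar> \<le> 1" using XY(3)[of i] by linarith
      ultimately show ?thesis by (simp add: abs_divide divide_right_mono)
    qed
    moreover have "c (sc ?N X) = c (sc ?N Y) \<and> g (sc ?N X) (c (sc ?N X)) * g (sc ?N Y) (c (sc ?N X)) \<le> 0"
      using XY(4) by (auto simp: lab_def mult_le_0_iff split: if_splits)
    ultimately show ?thesis using sc[OF XY(1)] sc[OF XY(2)] by (intro exI[of _ "sc ?N X"] exI[of _ "sc ?N Y"]) auto
  qed
  then obtain x y where xy: "\<And>k. x k \<in> cube_sphere n" "\<And>k. y k \<in> cube_sphere n"
     "\<And>k i. \<bar>x k i - y k i\<bar> \<le> 1 / real (Suc k)" "\<And>k. g (x k) (c (x k)) * g (y k) (c (x k)) \<le> 0"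
    by metis
  have "finite ((\<lambda>k. c (x k)) ` UNIV)"
    by (rule finite_subset[of _ "{..<n}"]) (simp_all add: image_subset_iff c)
  then obtain k0 where "infinite {k. c (x k) = c (x k0)}"
    using pigeonhole_infinite[OF infinite_UNIV_nat, of "\<lambda>k. c (x k)"] by (auto simp only: UNIV_I simp_thms)
  then obtain a where a: "infinite {k. c (x k) = a}" "a < n" using c[of "x k0"] by metis
  obtain q :: "nat \<Rightarrow> nat" where q: "strict_mono q" "\<forall>k. q k \<in> {k. c (x k) = a}"
    using infinite_enumerate[OF a(1)] by blast
  have cq: "c (x (q k)) = a" for k using q(2) by simp
  have "\<And>k i. \<bar>x (q k) i\<bar> \<le> 1" using xy(1) by (simp add: cube_sphere_def)
  note bd = this
  obtain r :: "nat \<Rightarrow> nat" where r: "strict_mono r" "\<forall>i<Suc n. convergent (\<lambda>k. x (q (r k)) i)"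
    using bounded_coords_convergent_subseq[of "\<lambda>k. x (q k)" 1 "Suc n", OF bd]
    by blast
  define l where "l = (\<lambda>i. lim (\<lambda>k. x (q (r k)) i))"
  have lx: "(\<lambda>k. x (q (r k)) i) \<longlonglongrightarrow> l i" for i
  proof (cases "i < Suc n")
    case True
    then show ?thesis using r(2) by (simp add: l_def convergent_LIMSEQ_iff)
  next
    case False
    then have "x (q (r k)) i = 0" for k using xy(1)[of "q (r k)"] by (simp add: cube_sphere_def)
    then show ?thesis by (simp add: l_def)
  qed
  have qr: "filterlim (\<lambda>k. q (r k)) sequentially sequentially"
    using q(1) r(1) by (intro filterlim_compose[OF filterlim_subseq filterlim_subseq])
  have ly: "(\<lambda>k. y (q (r k)) i) \<longlonglongrightarrow> l i" for i
  proof -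
    have "(\<lambda>k. 1 / real (Suc k)) \<longlonglongrightarrow> 0" using LIMSEQ_inverse_real_of_nat by (simp add: inverse_eq_divide)
    then have lim: "(\<lambda>k. 1 / real (Suc (q (r k)))) \<longlonglongrightarrow> 0" using qr by (rule filterlim_compose)
    have "\<forall>k. norm (x (q (r k)) i - y (q (r k)) i) \<le> 1 / real (Suc (q (r k)))"
      using xy(3) unfolding real_norm_def by blast
    then have "(\<lambda>k. x (q (r k)) i - y (q (r k)) i) \<longlonglongrightarrow> 0"
      by (rule Lim_null_comparison[OF always_eventually lim])
    from tendsto_diff[OF lx[of i] this] show ?thesis by simp
  qed
  have l: "l \<in> cube_sphere n" by (rule cube_sphere_closed[of "\<lambda>k. x (q (r k))", OF xy(1) lx])
  have gx: "(\<lambda>k. g (x (q (r k))) i) \<longlonglongrightarrow> g l i" if "i < n" for i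
    by (rule cont[of "\<lambda>k. x (q (r k))" l i, OF xy(1) l lx that])
  have gy: "(\<lambda>k. g (y (q (r k))) i) \<longlonglongrightarrow> g l i" if "i < n" for i
    by (rule cont[of "\<lambda>k. y (q (r k))" l i, OF xy(2) l ly that])
  have "g l a * g l a \<le> 0"
  proof (rule tendsto_upperbound)
    show "(\<lambda>k. g (x (q (r k))) a * g (y (q (r k))) a) \<longlonglongrightarrow> g l a * g l a"
      by (intro tendsto_mult gx gy a)
    show "\<forall>\<^sub>F k in sequentially. g (x (q (r k))) a * g (y (q (r k))) a \<le> 0"
    proof (intro always_eventually allI)
      fix k show "g (x (q (r k))) a * g (y (q (r k))) a \<le> 0" using xy(4)[of "q (r k)"] by (simp only: cq)
    qed
  qed auto
  then have ga: "g l a = 0" by (auto simp: mult_le_0_iff)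
  have zero: "g l i = 0" if "i < n" for i
  proof -
    have "\<bar>g l i\<bar> \<le> \<bar>g l a\<bar>"
    proof (rule LIMSEQ_le[OF tendsto_rabs[OF gx[OF that]] tendsto_rabs[OF gx[OF a(2)]]])
      have "\<bar>g (x (q (r k))) i\<bar> \<le> \<bar>g (x (q (r k))) a\<bar>" for k
        using M[OF that, of "x (q (r k))"] c[of "x (q (r k))"] by (simp only: cq)
      then show "\<exists>N. \<forall>k\<ge>N. \<bar>g (x (q (r k))) i\<bar> \<le> \<bar>g (x (q (r k))) a\<bar>"
        by (intro exI[of _ 0] allI impI)
    qed
    then show ?thesis using ga by simp
  qed
  have "\<exists>x\<in>cube_sphere n. \<forall>i<n. g x i = 0"
    by (intro bexI[OF _ l] allI impI zero)
  then show False using neg by simp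
qed

section \<open>The p-th power and Lebesgue spaces\<close>

lemma continuous_on_powr_nonneg:
  fixes f :: "'a::topological_space \<Rightarrow> real"
  assumes "0 < p" "continuous_on S f" "\<And>x. x \<in> S \<Longrightarrow> 0 \<le> f x"
  shows "continuous_on S (\<lambda>x. f x powr p)"
  using assms by (intro continuous_on_powr') (auto intro: continuous_intros)

lemma powr_abs_convex:
  fixes x y s p :: real
  assumes "1 < p" "0 \<le> s" "s \<le> 1"
  shows "\<bar>(1 - s) * x + s * y\<bar> powr p \<le> (1 - s) * \<bar>x\<bar> powr p + s * \<bar>y\<bar> powr p"
proof -
  have sp: "u powr p \<le> u" if "0 \<le> u" "u \<le> 1" for u :: real
    using that assms(1) powr_mono'[of 1 p u] by (cases "u = 0") auto
  have pos: "((1 - s) * a + s * b) powr p \<le> (1 - s) * a powr p + s * b powr p" if "a \<ge> 0" "b \<ge> 0" for a b :: real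
  proof (cases "a = 0 \<or> b = 0")
    case True
    then show ?thesis
      using assms that sp[of s] sp[of "1 - s"] by (auto simp: powr_mult intro!: mult_right_mono)
  next
    case False
    then have "a \<in> {0<..}" "b \<in> {0<..}" using that by auto
    then show ?thesis
      using convex_onD[OF powr_convex[of p], of s a b] assms by simp
  qed
  have "\<bar>(1 - s) * x + s * y\<bar> powr p \<le> ((1 - s) * \<bar>x\<bar> + s * \<bar>y\<bar>) powr p"
    using assms abs_triangle_ineq[of "(1 - s) * x" "s * y"] by (intro powr_mono2) (auto simp: abs_mult)
  also have "\<dots> \<le> (1 - s) * \<bar>x\<bar> powr p + s * \<bar>y\<bar> powr p" by (rule pos) auto
  finally show ?thesis .
qed

lemma powr_MVT:
  fixes a b p :: real
  assumes "0 < p" "0 \<le> a" "a < b"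
  obtains \<xi> where "a < \<xi>" "\<xi> < b" "b powr p - a powr p = (b - a) * (p * \<xi> powr (p - 1))"
proof -
  have d: "((\<lambda>x. x powr p) has_real_derivative p * x powr (p - 1)) (at x)" if "x > 0" for x
    using that by (auto intro!: derivative_eq_intros)
  have "continuous_on {a..b} (\<lambda>x. x powr p)"
    using assms by (intro continuous_on_powr_nonneg continuous_intros) auto
  moreover have "(\<lambda>x. x powr p) differentiable (at x)" if "a < x" for x
    using d[of x] that assms(2) by (auto simp: real_differentiable_def)
  ultimately obtain l \<xi> where \<xi>: "a < \<xi>" "\<xi> < b" "((\<lambda>x. x powr p) has_real_derivative l) (at \<xi>)"
      "b powr p - a powr p = (b - a) * l"
    using MVT[OF assms(3), of "\<lambda>x. x powr p"] by blast
  have "l = p * \<xi> powr (p - 1)" using DERIV_unique[OF \<xi>(3) d] \<xi>(1) assms(2) by simp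
  then show thesis using that \<xi> by blast
qed

lemma powr_midpoint_strict:
  fixes a b p :: real
  assumes "1 < p" "0 \<le> a" "a < b"
  shows "((a + b) / 2) powr p < (a powr p + b powr p) / 2"
proof -
  let ?m = "(a + b) / 2"
  obtain \<xi> where \<xi>: "a < \<xi>" "\<xi> < ?m" "?m powr p - a powr p = (?m - a) * (p * \<xi> powr (p - 1))"
    using powr_MVT[of p a ?m] assms by auto
  obtain \<zeta> where \<zeta>: "?m < \<zeta>" "\<zeta> < b" "b powr p - ?m powr p = (b - ?m) * (p * \<zeta> powr (p - 1))"
    using powr_MVT[of p ?m b] assms by auto
  have "\<xi> powr (p - 1) < \<zeta> powr (p - 1)" using \<xi> \<zeta> assms by (intro powr_less_mono2) auto
  then have "(b - a) / 2 * p * \<xi> powr (p - 1) < (b - a) / 2 * p * \<zeta> powr (p - 1)"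
    using assms by (intro mult_strict_left_mono) auto
  moreover have "?m powr p - a powr p = (b - a) / 2 * p * \<xi> powr (p - 1)"
    unfolding \<xi>(3) by (simp add: field_simps)
  moreover have "b powr p - ?m powr p = (b - a) / 2 * p * \<zeta> powr (p - 1)"
    unfolding \<zeta>(3) by (simp add: field_simps)
  ultimately have "?m powr p - a powr p < b powr p - ?m powr p" by simp
  moreover have "w - u < v - w \<Longrightarrow> w < (u + v) / 2" for u v w :: real by simp
  ultimately show ?thesis by blast
qed

lemma powr_abs_midpoint_strict:
  fixes x y p :: real
  assumes "1 < p" "x \<noteq> y"
  shows "\<bar>(x + y) / 2\<bar> powr p < (\<bar>x\<bar> powr p + \<bar>y\<bar> powr p) / 2"
proof (cases "\<bar>x\<bar> = \<bar>y\<bar>")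
  case True
  then have "y = - x" "x \<noteq> 0" using assms(2) by auto
  then show ?thesis by simp
next
  case False
  have "\<bar>(x + y) / 2\<bar> powr p \<le> ((\<bar>x\<bar> + \<bar>y\<bar>) / 2) powr p"
    using assms by (intro powr_mono2) auto
  also have "\<dots> < (\<bar>x\<bar> powr p + \<bar>y\<bar> powr p) / 2"
    using powr_midpoint_strict[of p "\<bar>x\<bar>" "\<bar>y\<bar>"] powr_midpoint_strict[of p "\<bar>y\<bar>" "\<bar>x\<bar>"] False assms(1)
    by (cases "\<bar>x\<bar> < \<bar>y\<bar>") (auto simp: add.commute)
  finally show ?thesis .
qed

text \<open>By homogeneity it suffices to use compactness of the unit sphere.\<close>

lemma powr_abs_uniformly_convex:
  fixes p \<epsilon> :: real
  assumes "1 < p" "\<epsilon> > 0"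
  obtains C where "C \<ge> 0" "\<And>x y. \<bar>x - y\<bar> powr p \<le> \<epsilon> * (\<bar>x\<bar> powr p + \<bar>y\<bar> powr p)
      + C * ((\<bar>x\<bar> powr p + \<bar>y\<bar> powr p) / 2 - \<bar>(x + y) / 2\<bar> powr p)"
proof -
  define m where "m z = (\<bar>fst z\<bar> powr p + \<bar>snd z\<bar> powr p) / 2 - \<bar>(fst z + snd z) / 2\<bar> powr p" for z :: "real \<times> real"
  \<comment> \<open>The midpoint gap is called upon only where the term with
    \<open>\<epsilon>\<close> alone does not exceed the left side. On this compact set
    \<open>x = y\<close> is impossible, so the gap has a positive minimum.\<close>
  define K where "K = {z :: real \<times> real. max \<bar>fst z\<bar> \<bar>snd z\<bar> = 1} \<inter> {z. \<epsilon> * (\<bar>fst z\<bar> powr p + \<bar>snd z\<bar> powr p) \<le> \<bar>fst z - snd z\<bar> powr p}"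
  have cont: "continuous_on UNIV m" unfolding m_def using assms by (intro continuous_intros continuous_on_powr_nonneg) auto
  have "closed K" unfolding K_def using assms
    by (intro closed_Int closed_Collect_eq closed_Collect_le continuous_intros continuous_on_powr_nonneg continuous_on_max) auto
  moreover have "bounded K"
  proof (rule bounded_subset)
    show "bounded ({-1..1::real} \<times> {-1..1::real})" by (intro bounded_Times bounded_closed_interval)
    show "K \<subseteq> {-1..1} \<times> {-1..1}" by (auto simp: K_def max_def split: if_splits)
  qed
  ultimately have "compact K" by (simp add: compact_eq_bounded_closed)
  have m0: "m z \<ge> 0" for z
    using powr_abs_midpoint_strict[OF assms(1), of "fst z" "snd z"] by (cases "fst z = snd z") (auto simp: m_def)
  have mK: "m z > 0" if "z \<in> K" for z
  proof -
    have "\<bar>fst z\<bar> = 1 \<or> \<bar>snd z\<bar> = 1" using that by (auto simp: K_def max_def split: if_splits)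
    then have "0 < \<bar>fst z\<bar> powr p + \<bar>snd z\<bar> powr p" by (auto intro: add_pos_nonneg add_nonneg_pos)
    then have "0 < \<bar>fst z - snd z\<bar> powr p" using that assms(2) unfolding K_def
      by (smt (verit, best) IntE mem_Collect_eq mult_pos_pos)
    then have "fst z \<noteq> snd z" using assms by auto
    then show ?thesis using powr_abs_midpoint_strict[OF assms(1)] by (simp add: m_def)
  qed
  obtain \<mu> where \<mu>: "\<mu> > 0" "\<And>z. z \<in> K \<Longrightarrow> \<mu> \<le> m z"
  proof (cases "K = {}")
    case True
    then show ?thesis using that[of 1] by auto
  next
    case False
    then obtain z where "z \<in> K" "\<And>w. w \<in> K \<Longrightarrow> m z \<le> m w"
      using continuous_attains_inf[OF \<open>compact K\<close> _ continuous_on_subset[OF cont]] by auto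
    then show ?thesis using that[of "m z"] mK by auto
  qed
  define C where "C = 2 powr p / \<mu>"
  have C: "C \<ge> 0" using \<mu> by (simp add: C_def)
  have unit: "\<bar>x - y\<bar> powr p \<le> \<epsilon> * (\<bar>x\<bar> powr p + \<bar>y\<bar> powr p) + C * m (x, y)" if "max \<bar>x\<bar> \<bar>y\<bar> = 1" for x y
  proof (cases "(x, y) \<in> K")
    case True
    have "\<bar>x - y\<bar> \<le> 2" using that by linarith
    then have "\<bar>x - y\<bar> powr p \<le> 2 powr p" using assms by (intro powr_mono2) auto
    also have "2 powr p = C * \<mu>" using \<mu> by (simp add: C_def)
    also have "\<dots> \<le> C * m (x, y)" using \<mu>(2)[OF True] C by (intro mult_left_mono)
    finally show ?thesis using assms by (smt (verit) mult_nonneg_nonneg powr_ge_zero)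
  next
    case False
    then have "\<bar>x - y\<bar> powr p \<le> \<epsilon> * (\<bar>x\<bar> powr p + \<bar>y\<bar> powr p)" using that by (auto simp: K_def)
    then show ?thesis using C m0[of "(x, y)"] by (smt (verit) mult_nonneg_nonneg)
  qed
  have "\<bar>x - y\<bar> powr p \<le> \<epsilon> * (\<bar>x\<bar> powr p + \<bar>y\<bar> powr p) + C * m (x, y)" for x y
  proof (cases "x = 0 \<and> y = 0")
    case True
    then show ?thesis using assms by (simp add: m_def)
  next
    case False
    define s where "s = max \<bar>x\<bar> \<bar>y\<bar>"
    have s: "s > 0" using False by (auto simp: s_def max_def)
    have "max \<bar>x / s\<bar> \<bar>y / s\<bar> = 1" using s by (auto simp: s_def max_def)
    note u = unit[OF this]
    have h: "\<bar>z / s\<bar> powr p = \<bar>z\<bar> powr p / s powr p" for z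
      using s by (simp add: powr_divide)
    have "x / s - y / s = (x - y) / s" "(x / s + y / s) / 2 = ((x + y) / 2) / s"
      using s by (auto simp: field_simps)
    then have "\<bar>x - y\<bar> powr p / s powr p \<le> \<epsilon> * (\<bar>x\<bar> powr p / s powr p + \<bar>y\<bar> powr p / s powr p)
        + C * ((\<bar>x\<bar> powr p / s powr p + \<bar>y\<bar> powr p / s powr p) / 2 - \<bar>(x + y) / 2\<bar> powr p / s powr p)"
      using u unfolding m_def fst_conv snd_conv by (simp only: h)
    moreover have "\<epsilon> * (a / S + b / S) + C * ((a / S + b / S) / 2 - d / S) = (\<epsilon> * (a + b) + C * ((a + b) / 2 - d)) / S"
      if "S > 0" for a b d S :: real using that by (simp add: field_simps)
    ultimately have "\<bar>x - y\<bar> powr p / s powr p \<le> (\<epsilon> * (\<bar>x\<bar> powr p + \<bar>y\<bar> powr p) + C * m (x, y)) / s powr p"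
      using s unfolding m_def fst_conv snd_conv by simp
    then show ?thesis using s by (simp add: divide_le_cancel)
  qed
  then show thesis using that[of C] C by (simp add: m_def)
qed

lemma powr_abs_diff_le:
  fixes p :: real
  assumes "1 < p"
  shows "\<bar>\<bar>x + y\<bar> powr p - \<bar>x\<bar> powr p\<bar> \<le> p * 2 powr (p - 1) * (\<bar>x\<bar> powr (p - 1) * \<bar>y\<bar> + \<bar>y\<bar> powr p)"
proof -
  have *: "b powr p - a powr p \<le> p * b powr (p - 1) * (b - a)" if "0 \<le> a" "a \<le> b" for a b :: real
  proof (cases "a < b")
    case True
    obtain \<xi> where \<xi>: "a < \<xi>" "\<xi> < b" "b powr p - a powr p = (b - a) * (p * \<xi> powr (p - 1))"
      using powr_MVT[of p a b] assms \<open>0 \<le> a\<close> True by auto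
    have "\<xi> powr (p - 1) \<le> b powr (p - 1)" using \<xi> that assms by (intro powr_mono2) auto
    then have "(b - a) * (p * \<xi> powr (p - 1)) \<le> (b - a) * (p * b powr (p - 1))"
      using assms True by (intro mult_left_mono) auto
    then show ?thesis using \<xi>(3) by (simp add: mult_ac)
  qed (use that in auto)
  define m where "m = max \<bar>x\<bar> \<bar>y\<bar>"
  have "\<bar>\<bar>x + y\<bar> powr p - \<bar>x\<bar> powr p\<bar> \<le> p * (max \<bar>x + y\<bar> \<bar>x\<bar>) powr (p - 1) * \<bar>\<bar>x + y\<bar> - \<bar>x\<bar>\<bar>"
  proof (cases "\<bar>x\<bar> \<le> \<bar>x + y\<bar>")
    case True
    then have "\<bar>x\<bar> powr p \<le> \<bar>x + y\<bar> powr p" using assms by (intro powr_mono2) auto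
    then show ?thesis using *[of "\<bar>x\<bar>" "\<bar>x + y\<bar>"] True by (simp add: max_def)
  next
    case False
    then have "\<bar>x + y\<bar> powr p \<le> \<bar>x\<bar> powr p" using assms by (intro powr_mono2) auto
    then show ?thesis using *[of "\<bar>x + y\<bar>" "\<bar>x\<bar>"] False by (simp add: max_def)
  qed
  also have "\<dots> \<le> p * (2 * m) powr (p - 1) * \<bar>y\<bar>"
    using assms by (intro mult_mono mult_nonneg_nonneg powr_mono2) (auto simp: m_def)
  also have "(2 * m) powr (p - 1) = 2 powr (p - 1) * m powr (p - 1)"
    by (simp add: powr_mult m_def)
  also have "p * (2 powr (p - 1) * m powr (p - 1)) * \<bar>y\<bar> = p * 2 powr (p - 1) * (m powr (p - 1) * \<bar>y\<bar>)" by simp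
  also have "\<dots> \<le> p * 2 powr (p - 1) * ((\<bar>x\<bar> powr (p - 1) + \<bar>y\<bar> powr (p - 1)) * \<bar>y\<bar>)"
    using assms by (intro mult_left_mono mult_right_mono) (auto simp: m_def max_def)
  also have "(\<bar>x\<bar> powr (p - 1) + \<bar>y\<bar> powr (p - 1)) * \<bar>y\<bar> = \<bar>x\<bar> powr (p - 1) * \<bar>y\<bar> + \<bar>y\<bar> powr p"
    by (cases "y = 0") (auto simp: algebra_simps powr_diff)
  finally show ?thesis .
qed

text \<open>By homogeneity it suffices to consider \<open>x = 1\<close>, which is differentiability at 1.\<close>

lemma powr_abs_uniformly_smooth:
  fixes p \<epsilon> :: real
  assumes "1 < p" "\<epsilon> > 0"
  obtains C where "C \<ge> 0" "\<And>x y. \<bar>x + y\<bar> powr p + \<bar>x - y\<bar> powr p - 2 * \<bar>x\<bar> powr p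
      \<le> \<epsilon> * (\<bar>x\<bar> powr (p - 1) * \<bar>y\<bar>) + C * \<bar>y\<bar> powr p"
proof -
  let ?\<phi> = "\<lambda>z :: real. (1 + z) powr p + (1 - z) powr p - 2"
  \<comment> \<open>The first-order terms cancel. This happens near the point 1, away from the
    singularity of the p-th power at 0, so exponents below 2 are covered too.\<close>
  have "(?\<phi> has_real_derivative 0) (at 0)"
    by (auto intro!: derivative_eq_intros)
  then have "(\<lambda>z. ?\<phi> z / z) \<midarrow>0\<rightarrow> 0"
    by (simp add: DERIV_def)
  then have "eventually (\<lambda>z. \<bar>?\<phi> z / z\<bar> < \<epsilon>) (at 0)"
    using assms(2) by (auto simp: tendsto_iff dist_real_def)
  then obtain \<delta>' where \<delta>': "\<delta>' > 0" "\<And>z. z \<noteq> 0 \<Longrightarrow> \<bar>z\<bar> < \<delta>' \<Longrightarrow> \<bar>?\<phi> z / z\<bar> < \<epsilon>"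
    by (auto simp: eventually_at dist_real_def)
  define \<delta> where "\<delta> = min \<delta>' 1"
  have \<delta>: "0 < \<delta>" "\<delta> \<le> 1" using \<delta>' by (auto simp: \<delta>_def)
  define C where "C = 2 * (1 / \<delta> + 1) powr p"
  have "1 \<le> (1 / \<delta> + 1) powr p" using assms \<delta> by (intro ge_one_powr_ge_zero) auto
  then have C: "C \<ge> 2" by (simp add: C_def)
  have one: "\<bar>1 + z\<bar> powr p + \<bar>1 - z\<bar> powr p - 2 \<le> \<epsilon> * \<bar>z\<bar> + C * \<bar>z\<bar> powr p" for z :: real
  proof (cases "\<bar>z\<bar> < \<delta>")
    case True
    then have "\<bar>1 + z\<bar> = 1 + z" "\<bar>1 - z\<bar> = 1 - z" using \<delta> by auto
    moreover have "?\<phi> z \<le> \<epsilon> * \<bar>z\<bar>"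
    proof (cases "z = 0")
      case False
      then have "\<bar>?\<phi> z\<bar> / \<bar>z\<bar> < \<epsilon>" using \<delta>'(2)[of z] True by (simp add: \<delta>_def)
      then have "\<bar>?\<phi> z\<bar> \<le> \<epsilon> * \<bar>z\<bar>" using False by (simp add: divide_less_eq)
      then show ?thesis by linarith
    qed auto
    ultimately show ?thesis using C by (smt (verit) mult_nonneg_nonneg powr_ge_zero)
  next
    case False
    then have "1 \<le> \<bar>z\<bar> / \<delta>" using \<delta> by simp
    then have "\<bar>1 + z\<bar> \<le> (1 / \<delta> + 1) * \<bar>z\<bar>" "\<bar>1 - z\<bar> \<le> (1 / \<delta> + 1) * \<bar>z\<bar>"
      by (auto simp: algebra_simps)
    then have "\<bar>1 + z\<bar> powr p \<le> ((1 / \<delta> + 1) * \<bar>z\<bar>) powr p" "\<bar>1 - z\<bar> powr p \<le> ((1 / \<delta> + 1) * \<bar>z\<bar>) powr p"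
      using assms by (auto intro!: powr_mono2)
    moreover have "((1 / \<delta> + 1) * \<bar>z\<bar>) powr p = C / 2 * \<bar>z\<bar> powr p"
      using \<delta> by (simp add: C_def powr_mult)
    moreover have "0 \<le> \<epsilon> * \<bar>z\<bar>" using assms by simp
    ultimately show ?thesis by linarith
  qed
  have "\<bar>x + y\<bar> powr p + \<bar>x - y\<bar> powr p - 2 * \<bar>x\<bar> powr p
      \<le> \<epsilon> * (\<bar>x\<bar> powr (p - 1) * \<bar>y\<bar>) + C * \<bar>y\<bar> powr p" for x y
  proof (cases "x = 0")
    case True
    have "2 * \<bar>y\<bar> powr p \<le> C * \<bar>y\<bar> powr p" using C by (intro mult_right_mono) auto
    then show ?thesis using True by simp
  next
    case False
    define z where "z = y / x"
    have y: "y = x * z" using False by (simp add: z_def)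
    have "x + y = x * (1 + z)" "x - y = x * (1 - z)" using y by (auto simp: algebra_simps)
    then have "\<bar>x + y\<bar> powr p + \<bar>x - y\<bar> powr p - 2 * \<bar>x\<bar> powr p
      = \<bar>x\<bar> powr p * (\<bar>1 + z\<bar> powr p + \<bar>1 - z\<bar> powr p - 2)"
      by (simp only: abs_mult powr_mult abs_ge_zero) (simp add: algebra_simps)
    also have "\<dots> \<le> \<bar>x\<bar> powr p * (\<epsilon> * \<bar>z\<bar> + C * \<bar>z\<bar> powr p)"
      by (intro mult_left_mono one) auto
    also have "\<dots> = \<epsilon> * (\<bar>x\<bar> powr (p - 1) * \<bar>y\<bar>) + C * \<bar>y\<bar> powr p"
      using False by (simp add: y abs_mult powr_mult powr_diff field_simps)
    finally show ?thesis .
  qed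
  then show thesis using that[of C] C by auto
qed

section \<open>Lebesgue spaces through p-th powers of norms\<close>

text \<open>The p-th power of the norm is convex by a pointwise inequality, so Minkowski's
  inequality is avoided at the price of the factor \<open>2 powr p\<close> in
  \<open>Lp_add\<close>.\<close>

definition Lp_integral :: "real \<Rightarrow> real \<Rightarrow> (real \<Rightarrow> real) \<Rightarrow> real" where
  "Lp_integral T p g = (\<integral>t. \<bar>g t\<bar> powr p \<partial>lebesgue_on {0..T})"

lemma Lp_norm_eq: "Lp_norm T p g = Lp_integral T p g powr (1 / p)"
  by (simp add: Lp_norm_def Lp_integral_def)

lemma Lp_integral_nonneg [simp]: "Lp_integral T p g \<ge> 0"
  unfolding Lp_integral_def by (rule integral_nonneg_AE) auto

lemma Lp_norm_powr: "p > 0 \<Longrightarrow> Lp_norm T p g powr p = Lp_integral T p g"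
  by (simp add: Lp_norm_eq powr_powr)

lemma LpD:
  assumes "g \<in> Lp T p"
  shows "g \<in> borel_measurable (lebesgue_on {0..T})" "integrable (lebesgue_on {0..T}) (\<lambda>t. \<bar>g t\<bar> powr p)"
  using assms by (auto simp: Lp_def)

lemma powr_abs_add_le:
  fixes x y p :: real
  assumes "1 < p"
  shows "\<bar>x + y\<bar> powr p \<le> 2 powr p * (\<bar>x\<bar> powr p + \<bar>y\<bar> powr p)"
proof -
  have "\<bar>x + y\<bar> powr p = 2 powr p * \<bar>(1 - 1/2) * x + 1/2 * y\<bar> powr p"
    by (subst powr_mult[symmetric]) (auto simp: field_simps)
  also have "\<dots> \<le> 2 powr p * ((1 - 1/2) * \<bar>x\<bar> powr p + 1/2 * \<bar>y\<bar> powr p)"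
    using assms by (intro mult_left_mono powr_abs_convex) auto
  also have "\<dots> \<le> 2 powr p * (\<bar>x\<bar> powr p + \<bar>y\<bar> powr p)"
    by (intro mult_left_mono add_mono) auto
  finally show ?thesis .
qed

lemma Lp_scale:
  assumes "f \<in> Lp T p"
  shows "(\<lambda>t. c * f t) \<in> Lp T p" "Lp_integral T p (\<lambda>t. c * f t) = \<bar>c\<bar> powr p * Lp_integral T p f"
  using LpD[OF assms] by (auto simp: Lp_def Lp_integral_def abs_mult powr_mult)

lemma Lp_add:
  assumes "1 < p" "f \<in> Lp T p" "g \<in> Lp T p"
  shows "(\<lambda>t. f t + g t) \<in> Lp T p"
    "Lp_integral T p (\<lambda>t. f t + g t) \<le> 2 powr p * (Lp_integral T p f + Lp_integral T p g)"
proof -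
  note [measurable] = LpD(1)[OF assms(2)] LpD(1)[OF assms(3)]
  note [simp] = LpD(2)[OF assms(2)] LpD(2)[OF assms(3)]
  have int: "integrable (lebesgue_on {0..T}) (\<lambda>t. \<bar>f t + g t\<bar> powr p)"
    by (rule Bochner_Integration.integrable_bound[of _ "\<lambda>t. 2 powr p * (\<bar>f t\<bar> powr p + \<bar>g t\<bar> powr p)"])
      (auto simp: powr_abs_add_le[OF assms(1)])
  then show "(\<lambda>t. f t + g t) \<in> Lp T p" by (simp add: Lp_def)
  have "Lp_integral T p (\<lambda>t. f t + g t) \<le> (\<integral>t. 2 powr p * (\<bar>f t\<bar> powr p + \<bar>g t\<bar> powr p) \<partial>lebesgue_on {0..T})"
    unfolding Lp_integral_def using int by (intro integral_mono powr_abs_add_le assms) auto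
  then show "Lp_integral T p (\<lambda>t. f t + g t) \<le> 2 powr p * (Lp_integral T p f + Lp_integral T p g)"
    by (simp add: Lp_integral_def)
qed

lemma Lp_lincomb:
  assumes "1 < p" "f \<in> Lp T p" "g \<in> Lp T p"
  shows "(\<lambda>t. a * f t + b * g t) \<in> Lp T p"
  using assms by (intro Lp_add Lp_scale)

lemma Lp_diff:
  assumes "1 < p" "f \<in> Lp T p" "g \<in> Lp T p"
  shows "(\<lambda>t. f t - g t) \<in> Lp T p"
  using Lp_lincomb[OF assms, of 1 "-1"] by simp

lemma Lp_integral_minus: "Lp_integral T p (\<lambda>t. f t - g t) = Lp_integral T p (\<lambda>t. g t - f t)"
  by (simp add: Lp_integral_def abs_minus_commute)

lemma Lp_integral_cong_AE:
  assumes "f \<in> Lp T p" "g \<in> Lp T p" "AE t in lebesgue_on {0..T}. f t = g t"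
  shows "Lp_integral T p f = Lp_integral T p g"
proof -
  note [measurable] = LpD(1)[OF assms(1)] LpD(1)[OF assms(2)]
  show ?thesis unfolding Lp_integral_def using assms(3) by (intro integral_cong_AE) auto
qed

lemma Lp_integral_eq_0_iff:
  assumes "g \<in> Lp T p"
  shows "Lp_integral T p g = 0 \<longleftrightarrow> (AE t in lebesgue_on {0..T}. g t = 0)"
  unfolding Lp_integral_def
  using integral_nonneg_eq_0_iff_AE[OF LpD(2)[OF assms]] by simp

lemma Lp_integral_convex:
  assumes "1 < p" "f \<in> Lp T p" "g \<in> Lp T p" "0 \<le> s" "s \<le> 1"
  shows "Lp_integral T p (\<lambda>t. (1 - s) * f t + s * g t) \<le> (1 - s) * Lp_integral T p f + s * Lp_integral T p g"
proof -
  have "Lp_integral T p (\<lambda>t. (1 - s) * f t + s * g t)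
      \<le> (\<integral>t. (1 - s) * \<bar>f t\<bar> powr p + s * \<bar>g t\<bar> powr p \<partial>lebesgue_on {0..T})"
    unfolding Lp_integral_def
    using LpD(2)[OF Lp_lincomb[OF assms(1-3)]] LpD(2)[OF assms(2)] LpD(2)[OF assms(3)] assms
    by (intro integral_mono powr_abs_convex) auto
  then show ?thesis using LpD(2)[OF assms(2)] LpD(2)[OF assms(3)] by (simp add: Lp_integral_def)
qed

text \<open>The pointwise inequality, integrated. It takes the place of Clarkson's inequalities and
  treats all \<open>p > 1\<close> at once; the price is an error proportional to the size of both
  functions, with a factor that may be chosen arbitrarily small.\<close>

lemma Lp_integral_uniformly_convex:
  assumes "1 < p" "\<epsilon> > 0"
  obtains C where "C \<ge> 0" "\<And>f g. f \<in> Lp T p \<Longrightarrow> g \<in> Lp T p \<Longrightarrow>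
    Lp_integral T p (\<lambda>t. f t - g t) \<le> \<epsilon> * (Lp_integral T p f + Lp_integral T p g)
      + C * ((Lp_integral T p f + Lp_integral T p g) / 2 - Lp_integral T p (\<lambda>t. (f t + g t) / 2))"
proof -
  obtain C where C: "C \<ge> 0" "\<And>x y. \<bar>x - y\<bar> powr p \<le> \<epsilon> * (\<bar>x\<bar> powr p + \<bar>y\<bar> powr p)
      + C * ((\<bar>x\<bar> powr p + \<bar>y\<bar> powr p) / 2 - \<bar>(x + y) / 2\<bar> powr p)"
    using powr_abs_uniformly_convex[OF assms] by metis
  have "Lp_integral T p (\<lambda>t. f t - g t) \<le> \<epsilon> * (Lp_integral T p f + Lp_integral T p g)
      + C * ((Lp_integral T p f + Lp_integral T p g) / 2 - Lp_integral T p (\<lambda>t. (f t + g t) / 2))"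
    if "f \<in> Lp T p" "g \<in> Lp T p" for f g
  proof -
    have "(\<lambda>t. (f t + g t) / 2) \<in> Lp T p"
      using Lp_lincomb[OF assms(1) that, of "1/2" "1/2"] by (simp add: add_divide_distrib)
    note int = LpD(2)[OF this] LpD(2)[OF that(1)] LpD(2)[OF that(2)] LpD(2)[OF Lp_diff[OF assms(1) that]]
    have "Lp_integral T p (\<lambda>t. f t - g t) \<le> (\<integral>t. \<epsilon> * (\<bar>f t\<bar> powr p + \<bar>g t\<bar> powr p)
      + C * ((\<bar>f t\<bar> powr p + \<bar>g t\<bar> powr p) / 2 - \<bar>(f t + g t) / 2\<bar> powr p) \<partial>lebesgue_on {0..T})"
      unfolding Lp_integral_def using int by (intro integral_mono C) auto
    also have "\<dots> = \<epsilon> * (Lp_integral T p f + Lp_integral T p g)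
      + C * ((Lp_integral T p f + Lp_integral T p g) / 2 - Lp_integral T p (\<lambda>t. (f t + g t) / 2))"
      unfolding Lp_integral_def using int
      by (simp add: Bochner_Integration.integral_add Bochner_Integration.integral_diff del: abs_divide)
    finally show ?thesis .
  qed
  then show thesis using that C(1) by blast
qed

lemma Lp_norm_tendsto_0_iff:
  assumes "p > 0"
  shows "(\<lambda>n. Lp_norm T p (g n)) \<longlonglongrightarrow> 0 \<longleftrightarrow> (\<lambda>n. Lp_integral T p (g n)) \<longlonglongrightarrow> 0"
proof
  assume "(\<lambda>n. Lp_norm T p (g n)) \<longlonglongrightarrow> 0"
  then have "(\<lambda>n. Lp_norm T p (g n) powr p) \<longlonglongrightarrow> 0 powr p"
    using assms by (intro tendsto_powr') (auto simp: Lp_norm_eq)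
  then show "(\<lambda>n. Lp_integral T p (g n)) \<longlonglongrightarrow> 0" using assms by (simp add: Lp_norm_powr)
next
  assume "(\<lambda>n. Lp_integral T p (g n)) \<longlonglongrightarrow> 0"
  then have "(\<lambda>n. Lp_integral T p (g n) powr (1 / p)) \<longlonglongrightarrow> 0 powr (1 / p)"
    using assms by (intro tendsto_powr') auto
  then show "(\<lambda>n. Lp_norm T p (g n)) \<longlonglongrightarrow> 0" using assms by (simp add: Lp_norm_eq)
qed

lemma Lp_converges_iff:
  assumes "p > 0"
  shows "Lp_converges T p g h \<longleftrightarrow> (\<forall>n. g n \<in> Lp T p) \<and> h \<in> Lp T p \<and>
     (\<lambda>n. Lp_integral T p (\<lambda>t. g n t - h t)) \<longlonglongrightarrow> 0"
  using Lp_norm_tendsto_0_iff[OF assms, of T "\<lambda>n t. g n t - h t"] by (simp add: Lp_converges_def)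

lemma Holder_inequality:
  fixes p q :: real
  assumes pq: "1 < p" "1 < q" "1 / p + 1 / q = 1" and f: "f \<in> Lp T p" and g: "g \<in> Lp T q"
  shows "integrable (lebesgue_on {0..T}) (\<lambda>t. f t * g t)"
    and "(\<integral>t. \<bar>f t * g t\<bar> \<partial>lebesgue_on {0..T}) \<le> Lp_norm T p f * Lp_norm T q g"
proof -
  let ?M = "lebesgue_on {0..T}"
  note [measurable] = LpD(1)[OF f] LpD(1)[OF g]
  note [simp] = LpD(2)[OF f] LpD(2)[OF g]
  show int: "integrable ?M (\<lambda>t. f t * g t)"
  proof (rule Bochner_Integration.integrable_bound[of _ "\<lambda>t. \<bar>f t\<bar> powr p / p + \<bar>g t\<bar> powr q / q"])
    show "AE t in ?M. norm (f t * g t) \<le> norm (\<bar>f t\<bar> powr p / p + \<bar>g t\<bar> powr q / q)"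
    proof (rule AE_I2)
      fix t
      have "\<bar>f t\<bar> * \<bar>g t\<bar> \<le> \<bar>f t\<bar> powr p / p + \<bar>g t\<bar> powr q / q"
        using pq by (intro Youngs_inequality) auto
      then show "norm (f t * g t) \<le> norm (\<bar>f t\<bar> powr p / p + \<bar>g t\<bar> powr q / q)"
        using pq by (simp add: abs_mult)
    qed
  qed auto
  let ?A = "Lp_norm T p f" and ?B = "Lp_norm T q g"
  have AB: "?A \<ge> 0" "?B \<ge> 0" by (auto simp: Lp_norm_def)
  show "(\<integral>t. \<bar>f t * g t\<bar> \<partial>?M) \<le> ?A * ?B"
  proof (cases "?A = 0 \<or> ?B = 0")
    case True
    then have "Lp_integral T p f = 0 \<or> Lp_integral T q g = 0"
      using pq by (auto simp: Lp_norm_eq)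
    then have "AE t in ?M. f t * g t = 0"
      unfolding Lp_integral_eq_0_iff[OF f] Lp_integral_eq_0_iff[OF g] by (auto elim: AE_mp)
    then have "(\<integral>t. \<bar>f t * g t\<bar> \<partial>?M) = (\<integral>t. 0 \<partial>?M)"
      by (intro integral_cong_AE) auto
    then show ?thesis using AB by simp
  next
    case False
    then have pos: "?A > 0" "?B > 0" using AB by auto
    have AE: "\<bar>f t * g t\<bar> \<le> ?A * ?B * (\<bar>f t\<bar> powr p / (p * Lp_integral T p f) + \<bar>g t\<bar> powr q / (q * Lp_integral T q g))" for t
    proof -
      have "(\<bar>f t\<bar> / ?A) * (\<bar>g t\<bar> / ?B) \<le> (\<bar>f t\<bar> / ?A) powr p / p + (\<bar>g t\<bar> / ?B) powr q / q"
        using pq pos by (intro Youngs_inequality) auto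
      also have "\<dots> = \<bar>f t\<bar> powr p / (p * Lp_integral T p f) + \<bar>g t\<bar> powr q / (q * Lp_integral T q g)"
        using pos pq by (simp add: powr_divide Lp_norm_powr mult.commute)
      finally show ?thesis using pos by (simp add: abs_mult field_simps)
    qed
    have pos': "Lp_integral T p f > 0" "Lp_integral T q g > 0"
      using pos Lp_integral_nonneg[of T p f] Lp_integral_nonneg[of T q g] by (auto simp: Lp_norm_eq less_le)
    have "(\<integral>t. \<bar>f t * g t\<bar> \<partial>?M) \<le> (\<integral>t. ?A * ?B * (\<bar>f t\<bar> powr p / (p * Lp_integral T p f) + \<bar>g t\<bar> powr q / (q * Lp_integral T q g)) \<partial>?M)"
      using int AE by (intro integral_mono) auto
    also have "\<dots> = ?A * ?B * (Lp_integral T p f / (p * Lp_integral T p f) + Lp_integral T q g / (q * Lp_integral T q g))"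
      by (simp add: Lp_integral_def)
    also have "\<dots> = ?A * ?B" using pos' pq(3) by simp
    finally show ?thesis .
  qed
qed

lemma Holder_powr:
  assumes "1 < p" "f \<in> Lp T p" "g \<in> Lp T p"
  shows "integrable (lebesgue_on {0..T}) (\<lambda>t. \<bar>f t\<bar> powr (p - 1) * \<bar>g t\<bar>)"
    and "(\<integral>t. \<bar>f t\<bar> powr (p - 1) * \<bar>g t\<bar> \<partial>lebesgue_on {0..T}) \<le> Lp_integral T p f powr ((p - 1) / p) * Lp_norm T p g"
proof -
  define q where "q = p / (p - 1)"
  have q: "1 < q" "1 / q + 1 / p = 1" "(p - 1) * q = p" "1 / q = (p - 1) / p"
    using assms(1) by (auto simp: q_def field_simps)
  note [measurable] = LpD(1)[OF assms(2)]
  have f: "(\<lambda>t. \<bar>f t\<bar> powr (p - 1)) \<in> Lp T q"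
    using LpD(2)[OF assms(2)] by (simp add: Lp_def powr_powr q)
  have g: "(\<lambda>t. \<bar>g t\<bar>) \<in> Lp T p" using LpD[OF assms(3)] by (simp add: Lp_def)
  show "integrable (lebesgue_on {0..T}) (\<lambda>t. \<bar>f t\<bar> powr (p - 1) * \<bar>g t\<bar>)"
    by (rule Holder_inequality(1)[OF q(1) assms(1) q(2) f g])
  have "Lp_norm T q (\<lambda>t. \<bar>f t\<bar> powr (p - 1)) = Lp_integral T p f powr ((p - 1) / p)"
    by (simp add: Lp_norm_eq Lp_integral_def powr_powr q)
  moreover have "Lp_norm T p (\<lambda>t. \<bar>g t\<bar>) = Lp_norm T p g" by (simp add: Lp_norm_def)
  ultimately show "(\<integral>t. \<bar>f t\<bar> powr (p - 1) * \<bar>g t\<bar> \<partial>lebesgue_on {0..T}) \<le> Lp_integral T p f powr ((p - 1) / p) * Lp_norm T p g"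
    using Holder_inequality(2)[OF q(1) assms(1) q(2) f g] by simp
qed

lemma Lp_integral_diff_le:
  assumes "1 < p" "f \<in> Lp T p" "g \<in> Lp T p"
  shows "\<bar>Lp_integral T p (\<lambda>t. f t + g t) - Lp_integral T p f\<bar>
    \<le> p * 2 powr (p - 1) * (Lp_integral T p f powr ((p - 1) / p) * Lp_norm T p g + Lp_integral T p g)"
proof -
  let ?M = "lebesgue_on {0..T}"
  note int = LpD(2)[OF assms(2)] LpD(2)[OF assms(3)] LpD(2)[OF Lp_add(1)[OF assms]] Holder_powr(1)[OF assms]
  have "\<bar>Lp_integral T p (\<lambda>t. f t + g t) - Lp_integral T p f\<bar>
     = \<bar>\<integral>t. \<bar>f t + g t\<bar> powr p - \<bar>f t\<bar> powr p \<partial>?M\<bar>"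
    using int by (simp add: Lp_integral_def)
  also have "\<dots> \<le> (\<integral>t. \<bar>\<bar>f t + g t\<bar> powr p - \<bar>f t\<bar> powr p\<bar> \<partial>?M)"
    by (rule integral_abs_bound)
  also have "\<dots> \<le> (\<integral>t. p * 2 powr (p - 1) * (\<bar>f t\<bar> powr (p - 1) * \<bar>g t\<bar> + \<bar>g t\<bar> powr p) \<partial>?M)"
    using int by (intro integral_mono powr_abs_diff_le assms) auto
  also have "\<dots> = p * 2 powr (p - 1) * ((\<integral>t. \<bar>f t\<bar> powr (p - 1) * \<bar>g t\<bar> \<partial>?M) + Lp_integral T p g)"
    using int by (simp add: Lp_integral_def)
  also have "\<dots> \<le> p * 2 powr (p - 1) * (Lp_integral T p f powr ((p - 1) / p) * Lp_norm T p g + Lp_integral T p g)"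
    using assms(1) by (intro mult_left_mono add_right_mono Holder_powr(2)[OF assms]) auto
  finally show ?thesis .
qed

lemma Lp_integral_uniformly_smooth:
  assumes "1 < p" "\<epsilon> > 0"
  obtains C where "C \<ge> 0" "\<And>f g. f \<in> Lp T p \<Longrightarrow> g \<in> Lp T p \<Longrightarrow>
    Lp_integral T p (\<lambda>t. f t + g t) + Lp_integral T p (\<lambda>t. f t - g t) - 2 * Lp_integral T p f
      \<le> \<epsilon> * (Lp_integral T p f powr ((p - 1) / p) * Lp_norm T p g) + C * Lp_integral T p g"
proof -
  let ?M = "lebesgue_on {0..T}"
  obtain C where C: "C \<ge> 0" "\<And>x y. \<bar>x + y\<bar> powr p + \<bar>x - y\<bar> powr p - 2 * \<bar>x\<bar> powr p
      \<le> \<epsilon> * (\<bar>x\<bar> powr (p - 1) * \<bar>y\<bar>) + C * \<bar>y\<bar> powr p"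
    using powr_abs_uniformly_smooth[OF assms] by metis
  have "Lp_integral T p (\<lambda>t. f t + g t) + Lp_integral T p (\<lambda>t. f t - g t) - 2 * Lp_integral T p f
      \<le> \<epsilon> * (Lp_integral T p f powr ((p - 1) / p) * Lp_norm T p g) + C * Lp_integral T p g"
    if fg: "f \<in> Lp T p" "g \<in> Lp T p" for f g
  proof -
    note int = LpD(2)[OF fg(1)] LpD(2)[OF fg(2)] LpD(2)[OF Lp_add(1)[OF assms(1) fg]]
      LpD(2)[OF Lp_diff[OF assms(1) fg]] Holder_powr(1)[OF assms(1) fg]
    have "Lp_integral T p (\<lambda>t. f t + g t) + Lp_integral T p (\<lambda>t. f t - g t) - 2 * Lp_integral T p f
       = (\<integral>t. \<bar>f t + g t\<bar> powr p + \<bar>f t - g t\<bar> powr p - 2 * \<bar>f t\<bar> powr p \<partial>?M)"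
      using int by (simp add: Lp_integral_def)
    also have "\<dots> \<le> (\<integral>t. \<epsilon> * (\<bar>f t\<bar> powr (p - 1) * \<bar>g t\<bar>) + C * \<bar>g t\<bar> powr p \<partial>?M)"
      using int by (intro integral_mono C) auto
    also have "\<dots> = \<epsilon> * (\<integral>t. \<bar>f t\<bar> powr (p - 1) * \<bar>g t\<bar> \<partial>?M) + C * Lp_integral T p g"
      using int by (simp add: Lp_integral_def)
    also have "\<dots> \<le> \<epsilon> * (Lp_integral T p f powr ((p - 1) / p) * Lp_norm T p g) + C * Lp_integral T p g"
      using assms(2) by (intro add_right_mono mult_left_mono Holder_powr(2)[OF assms(1) fg]) auto
    finally show ?thesis .
  qed
  then show thesis using that C(1) by blast
qed

lemma finite_measure_lebesgue_on_interval: "finite_measure (lebesgue_on {a..b::real})"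
  by (rule finite_measureI) (simp add: emeasure_restrict_space space_restrict_space emeasure_lborel_Icc_eq)

lemma Lp_abs_integrable:
  assumes "1 < p" "g \<in> Lp T p"
  shows "integrable (lebesgue_on {0..T}) g"
proof -
  interpret finite_measure "lebesgue_on {0..T}" by (rule finite_measure_lebesgue_on_interval)
  note [measurable] = LpD(1)[OF assms(2)]
  have *: "\<bar>x\<bar> \<le> 1 + \<bar>x\<bar> powr p" for x :: real
  proof (cases "\<bar>x\<bar> \<le> 1")
    case False
    then have "\<bar>x\<bar> powr 1 \<le> \<bar>x\<bar> powr p" using assms(1) by (intro powr_mono) auto
    then show ?thesis using False by simp
  qed (auto intro: order_trans[of _ 1])
  show ?thesis
    using LpD(2)[OF assms(2)] *
    by (intro Bochner_Integration.integrable_bound[of _ "\<lambda>t. 1 + \<bar>g t\<bar> powr p" g]) auto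
qed

text \<open>A substitute for Hoelder's inequality on a finite measure space: with \<open>h\<close>
  of the size of the norm it bounds an L1 norm by a p-th power.\<close>

lemma abs_le_powr_bound:
  fixes x h p :: real
  assumes "1 < p" "0 < h"
  shows "\<bar>x\<bar> \<le> h + h powr (1 - p) * \<bar>x\<bar> powr p"
proof (cases "\<bar>x\<bar> \<le> h")
  case False
  then have "h powr (p - 1) \<le> \<bar>x\<bar> powr (p - 1)" using assms by (intro powr_mono2) auto
  then have "h powr (1 - p) * h powr (p - 1) * \<bar>x\<bar> \<le> h powr (1 - p) * \<bar>x\<bar> powr (p - 1) * \<bar>x\<bar>"
    by (intro mult_right_mono mult_left_mono) auto
  moreover have "h powr (1 - p) * h powr (p - 1) = 1" using assms by (simp flip: powr_add)
  moreover have "\<bar>x\<bar> powr (p - 1) * \<bar>x\<bar> = \<bar>x\<bar> powr p" using False assms by (simp add: powr_diff)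
  ultimately show ?thesis using assms by (simp add: mult.assoc)
qed (use assms in \<open>auto intro: add_increasing2\<close>)

lemma AE_summable:
  fixes f :: "nat \<Rightarrow> 'a \<Rightarrow> real"
  assumes [measurable]: "\<And>i. integrable M (f i)" and sum: "summable (\<lambda>i. \<integral>x. \<bar>f i x\<bar> \<partial>M)"
  shows "AE x in M. summable (\<lambda>i. f i x)"
proof -
  have "(\<integral>\<^sup>+x. (\<Sum>i. ennreal \<bar>f i x\<bar>) \<partial>M) = (\<Sum>i. \<integral>\<^sup>+x. ennreal \<bar>f i x\<bar> \<partial>M)"
    using borel_measurable_integrable[OF assms(1)] by (intro nn_integral_suminf) auto
  also have "\<dots> = (\<Sum>i. ennreal (\<integral>x. \<bar>f i x\<bar> \<partial>M))"
    using assms(1) by (intro suminf_cong nn_integral_eq_integral) auto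
  also have "\<dots> = ennreal (\<Sum>i. \<integral>x. \<bar>f i x\<bar> \<partial>M)"
    using sum by (intro suminf_ennreal2) auto
  finally have "(\<integral>\<^sup>+x. (\<Sum>i. ennreal \<bar>f i x\<bar>) \<partial>M) \<noteq> \<infinity>" by simp
  moreover have "(\<lambda>x. \<Sum>i. ennreal \<bar>f i x\<bar>) \<in> borel_measurable M"
    using borel_measurable_integrable[OF assms(1)] by measurable
  ultimately have "AE x in M. (\<Sum>i. ennreal \<bar>f i x\<bar>) \<noteq> \<infinity>"
    by (intro nn_integral_noteq_infinite)
  then show ?thesis
  proof eventually_elim
    case (elim x)
    then have "summable (\<lambda>i. \<bar>f i x\<bar>)" by (intro summable_suminf_not_top) auto
    then show ?case by (rule summable_rabs_cancel)
  qed
qed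

text \<open>The increments have summable L1 norms, so their series converges absolutely almost
  everywhere.\<close>

lemma Lp_fast_Cauchy_AE_convergent:
  assumes p: "1 < p" and w: "\<And>k. w k \<in> Lp T p"
    and fast: "\<And>k. Lp_integral T p (\<lambda>t. w (Suc k) t - w k t) \<le> ((1/2) ^ k) powr p"
  shows "AE t in lebesgue_on {0..T}. convergent (\<lambda>k. w k t)"
proof -
  let ?M = "lebesgue_on {0..T}"
  interpret finite_measure ?M by (rule finite_measure_lebesgue_on_interval)
  have d: "(\<lambda>t. w (Suc k) t - w k t) \<in> Lp T p" for k by (intro Lp_diff p w)
  have int: "integrable ?M (\<lambda>t. w (Suc k) t - w k t)" for k
    by (rule Lp_abs_integrable[OF p d])
  have bnd: "(\<integral>t. \<bar>w (Suc k) t - w k t\<bar> \<partial>?M) \<le> (measure ?M (space ?M) + 1) * (1/2) ^ k" for k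
  proof -
    let ?h = "(1/2 :: real) ^ k"
    have "(\<integral>t. \<bar>w (Suc k) t - w k t\<bar> \<partial>?M) \<le> (\<integral>t. ?h + ?h powr (1 - p) * \<bar>w (Suc k) t - w k t\<bar> powr p \<partial>?M)"
      using int[of k] LpD(2)[OF d[of k]] p by (intro integral_mono abs_le_powr_bound) auto
    also have "\<dots> = measure ?M (space ?M) * ?h + ?h powr (1 - p) * Lp_integral T p (\<lambda>t. w (Suc k) t - w k t)"
      using LpD(2)[OF d[of k]] by (simp add: Lp_integral_def)
    also have "\<dots> \<le> measure ?M (space ?M) * ?h + ?h powr (1 - p) * ?h powr p"
      using fast[of k] by (intro add_left_mono mult_left_mono) auto
    also have "?h powr (1 - p) * ?h powr p = ?h" by (simp flip: powr_add)
    finally show ?thesis by (simp add: algebra_simps)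
  qed
  have "summable (\<lambda>k. (measure ?M (space ?M) + 1) * (1/2) ^ k)"
    by (intro summable_mult summable_geometric) auto
  then have "summable (\<lambda>k. \<integral>t. \<bar>w (Suc k) t - w k t\<bar> \<partial>?M)"
    by (rule summable_comparison_test') (use bnd in auto)
  from AE_summable[OF int this] show ?thesis
  proof eventually_elim
    case (elim t)
    then have "(\<lambda>n. \<Sum>k<n. w (Suc k) t - w k t) \<longlonglongrightarrow> (\<Sum>k. w (Suc k) t - w k t)"
      by (rule summable_LIMSEQ)
    then have "(\<lambda>n. w n t - w 0 t) \<longlonglongrightarrow> (\<Sum>k. w (Suc k) t - w k t)"
      unfolding sum_lessThan_telescope[of "\<lambda>k. w k t"] .
    from tendsto_add[OF this tendsto_const[of "w 0 t"]] show ?case by (auto simp: convergent_def)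
  qed
qed

text \<open>Riesz--Fischer: a fast subsequence converges almost everywhere, and Fatou's lemma turns
  the Cauchy estimates into estimates for the limit.\<close>

theorem Lp_complete:
  assumes p: "1 < p" and w: "\<And>k. w k \<in> Lp T p"
    and Cauchy: "\<And>e. e > 0 \<Longrightarrow> \<exists>N. \<forall>m\<ge>N. \<forall>n\<ge>N. Lp_integral T p (\<lambda>t. w m t - w n t) \<le> e"
  obtains g where "g \<in> Lp T p" "(\<lambda>n. Lp_integral T p (\<lambda>t. w n t - g t)) \<longlonglongrightarrow> 0"
proof -
  let ?M = "lebesgue_on {0..T}"
  have "\<exists>r. \<forall>k. (\<forall>m\<ge>r k. \<forall>n\<ge>r k. Lp_integral T p (\<lambda>t. w m t - w n t) \<le> ((1/2) ^ k) powr p) \<and> r k < r (Suc k)"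
  proof (rule dependent_nat_choice)
    show "\<exists>x. \<forall>m\<ge>x. \<forall>n\<ge>x. Lp_integral T p (\<lambda>t. w m t - w n t) \<le> ((1/2) ^ 0) powr p"
      by (rule Cauchy) auto
    fix x k
    obtain N where "\<forall>m\<ge>N. \<forall>n\<ge>N. Lp_integral T p (\<lambda>t. w m t - w n t) \<le> ((1/2) ^ Suc k) powr p"
      using Cauchy[of "((1/2) ^ Suc k) powr p"] by auto
    then show "\<exists>y. (\<forall>m\<ge>y. \<forall>n\<ge>y. Lp_integral T p (\<lambda>t. w m t - w n t) \<le> ((1/2) ^ Suc k) powr p) \<and> x < y"
      by (intro exI[of _ "max N (Suc x)"]) auto
  qed
  then obtain r where r: "\<And>k m n. m \<ge> r k \<Longrightarrow> n \<ge> r k \<Longrightarrow> Lp_integral T p (\<lambda>t. w m t - w n t) \<le> ((1/2) ^ k) powr p"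
      "\<And>k. r k < r (Suc k)" by metis
  have mono: "strict_mono r" using r(2) by (simp add: strict_mono_Suc_iff)
  have conv: "AE t in ?M. convergent (\<lambda>k. w (r k) t)"
    using r(2) by (intro Lp_fast_Cauchy_AE_convergent[OF p w] r(1)) (auto intro: less_imp_le)
  define g where "g t = lim (\<lambda>k. w (r k) t)" for t
  have [measurable]: "w k \<in> borel_measurable ?M" for k by (rule LpD(1)[OF w])
  have g[measurable]: "g \<in> borel_measurable ?M" unfolding g_def by measurable
  have est: "(\<integral>\<^sup>+t. ennreal (\<bar>w n t - g t\<bar> powr p) \<partial>?M) \<le> ennreal e"
    if N: "e > 0" "\<forall>m\<ge>N. \<forall>n\<ge>N. Lp_integral T p (\<lambda>t. w m t - w n t) \<le> e" "n \<ge> N" for n N e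
  proof -
    have "AE t in ?M. (\<lambda>k. ennreal (\<bar>w n t - w (r k) t\<bar> powr p)) \<longlonglongrightarrow> ennreal (\<bar>w n t - g t\<bar> powr p)"
      using conv
    proof eventually_elim
      case (elim t)
      then have "(\<lambda>k. w (r k) t) \<longlonglongrightarrow> g t" by (simp add: g_def convergent_LIMSEQ_iff)
      then have "(\<lambda>k. \<bar>w n t - w (r k) t\<bar> powr p) \<longlonglongrightarrow> \<bar>w n t - g t\<bar> powr p"
        using p by (intro tendsto_powr' tendsto_intros) auto
      then show ?case by (rule tendsto_ennrealI)
    qed
    then have "(\<integral>\<^sup>+t. ennreal (\<bar>w n t - g t\<bar> powr p) \<partial>?M)
       = (\<integral>\<^sup>+t. liminf (\<lambda>k. ennreal (\<bar>w n t - w (r k) t\<bar> powr p)) \<partial>?M)"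
      by (intro nn_integral_cong_AE, elim eventually_mono) (rule lim_imp_Liminf[OF sequentially_bot, symmetric])
    also have "\<dots> \<le> liminf (\<lambda>k. \<integral>\<^sup>+t. ennreal (\<bar>w n t - w (r k) t\<bar> powr p) \<partial>?M)"
      by (intro nn_integral_liminf) measurable
    also have "\<dots> \<le> limsup (\<lambda>k. \<integral>\<^sup>+t. ennreal (\<bar>w n t - w (r k) t\<bar> powr p) \<partial>?M)"
      by (intro Liminf_le_Limsup) auto
    also have "\<dots> \<le> ennreal e"
    proof (rule Limsup_bounded)
      have "eventually (\<lambda>k. r k \<ge> N) sequentially"
        using filterlim_subseq[OF mono] by (simp add: filterlim_at_top)
      then show "\<forall>\<^sub>F k in sequentially. (\<integral>\<^sup>+t. ennreal (\<bar>w n t - w (r k) t\<bar> powr p) \<partial>?M) \<le> ennreal e"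
      proof eventually_elim
        case (elim k)
        have "(\<integral>\<^sup>+t. ennreal (\<bar>w n t - w (r k) t\<bar> powr p) \<partial>?M) = ennreal (Lp_integral T p (\<lambda>t. w n t - w (r k) t))"
          unfolding Lp_integral_def by (intro nn_integral_eq_integral LpD(2)[OF Lp_diff[OF p w w]]) auto
        also have "\<dots> \<le> ennreal e" using N elim by (intro ennreal_leI) auto
        finally show ?case .
      qed
    qed
    finally show ?thesis .
  qed
  have diff: "(\<lambda>t. w n t - g t) \<in> Lp T p \<and> Lp_integral T p (\<lambda>t. w n t - g t) \<le> e"
    if N: "e > 0" "\<forall>m\<ge>N. \<forall>n\<ge>N. Lp_integral T p (\<lambda>t. w m t - w n t) \<le> e" "n \<ge> N" for n N e
  proof -
    have int: "integrable ?M (\<lambda>t. \<bar>w n t - g t\<bar> powr p)"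
      using est[OF N] by (intro integrableI_bounded) (auto simp: le_less_trans[OF _ ennreal_less_top])
    then have "ennreal (Lp_integral T p (\<lambda>t. w n t - g t)) \<le> ennreal e"
      using est[OF N] unfolding Lp_integral_def by (subst nn_integral_eq_integral[symmetric]) auto
    then show ?thesis using int N(1) by (auto simp: Lp_def ennreal_le_iff)
  qed
  obtain N where "\<forall>m\<ge>N. \<forall>n\<ge>N. Lp_integral T p (\<lambda>t. w m t - w n t) \<le> 1" using Cauchy[of 1] by auto
  then have "(\<lambda>t. w N t - g t) \<in> Lp T p" using diff[of 1 N N] by simp
  from Lp_diff[OF p w[of N] this] have gL: "g \<in> Lp T p" by simp
  moreover have "(\<lambda>n. Lp_integral T p (\<lambda>t. w n t - g t)) \<longlonglongrightarrow> 0"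
  proof (rule LIMSEQ_I)
    fix e :: real assume "e > 0"
    then obtain N where N: "\<forall>m\<ge>N. \<forall>n\<ge>N. Lp_integral T p (\<lambda>t. w m t - w n t) \<le> e / 2" using Cauchy[of "e / 2"] by auto
    show "\<exists>N. \<forall>n\<ge>N. norm (Lp_integral T p (\<lambda>t. w n t - g t) - 0) < e"
      using diff[OF _ N] \<open>e > 0\<close> by (intro exI[of _ N]) force
  qed
  ultimately show thesis using that by blast
qed

lemma Lp_integral_limit_le:
  assumes p: "1 < p" and w: "\<And>k. w k \<in> Lp T p" "g \<in> Lp T p"
    and lim: "(\<lambda>k. Lp_integral T p (\<lambda>t. w k t - g t)) \<longlonglongrightarrow> 0"
  shows "(\<lambda>k. Lp_integral T p (w k)) \<longlonglongrightarrow> Lp_integral T p g"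
proof -
  have d: "(\<lambda>t. w k t - g t) \<in> Lp T p" for k by (intro Lp_diff assms)
  have n: "(\<lambda>k. Lp_norm T p (\<lambda>t. w k t - g t)) \<longlonglongrightarrow> 0"
    using lim p by (subst Lp_norm_tendsto_0_iff) auto
  have "\<forall>k. norm (Lp_integral T p (w k) - Lp_integral T p g) \<le>
    p * 2 powr (p - 1) * (Lp_integral T p g powr ((p - 1) / p) * Lp_norm T p (\<lambda>t. w k t - g t) + Lp_integral T p (\<lambda>t. w k t - g t))"
    using Lp_integral_diff_le[OF p w(2) d] by simp
  moreover have lim0: "(\<lambda>k. p * 2 powr (p - 1) * (Lp_integral T p g powr ((p - 1) / p) * Lp_norm T p (\<lambda>t. w k t - g t) + Lp_integral T p (\<lambda>t. w k t - g t))) \<longlonglongrightarrow> 0"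
    using tendsto_mult[OF tendsto_const[of "p * 2 powr (p - 1)"] tendsto_add[OF tendsto_mult[OF tendsto_const[of "Lp_integral T p g powr ((p - 1) / p)"] n] lim]] by simp
  ultimately have "(\<lambda>k. Lp_integral T p (w k) - Lp_integral T p g) \<longlonglongrightarrow> 0"
    by (rule Lim_null_comparison[OF always_eventually])
  then show ?thesis by (simp add: LIM_zero_iff)
qed

section \<open>Fractional integrals\<close>

lemma nonneg_has_integral_lebesgue_on:
  fixes f :: "real \<Rightarrow> real"
  assumes "(f has_integral I) S" "S \<in> sets lebesgue" "\<And>x. x \<in> S \<Longrightarrow> f x \<ge> 0"
  shows "integrable (lebesgue_on S) f" "(\<integral>x. f x \<partial>lebesgue_on S) = I"
proof -
  have "f absolutely_integrable_on S"
    using assms by (subst absolutely_integrable_on_iff_nonneg) (auto simp: has_integral_iff)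
  then show int: "integrable (lebesgue_on S) f"
    using assms(2) by (simp add: absolutely_integrable_on_def set_integrable_def integrable_restrict_space)
  show "(\<integral>x. f x \<partial>lebesgue_on S) = I"
    using has_integral_integral_lebesgue_on[OF int assms(2)] assms(1) has_integral_unique by blast
qed

lemma nonneg_has_integral_lebesgue_on_subset:
  fixes f :: "real \<Rightarrow> real"
  assumes "(f has_integral I) {u..v}" "{u..v} \<subseteq> {0..T}" "\<And>x. x \<in> {u..v} \<Longrightarrow> f x \<ge> 0" "\<And>x. x \<notin> {u..v} \<Longrightarrow> f x = 0"
  shows "integrable (lebesgue_on {0..T}) f" "(\<integral>x. f x \<partial>lebesgue_on {0..T}) = I"
proof -
  have "(f has_integral I) {0..T}"
    using has_integral_on_superset[OF assms(1) assms(4) assms(2)] by blast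
  moreover have "\<And>x. f x \<ge> 0" using assms(3,4) by (metis order_refl)
  ultimately show "integrable (lebesgue_on {0..T}) f" "(\<integral>x. f x \<partial>lebesgue_on {0..T}) = I"
    using nonneg_has_integral_lebesgue_on[of f I "{0..T}"] by auto
qed

text \<open>The truncation places all integrals on the fixed interval \<open>{0..T}\<close>, so that
  kernels for different \<open>t\<close> can be subtracted and Fubini's theorem applies on a square.
  At \<open>s = t\<close> it agrees with the original integrand because
  \<open>0 powr x = 0\<close>.\<close>

definition rl_kernel :: "real \<Rightarrow> real \<Rightarrow> real \<Rightarrow> real" where
  "rl_kernel \<gamma> t s = (if 0 \<le> s \<and> s < t then (t - s) powr (\<gamma> - 1) else 0)"

lemma rl_kernel_nonneg [simp]: "rl_kernel \<gamma> t s \<ge> 0"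
  by (simp add: rl_kernel_def)

lemma left_RL_integral_eq_kernel:
  assumes "t \<le> T"
  shows "left_RL_integral \<gamma> u t = 1 / Gamma \<gamma> * (\<integral>s. rl_kernel \<gamma> t s * u s \<partial>lebesgue_on {0..T})"
proof -
  have "(LINT s:{0..t}|lebesgue. (t - s) powr (\<gamma> - 1) * u s) = (\<integral>s. indicator {0..T} s *\<^sub>R (rl_kernel \<gamma> t s * u s) \<partial>lebesgue)"
    unfolding set_lebesgue_integral_def
    using assms by (intro Bochner_Integration.integral_cong) (auto simp: rl_kernel_def indicator_def)
  then show ?thesis by (simp add: left_RL_integral_def integral_restrict_space)
qed

lemma has_integral_rl_power:
  fixes \<gamma> u t :: real
  assumes "\<gamma> > 0" "u \<le> t"
  shows "((\<lambda>s. (t - s) powr (\<gamma> - 1)) has_integral (t - u) powr \<gamma> / \<gamma>) {u..t}"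
proof -
  have "((\<lambda>s. (t - s) powr (\<gamma> - 1)) has_integral (- ((t - t) powr \<gamma> / \<gamma>) - - ((t - u) powr \<gamma> / \<gamma>))) {u..t}"
  proof (rule fundamental_theorem_of_calculus_interior[OF assms(2)])
    show "continuous_on {u..t} (\<lambda>s. - ((t - s) powr \<gamma> / \<gamma>))"
      using assms by (intro continuous_intros continuous_on_powr_nonneg) auto
    fix s assume "s \<in> {u<..<t}"
    then have "((\<lambda>s. - ((t - s) powr \<gamma> / \<gamma>)) has_real_derivative (t - s) powr (\<gamma> - 1)) (at s)"
      using assms by (auto intro!: derivative_eq_intros)
    then show "((\<lambda>s. - ((t - s) powr \<gamma> / \<gamma>)) has_vector_derivative (t - s) powr (\<gamma> - 1)) (at s)"
      by (simp add: has_real_derivative_iff_has_vector_derivative)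
  qed
  then show ?thesis using assms by simp
qed

lemma rl_kernel_tail_integral:
  assumes "\<gamma> > 0" "0 \<le> u" "u \<le> t" "t \<le> T"
  shows "integrable (lebesgue_on {0..T}) (\<lambda>s. of_bool (u \<le> s) * rl_kernel \<gamma> t s)"
    and "(\<integral>s. of_bool (u \<le> s) * rl_kernel \<gamma> t s \<partial>lebesgue_on {0..T}) = (t - u) powr \<gamma> / \<gamma>"
proof -
  have "((\<lambda>s. of_bool (u \<le> s) * rl_kernel \<gamma> t s) has_integral (t - u) powr \<gamma> / \<gamma>) {u..t}"
    using has_integral_rl_power[OF assms(1,3)]
    by (rule has_integral_eq[rotated]) (use assms in \<open>auto simp: rl_kernel_def\<close>)
  note H = this
  show "integrable (lebesgue_on {0..T}) (\<lambda>s. of_bool (u \<le> s) * rl_kernel \<gamma> t s)"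
    by (rule nonneg_has_integral_lebesgue_on_subset(1)[OF H]) (use assms in \<open>auto simp: rl_kernel_def\<close>)
  show "(\<integral>s. of_bool (u \<le> s) * rl_kernel \<gamma> t s \<partial>lebesgue_on {0..T}) = (t - u) powr \<gamma> / \<gamma>"
    by (rule nonneg_has_integral_lebesgue_on_subset(2)[OF H]) (use assms in \<open>auto simp: rl_kernel_def\<close>)
qed

lemma rl_kernel_integral:
  assumes "\<gamma> > 0" "0 \<le> t" "t \<le> T"
  shows "integrable (lebesgue_on {0..T}) (\<lambda>s. rl_kernel \<gamma> t s)"
    and "(\<integral>s. rl_kernel \<gamma> t s \<partial>lebesgue_on {0..T}) = t powr \<gamma> / \<gamma>"
proof -
  have *: "of_bool (0 \<le> s) * rl_kernel \<gamma> t s = rl_kernel \<gamma> t s" for s by (simp add: rl_kernel_def)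
  show "integrable (lebesgue_on {0..T}) (\<lambda>s. rl_kernel \<gamma> t s)"
    "(\<integral>s. rl_kernel \<gamma> t s \<partial>lebesgue_on {0..T}) = t powr \<gamma> / \<gamma>"
    using rl_kernel_tail_integral[OF assms(1) order_refl assms(2,3)] unfolding * by simp_all
qed

lemma powr_superadditive:
  fixes x y q :: real
  assumes "1 \<le> q" "0 \<le> x" "0 \<le> y"
  shows "x powr q + y powr q \<le> (x + y) powr q"
proof (cases "x + y = 0")
  case True
  then show ?thesis using assms by (simp add: add_nonneg_eq_0_iff)
next
  case False
  then have z: "x + y > 0" using assms by auto
  have *: "(u / (x + y)) powr q \<le> u / (x + y)" if "0 \<le> u" "u \<le> x + y" for u
  proof (cases "u = 0")
    case False
    then show ?thesis using that z assms powr_mono'[of 1 q "u / (x + y)"] by (simp add: divide_le_eq)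
  qed simp
  have "(x / (x + y)) powr q + (y / (x + y)) powr q \<le> x / (x + y) + y / (x + y)"
    using assms by (intro add_mono *) auto
  also have "\<dots> = 1" using z by (simp flip: add_divide_distrib)
  finally show ?thesis using z assms by (simp add: powr_divide flip: add_divide_distrib)
qed

text \<open>The elementary inequality \<open>(A - B)^q \<le> A^q - B^q\<close> makes the q-norm computable.\<close>

lemma rl_kernel_diff_Lp:
  fixes \<gamma> p q :: real
  assumes q: "1 < q" and \<beta>: "\<beta> = (\<gamma> - 1) * q + 1" "\<beta> > 0" and \<gamma>: "\<gamma> \<le> 1" and t: "0 \<le> t" "t \<le> t'" "t' \<le> T"
  shows "(\<lambda>s. rl_kernel \<gamma> t' s - rl_kernel \<gamma> t s) \<in> Lp T q"
    and "Lp_integral T q (\<lambda>s. rl_kernel \<gamma> t' s - rl_kernel \<gamma> t s) \<le> 2 * (t' - t) powr \<beta> / \<beta>"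
proof -
  let ?M = "lebesgue_on {0..T}"
  let ?K = "\<lambda>s. rl_kernel \<gamma> t' s - rl_kernel \<gamma> t s"
  \<comment> \<open>For \<open>s\<close> between \<open>t\<close> and \<open>t'\<close> the kernel
    at \<open>t'\<close> already enters with a minus sign, hence the factor 2. In the integral the
    first two terms have a nonpositive sum, which leaves the power of \<open>t' - t\<close>.\<close>
  let ?H = "\<lambda>s. rl_kernel \<beta> t s - rl_kernel \<beta> t' s + 2 * (of_bool (t \<le> s) * rl_kernel \<beta> t' s)"
  have b1: "\<beta> - 1 = (\<gamma> - 1) * q" using \<beta> by simp
  have bound: "\<bar>?K s\<bar> powr q \<le> ?H s" for s
  proof -
    consider "0 \<le> s \<and> s < t" | "t \<le> s \<and> s < t'" | "\<not> (0 \<le> s \<and> s < t')" using t by linarith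
    then show ?thesis
    proof cases
      case 1
      define A where "A = (t - s) powr (\<gamma> - 1)"
      define B where "B = (t' - s) powr (\<gamma> - 1)"
      have AB: "0 \<le> B" "B \<le> A" unfolding A_def B_def using 1 t \<gamma> by (auto intro!: powr_mono2')
      have "(A - B) powr q + B powr q \<le> A powr q"
        using powr_superadditive[of q "A - B" B] AB q by simp
      moreover have "A powr q = rl_kernel \<beta> t s" "B powr q = rl_kernel \<beta> t' s"
        using 1 t by (auto simp: A_def B_def rl_kernel_def powr_powr b1)
      moreover have "\<bar>?K s\<bar> = A - B" using 1 t AB by (simp add: rl_kernel_def A_def B_def)
      ultimately show ?thesis using 1 by simp
    next
      case 2
      then have "\<bar>?K s\<bar> powr q = rl_kernel \<beta> t' s" using t
        by (simp add: rl_kernel_def powr_powr b1)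
      then show ?thesis using 2 by (simp add: rl_kernel_def)
    next
      case 3
      then show ?thesis using t by (auto simp: rl_kernel_def)
    qed
  qed
  have t': "0 \<le> t'" "t \<le> T" using t by auto
  note ints = rl_kernel_integral[OF \<beta>(2) t(1) t'(2)] rl_kernel_integral[OF \<beta>(2) t'(1) t(3)] rl_kernel_tail_integral[OF \<beta>(2) t]
  have intH: "integrable ?M ?H" using ints by auto
  have id[measurable]: "(\<lambda>s. s) \<in> borel_measurable ?M"
    by (rule continuous_imp_measurable_on_sets_lebesgue) (auto intro: continuous_intros)
  have meas[measurable]: "?K \<in> borel_measurable ?M" unfolding rl_kernel_def by measurable
  have intK: "integrable ?M (\<lambda>s. \<bar>?K s\<bar> powr q)"
  proof (rule Bochner_Integration.integrable_bound[OF intH])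
    show "AE s in ?M. norm (\<bar>?K s\<bar> powr q) \<le> norm (?H s)"
      unfolding real_norm_def abs_of_nonneg[OF powr_ge_zero] by (intro AE_I2 order_trans[OF bound abs_ge_self])
  qed measurable
  then show "?K \<in> Lp T q" using meas by (simp add: Lp_def)
  have "Lp_integral T q ?K \<le> (\<integral>s. ?H s \<partial>?M)"
    unfolding Lp_integral_def using intK intH bound by (intro integral_mono) auto
  also have "\<dots> = t powr \<beta> / \<beta> - t' powr \<beta> / \<beta> + 2 * ((t' - t) powr \<beta> / \<beta>)"
    using ints by simp
  also have "\<dots> \<le> 2 * (t' - t) powr \<beta> / \<beta>"
    using t \<beta>(2) powr_mono2[of \<beta> t t'] by (simp add: divide_right_mono)
  finally show "Lp_integral T q ?K \<le> 2 * (t' - t) powr \<beta> / \<beta>" .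
qed

lemma rl_kernel_0: "rl_kernel \<gamma> 0 s = 0"
  by (simp add: rl_kernel_def)

text \<open>Hoelder's inequality against the difference of two kernels. Its q-norm yields the
  exponent \<open>\<beta> / q = \<gamma> - 1 / p\<close>, so the condition
  \<open>1 / p < \<gamma>\<close> is the positivity of \<open>\<beta>\<close>.\<close>

lemma left_RL_integral_Holder:
  assumes p: "1 < p" and \<gamma>: "1 / p < \<gamma>" "\<gamma> \<le> 1"
  obtains C where "C > 0" "\<And>w t t'. w \<in> Lp T p \<Longrightarrow> 0 \<le> t \<Longrightarrow> t \<le> t' \<Longrightarrow> t' \<le> T \<Longrightarrow>
     \<bar>left_RL_integral \<gamma> w t' - left_RL_integral \<gamma> w t\<bar> \<le> C * (t' - t) powr (\<gamma> - 1 / p) * Lp_norm T p w"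
    "\<And>w t. w \<in> Lp T p \<Longrightarrow> 0 \<le> t \<Longrightarrow> t \<le> T \<Longrightarrow> integrable (lebesgue_on {0..T}) (\<lambda>s. rl_kernel \<gamma> t s * w s)"
proof -
  define q where "q = p / (p - 1)"
  define \<beta> where "\<beta> = (\<gamma> - 1) * q + 1"
  have q: "1 < q" "1 / q + 1 / p = 1" "1 / q = 1 - 1 / p" using p by (auto simp: q_def field_simps)
  have \<beta>q: "\<beta> / q = \<gamma> - 1 / p" using q p by (simp add: \<beta>_def add_divide_distrib)
  have "\<beta> / q > 0" unfolding \<beta>q using \<gamma> by simp
  then have \<beta>: "\<beta> > 0" using q(1) by (simp add: zero_less_divide_iff)
  have \<gamma>0: "\<gamma> > 0" using \<gamma> p by (meson divide_pos_pos less_trans zero_less_one)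
  then have G: "Gamma \<gamma> > 0" by (simp add: Gamma_real_pos)
  define C where "C = (2 / \<beta>) powr (1 / q) / Gamma \<gamma>"
  have C: "C > 0" using \<beta> G by (simp add: C_def)
  have int: "integrable (lebesgue_on {0..T}) (\<lambda>s. rl_kernel \<gamma> t s * w s)"
    if "w \<in> Lp T p" "0 \<le> t" "t \<le> T" for w t
    using Holder_inequality(1)[OF q(1) p q(2) rl_kernel_diff_Lp(1)[OF q(1) \<beta>_def \<beta> \<gamma>(2), of 0 t T] that(1)] that
    by (simp add: rl_kernel_0)
  have "\<bar>left_RL_integral \<gamma> w t' - left_RL_integral \<gamma> w t\<bar> \<le> C * (t' - t) powr (\<gamma> - 1 / p) * Lp_norm T p w"
    if w: "w \<in> Lp T p" and t: "0 \<le> t" "t \<le> t'" "t' \<le> T" for w t t'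
  proof -
    let ?M = "lebesgue_on {0..T}"
    let ?K = "\<lambda>s. rl_kernel \<gamma> t' s - rl_kernel \<gamma> t s"
    note K = rl_kernel_diff_Lp[OF q(1) \<beta>_def \<beta> \<gamma>(2) t]
    have "left_RL_integral \<gamma> w t' - left_RL_integral \<gamma> w t = 1 / Gamma \<gamma> * (\<integral>s. ?K s * w s \<partial>?M)"
      using t int[OF w, of t] int[OF w, of t'] left_RL_integral_eq_kernel[of t' T \<gamma> w] left_RL_integral_eq_kernel[of t T \<gamma> w]
      by (simp add: left_diff_distrib right_diff_distrib)
    then have "\<bar>left_RL_integral \<gamma> w t' - left_RL_integral \<gamma> w t\<bar> = 1 / Gamma \<gamma> * \<bar>\<integral>s. ?K s * w s \<partial>?M\<bar>"
      using G by (simp add: abs_mult)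
    also have "\<dots> \<le> 1 / Gamma \<gamma> * (\<integral>s. \<bar>?K s * w s\<bar> \<partial>?M)"
      using G by (intro mult_left_mono integral_abs_bound) auto
    also have "\<dots> \<le> 1 / Gamma \<gamma> * (Lp_norm T q ?K * Lp_norm T p w)"
      using G by (intro mult_left_mono Holder_inequality(2)[OF q(1) p q(2) K(1) w]) auto
    also have "\<dots> \<le> 1 / Gamma \<gamma> * ((2 * (t' - t) powr \<beta> / \<beta>) powr (1 / q) * Lp_norm T p w)"
      unfolding Lp_norm_eq[of T q] using G q(1) K(2)
      by (intro mult_left_mono mult_right_mono powr_mono2) (auto simp: Lp_norm_def)
    also have "(2 * (t' - t) powr \<beta> / \<beta>) powr (1 / q) = (2 / \<beta>) powr (1 / q) * (t' - t) powr (\<gamma> - 1 / p)"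
    proof -
      have "2 * (t' - t) powr \<beta> / \<beta> = (2 / \<beta>) * (t' - t) powr \<beta>" by simp
      then show ?thesis using \<beta> \<beta>q by (simp only: powr_mult powr_powr) simp
    qed
    finally show ?thesis by (simp add: C_def mult_ac)
  qed
  then show thesis using that C int by blast
qed

lemma left_RL_integral_0: "left_RL_integral \<gamma> w 0 = 0"
  by (simp add: left_RL_integral_eq_kernel[of 0 0] rl_kernel_0)

lemma left_RL_integral_continuous:
  assumes p: "1 < p" and \<gamma>: "1 / p < \<gamma>" "\<gamma> \<le> 1" and w: "w \<in> Lp T p"
  shows "continuous_on {0..T} (left_RL_integral \<gamma> w)"
proof -
  obtain C where C: "C > 0" "\<And>t t'. 0 \<le> t \<Longrightarrow> t \<le> t' \<Longrightarrow> t' \<le> T \<Longrightarrow>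
     \<bar>left_RL_integral \<gamma> w t' - left_RL_integral \<gamma> w t\<bar> \<le> C * (t' - t) powr (\<gamma> - 1 / p) * Lp_norm T p w"
    using left_RL_integral_Holder[OF p \<gamma>, of T] w by metis
  have *: "\<bar>left_RL_integral \<gamma> w t' - left_RL_integral \<gamma> w t\<bar> \<le> C * Lp_norm T p w * \<bar>t' - t\<bar> powr (\<gamma> - 1 / p)"
    if "t \<in> {0..T}" "t' \<in> {0..T}" for t t'
    using C(2)[of t t'] C(2)[of t' t] that by (cases "t \<le> t'") (auto simp: mult_ac abs_minus_commute)
  show ?thesis
    unfolding continuous_on_def
  proof
    fix t assume t: "t \<in> {0..T}"
    have "((\<lambda>t'. C * Lp_norm T p w * \<bar>t' - t\<bar> powr (\<gamma> - 1 / p)) \<longlongrightarrow> C * Lp_norm T p w * \<bar>t - t\<bar> powr (\<gamma> - 1 / p)) (at t within {0..T})"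
      using \<gamma> by (intro tendsto_intros tendsto_powr') auto
    then have lim: "((\<lambda>t'. C * Lp_norm T p w * \<bar>t' - t\<bar> powr (\<gamma> - 1 / p)) \<longlongrightarrow> 0) (at t within {0..T})" by simp
    have "((\<lambda>t'. left_RL_integral \<gamma> w t' - left_RL_integral \<gamma> w t) \<longlongrightarrow> 0) (at t within {0..T})"
      by (rule Lim_null_comparison[OF _ lim]) (use * t in \<open>auto simp: eventually_at_filter\<close>)
    then show "(left_RL_integral \<gamma> w \<longlongrightarrow> left_RL_integral \<gamma> w t) (at t within {0..T})"
      by (simp add: LIM_zero_iff)
  qed
qed

lemma id_borel_measurable_lebesgue_on [measurable]: "(\<lambda>x. x) \<in> borel_measurable (lebesgue_on {a..b::real})"
  by (rule continuous_imp_measurable_on_sets_lebesgue) (auto intro: continuous_intros)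

section \<open>Semigroup law and injectivity of fractional integrals\<close>

text \<open>The substitution \<open>r = s + (t - s) * x\<close> turns the left side into Euler's
  Beta integral.\<close>

lemma rl_kernel_Beta:
  assumes ab: "a > 0" "b > 0" and s: "0 \<le> s" and t: "t \<le> T"
  shows "integrable (lebesgue_on {0..T}) (\<lambda>r. rl_kernel a t r * rl_kernel b r s)"
    and "(\<integral>r. rl_kernel a t r * rl_kernel b r s \<partial>lebesgue_on {0..T}) = Beta b a * rl_kernel (a + b) t s"
proof -
  have "integrable (lebesgue_on {0..T}) (\<lambda>r. rl_kernel a t r * rl_kernel b r s) \<and>
    (\<integral>r. rl_kernel a t r * rl_kernel b r s \<partial>lebesgue_on {0..T}) = Beta b a * rl_kernel (a + b) t s"
  proof (cases "s < t")
    case True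
    define d where "d = t - s"
    have d: "d > 0" using True by (simp add: d_def)
    have "((\<lambda>x. x powr (b - 1) * (1 - x) powr (a - 1)) has_integral Beta b a) (cbox 0 1)"
      using has_integral_Beta_real[of b a] ab by simp
    from has_integral_affinity'[OF this, of "1 / d" "- s / d"] d
    have "((\<lambda>r. (r / d - s / d) powr (b - 1) * (1 - (r / d - s / d)) powr (a - 1)) has_integral Beta b a * d)
        {s / d * d..(1 + s / d) * d}"
      by (simp add: mult.commute)
    moreover have "s / d * d = s" "(1 + s / d) * d = t" using d by (simp_all add: distrib_right) (simp add: d_def)
    ultimately have "((\<lambda>r. (r / d - s / d) powr (b - 1) * (1 - (r / d - s / d)) powr (a - 1)) has_integral Beta b a * d) {s..t}"
      by simp
    from has_integral_mult_right[OF this, of "d powr (a + b - 2)"]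
    have "((\<lambda>r. rl_kernel a t r * rl_kernel b r s) has_integral d powr (a + b - 2) * (Beta b a * d)) {s..t}"
    proof (rule has_integral_eq[rotated])
      fix r assume r: "r \<in> {s..t}"
      have "t - r = d - (r - s)" by (simp add: d_def)
      then have e1: "r / d - s / d = (r - s) / d" "1 - (r / d - s / d) = (t - r) / d"
        using d by (simp_all add: diff_divide_distrib add_divide_distrib)
      have "d powr (a + b - 2) = d powr (b - 1) * d powr (a - 1)"
        by (simp add: add.commute flip: powr_add)
      then have "d powr (a + b - 2) * ((r / d - s / d) powr (b - 1) * (1 - (r / d - s / d)) powr (a - 1))
         = (r - s) powr (b - 1) * (t - r) powr (a - 1)"
        unfolding e1(2) unfolding e1(1) using d r by (simp add: powr_divide)
      also have "\<dots> = rl_kernel a t r * rl_kernel b r s"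
        using r s by (auto simp: rl_kernel_def)
      finally show "d powr (a + b - 2) * ((r / d - s / d) powr (b - 1) * (1 - (r / d - s / d)) powr (a - 1)) = rl_kernel a t r * rl_kernel b r s" .
    qed
    moreover have "d powr (a + b - 2) * (Beta b a * d) = Beta b a * rl_kernel (a + b) t s"
    proof -
      have "d powr (a + b - 2) * d = d powr (a + b - 1)"
        using d powr_add[of d "a + b - 2" 1] by simp
      then show ?thesis using True s by (simp add: rl_kernel_def d_def mult_ac)
    qed
    ultimately have "((\<lambda>r. rl_kernel a t r * rl_kernel b r s) has_integral Beta b a * rl_kernel (a + b) t s) {s..t}" by simp
    note H = this
    have H': "{s..t} \<subseteq> {0..T}" "\<And>r. r \<in> {s..t} \<Longrightarrow> 0 \<le> rl_kernel a t r * rl_kernel b r s"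
      "\<And>r. r \<notin> {s..t} \<Longrightarrow> rl_kernel a t r * rl_kernel b r s = 0"
      using s t by (auto simp: rl_kernel_def)
    show ?thesis
      using nonneg_has_integral_lebesgue_on_subset[OF H H'] by blast
  next
    case False
    then have "(\<lambda>r. rl_kernel a t r * rl_kernel b r s) = (\<lambda>r. 0)" "rl_kernel (a + b) t s = 0"
      by (auto simp: rl_kernel_def)
    then show ?thesis by simp
  qed
  then show "integrable (lebesgue_on {0..T}) (\<lambda>r. rl_kernel a t r * rl_kernel b r s)"
    "(\<integral>r. rl_kernel a t r * rl_kernel b r s \<partial>lebesgue_on {0..T}) = Beta b a * rl_kernel (a + b) t s" by auto
qed

text \<open>Fubini's theorem on the triangle \<open>s < r < t\<close>. With
  \<open>a + b \<ge> 1\<close> the composed kernel is bounded, so plain integrability of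
  \<open>w\<close> gives integrability on the product.\<close>

theorem left_RL_integral_semigroup:
  assumes ab: "a > 0" "b > 0" "a + b \<ge> 1" and w: "integrable (lebesgue_on {0..T}) w" and t: "0 \<le> t" "t \<le> T"
  shows "left_RL_integral a (left_RL_integral b w) t = left_RL_integral (a + b) w t"
proof -
  let ?M = "lebesgue_on {0..T}"
  interpret fm: finite_measure ?M by (rule finite_measure_lebesgue_on_interval)
  interpret pair_sigma_finite ?M ?M by unfold_locales
  let ?f = "\<lambda>s r. rl_kernel a t r * rl_kernel b r s * w s"
  have [measurable]: "w \<in> borel_measurable ?M" using w by auto
  have [measurable]: "fst \<in> borel_measurable (?M \<Otimes>\<^sub>M ?M)" "snd \<in> borel_measurable (?M \<Otimes>\<^sub>M ?M)"
    using measurable_compose[OF measurable_fst id_borel_measurable_lebesgue_on] measurable_compose[OF measurable_snd id_borel_measurable_lebesgue_on]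
    by auto
  have meas: "(\<lambda>(s, r). ?f s r) \<in> borel_measurable (?M \<Otimes>\<^sub>M ?M)"
    unfolding rl_kernel_def case_prod_beta by measurable
  have inner: "(\<integral>r. \<bar>?f s r\<bar> \<partial>?M) = Beta b a * (rl_kernel (a + b) t s * \<bar>w s\<bar>)"
    "(\<integral>r. ?f s r \<partial>?M) = Beta b a * (rl_kernel (a + b) t s * w s)" "integrable ?M (\<lambda>r. ?f s r)"
    if "s \<in> space ?M" for s
    using rl_kernel_Beta[OF ab(1,2), of s t T] that t by (auto simp: abs_mult space_restrict_space)
  have bound: "rl_kernel (a + b) t s \<le> T powr (a + b - 1)" for s
    using ab t by (auto simp: rl_kernel_def intro!: powr_mono2)
  have [measurable]: "rl_kernel (a + b) t \<in> borel_measurable ?M"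
    unfolding rl_kernel_def by measurable
  have int2: "integrable ?M (\<lambda>s. rl_kernel (a + b) t s * w s)"
    by (rule Bochner_Integration.integrable_bound[of _ "\<lambda>s. T powr (a + b - 1) * \<bar>w s\<bar>"])
      (use w bound in \<open>auto simp: abs_mult intro!: mult_right_mono\<close>)
  have "integrable ?M (\<lambda>s. \<integral>r. norm (?f s r) \<partial>?M)"
  proof (subst Bochner_Integration.integrable_cong[OF refl])
    show "(\<integral>r. norm (?f s r) \<partial>?M) = Beta b a * \<bar>rl_kernel (a + b) t s * w s\<bar>" if "s \<in> space ?M" for s
      using inner(1)[OF that] by (simp add: abs_mult)
    show "integrable ?M (\<lambda>s. Beta b a * \<bar>rl_kernel (a + b) t s * w s\<bar>)" using int2 by auto
  qed
  then have "integrable (?M \<Otimes>\<^sub>M ?M) (\<lambda>(s, r). ?f s r)"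
  proof (intro Fubini_integrable meas)
    show "AE s in ?M. integrable ?M (\<lambda>r. case (s, r) of (s, r) \<Rightarrow> ?f s r)"
      unfolding prod.case by (rule AE_I2) (rule inner(3))
  qed simp
  from Fubini_integral[OF this]
  have F: "(\<integral>r. (\<integral>s. ?f s r \<partial>?M) \<partial>?M) = (\<integral>s. (\<integral>r. ?f s r \<partial>?M) \<partial>?M)" .
  have "left_RL_integral a (left_RL_integral b w) t
      = 1 / Gamma a * (\<integral>r. rl_kernel a t r * (1 / Gamma b * (\<integral>s. rl_kernel b r s * w s \<partial>?M)) \<partial>?M)"
    unfolding left_RL_integral_eq_kernel[OF t(2)]
    by (intro arg_cong2[of _ _ _ _ times] refl Bochner_Integration.integral_cong)
       (auto simp: left_RL_integral_eq_kernel[of _ T] space_restrict_space)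
  also have "\<dots> = 1 / (Gamma a * Gamma b) * (\<integral>r. (\<integral>s. ?f s r \<partial>?M) \<partial>?M)"
  proof -
    have "rl_kernel a t r * (1 / Gamma b * (\<integral>s. rl_kernel b r s * w s \<partial>?M)) = 1 / Gamma b * (\<integral>s. ?f s r \<partial>?M)" for r
      by (simp add: mult.assoc)
    then have "(\<integral>r. rl_kernel a t r * (1 / Gamma b * (\<integral>s. rl_kernel b r s * w s \<partial>?M)) \<partial>?M) = 1 / Gamma b * (\<integral>r. (\<integral>s. ?f s r \<partial>?M) \<partial>?M)"
      by (simp only: integral_mult_right_zero)
    then show ?thesis by simp
  qed
  also have "(\<integral>r. (\<integral>s. ?f s r \<partial>?M) \<partial>?M) = (\<integral>s. Beta b a * (rl_kernel (a + b) t s * w s) \<partial>?M)"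
    unfolding F by (intro Bochner_Integration.integral_cong inner(2)) auto
  also have "\<dots> = Beta b a * (\<integral>s. rl_kernel (a + b) t s * w s \<partial>?M)" by simp
  also have "1 / (Gamma a * Gamma b) * \<dots> = 1 / Gamma (a + b) * (\<integral>s. rl_kernel (a + b) t s * w s \<partial>?M)"
  proof -
    have "Gamma a > 0" "Gamma b > 0" using ab by (auto intro: Gamma_real_pos)
    then show ?thesis by (simp add: Beta_def add.commute)
  qed
  also have "\<dots> = left_RL_integral (a + b) w t" by (rule left_RL_integral_eq_kernel[OF t(2), symmetric])
  finally show ?thesis .
qed

lemma left_RL_integral_cong:
  assumes "\<And>s. 0 \<le> s \<Longrightarrow> s \<le> t \<Longrightarrow> u s = v s"
  shows "left_RL_integral \<gamma> u t = left_RL_integral \<gamma> v t"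
  unfolding left_RL_integral_def set_lebesgue_integral_def
  using assms by (intro arg_cong2[of _ _ _ _ times] refl Bochner_Integration.integral_cong) (auto simp: indicator_def)

lemma rl_kernel_one: "rl_kernel 1 t s = of_bool (0 \<le> s \<and> s < t)"
  by (simp add: rl_kernel_def)

lemma AE_neq_lebesgue_on: "AE s in lebesgue_on {a..b::real}. s \<noteq> c"
proof -
  have "AE s in lebesgue. s \<noteq> c"
    by (rule AE_completion) (simp add: AE_lborel_singleton)
  then show ?thesis by (auto simp: AE_restrict_space_iff elim: AE_mp)
qed

text \<open>The positive and the negative part of a function all of whose integrals over half lines
  vanish are densities of the same measure.\<close>

lemma AE_zero_if_tail_integrals_zero:
  fixes w :: "real \<Rightarrow> real"
  assumes w: "integrable lborel w" and z: "\<And>t. (\<integral>x. indicator {t<..} x * w x \<partial>lborel) = 0"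
  shows "AE x in lborel. w x = 0"
proof -
  have [measurable]: "w \<in> borel_measurable borel" using w by (simp add: borel_measurable_integrable)
  define P where "P x = max 0 (w x)" for x
  define N where "N x = max 0 (- w x)" for x
  have "integrable lborel P" "integrable lborel N"
    unfolding P_def N_def using w by (intro integrable_max; simp)+
  moreover have "\<And>x. P x \<ge> 0" "\<And>x. N x \<ge> 0" "\<And>x. w x = P x - N x"
    by (auto simp: P_def N_def max_def)
  ultimately have PN: "integrable lborel P" "integrable lborel N" "\<And>x. P x \<ge> 0" "\<And>x. N x \<ge> 0" "\<And>x. w x = P x - N x"
    by blast+
  have [measurable]: "P \<in> borel_measurable borel" "N \<in> borel_measurable borel"
    unfolding P_def N_def by measurable
  have emeas: "emeasure (density lborel (\<lambda>x. ennreal (f x))) {t<..} = ennreal (\<integral>x. indicator {t<..} x * f x \<partial>lborel)"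
    if "integrable lborel f" "\<And>x. f x \<ge> 0" for f :: "real \<Rightarrow> real" and t
  proof -
    have "emeasure (density lborel (\<lambda>x. ennreal (f x))) {t<..} = (\<integral>\<^sup>+x. ennreal (indicator {t<..} x * f x) \<partial>lborel)"
      using that by (subst emeasure_density) (auto intro!: nn_integral_cong simp: indicator_def)
    also have "\<dots> = ennreal (\<integral>x. indicator {t<..} x * f x \<partial>lborel)"
      using that integrable_mult_indicator[of "{t<..}" lborel f] by (intro nn_integral_eq_integral) auto
    finally show ?thesis .
  qed
  have eq: "(\<integral>x. indicator {t<..} x * P x \<partial>lborel) = (\<integral>x. indicator {t<..} x * N x \<partial>lborel)" for t
  proof -
    have "integrable lborel (\<lambda>x. indicator {t<..} x * P x)" "integrable lborel (\<lambda>x. indicator {t<..} x * N x)"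
      using integrable_mult_indicator[of "{t<..}" lborel P] integrable_mult_indicator[of "{t<..}" lborel N] PN by auto
    then show ?thesis using z[of t] unfolding PN(5) by (simp add: right_diff_distrib)
  qed
  have "density lborel (\<lambda>x. ennreal (P x)) = density lborel (\<lambda>x. ennreal (N x))"
    by (rule measure_eqI_lessThan) (simp_all add: emeas PN eq)
  moreover have "(\<integral>\<^sup>+x. ennreal (P x) \<partial>lborel) \<noteq> \<infinity>"
    using nn_integral_eq_integral[OF PN(1)] PN(3) by simp
  ultimately have "AE x in lborel. ennreal (P x) = ennreal (N x)"
    by (subst finite_density_unique[symmetric]) auto
  then show ?thesis
    by eventually_elim (use PN(3-5) in auto)
qed

text \<open>Half-line integrals of the extension by zero are differences of two values of the
  primitive. A Borel representative carries the question from \<open>lebesgue\<close> to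
  \<open>lborel\<close>.\<close>

lemma AE_zero_if_primitive_zero:
  assumes T: "0 \<le> T" and w: "integrable (lebesgue_on {0..T}) w"
    and z: "\<And>t. 0 \<le> t \<Longrightarrow> t \<le> T \<Longrightarrow> left_RL_integral 1 w t = 0"
  shows "AE t in lebesgue_on {0..T}. w t = 0"
proof -
  let ?M = "lebesgue_on {0..T}"
  define W where "W s = indicator {0..T} s * w s" for s
  have W: "integrable lebesgue W"
    using w unfolding W_def by (simp add: integrable_restrict_space)
  obtain w' where w': "w' \<in> borel_measurable lborel" "AE x in lborel. W x = w' x"
    using completion_ex_borel_measurable_real[of W lborel] W by auto
  have w'2: "AE x in lebesgue. W x = w' x" using w'(2) by (rule AE_completion)
  have w'leb[measurable]: "w' \<in> borel_measurable lebesgue" using w'(1) by (rule measurable_completion)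
  have "integrable lebesgue w'"
    using W w'2 by (subst integrable_cong_AE[symmetric, of W]) auto
  then have intw': "integrable lborel w'" using w'(1) by (simp add: integrable_completion)
  have "AE x in lborel. w' x = 0"
  proof (rule AE_zero_if_tail_integrals_zero[OF intw'])
    fix t
    \<comment> \<open>The extension vanishes outside the interval, so the half-line may be taken to
      start at the point of the interval nearest to \<open>t\<close>.\<close>
    define c where "c = max 0 (min t T)"
    have c: "0 \<le> c" "c \<le> T" using T by (auto simp: c_def)
    have k0: "(\<integral>s. rl_kernel 1 u s * w s \<partial>?M) = 0" if "0 \<le> u" "u \<le> T" for u
      using z[OF that] left_RL_integral_eq_kernel[OF that(2), of 1 w] by simp
    have ik: "integrable ?M (\<lambda>s. rl_kernel 1 u s * w s)" for u
    proof (rule Bochner_Integration.integrable_bound[OF w])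
      have [measurable]: "w \<in> borel_measurable ?M" using w by auto
      show "(\<lambda>s. rl_kernel 1 u s * w s) \<in> borel_measurable ?M" unfolding rl_kernel_one by measurable
    qed (auto simp: rl_kernel_one)
    have "(\<integral>x. indicator {t<..} x * w' x \<partial>lborel) = (\<integral>x. indicator {t<..} x * w' x \<partial>lebesgue)"
      by (intro integral_completion[symmetric] borel_measurable_times w'(1)) simp
    also have "\<dots> = (\<integral>x. indicator {0..T} x *\<^sub>R ((rl_kernel 1 T x - rl_kernel 1 c x) * w x) \<partial>lebesgue)"
    proof (rule integral_cong_AE)
      have "AE x in lebesgue. x \<noteq> c" "AE x in lebesgue. x \<noteq> T"
        by (rule AE_completion, simp add: AE_lborel_singleton)+
      then show "AE x in lebesgue. indicator {t<..} x * w' x = indicator {0..T} x *\<^sub>R ((rl_kernel 1 T x - rl_kernel 1 c x) * w x)"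
        using w'2
      proof eventually_elim
        case (elim x)
        then show ?case
          by (auto simp: W_def[symmetric] rl_kernel_one c_def indicator_def W_def min_def max_def split: if_splits)
      qed
      have "integrable ?M (\<lambda>x. (rl_kernel 1 T x - rl_kernel 1 c x) * w x)"
        using ik[of T] ik[of c] by (simp add: left_diff_distrib)
      then have "integrable lebesgue (\<lambda>x. indicator {0..T} x *\<^sub>R ((rl_kernel 1 T x - rl_kernel 1 c x) * w x))"
        by (simp add: integrable_restrict_space)
      then show "(\<lambda>x. indicator {0..T} x *\<^sub>R ((rl_kernel 1 T x - rl_kernel 1 c x) * w x)) \<in> borel_measurable lebesgue"
        by (rule borel_measurable_integrable)
      show "(\<lambda>x. indicator {t<..} x * w' x) \<in> borel_measurable lebesgue"
        by (intro borel_measurable_times w'leb borel_measurable_indicator) simp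
    qed
    also have "\<dots> = (\<integral>x. (rl_kernel 1 T x - rl_kernel 1 c x) * w x \<partial>?M)"
      by (simp add: integral_restrict_space)
    also have "\<dots> = 0"
      using ik[of T] ik[of c] k0[OF T order_refl] k0[OF c] by (simp add: left_diff_distrib)
    finally show "(\<integral>x. indicator {t<..} x * w' x \<partial>lborel) = 0" .
  qed
  then have "AE x in lebesgue. w' x = 0" by (rule AE_completion)
  then have "AE x in lebesgue. x \<in> {0..T} \<longrightarrow> w x = 0"
    using w'2 by eventually_elim (auto simp: W_def)
  then show ?thesis by (simp add: AE_restrict_space_iff)
qed

text \<open>Integrating once more, with order \<open>1 - \<alpha>\<close>, reduces the claim to the
  ordinary primitive by the semigroup law.\<close>

theorem left_RL_integral_injective:
  assumes T: "0 \<le> T" and p: "1 < p" and \<alpha>: "0 < \<alpha>" "\<alpha> \<le> 1" and w: "w \<in> Lp T p"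
    and z: "\<And>t. 0 \<le> t \<Longrightarrow> t \<le> T \<Longrightarrow> left_RL_integral \<alpha> w t = 0"
  shows "AE t in lebesgue_on {0..T}. w t = 0"
proof (rule AE_zero_if_primitive_zero[OF T Lp_abs_integrable[OF p w]])
  fix t assume t: "0 \<le> t" "t \<le> T"
  show "left_RL_integral 1 w t = 0"
  proof (cases "\<alpha> = 1")
    case True
    then show ?thesis using z t by simp
  next
    case False
    then have "left_RL_integral 1 w t = left_RL_integral (1 - \<alpha>) (left_RL_integral \<alpha> w) t"
      using left_RL_integral_semigroup[OF _ \<alpha>(1) _ Lp_abs_integrable[OF p w] t, of "1 - \<alpha>"] \<alpha> by simp
    also have "\<dots> = left_RL_integral (1 - \<alpha>) (\<lambda>_. 0) t"
      using z t by (intro left_RL_integral_cong) auto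
    also have "\<dots> = 0" by (simp add: left_RL_integral_def set_lebesgue_integral_def)
    finally show ?thesis .
  qed
qed

lemma continuous_imp_Lp:
  assumes "0 < p" "continuous_on {0..T} h"
  shows "h \<in> Lp T p"
proof -
  have "continuous_on {0..T} (\<lambda>t. \<bar>h t\<bar> powr p)"
    using assms by (intro continuous_on_powr_nonneg continuous_intros) auto
  then show ?thesis
    using assms by (auto simp: Lp_def intro: continuous_imp_integrable_real continuous_imp_measurable_on_sets_lebesgue)
qed

lemma left_RL_integral_one_continuous:
  assumes h: "continuous_on {0..T} h" and t: "0 \<le> t" "t \<le> T"
  shows "left_RL_integral 1 h t = integral {0..t} h"
proof -
  have ht: "continuous_on {0..t} h" using h by (rule continuous_on_subset) (use t in auto)
  have "left_RL_integral 1 h t = (\<integral>s. rl_kernel 1 t s * h s \<partial>lebesgue_on {0..t})"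
    using left_RL_integral_eq_kernel[of t t 1 h] by simp
  also have "\<dots> = (\<integral>s. h s \<partial>lebesgue_on {0..t})"
  proof (rule integral_cong_AE)
    have [measurable]: "h \<in> borel_measurable (lebesgue_on {0..t})"
      using ht by (intro continuous_imp_measurable_on_sets_lebesgue) auto
    show "(\<lambda>s. rl_kernel 1 t s * h s) \<in> borel_measurable (lebesgue_on {0..t})" unfolding rl_kernel_one by measurable
    show "h \<in> borel_measurable (lebesgue_on {0..t})" by measurable
    have "AE s in lebesgue_on {0..t}. s \<in> space (lebesgue_on {0..t})" by (rule AE_space)
    then show "AE s in lebesgue_on {0..t}. rl_kernel 1 t s * h s = h s"
      using AE_neq_lebesgue_on[where a = 0 and b = t and c = t] by eventually_elim (auto simp: rl_kernel_one space_restrict_space)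
  qed
  also have "\<dots> = integral {0..t} h"
    using has_integral_integral_lebesgue_on[OF continuous_imp_integrable_real[OF ht]] by (simp add: integral_unique)
  finally show ?thesis .
qed

text \<open>Since \<open>\<phi> 0 = 0\<close>, the Riemann--Liouville derivative is the fractional integral of \<open>\<phi>'\<close>.\<close>

lemma C0_infinity_frac_deriv:
  assumes T: "T > 0" and \<alpha>: "0 < \<alpha>" "\<alpha> \<le> 1" and \<phi>: "\<phi> \<in> C0_infinity T"
  obtains h where "continuous_on {0..T} h" "\<And>t. t \<in> {0..T} \<Longrightarrow> left_RL_deriv T \<alpha> \<phi> t = h t"
    "\<And>t. t \<in> {0..T} \<Longrightarrow> left_RL_integral \<alpha> h t = \<phi> t"
proof -
  obtain g where g: "g 0 = \<phi>" "\<And>n t. t \<in> {0..T} \<Longrightarrow> (g n has_real_derivative g (Suc n) t) (at t within {0..T})"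
    and \<phi>0: "\<phi> 0 = 0"
    using \<phi> by (auto simp: C0_infinity_def)
  define \<phi>' where "\<phi>' = g 1"
  have d: "(\<phi> has_vector_derivative \<phi>' t) (at t within {0..T})" if "t \<in> {0..T}" for t
    using g(2)[OF that, of 0] g(1) by (simp add: \<phi>'_def has_real_derivative_iff_has_vector_derivative)
  have cont: "continuous_on {0..T} \<phi>'"
    unfolding \<phi>'_def using g(2)[of _ 1] by (intro DERIV_continuous_on) auto
  have prim: "left_RL_integral 1 \<phi>' t = \<phi> t" if "t \<in> {0..T}" for t
  proof -
    have "(\<phi>' has_integral \<phi> t - \<phi> 0) {0..t}"
    proof (rule fundamental_theorem_of_calculus)
      show "(\<phi> has_vector_derivative \<phi>' x) (at x within {0..t})" if "x \<in> {0..t}" for x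
        using d[of x] that \<open>t \<in> {0..T}\<close> by (auto intro: has_vector_derivative_within_subset)
    qed (use that in auto)
    then show ?thesis
      using left_RL_integral_one_continuous[OF cont, of t] that \<phi>0 by (simp add: integral_unique)
  qed
  have vd: "vector_derivative f (at t within {0..T}) = l"
    if "(f has_vector_derivative l) (at t within {0..T})" "t \<in> {0..T}" for f :: "real \<Rightarrow> real" and l t
    using that T vector_derivative_within_cbox[of 0 T t f l] by (simp add: cbox_interval)
  show thesis
  proof (cases "\<alpha> = 1")
    case True
    show thesis
      using that[OF cont] True prim vd[OF d] by (simp add: left_RL_deriv_def)
  next
    case False
    define \<beta> where "\<beta> = 1 - \<alpha>"
    have \<beta>: "0 < \<beta>" "\<beta> < 1" using False \<alpha> by (auto simp: \<beta>_def)
    \<comment> \<open>The Caputo form of the derivative. Commuting the integrals of orders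
      \<open>\<beta>\<close> and 1 shows that \<open>h\<close> is the derivative of the integral of
      \<open>\<phi>\<close> of order \<open>\<beta>\<close>.\<close>
    define h where "h = left_RL_integral \<beta> \<phi>'"
    have int\<phi>': "integrable (lebesgue_on {0..T}) \<phi>'" by (rule continuous_imp_integrable_real[OF cont])
    \<comment> \<open>A continuous function lies in every Lebesgue space, and
      \<open>2 / \<beta>\<close> is an exponent whose reciprocal is below
      \<open>\<beta>\<close>.\<close>
    have conth: "continuous_on {0..T} h"
      unfolding h_def using \<beta>
      by (intro left_RL_integral_continuous[of "2 / \<beta>"] continuous_imp_Lp cont) (auto simp: field_simps)
    have "left_RL_integral \<beta> \<phi> t = integral {0..t} h" if t: "t \<in> {0..T}" for t
    proof -
      have "left_RL_integral \<beta> \<phi> t = left_RL_integral \<beta> (left_RL_integral 1 \<phi>') t"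
        using prim t by (intro left_RL_integral_cong) auto
      also have "\<dots> = left_RL_integral (\<beta> + 1) \<phi>' t"
        using \<beta> t by (intro left_RL_integral_semigroup[OF _ _ _ int\<phi>']) auto
      also have "\<dots> = left_RL_integral 1 (left_RL_integral \<beta> \<phi>') t"
        using \<beta> t left_RL_integral_semigroup[OF _ \<beta>(1) _ int\<phi>', of 1 t] by (simp add: add.commute)
      also have "\<dots> = integral {0..t} h"
        unfolding h_def[symmetric] using conth t by (intro left_RL_integral_one_continuous) auto
      finally show ?thesis .
    qed
    then have "(left_RL_integral \<beta> \<phi> has_vector_derivative h t) (at t within {0..T})" if "t \<in> {0..T}" for t
      using integral_has_vector_derivative[OF conth that]
      by (rule has_vector_derivative_transform[OF that])
    from vd[OF this] have "left_RL_deriv T \<alpha> \<phi> t = h t" if "t \<in> {0..T}" for t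
      using that False by (simp add: left_RL_deriv_def \<beta>_def)
    moreover have "left_RL_integral \<alpha> h t = \<phi> t" if "t \<in> {0..T}" for t
    proof -
      have "left_RL_integral \<alpha> h t = left_RL_integral (\<alpha> + \<beta>) \<phi>' t"
        unfolding h_def using \<beta> \<alpha> that by (intro left_RL_integral_semigroup[OF _ _ _ int\<phi>']) (auto simp: \<beta>_def)
      then show ?thesis using prim[OF that] by (simp add: \<beta>_def)
    qed
    ultimately show thesis using that conth by blast
  qed
qed

section \<open>The fractional derivative space\<close>

locale fractional_space =
  fixes T \<alpha> p :: real
  assumes T: "T > 0" and p: "1 < p" and \<alpha>p: "1 / p < \<alpha>" and \<alpha>1: "\<alpha> \<le> 1"
begin

abbreviation "J \<equiv> left_RL_integral \<alpha>"

lemma \<alpha>0: "\<alpha> > 0"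
  using \<alpha>p p by (meson divide_pos_pos less_trans zero_less_one)

lemma p0: "p > 0" using p by simp

lemma J_lincomb:
  assumes "w \<in> Lp T p" "v \<in> Lp T p" "t \<in> {0..T}"
  shows "J (\<lambda>s. a * w s + b * v s) t = a * J w t + b * J v t"
proof -
  obtain C where "\<And>w t. w \<in> Lp T p \<Longrightarrow> 0 \<le> t \<Longrightarrow> t \<le> T \<Longrightarrow> integrable (lebesgue_on {0..T}) (\<lambda>s. rl_kernel \<alpha> t s * w s)"
    using left_RL_integral_Holder[OF p \<alpha>p \<alpha>1, of T] by metis
  then have "integrable (lebesgue_on {0..T}) (\<lambda>s. rl_kernel \<alpha> t s * w s)" "integrable (lebesgue_on {0..T}) (\<lambda>s. rl_kernel \<alpha> t s * v s)"
    using assms by auto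
  moreover have "rl_kernel \<alpha> t s * (a * w s + b * v s) = a * (rl_kernel \<alpha> t s * w s) + b * (rl_kernel \<alpha> t s * v s)" for s
    by (simp add: algebra_simps)
  ultimately show ?thesis
    using assms(3) by (simp add: left_RL_integral_eq_kernel[of t T] algebra_simps add_divide_distrib)
qed

lemma J_Holder:
  obtains C where "C > 0" "\<And>w t t'. w \<in> Lp T p \<Longrightarrow> t \<in> {0..T} \<Longrightarrow> t' \<in> {0..T} \<Longrightarrow>
     \<bar>J w t' - J w t\<bar> \<le> C * \<bar>t' - t\<bar> powr (\<alpha> - 1 / p) * Lp_norm T p w"
proof -
  obtain C where C: "C > 0" "\<And>w t t'. w \<in> Lp T p \<Longrightarrow> 0 \<le> t \<Longrightarrow> t \<le> t' \<Longrightarrow> t' \<le> T \<Longrightarrow>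
     \<bar>J w t' - J w t\<bar> \<le> C * (t' - t) powr (\<alpha> - 1 / p) * Lp_norm T p w"
    using left_RL_integral_Holder[OF p \<alpha>p \<alpha>1, of T] by metis
  have "\<bar>J w t' - J w t\<bar> \<le> C * \<bar>t' - t\<bar> powr (\<alpha> - 1 / p) * Lp_norm T p w"
    if "w \<in> Lp T p" "t \<in> {0..T}" "t' \<in> {0..T}" for w t t'
    using C(2)[of w t t'] C(2)[of w t' t] that by (cases "t \<le> t'") (auto simp: abs_minus_commute)
  then show thesis using that C(1) by blast
qed

lemma J_bound:
  obtains C where "C > 0" "\<And>w t. w \<in> Lp T p \<Longrightarrow> t \<in> {0..T} \<Longrightarrow> \<bar>J w t\<bar> \<le> C * Lp_norm T p w"
proof -
  obtain C where C: "C > 0" "\<And>w t t'. w \<in> Lp T p \<Longrightarrow> t \<in> {0..T} \<Longrightarrow> t' \<in> {0..T} \<Longrightarrow>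
     \<bar>J w t' - J w t\<bar> \<le> C * \<bar>t' - t\<bar> powr (\<alpha> - 1 / p) * Lp_norm T p w"
    using J_Holder by blast
  have "\<bar>J w t\<bar> \<le> C * T powr (\<alpha> - 1 / p) * Lp_norm T p w" if "w \<in> Lp T p" "t \<in> {0..T}" for w t
  proof -
    have "\<bar>J w t\<bar> \<le> C * \<bar>t - 0\<bar> powr (\<alpha> - 1 / p) * Lp_norm T p w"
      using C(2)[of w 0 t] that T by (simp add: left_RL_integral_0)
    also have "\<dots> \<le> C * T powr (\<alpha> - 1 / p) * Lp_norm T p w"
      using that T C(1) \<alpha>p by (intro mult_right_mono mult_left_mono powr_mono2) (auto simp: Lp_norm_def)
    finally show ?thesis .
  qed
  then show thesis using that[of "C * T powr (\<alpha> - 1 / p)"] C(1) T by auto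
qed

lemma J_continuous: "w \<in> Lp T p \<Longrightarrow> continuous_on {0..T} (J w)"
  using left_RL_integral_continuous[OF p \<alpha>p \<alpha>1] by blast

abbreviation "D \<equiv> left_RL_deriv T \<alpha>"

lemma C0_infinityD:
  assumes "\<phi> \<in> C0_infinity T"
  shows "D \<phi> \<in> Lp T p" "\<phi> \<in> Lp T p" "\<And>t. t \<in> {0..T} \<Longrightarrow> J (D \<phi>) t = \<phi> t" "continuous_on {0..T} \<phi>"
proof -
  obtain h where h: "continuous_on {0..T} h" "\<And>t. t \<in> {0..T} \<Longrightarrow> D \<phi> t = h t"
    "\<And>t. t \<in> {0..T} \<Longrightarrow> J h t = \<phi> t"
    using C0_infinity_frac_deriv[OF T \<alpha>0 \<alpha>1 assms] by blast
  have hL: "h \<in> Lp T p" by (rule continuous_imp_Lp[OF p0 h(1)])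
  have "continuous_on {0..T} (D \<phi>)" by (rule continuous_on_eq[OF h(1)]) (simp add: h(2))
  then show "D \<phi> \<in> Lp T p" by (rule continuous_imp_Lp[OF p0])
  show c: "continuous_on {0..T} \<phi>" by (rule continuous_on_eq[OF J_continuous[OF hL] h(3)])
  show "\<phi> \<in> Lp T p" by (rule continuous_imp_Lp[OF p0 c])
  fix t assume t: "t \<in> {0..T}"
  have "J (D \<phi>) t = J h t" using h(2) t by (intro left_RL_integral_cong) auto
  then show "J (D \<phi>) t = \<phi> t" using h(3) t by simp
qed

lemma C0_infinity_lincomb:
  assumes "\<phi> \<in> C0_infinity T" "\<psi> \<in> C0_infinity T"
  shows "(\<lambda>t. a * \<phi> t + b * \<psi> t) \<in> C0_infinity T"
proof -
  obtain g where g: "g 0 = \<phi>" "\<And>n t. t \<in> {0..T} \<Longrightarrow> (g n has_real_derivative g (Suc n) t) (at t within {0..T})"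
    using assms(1) by (auto simp: C0_infinity_def)
  obtain k where k: "k 0 = \<psi>" "\<And>n t. t \<in> {0..T} \<Longrightarrow> (k n has_real_derivative k (Suc n) t) (at t within {0..T})"
    using assms(2) by (auto simp: C0_infinity_def)
  have "((\<lambda>t. a * g n t + b * k n t) has_real_derivative a * g (Suc n) t + b * k (Suc n) t) (at t within {0..T})"
    if "t \<in> {0..T}" for n t
    using that by (intro DERIV_add DERIV_cmult g(2) k(2))
  then show ?thesis
    using g(1) k(1) assms unfolding C0_infinity_def
    by (auto intro!: exI[of _ "\<lambda>n t. a * g n t + b * k n t"])
qed

lemma AE_eq_if_J_eq:
  assumes "w \<in> Lp T p" "v \<in> Lp T p" "\<And>t. t \<in> {0..T} \<Longrightarrow> J w t = J v t"
  shows "AE t in lebesgue_on {0..T}. w t = v t"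
proof -
  have "AE t in lebesgue_on {0..T}. 1 * w t + (-1) * v t = 0"
    using T assms J_lincomb[OF assms(1,2), of _ 1 "-1"]
    by (intro left_RL_integral_injective[OF _ p \<alpha>0 \<alpha>1 Lp_lincomb[OF p assms(1,2)]]) auto
  then show ?thesis by eventually_elim simp
qed

text \<open>Linearity is pulled back through \<open>J\<close>, which is linear and injective up to
  null sets, instead of being obtained by differentiation.\<close>

lemma D_lincomb_AE:
  assumes "\<phi> \<in> C0_infinity T" "\<psi> \<in> C0_infinity T"
  shows "AE t in lebesgue_on {0..T}. D (\<lambda>t. a * \<phi> t + b * \<psi> t) t = a * D \<phi> t + b * D \<psi> t"
proof (rule AE_eq_if_J_eq)
  note c = C0_infinityD[OF C0_infinity_lincomb[OF assms, of a b]] C0_infinityD[OF assms(1)] C0_infinityD[OF assms(2)]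
  show "D (\<lambda>t. a * \<phi> t + b * \<psi> t) \<in> Lp T p" by (rule c)
  show "(\<lambda>t. a * D \<phi> t + b * D \<psi> t) \<in> Lp T p" by (intro Lp_lincomb p c)
  show "J (D (\<lambda>t. a * \<phi> t + b * \<psi> t)) t = J (\<lambda>t. a * D \<phi> t + b * D \<psi> t) t" if "t \<in> {0..T}" for t
    using c(3,7,11)[OF that] J_lincomb[OF c(5,9) that, of a b] by simp
qed

abbreviation "is_deriv \<equiv> is_frac_deriv T \<alpha> p"

lemma is_deriv_iff:
  "is_deriv u w \<longleftrightarrow> u \<in> Lp T p \<and> w \<in> Lp T p \<and> (\<exists>\<phi>. (\<forall>n. \<phi> n \<in> C0_infinity T) \<and>
     (\<lambda>n. Lp_integral T p (\<lambda>t. \<phi> n t - u t)) \<longlonglongrightarrow> 0 \<and> (\<lambda>n. Lp_integral T p (\<lambda>t. D (\<phi> n) t - w t)) \<longlonglongrightarrow> 0)"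
  unfolding is_frac_deriv_def Lp_converges_iff[OF p0] using C0_infinityD(1,2) by blast

text \<open>The closure expressed with \<open>e\<close> in place of sequences, which spares the
  diagonal argument in \<open>is_deriv_closed\<close>.\<close>

lemma is_deriv_approx:
  "is_deriv u w \<longleftrightarrow> u \<in> Lp T p \<and> w \<in> Lp T p \<and>
     (\<forall>e>0. \<exists>\<phi>\<in>C0_infinity T. Lp_integral T p (\<lambda>t. \<phi> t - u t) < e \<and> Lp_integral T p (\<lambda>t. D \<phi> t - w t) < e)"
  (is "_ \<longleftrightarrow> ?u \<and> ?w \<and> ?A")
proof
  assume "is_deriv u w"
  then obtain \<phi> where \<phi>: "?u" "?w" "\<And>n. \<phi> n \<in> C0_infinity T"
     "(\<lambda>n. Lp_integral T p (\<lambda>t. \<phi> n t - u t)) \<longlonglongrightarrow> 0" "(\<lambda>n. Lp_integral T p (\<lambda>t. D (\<phi> n) t - w t)) \<longlonglongrightarrow> 0"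
    unfolding is_deriv_iff by auto
  have "?A"
  proof (intro allI impI)
    fix e :: real assume "e > 0"
    then have "eventually (\<lambda>n. Lp_integral T p (\<lambda>t. \<phi> n t - u t) < e \<and> Lp_integral T p (\<lambda>t. D (\<phi> n) t - w t) < e) sequentially"
      using order_tendstoD(2)[OF \<phi>(4)] order_tendstoD(2)[OF \<phi>(5)] by (intro eventually_conj) auto
    then show "\<exists>\<phi>\<in>C0_infinity T. Lp_integral T p (\<lambda>t. \<phi> t - u t) < e \<and> Lp_integral T p (\<lambda>t. D \<phi> t - w t) < e"
      using \<phi>(3) by (auto simp: eventually_sequentially)
  qed
  then show "?u \<and> ?w \<and> ?A" using \<phi> by blast
next
  assume *: "?u \<and> ?w \<and> ?A"
  then have "\<exists>\<phi>\<in>C0_infinity T. Lp_integral T p (\<lambda>t. \<phi> t - u t) < 1 / real (Suc n) \<and> Lp_integral T p (\<lambda>t. D \<phi> t - w t) < 1 / real (Suc n)" for n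
    by simp
  then obtain \<phi> where \<phi>: "\<And>n. \<phi> n \<in> C0_infinity T" "\<And>n. Lp_integral T p (\<lambda>t. \<phi> n t - u t) < 1 / real (Suc n)"
    "\<And>n. Lp_integral T p (\<lambda>t. D (\<phi> n) t - w t) < 1 / real (Suc n)"
    by metis
  have l: "(\<lambda>k. 1 / real (Suc k)) \<longlonglongrightarrow> 0" using LIMSEQ_inverse_real_of_nat by (simp add: inverse_eq_divide)
  have "(\<lambda>n. Lp_integral T p (\<lambda>t. \<phi> n t - u t)) \<longlonglongrightarrow> 0" "(\<lambda>n. Lp_integral T p (\<lambda>t. D (\<phi> n) t - w t)) \<longlonglongrightarrow> 0"
    by (rule tendsto_sandwich[OF _ _ tendsto_const l]; simp add: less_imp_le[OF \<phi>(2)] less_imp_le[OF \<phi>(3)] del: of_nat_Suc)+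
  then show "is_deriv u w" unfolding is_deriv_iff using * \<phi>(1) by blast
qed

lemma is_deriv_closed:
  assumes d: "\<And>k. is_deriv (u k) (w k)" and U: "U \<in> Lp T p" and W: "W \<in> Lp T p"
    and lim: "(\<lambda>k. Lp_integral T p (\<lambda>t. u k t - U t)) \<longlonglongrightarrow> 0" "(\<lambda>k. Lp_integral T p (\<lambda>t. w k t - W t)) \<longlonglongrightarrow> 0"
  shows "is_deriv U W"
  unfolding is_deriv_approx
proof (intro conjI U W allI impI)
  fix e :: real assume "e > 0"
  define e' where "e' = e / (2 * 2 powr p)"
  have e': "e' > 0" "2 powr p * (e' + e') = e" using \<open>e > 0\<close> by (auto simp: e'_def)
  have "eventually (\<lambda>k. Lp_integral T p (\<lambda>t. u k t - U t) < e' \<and> Lp_integral T p (\<lambda>t. w k t - W t) < e') sequentially"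
    using order_tendstoD(2)[OF lim(1) e'(1)] order_tendstoD(2)[OF lim(2) e'(1)] by (intro eventually_conj)
  then obtain k where k: "Lp_integral T p (\<lambda>t. u k t - U t) < e'" "Lp_integral T p (\<lambda>t. w k t - W t) < e'"
    by (auto simp: eventually_sequentially)
  obtain \<phi> where \<phi>: "\<phi> \<in> C0_infinity T" "Lp_integral T p (\<lambda>t. \<phi> t - u k t) < e'" "Lp_integral T p (\<lambda>t. D \<phi> t - w k t) < e'"
    and uk: "u k \<in> Lp T p" "w k \<in> Lp T p"
    using d[of k] e'(1) unfolding is_deriv_approx by blast
  have tri: "Lp_integral T p (\<lambda>t. f t - h t) < e"
    if "f \<in> Lp T p" "g \<in> Lp T p" "h \<in> Lp T p" "Lp_integral T p (\<lambda>t. f t - g t) < e'" "Lp_integral T p (\<lambda>t. g t - h t) < e'" for f g h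
  proof -
    have "Lp_integral T p (\<lambda>t. f t - h t) \<le> 2 powr p * (Lp_integral T p (\<lambda>t. f t - g t) + Lp_integral T p (\<lambda>t. g t - h t))"
      using Lp_add(2)[OF p Lp_diff[OF p that(1,2)] Lp_diff[OF p that(2,3)]] by simp
    also have "\<dots> < 2 powr p * (e' + e')" using that by (intro mult_strict_left_mono) auto
    finally show ?thesis using e'(2) by simp
  qed
  show "\<exists>\<phi>\<in>C0_infinity T. Lp_integral T p (\<lambda>t. \<phi> t - U t) < e \<and> Lp_integral T p (\<lambda>t. D \<phi> t - W t) < e"
    using \<phi>(1) tri[OF C0_infinityD(2)[OF \<phi>(1)] uk(1) U \<phi>(2) k(1)] tri[OF C0_infinityD(1)[OF \<phi>(1)] uk(2) W \<phi>(3) k(2)] by blast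
qed

lemma is_deriv_lincomb:
  assumes "is_deriv u w" "is_deriv v z"
  shows "is_deriv (\<lambda>t. a * u t + b * v t) (\<lambda>t. a * w t + b * z t)"
proof -
  obtain \<phi> where \<phi>: "u \<in> Lp T p" "w \<in> Lp T p" "\<And>n. \<phi> n \<in> C0_infinity T"
     "(\<lambda>n. Lp_integral T p (\<lambda>t. \<phi> n t - u t)) \<longlonglongrightarrow> 0" "(\<lambda>n. Lp_integral T p (\<lambda>t. D (\<phi> n) t - w t)) \<longlonglongrightarrow> 0"
    using assms(1) unfolding is_deriv_iff by auto
  obtain \<psi> where \<psi>: "v \<in> Lp T p" "z \<in> Lp T p" "\<And>n. \<psi> n \<in> C0_infinity T"
     "(\<lambda>n. Lp_integral T p (\<lambda>t. \<psi> n t - v t)) \<longlonglongrightarrow> 0" "(\<lambda>n. Lp_integral T p (\<lambda>t. D (\<psi> n) t - z t)) \<longlonglongrightarrow> 0"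
    using assms(2) unfolding is_deriv_iff by auto
  have lim: "(\<lambda>n. Lp_integral T p (\<lambda>t. (a * f n t + b * g n t) - (a * f' t + b * g' t))) \<longlonglongrightarrow> 0"
    if "\<And>n. f n \<in> Lp T p" "\<And>n. g n \<in> Lp T p" "f' \<in> Lp T p" "g' \<in> Lp T p"
      "(\<lambda>n. Lp_integral T p (\<lambda>t. f n t - f' t)) \<longlonglongrightarrow> 0" "(\<lambda>n. Lp_integral T p (\<lambda>t. g n t - g' t)) \<longlonglongrightarrow> 0" for f g f' g'
  proof (rule tendsto_sandwich[OF _ _ tendsto_const])
    let ?B = "\<lambda>n. 2 powr p * (\<bar>a\<bar> powr p * Lp_integral T p (\<lambda>t. f n t - f' t) + \<bar>b\<bar> powr p * Lp_integral T p (\<lambda>t. g n t - g' t))"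
    have "Lp_integral T p (\<lambda>t. (a * f n t + b * g n t) - (a * f' t + b * g' t)) \<le> ?B n" for n
    proof -
      have "(\<lambda>t. (a * f n t + b * g n t) - (a * f' t + b * g' t)) = (\<lambda>t. a * (f n t - f' t) + b * (g n t - g' t))"
        by (auto simp: algebra_simps)
      then show ?thesis
        using Lp_add(2)[OF p Lp_scale(1)[OF Lp_diff[OF p that(1,3)], of a n] Lp_scale(1)[OF Lp_diff[OF p that(2,4)], of b n]]
        by (simp add: Lp_scale(2)[OF Lp_diff[OF p that(1,3)]] Lp_scale(2)[OF Lp_diff[OF p that(2,4)]])
    qed
    then show "\<forall>\<^sub>F n in sequentially. Lp_integral T p (\<lambda>t. (a * f n t + b * g n t) - (a * f' t + b * g' t)) \<le> ?B n" by simp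
    show "?B \<longlonglongrightarrow> 0"
      using tendsto_mult[OF tendsto_const[of "2 powr p"] tendsto_add[OF tendsto_mult[OF tendsto_const[of "\<bar>a\<bar> powr p"] that(5)] tendsto_mult[OF tendsto_const[of "\<bar>b\<bar> powr p"] that(6)]]]
      by simp
  qed simp
  show ?thesis
    unfolding is_deriv_iff
  proof (intro conjI exI[of _ "\<lambda>n t. a * \<phi> n t + b * \<psi> n t"] allI)
    show "(\<lambda>t. a * u t + b * v t) \<in> Lp T p" "(\<lambda>t. a * w t + b * z t) \<in> Lp T p"
      by (intro Lp_lincomb p \<phi> \<psi>)+
    show "(\<lambda>t. a * \<phi> n t + b * \<psi> n t) \<in> C0_infinity T" for n by (intro C0_infinity_lincomb \<phi> \<psi>)
    show "(\<lambda>n. Lp_integral T p (\<lambda>t. a * \<phi> n t + b * \<psi> n t - (a * u t + b * v t))) \<longlonglongrightarrow> 0"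
      by (intro lim C0_infinityD \<phi> \<psi>)
    have "Lp_integral T p (\<lambda>t. D (\<lambda>t. a * \<phi> n t + b * \<psi> n t) t - (a * w t + b * z t))
       = Lp_integral T p (\<lambda>t. a * D (\<phi> n) t + b * D (\<psi> n) t - (a * w t + b * z t))" for n
    proof (rule Lp_integral_cong_AE)
      show "(\<lambda>t. D (\<lambda>t. a * \<phi> n t + b * \<psi> n t) t - (a * w t + b * z t)) \<in> Lp T p"
        by (intro Lp_diff Lp_lincomb p \<phi> \<psi> C0_infinityD C0_infinity_lincomb)
      show "(\<lambda>t. a * D (\<phi> n) t + b * D (\<psi> n) t - (a * w t + b * z t)) \<in> Lp T p"
        by (intro Lp_diff Lp_lincomb p \<phi> \<psi> C0_infinityD)
      show "AE t in lebesgue_on {0..T}. D (\<lambda>t. a * \<phi> n t + b * \<psi> n t) t - (a * w t + b * z t) = a * D (\<phi> n) t + b * D (\<psi> n) t - (a * w t + b * z t)"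
        using D_lincomb_AE[OF \<phi>(3) \<psi>(3)] by eventually_elim simp
    qed
    then show "(\<lambda>n. Lp_integral T p (\<lambda>t. D (\<lambda>t. a * \<phi> n t + b * \<psi> n t) t - (a * w t + b * z t))) \<longlonglongrightarrow> 0"
      using lim[OF C0_infinityD(1)[OF \<phi>(3)] C0_infinityD(1)[OF \<psi>(3)] \<phi>(2) \<psi>(2) \<phi>(5) \<psi>(5)] by simp
  qed
qed

lemma Lp_limit_unique:
  assumes "\<And>n. f n \<in> Lp T p" "g \<in> Lp T p" "h \<in> Lp T p"
    "(\<lambda>n. Lp_integral T p (\<lambda>t. f n t - g t)) \<longlonglongrightarrow> 0" "(\<lambda>n. Lp_integral T p (\<lambda>t. f n t - h t)) \<longlonglongrightarrow> 0"
  shows "AE t in lebesgue_on {0..T}. g t = h t"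
proof -
  have "Lp_integral T p (\<lambda>t. g t - h t) \<le> 2 powr p * (Lp_integral T p (\<lambda>t. f n t - g t) + Lp_integral T p (\<lambda>t. f n t - h t))" for n
    using Lp_add(2)[OF p Lp_diff[OF p assms(2,1)] Lp_diff[OF p assms(1,3)], of n n]
    by (simp add: Lp_integral_minus[of T p g])
  moreover have "(\<lambda>n. 2 powr p * (Lp_integral T p (\<lambda>t. f n t - g t) + Lp_integral T p (\<lambda>t. f n t - h t))) \<longlonglongrightarrow> 2 powr p * (0 + 0)"
    by (intro tendsto_mult tendsto_add tendsto_const assms)
  ultimately have "Lp_integral T p (\<lambda>t. g t - h t) \<le> 2 powr p * (0 + 0)"
    by (intro LIMSEQ_le_const) blast+
  then have "Lp_integral T p (\<lambda>t. g t - h t) = 0" using Lp_integral_nonneg[of T p "\<lambda>t. g t - h t"] by simp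
  then have "AE t in lebesgue_on {0..T}. g t - h t = 0"
    using Lp_integral_eq_0_iff[OF Lp_diff[OF p assms(2,3)]] by simp
  then show ?thesis by eventually_elim simp
qed

lemma Lp_integral_le_bound:
  assumes "f \<in> Lp T p" "\<And>t. t \<in> {0..T} \<Longrightarrow> \<bar>f t\<bar> \<le> B"
  shows "Lp_integral T p f \<le> T * B powr p"
proof -
  interpret finite_measure "lebesgue_on {0..T}" by (rule finite_measure_lebesgue_on_interval)
  have "Lp_integral T p f \<le> (\<integral>t. B powr p \<partial>lebesgue_on {0..T})"
    unfolding Lp_integral_def using LpD(2)[OF assms(1)] assms(2) p
    by (intro integral_mono powr_mono2) (auto simp: space_restrict_space)
  also have "\<dots> = T * B powr p" using T by (simp add: measure_restrict_space space_restrict_space)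
  finally show ?thesis .
qed

text \<open>Passage to the limit in \<open>\<phi> n = J (D (\<phi> n))\<close>: by
  \<open>J_bound\<close> the right side converges uniformly to \<open>J w\<close>, while the left
  side converges to \<open>u\<close> in the p-th Lebesgue space.\<close>

lemma is_deriv_J_AE:
  assumes "is_deriv u w"
  shows "AE t in lebesgue_on {0..T}. u t = J w t"
proof -
  obtain \<phi> where \<phi>: "u \<in> Lp T p" "w \<in> Lp T p" "\<And>n. \<phi> n \<in> C0_infinity T"
     "(\<lambda>n. Lp_integral T p (\<lambda>t. \<phi> n t - u t)) \<longlonglongrightarrow> 0" "(\<lambda>n. Lp_integral T p (\<lambda>t. D (\<phi> n) t - w t)) \<longlonglongrightarrow> 0"
    using assms(1) unfolding is_deriv_iff by auto
  obtain C where C: "C > 0" "\<And>w t. w \<in> Lp T p \<Longrightarrow> t \<in> {0..T} \<Longrightarrow> \<bar>J w t\<bar> \<le> C * Lp_norm T p w"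
    using J_bound by blast
  have JL: "J w \<in> Lp T p" by (intro continuous_imp_Lp p0 J_continuous \<phi>)
  have "Lp_integral T p (\<lambda>t. \<phi> n t - J w t) \<le> T * C powr p * Lp_integral T p (\<lambda>t. D (\<phi> n) t - w t)" for n
  proof -
    note c = C0_infinityD[OF \<phi>(3)[of n]]
    have "\<bar>\<phi> n t - J w t\<bar> \<le> C * Lp_norm T p (\<lambda>t. D (\<phi> n) t - w t)" if "t \<in> {0..T}" for t
      using C(2)[OF Lp_diff[OF p c(1) \<phi>(2)] that] J_lincomb[OF c(1) \<phi>(2) that, of 1 "-1"] c(3)[OF that] by simp
    from Lp_integral_le_bound[OF Lp_diff[OF p c(2) JL] this]
    moreover have "(C * Lp_norm T p (\<lambda>t. D (\<phi> n) t - w t)) powr p = C powr p * Lp_integral T p (\<lambda>t. D (\<phi> n) t - w t)"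
      using Lp_norm_powr[OF p0] by (simp add: powr_mult)
    ultimately show ?thesis by (simp add: mult.assoc)
  qed
  note bound = this
  have lim: "(\<lambda>n. T * C powr p * Lp_integral T p (\<lambda>t. D (\<phi> n) t - w t)) \<longlonglongrightarrow> 0"
    using tendsto_mult[OF tendsto_const[of "T * C powr p"] \<phi>(5)] by simp
  have "(\<lambda>n. Lp_integral T p (\<lambda>t. \<phi> n t - J w t)) \<longlonglongrightarrow> 0"
    by (rule tendsto_sandwich[OF _ _ tendsto_const lim]) (rule always_eventually, rule allI, rule Lp_integral_nonneg, rule always_eventually, rule allI, rule bound)
  from Lp_limit_unique[OF C0_infinityD(2)[OF \<phi>(3)] \<phi>(1) JL \<phi>(4) this] show ?thesis .
qed

lemma continuous_AE_eq:
  fixes f g :: "real \<Rightarrow> real"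
  assumes f: "continuous_on {0..T} f" and g: "continuous_on {0..T} g"
    and ae: "AE t in lebesgue_on {0..T}. f t = g t" and t: "t \<in> {0..T}"
  shows "f t = g t"
proof -
  have c: "continuous_on {0..T} (\<lambda>t. \<bar>f t - g t\<bar>)" by (intro continuous_intros f g)
  have "(\<integral>t. \<bar>f t - g t\<bar> \<partial>lebesgue_on {0..T}) = (\<integral>t. 0 \<partial>lebesgue_on {0..T})"
    using ae by (intro integral_cong_AE) (auto intro!: continuous_imp_measurable_on_sets_lebesgue c elim: eventually_mono)
  then have "integral {0..T} (\<lambda>t. \<bar>f t - g t\<bar>) = 0"
    using has_integral_integral_lebesgue_on[OF continuous_imp_integrable_real[OF c]] by (simp add: integral_unique)
  then show ?thesis
    using integral_eq_0_iff[OF c T] t by auto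
qed

lemma is_deriv_J:
  assumes "is_deriv u w" "continuous_on {0..T} u" "t \<in> {0..T}"
  shows "u t = J w t"
  using continuous_AE_eq[OF assms(2) J_continuous is_deriv_J_AE[OF assms(1)] assms(3)] assms(1)
  by (auto simp: is_deriv_iff)

text \<open>Both candidates have the same image \<open>u\<close> under \<open>J\<close> almost
  everywhere, hence everywhere by continuity, and \<open>J\<close> is injective up to null
  sets.\<close>

lemma is_deriv_unique:
  assumes "is_deriv u w" "is_deriv u z"
  shows "AE t in lebesgue_on {0..T}. w t = z t"
proof (rule AE_eq_if_J_eq)
  show wz: "w \<in> Lp T p" "z \<in> Lp T p" using assms by (auto simp: is_deriv_iff)
  fix t assume "t \<in> {0..T}"
  show "J w t = J z t"
  proof (rule continuous_AE_eq[OF J_continuous[OF wz(1)] J_continuous[OF wz(2)] _ \<open>t \<in> {0..T}\<close>])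
    show "AE t in lebesgue_on {0..T}. J w t = J z t"
      using is_deriv_J_AE[OF assms(1)] is_deriv_J_AE[OF assms(2)] by eventually_elim simp
  qed
qed

abbreviation "E \<equiv> E_space T \<alpha> p"

definition Q :: "(real \<Rightarrow> real) \<Rightarrow> real" where
  "Q u = Lp_integral T p (frac_deriv T \<alpha> p u)"

lemma E_norm_powr: "E_norm T \<alpha> p u powr p = Q u" "E_norm T \<alpha> p u = Q u powr (1 / p)"
  using Lp_norm_powr[OF p0] by (simp_all add: E_norm_def Q_def) (simp add: Lp_norm_eq)

lemma Q_nonneg [simp]: "Q u \<ge> 0" by (simp add: Q_def)

lemma E_spaceD:
  assumes "u \<in> E"
  shows "continuous_on {0..T} u" "\<And>t. t \<notin> {0..T} \<Longrightarrow> u t = 0" "is_deriv u (frac_deriv T \<alpha> p u)"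
  using assms someI_ex[of "is_deriv u"] by (auto simp: E_space_def frac_deriv_def)

lemma Q_eq: "is_deriv u w \<Longrightarrow> Q u = Lp_integral T p w"
  unfolding Q_def
proof (rule Lp_integral_cong_AE)
  assume w: "is_deriv u w"
  then have d: "is_deriv u (frac_deriv T \<alpha> p u)" unfolding frac_deriv_def by (rule someI[of "is_deriv u"])
  show "frac_deriv T \<alpha> p u \<in> Lp T p" "w \<in> Lp T p" using w d by (auto simp: is_deriv_iff)
  show "AE t in lebesgue_on {0..T}. frac_deriv T \<alpha> p u t = w t" by (rule is_deriv_unique[OF d w])
qed

lemma E_lincomb:
  assumes "u \<in> E" "v \<in> E"
  shows "(\<lambda>t. a * u t + b * v t) \<in> E"
    "is_deriv (\<lambda>t. a * u t + b * v t) (\<lambda>t. a * frac_deriv T \<alpha> p u t + b * frac_deriv T \<alpha> p v t)"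
proof -
  note u = E_spaceD[OF assms(1)] and v = E_spaceD[OF assms(2)]
  show d: "is_deriv (\<lambda>t. a * u t + b * v t) (\<lambda>t. a * frac_deriv T \<alpha> p u t + b * frac_deriv T \<alpha> p v t)"
    by (rule is_deriv_lincomb[OF u(3) v(3)])
  have "continuous_on {0..T} (\<lambda>t. a * u t + b * v t)" by (intro continuous_intros u v)
  then show "(\<lambda>t. a * u t + b * v t) \<in> E" using d u(2) v(2) by (auto simp: E_space_def)
qed

end

section \<open>Embedding, uniform convexity and compactness\<close>

context fractional_space
begin

lemma E_J: "u \<in> E \<Longrightarrow> t \<in> {0..T} \<Longrightarrow> u t = J (frac_deriv T \<alpha> p u) t"
  using is_deriv_J E_spaceD by blast

lemma E_Holder:
  obtains C where "C > 0" "\<And>u t t'. u \<in> E \<Longrightarrow> t \<in> {0..T} \<Longrightarrow> t' \<in> {0..T} \<Longrightarrow>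
     \<bar>u t' - u t\<bar> \<le> C * \<bar>t' - t\<bar> powr (\<alpha> - 1 / p) * Q u powr (1 / p)"
proof -
  obtain C where C: "C > 0" "\<And>w t t'. w \<in> Lp T p \<Longrightarrow> t \<in> {0..T} \<Longrightarrow> t' \<in> {0..T} \<Longrightarrow>
     \<bar>J w t' - J w t\<bar> \<le> C * \<bar>t' - t\<bar> powr (\<alpha> - 1 / p) * Lp_norm T p w"
    using J_Holder by blast
  have "\<bar>u t' - u t\<bar> \<le> C * \<bar>t' - t\<bar> powr (\<alpha> - 1 / p) * Q u powr (1 / p)"
    if "u \<in> E" "t \<in> {0..T}" "t' \<in> {0..T}" for u t t'
    using C(2)[of "frac_deriv T \<alpha> p u" t t'] E_spaceD(3)[OF that(1)] E_J[OF that(1)] that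
    by (simp add: is_deriv_iff Q_def Lp_norm_eq)
  then show thesis using that C(1) by blast
qed

lemma E_bound:
  obtains C where "C > 0" "\<And>u t. u \<in> E \<Longrightarrow> \<bar>u t\<bar> \<le> C * Q u powr (1 / p)"
proof -
  obtain C where C: "C > 0" "\<And>w t. w \<in> Lp T p \<Longrightarrow> t \<in> {0..T} \<Longrightarrow> \<bar>J w t\<bar> \<le> C * Lp_norm T p w"
    using J_bound by blast
  have "\<bar>u t\<bar> \<le> C * Q u powr (1 / p)" if "u \<in> E" for u t
  proof (cases "t \<in> {0..T}")
    case True
    then show ?thesis
      using C(2)[of "frac_deriv T \<alpha> p u" t] E_spaceD(3)[OF that(1)] E_J[OF that(1)]
      by (simp add: is_deriv_iff Q_def Lp_norm_eq)
  next
    case False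
    then show ?thesis using E_spaceD(2)[OF that(1)] C(1) by simp
  qed
  then show thesis using that C(1) by blast
qed

lemma Q_zero_imp: "u \<in> E \<Longrightarrow> Q u = 0 \<Longrightarrow> u = (\<lambda>t. 0)"
proof -
  assume u: "u \<in> E" "Q u = 0"
  obtain C where "C > 0" "\<And>u t. u \<in> E \<Longrightarrow> \<bar>u t\<bar> \<le> C * Q u powr (1 / p)" using E_bound by blast
  then have "\<bar>u t\<bar> \<le> 0" for t using u by (metis mult_zero_right powr_0)
  then show ?thesis by auto
qed

lemma frac_deriv_Lp: "u \<in> E \<Longrightarrow> frac_deriv T \<alpha> p u \<in> Lp T p"
  using E_spaceD(3) by (simp add: is_deriv_iff)

lemma Q_lincomb:
  "u \<in> E \<Longrightarrow> v \<in> E \<Longrightarrow> Q (\<lambda>t. a * u t + b * v t)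
     = Lp_integral T p (\<lambda>t. a * frac_deriv T \<alpha> p u t + b * frac_deriv T \<alpha> p v t)"
  by (rule Q_eq[OF E_lincomb(2)])

lemma E_scale: "u \<in> E \<Longrightarrow> (\<lambda>t. c * u t) \<in> E" "u \<in> E \<Longrightarrow> Q (\<lambda>t. c * u t) = \<bar>c\<bar> powr p * Q u"
  using E_lincomb(1)[of u u c 0] Q_lincomb[of u u c 0] Lp_scale(2)[OF frac_deriv_Lp, of u c] by (simp_all add: Q_def)

lemma Q_convex:
  "u \<in> E \<Longrightarrow> v \<in> E \<Longrightarrow> 0 \<le> s \<Longrightarrow> s \<le> 1 \<Longrightarrow> Q (\<lambda>t. (1 - s) * u t + s * v t) \<le> (1 - s) * Q u + s * Q v"
  by (simp only: Q_lincomb) (simp only: Q_def Lp_integral_convex[OF p frac_deriv_Lp frac_deriv_Lp])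

lemma Q_uniformly_convex:
  assumes "\<epsilon> > 0"
  obtains C where "C \<ge> 0" "\<And>u v. u \<in> E \<Longrightarrow> v \<in> E \<Longrightarrow>
    Q (\<lambda>t. u t - v t) \<le> \<epsilon> * (Q u + Q v) + C * ((Q u + Q v) / 2 - Q (\<lambda>t. (u t + v t) / 2))"
proof -
  obtain C where C: "C \<ge> 0" "\<And>f g. f \<in> Lp T p \<Longrightarrow> g \<in> Lp T p \<Longrightarrow>
    Lp_integral T p (\<lambda>t. f t - g t) \<le> \<epsilon> * (Lp_integral T p f + Lp_integral T p g)
      + C * ((Lp_integral T p f + Lp_integral T p g) / 2 - Lp_integral T p (\<lambda>t. (f t + g t) / 2))"
    by (rule Lp_integral_uniformly_convex[OF p assms, of T]) (rule that)
  have "Q (\<lambda>t. u t - v t) \<le> \<epsilon> * (Q u + Q v) + C * ((Q u + Q v) / 2 - Q (\<lambda>t. (u t + v t) / 2))"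
    if "u \<in> E" "v \<in> E" for u v
    using C(2)[OF frac_deriv_Lp[OF that(1)] frac_deriv_Lp[OF that(2)]]
      Q_lincomb[OF that, of 1 "-1"] Q_lincomb[OF that, of "1/2" "1/2"]
    by (simp add: Q_def add_divide_distrib)
  then show thesis using that C(1) by blast
qed

lemma E_midpoint: "u \<in> E \<Longrightarrow> v \<in> E \<Longrightarrow> (\<lambda>t. (u t + v t) / 2) \<in> E"
  using E_lincomb(1)[of u v "1/2" "1/2"] by (simp add: add_divide_distrib)

text \<open>Uniform convexity with \<open>\<epsilon>\<close> tending to 0: without a gap at the
  midpoint the difference \<open>u - v\<close> would have norm zero, hence vanish.\<close>

lemma Q_midpoint_strict:
  assumes "u \<in> E" "v \<in> E" "u \<noteq> v"
  shows "Q (\<lambda>t. (u t + v t) / 2) < (Q u + Q v) / 2"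
proof (rule ccontr)
  assume *: "\<not> ?thesis"
  have d: "(\<lambda>t. u t - v t) \<in> E" using E_lincomb(1)[OF assms(1,2), of 1 "-1"] by simp
  have "Q (\<lambda>t. u t - v t) \<le> \<epsilon>" if "\<epsilon> > 0" for \<epsilon>
  proof -
    define \<epsilon>' where "\<epsilon>' = \<epsilon> / (Q u + Q v + 1)"
    have pos: "Q u + Q v + 1 > 0" by (simp add: add_nonneg_pos)
    have e': "\<epsilon>' > 0" using that pos by (simp add: \<epsilon>'_def)
    obtain C where C: "C \<ge> 0" "\<And>u v. u \<in> E \<Longrightarrow> v \<in> E \<Longrightarrow>
      Q (\<lambda>t. u t - v t) \<le> \<epsilon>' * (Q u + Q v) + C * ((Q u + Q v) / 2 - Q (\<lambda>t. (u t + v t) / 2))"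
      by (rule Q_uniformly_convex[OF e']) (rule that)
    have "C * ((Q u + Q v) / 2 - Q (\<lambda>t. (u t + v t) / 2)) \<le> 0"
      using * C(1) by (intro mult_nonneg_nonpos) auto
    moreover have "\<epsilon>' * (Q u + Q v) \<le> \<epsilon>' * (Q u + Q v + 1)" using e' by simp
    moreover have "\<epsilon>' * (Q u + Q v + 1) = \<epsilon>" using pos by (simp add: \<epsilon>'_def)
    ultimately show ?thesis using C(2)[OF assms(1,2)] by linarith
  qed
  then have "Q (\<lambda>t. u t - v t) \<le> 0" by (rule field_le_epsilon[of _ 0, simplified])
  then have "(\<lambda>t. u t - v t) = (\<lambda>t. 0)" using Q_zero_imp[OF d] Q_nonneg[of "\<lambda>t. u t - v t"] by simp
  then show False using assms(3) by (auto simp: fun_eq_iff)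
qed

text \<open>Weak sequential compactness of balls is replaced by uniform convexity: near-minimizers \<open>v k\<close> of
  \<open>Q\<close> over the convex sets \<open>V k\<close> of elements close to \<open>u\<close> form a Cauchy sequence.\<close>

lemma E_closed:
  assumes U: "\<And>n :: nat. U n \<in> E" "\<And>n. Q (U n) \<le> M" and u: "continuous_on {0..T} u" "\<And>t. t \<notin> {0..T} \<Longrightarrow> u t = 0"
    and unif: "\<And>e. e > 0 \<Longrightarrow> \<exists>n. \<forall>t\<in>{0..T}. \<bar>U n t - u t\<bar> \<le> e"
  shows "u \<in> E" "Q u \<le> M"
proof -
  have M0: "M \<ge> 0" using U(2)[of 0] Q_nonneg[of "U 0"] by linarith
  define V where "V k = {v \<in> E. Q v \<le> M \<and> (\<forall>t\<in>{0..T}. \<bar>v t - u t\<bar> \<le> 1 / real (Suc k))}" for k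
  define d where "d k = Inf (Q ` V k)" for k
  have Vne: "V k \<noteq> {}" for k
    using unif[of "1 / real (Suc k)"] U by (fastforce simp: V_def)
  have Vmono: "V j \<subseteq> V k" if "k \<le> j" for j k
  proof -
    have "1 / real (Suc j) \<le> 1 / real (Suc k)" using that by (intro divide_left_mono) auto
    then show ?thesis by (fastforce simp: V_def)
  qed
  have bdd: "bdd_below (Q ` V k)" for k by (intro bdd_belowI[of _ 0]) auto
  have dle: "d k \<le> Q v" if "v \<in> V k" for v k unfolding d_def using that bdd by (intro cInf_lower) auto
  have dinc: "d k \<le> d j" if "k \<le> j" for j k
    unfolding d_def using Vne Vmono[OF that] bdd by (intro cInf_superset_mono) auto
  have dM: "d k \<le> M" for k
  proof -
    obtain v where "v \<in> V k" using Vne by blast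
    then show ?thesis using dle[of v k] by (auto simp: V_def)
  qed
  obtain dl where dl: "d \<longlonglongrightarrow> dl" "\<And>k. d k \<le> dl"
    using incseq_convergent[of d M] dinc dM by (auto simp: incseq_def)
  have "\<exists>v. v \<in> V k \<and> Q v < d k + 1 / real (Suc k)" for k
    using cInf_lessD[of "Q ` V k" "d k + 1 / real (Suc k)"] Vne by (auto simp: d_def)
  then obtain v where v: "\<And>k. v k \<in> V k" "\<And>k. Q (v k) < d k + 1 / real (Suc k)" by metis
  have vE: "v k \<in> E" "Q (v k) \<le> M" "\<And>t. t \<in> {0..T} \<Longrightarrow> \<bar>v k t - u t\<bar> \<le> 1 / real (Suc k)" for k
    using v(1)[of k] by (auto simp: V_def)
  define \<eta> where "\<eta> k = (dl - d k) / 2 + 1 / real (Suc k)" for k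
  have l: "(\<lambda>k. 1 / real (Suc k)) \<longlonglongrightarrow> 0" using LIMSEQ_inverse_real_of_nat by (simp add: inverse_eq_divide)
  have \<eta>: "\<eta> \<longlonglongrightarrow> 0"
    unfolding \<eta>_def using tendsto_add[OF tendsto_divide[OF tendsto_diff[OF tendsto_const[of dl] dl(1)] tendsto_const[of 2]] l] by simp
  \<comment> \<open>The midpoint lies in \<open>V k\<close> again, so \<open>d k\<close> bounds its
    \<open>Q\<close> from below, while both end points are nearly minimal. This makes the gap in the
    uniform convexity inequality tend to 0.\<close>
  have mid: "(Q (v k) + Q (v j)) / 2 - Q (\<lambda>t. (v k t + v j t) / 2) \<le> \<eta> k" if "k \<le> j" for j k
  proof -
    have le: "1 / real (Suc j) \<le> 1 / real (Suc k)" using that by (intro divide_left_mono) auto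
    have "(\<lambda>t. (v k t + v j t) / 2) \<in> V k"
      unfolding V_def mem_Collect_eq
    proof (intro conjI ballI)
      show "(\<lambda>t. (v k t + v j t) / 2) \<in> E" by (intro E_midpoint vE)
      have "Q (\<lambda>t. (v k t + v j t) / 2) \<le> (1 - 1/2) * Q (v k) + 1/2 * Q (v j)"
        using Q_convex[OF vE(1)[of k] vE(1)[of j], of "1/2"] by (simp add: add_divide_distrib)
      then show "Q (\<lambda>t. (v k t + v j t) / 2) \<le> M" using vE(2)[of k] vE(2)[of j] by simp
      fix t assume t: "t \<in> {0..T}"
      have "\<bar>(a + b) / 2 - x\<bar> \<le> z" if "\<bar>a - x\<bar> \<le> z" "\<bar>b - x\<bar> \<le> y" "y \<le> z" for a b x y z :: real
        using that unfolding abs_le_iff by (auto simp: field_simps)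
      from this[OF vE(3)[OF t, of k] vE(3)[OF t, of j] le]
      show "\<bar>(v k t + v j t) / 2 - u t\<bar> \<le> 1 / real (Suc k)" .
    qed
    note dm = dle[OF this]
    have "(qk + qj) / 2 - qm \<le> (l' - dk) / 2 + hk"
      if "dk \<le> qm" "qk < dk + hk" "qj < dj + hj" "dj \<le> l'" "hj \<le> hk" for dk qm qk qj hk hj dj l' :: real
      using that by (simp add: field_simps)
    from this[OF dm v(2)[of k] v(2)[of j] dl(2)[of j] le] show ?thesis unfolding \<eta>_def .
  qed
  define w where "w k = frac_deriv T \<alpha> p (v k)" for k
  have wL: "w k \<in> Lp T p" for k unfolding w_def by (intro frac_deriv_Lp vE)
  have wd: "is_deriv (v k) (w k)" for k unfolding w_def by (intro E_spaceD vE)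
  have Qd: "Q (\<lambda>t. v k t - v j t) = Lp_integral T p (\<lambda>t. w k t - w j t)" for k j
    using Q_lincomb[OF vE(1)[of k] vE(1)[of j], of 1 "-1"] by (simp add: w_def)
  have Cauchy: "\<exists>N. \<forall>m\<ge>N. \<forall>n\<ge>N. Lp_integral T p (\<lambda>t. w m t - w n t) \<le> e" if "e > 0" for e
  proof -
    define \<epsilon> where "\<epsilon> = e / (4 * (M + 1))"
    have \<epsilon>: "\<epsilon> > 0" using that M0 by (simp add: \<epsilon>_def)
    obtain C where C: "C \<ge> 0" "\<And>u v. u \<in> E \<Longrightarrow> v \<in> E \<Longrightarrow>
      Q (\<lambda>t. u t - v t) \<le> \<epsilon> * (Q u + Q v) + C * ((Q u + Q v) / 2 - Q (\<lambda>t. (u t + v t) / 2))"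
      by (rule Q_uniformly_convex[OF \<epsilon>]) (rule that)
    have "(\<lambda>k. C * \<eta> k) \<longlonglongrightarrow> 0" using tendsto_mult[OF tendsto_const[of C] \<eta>] by simp
    then have "eventually (\<lambda>k. C * \<eta> k < e / 2) sequentially" using that by (intro order_tendstoD(2)) auto
    then obtain N where N: "\<And>k. k \<ge> N \<Longrightarrow> C * \<eta> k < e / 2" by (auto simp: eventually_sequentially)
    have *: "Lp_integral T p (\<lambda>t. w k t - w j t) \<le> e" if "N \<le> k" "k \<le> j" for k j
    proof -
      have "Q (\<lambda>t. v k t - v j t) \<le> \<epsilon> * (Q (v k) + Q (v j)) + C * ((Q (v k) + Q (v j)) / 2 - Q (\<lambda>t. (v k t + v j t) / 2))"
        by (intro C(2) vE)
      also have "\<dots> \<le> \<epsilon> * (M + M) + C * \<eta> k"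
        using C(1) \<epsilon> vE(2) mid[OF that(2)] by (intro add_mono mult_left_mono) auto
      also have "\<epsilon> * (M + M) \<le> e / 2"
        using M0 \<open>e > 0\<close> unfolding \<epsilon>_def by (simp add: field_simps)
      finally show ?thesis using N[OF that(1)] Qd by simp
    qed
    show ?thesis
    proof (intro exI[of _ N] allI impI)
      fix m n assume "N \<le> m" "N \<le> n"
      then show "Lp_integral T p (\<lambda>t. w m t - w n t) \<le> e"
        using *[of m n] *[of n m] Lp_integral_minus[of T p "w m" "w n"] by (cases "m \<le> n") auto
    qed
  qed
  obtain W where W: "W \<in> Lp T p" "(\<lambda>k. Lp_integral T p (\<lambda>t. w k t - W t)) \<longlonglongrightarrow> 0"
    using Lp_complete[OF p wL Cauchy] by blast
  have uL: "u \<in> Lp T p" by (rule continuous_imp_Lp[OF p0 u(1)])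
  have "Lp_integral T p (\<lambda>t. v k t - u t) \<le> T * (1 / real (Suc k)) powr p" for k
  proof (rule Lp_integral_le_bound)
    show "(\<lambda>t. v k t - u t) \<in> Lp T p"
      using E_spaceD(3)[OF vE(1)[of k]] uL by (intro Lp_diff p) (auto simp: is_deriv_iff)
  qed (rule vE)
  note bound = this
  have "(\<lambda>k. (1 / real (Suc k)) powr p) \<longlonglongrightarrow> 0 powr p"
    by (rule tendsto_powr'[OF l tendsto_const]) (use p0 in auto)
  from tendsto_mult[OF tendsto_const[of T] this] have lim: "(\<lambda>k. T * (1 / real (Suc k)) powr p) \<longlonglongrightarrow> 0" by simp
  have "(\<lambda>k. Lp_integral T p (\<lambda>t. v k t - u t)) \<longlonglongrightarrow> 0"
    by (rule tendsto_sandwich[OF _ _ tendsto_const lim]) (rule always_eventually, rule allI, rule Lp_integral_nonneg, rule always_eventually, rule allI, rule bound)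
  from is_deriv_closed[OF wd uL W(1) this W(2)] have "is_deriv u W" .
  then show "u \<in> E" using u by (auto simp: E_space_def)
  have "(\<lambda>k. Lp_integral T p (w k)) \<longlonglongrightarrow> Q u"
    using Lp_integral_limit_le[OF p wL W] Q_eq[OF \<open>is_deriv u W\<close>] by simp
  moreover have "Lp_integral T p (w k) \<le> M" for k using vE(2)[of k] Q_eq[OF wd[of k]] by simp
  ultimately show "Q u \<le> M" by (intro LIMSEQ_le_const2) blast+
qed

text \<open>Arzela--Ascoli, with the Hoelder estimate as equicontinuity. The inequality
  \<open>Q u \<le> L\<close> is lower semicontinuity: \<open>E_closed\<close> is applied to tails of
  the subsequence with the bound \<open>L + e\<close>.\<close>

theorem E_compact:
  assumes U: "\<And>n. U n \<in> E" "\<And>n. Q (U n) \<le> M"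
  obtains r u L where "strict_mono (r :: nat \<Rightarrow> nat)" "u \<in> E" "\<And>t. (\<lambda>n. U (r n) t) \<longlonglongrightarrow> u t"
    "(\<lambda>n. Q (U (r n))) \<longlonglongrightarrow> L" "Q u \<le> L"
proof -
  have M0: "M \<ge> 0" using U(2)[of 0] Q_nonneg[of "U 0"] by linarith
  have Qp: "Q (U n) powr (1 / p) \<le> M powr (1 / p)" for n using U(2) p0 by (intro powr_mono2) auto
  obtain C where C: "C > 0" "\<And>u t. u \<in> E \<Longrightarrow> \<bar>u t\<bar> \<le> C * Q u powr (1 / p)" using E_bound by blast
  obtain H where H: "H > 0" "\<And>u t t'. u \<in> E \<Longrightarrow> t \<in> {0..T} \<Longrightarrow> t' \<in> {0..T} \<Longrightarrow>
     \<bar>u t' - u t\<bar> \<le> H * \<bar>t' - t\<bar> powr (\<alpha> - 1 / p) * Q u powr (1 / p)" using E_Holder by blast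
  have bnd: "norm (U n t) \<le> C * M powr (1 / p)" for n t
    using order_trans[OF C(2)[OF U(1)] mult_left_mono[OF Qp less_imp_le[OF C(1)]]] by simp
  have equi: "\<exists>\<delta>>0. \<forall>n y. y \<in> {0..T} \<and> norm (x - y) < \<delta> \<longrightarrow> norm (U n x - U n y) < e"
    if "x \<in> {0..T}" "e > 0" for x e
  proof -
    define B where "B = H * M powr (1 / p) + 1"
    have B: "B > 0" using H(1) by (auto simp: B_def intro: add_nonneg_pos)
    define \<theta> where "\<theta> = \<alpha> - 1 / p"
    have \<theta>: "\<theta> > 0" using \<alpha>p by (simp add: \<theta>_def)
    define \<delta> where "\<delta> = (e / B) powr (1 / \<theta>)"
    have "norm (U n x - U n y) < e" if y: "y \<in> {0..T}" "norm (x - y) < \<delta>" for n y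
    proof -
      have "\<bar>U n x - U n y\<bar> \<le> H * \<bar>x - y\<bar> powr \<theta> * Q (U n) powr (1 / p)"
        using H(2)[OF U(1)[of n] y(1) \<open>x \<in> {0..T}\<close>] by (simp add: \<theta>_def)
      also have "\<dots> \<le> H * \<bar>x - y\<bar> powr \<theta> * M powr (1 / p)" using H(1) Qp by (intro mult_left_mono) auto
      also have "\<dots> = (H * M powr (1 / p)) * \<bar>x - y\<bar> powr \<theta>" by simp
      also have "\<dots> \<le> B * \<bar>x - y\<bar> powr \<theta>" by (intro mult_right_mono) (auto simp: B_def)
      also have "\<bar>x - y\<bar> powr \<theta> < \<delta> powr \<theta>" using y(2) \<theta> by (intro powr_less_mono2) auto
      also have "\<delta> powr \<theta> = e / B" using \<theta> B \<open>e > 0\<close> by (simp add: \<delta>_def powr_powr)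
      finally show ?thesis using B by simp
    qed
    moreover have "\<delta> > 0" using \<open>e > 0\<close> B by (simp add: \<delta>_def)
    ultimately show ?thesis by blast
  qed
  obtain g k where g: "continuous_on {0..T} g" "strict_mono (k :: nat \<Rightarrow> nat)"
      "\<And>e. 0 < e \<Longrightarrow> \<exists>N. \<forall>n x. n \<ge> N \<and> x \<in> {0..T} \<longrightarrow> norm (U (k n) x - g x) < e"
    using Arzela_Ascoli[of "{0..T}" U "C * M powr (1 / p)"] bnd equi by (metis compact_Icc)
  define u where "u t = (if t \<in> {0..T} then g t else 0)" for t
  have u: "continuous_on {0..T} u" "\<And>t. t \<notin> {0..T} \<Longrightarrow> u t = 0"
    by (auto simp: u_def intro: continuous_on_eq[OF g(1)])
  have unif: "\<exists>N. \<forall>n\<ge>N. \<forall>t\<in>{0..T}. \<bar>U (k n) t - u t\<bar> \<le> e" if "e > 0" for e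
  proof -
    obtain N where "\<forall>n x. n \<ge> N \<and> x \<in> {0..T} \<longrightarrow> norm (U (k n) x - g x) < e" using g(3)[OF \<open>e > 0\<close>] by blast
    then show ?thesis by (intro exI[of _ N] allI impI ballI less_imp_le) (simp add: u_def)
  qed
  have "bounded (range (\<lambda>n. Q (U (k n))))"
    using U(2) by (intro boundedI[of _ M]) auto
  then obtain L q where q: "strict_mono q" "((\<lambda>n. Q (U (k n))) \<circ> q) \<longlonglongrightarrow> L"
    using bounded_imp_convergent_subsequence by blast
  have kq: "strict_mono (k \<circ> q)" using g(2) q(1) by (rule strict_mono_o)
  have lim: "(\<lambda>n. Q (U ((k \<circ> q) n))) \<longlonglongrightarrow> L" using q(2) by (simp add: comp_def)
  have uE: "u \<in> E \<and> Q u \<le> L + e" if "e > 0" for e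
  proof -
    have "eventually (\<lambda>n. Q (U ((k \<circ> q) n)) < L + e) sequentially"
      using lim that by (intro order_tendstoD(2)) auto
    then obtain N where "\<forall>n\<ge>N. Q (U ((k \<circ> q) n)) < L + e" unfolding eventually_sequentially by blast
    then have N: "\<And>n. n \<ge> N \<Longrightarrow> Q (U ((k \<circ> q) n)) \<le> L + e" by (blast intro: less_imp_le)
    have "\<exists>n. \<forall>t\<in>{0..T}. \<bar>U ((k \<circ> q) (n + N)) t - u t\<bar> \<le> e'" if "e' > 0" for e'
    proof -
      obtain N' where N': "\<forall>n\<ge>N'. \<forall>t\<in>{0..T}. \<bar>U (k n) t - u t\<bar> \<le> e'" using unif[OF \<open>e' > 0\<close>] by blast
      have "N' \<le> q (N' + N)" using seq_suble[OF q(1), of "N' + N"] by simp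
      then show ?thesis using N' by (intro exI[of _ N']) simp
    qed
    then show ?thesis
      using E_closed[of "\<lambda>n. U ((k \<circ> q) (n + N))" "L + e" u] U(1) N u by auto
  qed
  have ptw: "(\<lambda>n. U ((k \<circ> q) n) t) \<longlonglongrightarrow> u t" for t
  proof (cases "t \<in> {0..T}")
    case True
    have "(\<lambda>n. U (k n) t) \<longlonglongrightarrow> u t"
    proof (rule LIMSEQ_I)
      fix e :: real assume "e > 0"
      then show "\<exists>N. \<forall>n\<ge>N. norm (U (k n) t - u t) < e"
        using g(3)[of e] True by (auto simp: u_def)
    qed
    from LIMSEQ_subseq_LIMSEQ[OF this q(1)] show ?thesis by (simp add: comp_def)
  next
    case False
    then show ?thesis using E_spaceD(2)[OF U(1)] u(2) by simp
  qed
  have QL: "Q u \<le> L" by (rule field_le_epsilon) (use uE in blast)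
  have "u \<in> E" using uE[of 1] by simp
  then show thesis by (rule that[OF kq _ ptw lim QL])
qed

end

section \<open>The minimax principle\<close>

locale nonlinearity =
  fixes T :: real and f :: "real \<Rightarrow> real \<Rightarrow> real" and d :: "real \<Rightarrow> real" and r :: real
  assumes T: "T > 0"
    and f_cont: "continuous_on ({0..T} \<times> UNIV) (\<lambda>(t, x). f t x)"
    and f_odd: "\<And>t x. t \<in> {0..T} \<Longrightarrow> f t (- x) = - f t x"
    and d_int: "integrable (lebesgue_on {0..T}) d" and d_nonneg: "\<And>t. t \<in> {0..T} \<Longrightarrow> d t \<ge> 0"
    and r: "1 < r"
    and growth: "\<And>t x. t \<in> {0..T} \<Longrightarrow> \<bar>f t x\<bar> \<le> d t * \<bar>x\<bar> powr (r - 1)"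
begin

abbreviation "M \<equiv> lebesgue_on {0..T}"

sublocale finite_measure M by (rule finite_measure_lebesgue_on_interval)

lemma space_M: "space M = {0..T}" by (simp add: space_restrict_space)

lemma measure_M: "measure M (space M) = T"
  using T by (simp add: space_M measure_restrict_space)

abbreviation "F \<equiv> primitive f"

lemma f_cont_x: "t \<in> {0..T} \<Longrightarrow> continuous_on UNIV (f t)"
  using continuous_on_compose2[OF f_cont continuous_on_Pair[OF continuous_on_const continuous_on_id, of UNIV t]]
  by (simp add: image_subset_iff)

lemma f_cont_comp: "continuous_on {0..T} u \<Longrightarrow> continuous_on {0..T} (\<lambda>t. f t (u t))"
  using continuous_on_compose2[OF f_cont continuous_on_Pair[OF continuous_on_id, of "{0..T}" u]] by auto

lemma F_deriv:
  assumes "t \<in> {0..T}"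
  shows "(F t has_real_derivative f t x) (at x)"
proof -
  define R where "R = \<bar>x\<bar> + 1"
  have "((\<lambda>u. LBINT y=(0::real)..u. f t y) has_vector_derivative f t x) (at x within {-R..R})"
    using continuous_on_subset[OF f_cont_x[OF assms]] by (intro interval_integral_FTC2) (auto simp: R_def)
  then have "(F t has_vector_derivative f t x) (at x within {-R<..<R})"
    unfolding primitive_def zero_ereal_def by (rule has_vector_derivative_within_subset) auto
  moreover have "x \<in> {-R<..<R}" by (auto simp: R_def)
  ultimately have "(F t has_vector_derivative f t x) (at x)"
    using has_vector_derivative_within_open[of x "{-R<..<R}" "F t"] by simp
  then show ?thesis by (simp add: has_real_derivative_iff_has_vector_derivative)
qed

lemma F_zero: "F t 0 = 0" by (simp add: primitive_def zero_ereal_def)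

lemma F_MVT:
  assumes "t \<in> {0..T}"
  obtains \<xi> where "\<bar>\<xi> - x\<bar> \<le> \<bar>y - x\<bar>" "F t y - F t x = (y - x) * f t \<xi>" "min x y \<le> \<xi>" "\<xi> \<le> max x y"
proof -
  consider "x < y" | "y < x" | "x = y" by linarith
  then show thesis
  proof cases
    case 1
    then obtain z where "x < z" "z < y" "F t y - F t x = (y - x) * f t z"
      using MVT2[of x y "F t" "f t"] F_deriv[OF assms] by auto
    then show thesis by (intro that[of z]) auto
  next
    case 2
    then obtain z where "y < z" "z < x" "F t x - F t y = (x - y) * f t z"
      using MVT2[of y x "F t" "f t"] F_deriv[OF assms] by auto
    then show thesis by (intro that[of z]) (auto simp: algebra_simps)
  next
    case 3
    then show thesis by (intro that[of x]) auto
  qed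
qed

lemma F_growth:
  assumes "t \<in> {0..T}"
  shows "\<bar>F t x\<bar> \<le> d t * \<bar>x\<bar> powr r"
proof -
  obtain \<xi> where \<xi>: "F t x - F t 0 = (x - 0) * f t \<xi>" "\<bar>\<xi> - 0\<bar> \<le> \<bar>x - 0\<bar>" using F_MVT[OF assms, of 0 x] by metis
  have "\<bar>F t x\<bar> = \<bar>x\<bar> * \<bar>f t \<xi>\<bar>" using \<xi> by (simp add: F_zero abs_mult)
  also have "\<dots> \<le> \<bar>x\<bar> * (d t * \<bar>\<xi>\<bar> powr (r - 1))" using growth[OF assms] by (intro mult_left_mono) auto
  also have "\<dots> \<le> \<bar>x\<bar> * (d t * \<bar>x\<bar> powr (r - 1))"
    using \<xi>(2) r d_nonneg[OF assms] by (intro mult_left_mono powr_mono2) auto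
  also have "\<dots> = d t * \<bar>x\<bar> powr r" by (cases "x = 0") (auto simp: powr_diff)
  finally show ?thesis .
qed

lemma f_bounded:
  obtains B where "B > 0" "\<And>t x. t \<in> {0..T} \<Longrightarrow> \<bar>x\<bar> \<le> R \<Longrightarrow> \<bar>f t x\<bar> \<le> B"
proof -
  have "compact ((\<lambda>(t, x). f t x) ` ({0..T} \<times> {-R..R}))"
    by (intro compact_continuous_image continuous_on_subset[OF f_cont] compact_Times) auto
  then obtain B where B: "\<And>z. z \<in> (\<lambda>(t, x). f t x) ` ({0..T} \<times> {-R..R}) \<Longrightarrow> norm z \<le> B"
    using compact_imp_bounded bounded_iff by metis
  have "\<bar>f t x\<bar> \<le> max B 1" if "t \<in> {0..T}" "\<bar>x\<bar> \<le> R" for t x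
  proof -
    have "f t x \<in> (\<lambda>(t, x). f t x) ` ({0..T} \<times> {-R..R})" using that by (intro image_eqI[of _ _ "(t, x)"]) auto
    from B[OF this] show ?thesis by simp
  qed
  then show thesis using that[of "max B 1"] by auto
qed

lemma f_unif_cont:
  assumes "e > 0"
  obtains \<delta> where "\<delta> > 0" "\<And>t s x y. t \<in> {0..T} \<Longrightarrow> s \<in> {0..T} \<Longrightarrow> \<bar>x\<bar> \<le> R \<Longrightarrow> \<bar>y\<bar> \<le> R \<Longrightarrow>
     \<bar>t - s\<bar> < \<delta> \<Longrightarrow> \<bar>x - y\<bar> < \<delta> \<Longrightarrow> \<bar>f t x - f s y\<bar> \<le> e"
proof -
  have "uniformly_continuous_on ({0..T} \<times> {-R..R}) (\<lambda>(t, x). f t x)"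
    by (intro compact_uniformly_continuous continuous_on_subset[OF f_cont] compact_Times) auto
  then obtain \<delta> where \<delta>: "\<delta> > 0" "\<And>z z'. z \<in> {0..T} \<times> {-R..R} \<Longrightarrow> z' \<in> {0..T} \<times> {-R..R} \<Longrightarrow> dist z' z < \<delta> \<Longrightarrow>
      dist ((\<lambda>(t, x). f t x) z') ((\<lambda>(t, x). f t x) z) < e"
    using assms unfolding uniformly_continuous_on_def by metis
  have "\<bar>f t x - f s y\<bar> \<le> e"
    if "t \<in> {0..T}" "s \<in> {0..T}" "\<bar>x\<bar> \<le> R" "\<bar>y\<bar> \<le> R" "\<bar>t - s\<bar> < \<delta> / 2" "\<bar>x - y\<bar> < \<delta> / 2" for t s x y
  proof -
    have "dist (t, x) (s, y) \<le> \<bar>t - s\<bar> + \<bar>x - y\<bar>"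
      unfolding dist_Pair_Pair dist_real_def using sqrt_sum_squares_le_sum_abs[of "\<bar>t - s\<bar>" "\<bar>x - y\<bar>"] by simp
    then have "dist (t, x) (s, y) < \<delta>" using that by linarith
    moreover have "(t, x) \<in> {0..T} \<times> {-R..R}" "(s, y) \<in> {0..T} \<times> {-R..R}"
      using that by (auto simp: abs_le_iff)
    ultimately show ?thesis using \<delta>(2)[of "(s, y)" "(t, x)"] by (auto simp: dist_real_def)
  qed
  then show thesis using that[of "\<delta> / 2"] \<delta>(1) by auto
qed

text \<open>Derivatives of \<open>F\<close> are available only in the second argument. The change in
  that argument is handled by the mean value theorem, the change in \<open>t\<close> by integrating
  the uniform continuity of \<open>f\<close> from 0 to \<open>u t\<close>.\<close>

lemma F_cont_comp:
  assumes u: "continuous_on {0..T} u"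
  shows "continuous_on {0..T} (\<lambda>t. F t (u t))"
proof -
  obtain R0 where R0: "\<And>t. t \<in> {0..T} \<Longrightarrow> norm (u t) \<le> R0"
    using compact_imp_bounded[OF compact_continuous_image[OF u compact_Icc]] unfolding bounded_iff by blast
  define R where "R = max R0 1"
  have R: "R > 0" "\<And>t. t \<in> {0..T} \<Longrightarrow> \<bar>u t\<bar> \<le> R" using R0 by (force simp: R_def)+
  obtain B where B: "B > 0" "\<And>t x. t \<in> {0..T} \<Longrightarrow> \<bar>x\<bar> \<le> R \<Longrightarrow> \<bar>f t x\<bar> \<le> B"
    using f_bounded[of R] by metis
  show ?thesis
    unfolding continuous_on_iff dist_real_def
  proof (intro ballI allI impI)
    fix t e :: real assume t: "t \<in> {0..T}" and e: "e > 0"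
    obtain \<delta> where \<delta>: "\<delta> > 0" "\<And>t s x y. t \<in> {0..T} \<Longrightarrow> s \<in> {0..T} \<Longrightarrow> \<bar>x\<bar> \<le> R \<Longrightarrow> \<bar>y\<bar> \<le> R \<Longrightarrow>
     \<bar>t - s\<bar> < \<delta> \<Longrightarrow> \<bar>x - y\<bar> < \<delta> \<Longrightarrow> \<bar>f t x - f s y\<bar> \<le> e / (4 * R)"
      using f_unif_cont[of "e / (4 * R)" R] e R(1) by (metis divide_pos_pos mult_pos_pos zero_less_numeral)
    obtain \<delta>' where \<delta>': "\<delta>' > 0" "\<And>s. s \<in> {0..T} \<Longrightarrow> \<bar>s - t\<bar> < \<delta>' \<Longrightarrow> \<bar>u s - u t\<bar> < e / (4 * B)"
      using u[unfolded continuous_on_iff dist_real_def, rule_format, OF t, of "e / (4 * B)"] e B(1) by auto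
    have "\<bar>F s (u s) - F t (u t)\<bar> < e" if s: "s \<in> {0..T}" "\<bar>s - t\<bar> < min \<delta> \<delta>'" for s
    proof -
      obtain \<xi> where \<xi>: "F s (u s) - F s (u t) = (u s - u t) * f s \<xi>" "min (u t) (u s) \<le> \<xi>" "\<xi> \<le> max (u t) (u s)"
        using F_MVT[OF s(1), of "u t" "u s"] by metis
      have "\<bar>\<xi>\<bar> \<le> R" using \<xi>(2,3) R(2)[OF t] R(2)[OF s(1)] by (auto simp: min_def max_def abs_le_iff split: if_splits)
      then have "\<bar>F s (u s) - F s (u t)\<bar> \<le> e / (4 * B) * B"
        unfolding \<xi>(1) abs_mult using B \<delta>'(2)[OF s(1)] s by (intro mult_mono) (auto intro: less_imp_le)
      then have 1: "\<bar>F s (u s) - F s (u t)\<bar> \<le> e / 4" using B(1) by simp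
      define G where "G x = F s x - F t x" for x
      have "\<bar>G (u t) - G 0\<bar> \<le> e / (4 * R) * \<bar>u t - 0\<bar>"
      proof -
        have dG: "(G has_real_derivative f s x - f t x) (at x within {-R..R})" for x
          unfolding G_def by (intro DERIV_diff DERIV_subset[OF F_deriv[OF s(1)]] DERIV_subset[OF F_deriv[OF t]]) auto
        have bd: "norm (f s z - f t z) \<le> e / (4 * R)" if "z \<in> {-R..R}" for z
          using \<delta>(2)[OF s(1) t, of z z] \<delta>(1) s(2) that by (auto simp: abs_le_iff)
        have "norm (G (u t) - G 0) \<le> e / (4 * R) * norm (u t - 0)"
          by (rule field_differentiable_bound[OF _ dG bd]) (use R(1) R(2)[OF t] in \<open>auto simp: abs_le_iff\<close>)
        then show ?thesis by simp
      qed
      also have "\<dots> \<le> e / (4 * R) * R" using R(2)[OF t] R(1) e by (intro mult_left_mono) auto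
      finally have "\<bar>F s (u t) - F t (u t)\<bar> \<le> e / 4" using R(1) by (simp add: G_def F_zero)
      then show ?thesis using 1 e by linarith
    qed
    then show "\<exists>\<delta>>0. \<forall>s\<in>{0..T}. \<bar>s - t\<bar> < \<delta> \<longrightarrow> \<bar>F s (u s) - F t (u t)\<bar> < e"
      using \<delta>(1) \<delta>'(1) by (intro exI[of _ "min \<delta> \<delta>'"]) auto
  qed
qed

definition \<psi> :: "(real \<Rightarrow> real) \<Rightarrow> real" where
  "\<psi> u = (\<integral>t. F t (u t) \<partial>M)"

definition \<psi>' :: "(real \<Rightarrow> real) \<Rightarrow> (real \<Rightarrow> real) \<Rightarrow> real" where
  "\<psi>' u v = (\<integral>t. f t (u t) * v t \<partial>M)"

lemma integrable_F: "continuous_on {0..T} u \<Longrightarrow> integrable M (\<lambda>t. F t (u t))"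
  by (intro continuous_imp_integrable_real F_cont_comp)

lemma integrable_f: "continuous_on {0..T} u \<Longrightarrow> continuous_on {0..T} v \<Longrightarrow> integrable M (\<lambda>t. f t (u t) * v t)"
  by (intro continuous_imp_integrable_real continuous_on_mult f_cont_comp)

lemma integral_tendsto:
  fixes g :: "nat \<Rightarrow> real \<Rightarrow> real"
  assumes g: "\<And>n. continuous_on {0..T} (g n)" "continuous_on {0..T} h"
    and lim: "\<And>t. t \<in> {0..T} \<Longrightarrow> (\<lambda>n. g n t) \<longlonglongrightarrow> h t" and B: "\<And>n t. t \<in> {0..T} \<Longrightarrow> \<bar>g n t\<bar> \<le> B"
  shows "(\<lambda>n. \<integral>t. g n t \<partial>M) \<longlonglongrightarrow> (\<integral>t. h t \<partial>M)"
  by (rule integral_dominated_convergence[where w = "\<lambda>_. B"])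
    (use assms in \<open>auto intro!: continuous_imp_measurable_on_sets_lebesgue AE_I2 simp: space_M\<close>)

lemma F_tendsto:
  assumes t: "t \<in> {0..T}" and "x \<longlonglongrightarrow> y"
  shows "(\<lambda>n. F t (x n)) \<longlonglongrightarrow> F t y" "(\<lambda>n. f t (x n)) \<longlonglongrightarrow> f t y"
  using isCont_tendsto_compose[OF DERIV_isCont[OF F_deriv[OF t]] assms(2)]
    isCont_tendsto_compose[OF _ assms(2), of "f t"] f_cont_x[OF t]
  by (auto simp: continuous_on_eq_continuous_at)

lemma F_bounded:
  assumes "\<And>t x. t \<in> {0..T} \<Longrightarrow> \<bar>x\<bar> \<le> R \<Longrightarrow> \<bar>f t x\<bar> \<le> B" "t \<in> {0..T}" "\<bar>x\<bar> \<le> R"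
  shows "\<bar>F t x\<bar> \<le> B * R"
proof -
  obtain \<xi> where \<xi>: "F t x - F t 0 = (x - 0) * f t \<xi>" "\<bar>\<xi> - 0\<bar> \<le> \<bar>x - 0\<bar>" using F_MVT[OF assms(2), of 0 x] by metis
  have "\<bar>f t \<xi>\<bar> \<le> B" using \<xi>(2) assms by auto
  then have "\<bar>x\<bar> * \<bar>f t \<xi>\<bar> \<le> R * B" using assms(3) by (intro mult_mono) auto
  then show ?thesis using \<xi>(1) by (simp add: F_zero abs_mult mult.commute)
qed

lemma \<psi>_tendsto:
  assumes u: "\<And>n. continuous_on {0..T} (u n)" "continuous_on {0..T} U"
    and lim: "\<And>t. t \<in> {0..T} \<Longrightarrow> (\<lambda>n. u n t) \<longlonglongrightarrow> U t" and R: "\<And>n t. t \<in> {0..T} \<Longrightarrow> \<bar>u n t\<bar> \<le> R"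
  shows "(\<lambda>n. \<psi> (u n)) \<longlonglongrightarrow> \<psi> U"
proof -
  obtain B where "B > 0" "\<And>t x. t \<in> {0..T} \<Longrightarrow> \<bar>x\<bar> \<le> R \<Longrightarrow> \<bar>f t x\<bar> \<le> B" using f_bounded[of R] by metis
  then have "\<bar>F t (u n t)\<bar> \<le> B * R" if "t \<in> {0..T}" for n t using F_bounded[of R B t "u n t"] R[OF that] that by blast
  then show ?thesis unfolding \<psi>_def
    by (intro integral_tendsto F_cont_comp u F_tendsto lim)
qed

lemma \<psi>'_tendsto:
  assumes u: "\<And>n. continuous_on {0..T} (u n)" "continuous_on {0..T} U"
    and lim: "\<And>t. t \<in> {0..T} \<Longrightarrow> (\<lambda>n. u n t) \<longlonglongrightarrow> U t" and R: "\<And>n t. t \<in> {0..T} \<Longrightarrow> \<bar>u n t\<bar> \<le> R"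
    and v: "\<And>n. continuous_on {0..T} (v n)" "continuous_on {0..T} V"
    and limv: "\<And>t. t \<in> {0..T} \<Longrightarrow> (\<lambda>n. v n t) \<longlonglongrightarrow> V t" and Rv: "\<And>n t. t \<in> {0..T} \<Longrightarrow> \<bar>v n t\<bar> \<le> R'"
  shows "(\<lambda>n. \<psi>' (u n) (v n)) \<longlonglongrightarrow> \<psi>' U V"
proof -
  obtain B where B: "B > 0" "\<And>t x. t \<in> {0..T} \<Longrightarrow> \<bar>x\<bar> \<le> R \<Longrightarrow> \<bar>f t x\<bar> \<le> B" using f_bounded[of R] by metis
  have "\<bar>f t (u n t) * v n t\<bar> \<le> B * R'" if "t \<in> {0..T}" for n t
    unfolding abs_mult using B(1) B(2)[OF that R[OF that]] Rv[OF that] by (intro mult_mono) auto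
  then show ?thesis unfolding \<psi>'_def
    by (intro integral_tendsto continuous_on_mult f_cont_comp u v tendsto_mult F_tendsto lim limv)
qed

lemma \<psi>'_linear:
  assumes "continuous_on {0..T} u" "continuous_on {0..T} v" "continuous_on {0..T} z"
  shows "\<psi>' u (\<lambda>t. a * v t + b * z t) = a * \<psi>' u v + b * \<psi>' u z"
proof -
  have "f t (u t) * (a * v t + b * z t) = a * (f t (u t) * v t) + b * (f t (u t) * z t)" for t
    by (simp add: algebra_simps)
  then show ?thesis unfolding \<psi>'_def using integrable_f[OF assms(1,2)] integrable_f[OF assms(1,3)] by simp
qed

lemma \<psi>'_bound:
  assumes "continuous_on {0..T} u" "continuous_on {0..T} v" "\<And>t. t \<in> {0..T} \<Longrightarrow> \<bar>f t (u t)\<bar> \<le> B"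
    "\<And>t. t \<in> {0..T} \<Longrightarrow> \<bar>v t\<bar> \<le> R" "B \<ge> 0"
  shows "\<bar>\<psi>' u v\<bar> \<le> T * (B * R)"
proof -
  have pw: "\<bar>f t (u t) * v t\<bar> \<le> B * R" if "t \<in> {0..T}" for t
    unfolding abs_mult using assms(3-5) that by (intro mult_mono) auto
  have "\<bar>\<psi>' u v\<bar> \<le> (\<integral>t. \<bar>f t (u t) * v t\<bar> \<partial>M)" unfolding \<psi>'_def by (rule integral_abs_bound)
  also have "\<dots> \<le> (\<integral>t. B * R \<partial>M)"
    by (intro integral_mono integrable_abs integrable_f assms(1,2)) (use pw space_M in simp_all)
  also have "\<dots> = T * (B * R)" using measure_M by (simp add: mult.commute)
  finally show ?thesis .
qed

lemma \<psi>'_uminus: "\<psi>' (\<lambda>t. - u t) (\<lambda>t. - v t) = \<psi>' u v" "\<psi>' (\<lambda>t. - u t) v = - \<psi>' u v"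
proof -
  show "\<psi>' (\<lambda>t. - u t) (\<lambda>t. - v t) = \<psi>' u v"
    unfolding \<psi>'_def by (intro Bochner_Integration.integral_cong) (auto simp: space_M f_odd)
  have "\<psi>' (\<lambda>t. - u t) v = (\<integral>t. - (f t (u t) * v t) \<partial>M)"
    unfolding \<psi>'_def by (intro Bochner_Integration.integral_cong) (auto simp: space_M f_odd)
  then show "\<psi>' (\<lambda>t. - u t) v = - \<psi>' u v" by (simp add: \<psi>'_def)
qed

lemma \<psi>_zero: "\<psi> (\<lambda>t. 0) = 0" by (simp add: \<psi>_def F_zero)

lemma \<psi>_growth:
  assumes u: "continuous_on {0..T} u" and S: "\<And>t. t \<in> {0..T} \<Longrightarrow> \<bar>u t\<bar> \<le> S"
  shows "\<psi> u \<le> (\<integral>t. d t \<partial>M) * S powr r"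
proof -
  have "\<psi> u \<le> (\<integral>t. d t * S powr r \<partial>M)"
    unfolding \<psi>_def
  proof (rule integral_mono)
    fix t assume "t \<in> space M"
    then have t: "t \<in> {0..T}" by (simp add: space_M)
    have "F t (u t) \<le> d t * \<bar>u t\<bar> powr r" using F_growth[OF t, of "u t"] by linarith
    also have "\<dots> \<le> d t * S powr r" using S[OF t] r d_nonneg[OF t] by (intro mult_left_mono powr_mono2) auto
    finally show "F t (u t) \<le> d t * S powr r" .
  qed (use integrable_F[OF u] d_int in auto)
  then show ?thesis by simp
qed

lemma d_integral_nonneg: "(\<integral>t. d t \<partial>M) \<ge> 0"
  by (intro integral_nonneg_AE AE_I2) (auto simp: space_M d_nonneg)

text \<open>Differentiability of \<open>\<psi>\<close> in the sup norm, uniform over all functions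
  bounded by \<open>R\<close>. This uniformity allows a single step length for a whole sphere in
  \<open>critical_level\<close>.\<close>

lemma \<psi>_expansion:
  assumes "e > 0"
  obtains \<delta> where "\<delta> > 0" "\<And>u v \<zeta>. continuous_on {0..T} u \<Longrightarrow> continuous_on {0..T} v \<Longrightarrow>
    (\<And>t. t \<in> {0..T} \<Longrightarrow> \<bar>u t\<bar> \<le> R) \<Longrightarrow> (\<And>t. t \<in> {0..T} \<Longrightarrow> \<bar>v t\<bar> \<le> R) \<Longrightarrow>
    (\<And>t. t \<in> {0..T} \<Longrightarrow> \<bar>v t - u t\<bar> \<le> \<zeta>) \<Longrightarrow> \<zeta> < \<delta> \<Longrightarrow> \<bar>\<psi> v - \<psi> u - \<psi>' u (\<lambda>t. v t - u t)\<bar> \<le> e * \<zeta>"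
proof -
  obtain \<delta> where \<delta>: "\<delta> > 0" "\<And>t s x y. t \<in> {0..T} \<Longrightarrow> s \<in> {0..T} \<Longrightarrow> \<bar>x\<bar> \<le> R \<Longrightarrow> \<bar>y\<bar> \<le> R \<Longrightarrow>
     \<bar>t - s\<bar> < \<delta> \<Longrightarrow> \<bar>x - y\<bar> < \<delta> \<Longrightarrow> \<bar>f t x - f s y\<bar> \<le> e / T"
    using f_unif_cont[of "e / T" R] assms T by (metis divide_pos_pos)
  have "\<bar>\<psi> v - \<psi> u - \<psi>' u (\<lambda>t. v t - u t)\<bar> \<le> e * \<zeta>"
    if u: "continuous_on {0..T} u" "continuous_on {0..T} v" and R: "\<And>t. t \<in> {0..T} \<Longrightarrow> \<bar>u t\<bar> \<le> R" "\<And>t. t \<in> {0..T} \<Longrightarrow> \<bar>v t\<bar> \<le> R"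
      and \<zeta>: "\<And>t. t \<in> {0..T} \<Longrightarrow> \<bar>v t - u t\<bar> \<le> \<zeta>" "\<zeta> < \<delta>" for u v \<zeta>
  proof -
    have \<zeta>0: "\<zeta> \<ge> 0" using \<zeta>(1)[of 0] T by auto
    have pw: "\<bar>F t (v t) - F t (u t) - f t (u t) * (v t - u t)\<bar> \<le> e / T * \<zeta>" if t: "t \<in> {0..T}" for t
    proof -
      obtain \<xi> where \<xi>: "\<bar>\<xi> - u t\<bar> \<le> \<bar>v t - u t\<bar>" "F t (v t) - F t (u t) = (v t - u t) * f t \<xi>"
        "min (u t) (v t) \<le> \<xi>" "\<xi> \<le> max (u t) (v t)" using F_MVT[OF t, of "u t" "v t"] by metis
      have "\<bar>\<xi>\<bar> \<le> R" using \<xi>(3,4) R[OF t] by (auto simp: min_def max_def abs_le_iff split: if_splits)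
      then have "\<bar>f t \<xi> - f t (u t)\<bar> \<le> e / T" using \<delta>(1) \<xi>(1) \<zeta>(1)[OF t] \<zeta>(2) R(1)[OF t] by (intro \<delta>(2) t) auto
      moreover have "F t (v t) - F t (u t) - f t (u t) * (v t - u t) = (f t \<xi> - f t (u t)) * (v t - u t)"
        using \<xi>(2) by (simp add: algebra_simps)
      moreover have "\<bar>f t \<xi> - f t (u t)\<bar> * \<bar>v t - u t\<bar> \<le> e / T * \<zeta>"
        using calculation(1) \<zeta>(1)[OF t] assms T by (intro mult_mono) auto
      ultimately show ?thesis by (simp only: abs_mult)
    qed
    have int: "integrable M (\<lambda>t. F t (v t) - F t (u t) - f t (u t) * (v t - u t))"
      by (intro Bochner_Integration.integrable_diff integrable_F integrable_f continuous_on_diff u)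
    have "\<psi> v - \<psi> u - \<psi>' u (\<lambda>t. v t - u t) = (\<integral>t. F t (v t) - F t (u t) - f t (u t) * (v t - u t) \<partial>M)"
      unfolding \<psi>_def \<psi>'_def
      using integrable_F[OF u(1)] integrable_F[OF u(2)] integrable_f[OF u(1) continuous_on_diff[OF u(2,1)]] by simp
    then have "\<bar>\<psi> v - \<psi> u - \<psi>' u (\<lambda>t. v t - u t)\<bar> \<le> (\<integral>t. \<bar>F t (v t) - F t (u t) - f t (u t) * (v t - u t)\<bar> \<partial>M)"
      using integral_abs_bound[of M "\<lambda>t. F t (v t) - F t (u t) - f t (u t) * (v t - u t)"] by simp
    also have "\<dots> \<le> (\<integral>t. e / T * \<zeta> \<partial>M)" using int pw by (intro integral_mono) (auto simp: space_M)
    also have "\<dots> = e * \<zeta>" using measure_M T by simp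
    finally show ?thesis .
  qed
  then show thesis using that[OF \<delta>(1)] by blast
qed

end

section \<open>Abstract minimax argument\<close>

text \<open>\<open>X_compact\<close> stands for weak compactness of the sublevel sets together with
  weak lower semicontinuity of \<open>\<Phi>\<close>, and \<open>X_small\<close> for compactness of
  the embedding into the continuous functions. \<open>\<Phi>\<close> grows like a power
  \<open>q\<close> of a norm.\<close>

locale minimax = nonlinearity +
  fixes X :: "(real \<Rightarrow> real) set" and \<Phi> :: "(real \<Rightarrow> real) \<Rightarrow> real" and \<kappa> q :: real
  assumes X_zero: "(\<lambda>t. 0) \<in> X"
    and X_lincomb: "\<And>u v a b. u \<in> X \<Longrightarrow> v \<in> X \<Longrightarrow> (\<lambda>t. a * u t + b * v t) \<in> X"
    and X_cont: "\<And>u. u \<in> X \<Longrightarrow> continuous_on {0..T} u"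
    and \<Phi>_nonneg: "\<And>u. u \<in> X \<Longrightarrow> \<Phi> u \<ge> 0" and \<Phi>_zero: "\<Phi> (\<lambda>t. 0) = 0"
    and \<Phi>_even: "\<And>u. u \<in> X \<Longrightarrow> \<Phi> (\<lambda>t. - u t) = \<Phi> u"
    and \<Phi>_convex: "\<And>u v s. u \<in> X \<Longrightarrow> v \<in> X \<Longrightarrow> 0 \<le> s \<Longrightarrow> s \<le> 1 \<Longrightarrow>
        \<Phi> (\<lambda>t. (1 - s) * u t + s * v t) \<le> (1 - s) * \<Phi> u + s * \<Phi> v"
    and \<Phi>_strict: "\<And>u v. u \<in> X \<Longrightarrow> v \<in> X \<Longrightarrow> u \<noteq> v \<Longrightarrow> \<Phi> (\<lambda>t. (u t + v t) / 2) < (\<Phi> u + \<Phi> v) / 2"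
    and \<kappa>: "\<kappa> > 0" and q: "r < q"
    and X_bound: "\<And>u t. u \<in> X \<Longrightarrow> \<bar>u t\<bar> \<le> \<kappa> * \<Phi> u powr (1 / q)"
    and X_compact: "\<And>U B. (\<And>n. U n \<in> X) \<Longrightarrow> (\<And>n. \<Phi> (U n) \<le> B) \<Longrightarrow>
        \<exists>k u L. strict_mono (k :: nat \<Rightarrow> nat) \<and> u \<in> X \<and> (\<forall>t. (\<lambda>n. U (k n) t) \<longlonglongrightarrow> u t) \<and>
           (\<lambda>n. \<Phi> (U (k n))) \<longlonglongrightarrow> L \<and> \<Phi> u \<le> L"
    and X_small: "\<And>B e. e > 0 \<Longrightarrow> \<exists>n. \<forall>u\<in>X. \<Phi> u \<le> B \<longrightarrow>
        (\<forall>i<n. u (T * real (Suc i) / real n) = 0) \<longrightarrow> (\<forall>t\<in>{0..T}. \<bar>u t\<bar> \<le> e)"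
begin

definition energy_fun :: "(real \<Rightarrow> real) \<Rightarrow> real" where
  "energy_fun u = \<Phi> u - \<psi> u"

text \<open>For convex differentiable \<open>\<Phi>\<close>, minimality of \<open>u\<close> for its
  own \<open>linearized u\<close> expresses that \<open>\<Phi>\<close> and \<open>\<psi>\<close>
  have the same derivative at \<open>u\<close>.\<close>

definition linearized :: "(real \<Rightarrow> real) \<Rightarrow> (real \<Rightarrow> real) \<Rightarrow> real" where
  "linearized u v = \<Phi> v - \<psi>' u v"

lemma q1: "1 < q" using r q by simp

lemma X_uminus: "u \<in> X \<Longrightarrow> (\<lambda>t. - u t) \<in> X"
  using X_lincomb[of u u "-1" 0] by simp

lemma X_midpoint: "u \<in> X \<Longrightarrow> v \<in> X \<Longrightarrow> (\<lambda>t. (u t + v t) / 2) \<in> X"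
  using X_lincomb[of u v "1/2" "1/2"] by (simp add: add_divide_distrib)

lemma X_bound_le:
  assumes "u \<in> X" "\<Phi> u \<le> B"
  shows "\<bar>u t\<bar> \<le> \<kappa> * B powr (1 / q)"
proof -
  have "\<Phi> u powr (1 / q) \<le> B powr (1 / q)" using assms \<Phi>_nonneg q1 by (intro powr_mono2) auto
  then show ?thesis using X_bound[OF assms(1), of t] \<kappa> by (meson less_imp_le mult_left_mono order_trans)
qed

lemma powr_self_bound:
  fixes y c \<theta> :: real
  assumes "0 \<le> y" "0 \<le> \<theta>" "\<theta> < 1" "y \<le> c * y powr \<theta>"
  shows "y \<le> c powr (1 / (1 - \<theta>))"
proof (cases "y = 0")
  case False
  then have y: "y > 0" using assms by simp
  have "y powr (1 - \<theta>) = y / y powr \<theta>" using y by (simp add: powr_diff)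
  also have "\<dots> \<le> c" using assms(4) y by (simp add: divide_le_eq)
  finally have "(y powr (1 - \<theta>)) powr (1 / (1 - \<theta>)) \<le> c powr (1 / (1 - \<theta>))"
    using assms by (intro powr_mono2) auto
  then show ?thesis using y assms by (simp add: powr_powr)
qed simp

text \<open>At nonpositive energy \<open>\<Phi> u \<le> \<psi> u\<close>, and
  \<open>\<psi> u\<close> is of order \<open>\<Phi> u powr (r / q)\<close>; since
  \<open>r < q\<close>, this is sublinear in \<open>\<Phi> u\<close>.\<close>

lemma coercive: "\<exists>B. \<forall>u\<in>X. energy_fun u \<le> 0 \<longrightarrow> \<Phi> u \<le> B"
proof -
  define c where "c = (\<integral>t. d t \<partial>M) * \<kappa> powr r"
  have "\<Phi> u \<le> c powr (1 / (1 - r / q))" if u: "u \<in> X" "energy_fun u \<le> 0" for u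
  proof (rule powr_self_bound)
    have "\<Phi> u \<le> \<psi> u" using u(2) by (simp add: energy_fun_def)
    also have "\<dots> \<le> (\<integral>t. d t \<partial>M) * (\<kappa> * \<Phi> u powr (1 / q)) powr r"
      using X_bound[OF u(1)] by (intro \<psi>_growth X_cont u) auto
    also have "(\<kappa> * \<Phi> u powr (1 / q)) powr r = \<kappa> powr r * \<Phi> u powr (r / q)"
      using \<kappa> by (simp add: powr_mult powr_powr)
    finally show "\<Phi> u \<le> c * \<Phi> u powr (r / q)" by (simp add: c_def)
  qed (use \<Phi>_nonneg[OF u(1)] r q in auto)
  then show ?thesis by blast
qed

lemma linearized_coercive:
  assumes B: "\<And>t. t \<in> {0..T} \<Longrightarrow> \<bar>f t (u t)\<bar> \<le> B" and u: "continuous_on {0..T} u" and v: "v \<in> X" "linearized u v \<le> 0"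
  shows "\<Phi> v \<le> (T * B * \<kappa>) powr (1 / (1 - 1 / q))"
proof (rule powr_self_bound)
  have B0: "B \<ge> 0" using B[of 0] T by auto
  have "\<Phi> v \<le> \<psi>' u v" using v(2) by (simp add: linearized_def)
  also have "\<dots> \<le> T * (B * (\<kappa> * \<Phi> v powr (1 / q)))"
    using \<psi>'_bound[OF u X_cont[OF v(1)] B X_bound[OF v(1)] B0] by linarith
  finally show "\<Phi> v \<le> T * B * \<kappa> * \<Phi> v powr (1 / q)" by (simp add: mult.assoc)
qed (use \<Phi>_nonneg[OF v(1)] q1 in auto)

lemma linearized_zero: "linearized u (\<lambda>t. 0) = 0"
  by (simp add: linearized_def \<Phi>_zero \<psi>'_def)

definition minimizer :: "(real \<Rightarrow> real) \<Rightarrow> (real \<Rightarrow> real) \<Rightarrow> bool" where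
  "minimizer u k \<longleftrightarrow> k \<in> X \<and> (\<forall>v\<in>X. linearized u k \<le> linearized u v)"

lemma f_comp_bounded:
  assumes "continuous_on {0..T} u"
  obtains B where "\<And>t. t \<in> {0..T} \<Longrightarrow> \<bar>f t (u t)\<bar> \<le> B"
  using compact_imp_bounded[OF compact_continuous_image[OF f_cont_comp[OF assms] compact_Icc]]
  unfolding bounded_iff by fastforce

lemma compact_limit:
  assumes "\<And>n. U n \<in> X" "\<And>n. \<Phi> (U n) \<le> B"
  obtains k u L where "strict_mono (k :: nat \<Rightarrow> nat)" "u \<in> X" "\<And>t. (\<lambda>n. U (k n) t) \<longlonglongrightarrow> u t"
    "(\<lambda>n. \<Phi> (U (k n))) \<longlonglongrightarrow> L" "\<Phi> u \<le> L"
  using X_compact[of U B] assms by blast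

lemma minimizer_exists:
  assumes u: "continuous_on {0..T} u"
  shows "\<exists>k. minimizer u k"
proof -
  obtain B where B: "\<And>t. t \<in> {0..T} \<Longrightarrow> \<bar>f t (u t)\<bar> \<le> B" using f_comp_bounded[OF u] by blast
  obtain R where R: "\<And>t. t \<in> {0..T} \<Longrightarrow> \<bar>u t\<bar> \<le> R"
    using compact_imp_bounded[OF compact_continuous_image[OF u compact_Icc]] unfolding bounded_iff by fastforce
  have B0: "B \<ge> 0" using B[of 0] T by auto
  define C where "C = (T * B * \<kappa>) powr (1 / (1 - 1 / q))"
  \<comment> \<open>On this set \<open>\<Phi>\<close> is bounded, so minimizing sequences have
    limits. It contains the zero function, hence a minimum over it is a minimum over
    \<open>X\<close>.\<close>
  define V where "V = {v \<in> X. linearized u v \<le> 0}"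
  have V: "\<Phi> v \<le> C" if "v \<in> V" for v
    using linearized_coercive[OF B u, of v] that by (simp add: V_def C_def)
  have zV: "(\<lambda>t. 0) \<in> V" by (simp add: V_def X_zero linearized_zero)
  have lb: "- (T * (B * (\<kappa> * C powr (1 / q)))) \<le> linearized u v" if "v \<in> V" for v
  proof -
    have vX: "v \<in> X" using that by (simp add: V_def)
    have "\<psi>' u v \<le> T * (B * (\<kappa> * C powr (1 / q)))"
      using \<psi>'_bound[OF u X_cont[OF vX] B X_bound_le[OF vX V[OF that]] B0] by linarith
    then show ?thesis using \<Phi>_nonneg[OF vX] by (simp add: linearized_def)
  qed
  define m where "m = Inf (linearized u ` V)"
  have bdd: "bdd_below (linearized u ` V)" using lb by (intro bdd_belowI2) auto
  have "\<exists>v. v \<in> V \<and> linearized u v < m + 1 / real (Suc n)" for n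
    using cInf_lessD[of "linearized u ` V" "m + 1 / real (Suc n)"] zV by (auto simp: m_def)
  then obtain v where v: "\<And>n. v n \<in> V" "\<And>n. linearized u (v n) < m + 1 / real (Suc n)" by metis
  have vX: "v n \<in> X" for n using v(1)[of n] by (simp add: V_def)
  obtain k w L where k: "strict_mono (k :: nat \<Rightarrow> nat)" "w \<in> X" "\<And>t. (\<lambda>n. v (k n) t) \<longlonglongrightarrow> w t"
     "(\<lambda>n. \<Phi> (v (k n))) \<longlonglongrightarrow> L" "\<Phi> w \<le> L"
    using compact_limit[of v C] vX V[OF v(1)] by blast
  have vb: "\<bar>v n t\<bar> \<le> \<kappa> * C powr (1 / q)" for n t by (intro X_bound_le vX V v(1))
  have "(\<lambda>n. \<psi>' u (v (k n))) \<longlonglongrightarrow> \<psi>' u w"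
    by (intro \<psi>'_tendsto[where R = R and R' = "\<kappa> * C powr (1 / q)"] u X_cont vX k(2,3) tendsto_const R vb)
  then have lim: "(\<lambda>n. linearized u (v (k n))) \<longlonglongrightarrow> L - \<psi>' u w"
    unfolding linearized_def using k(4) by (intro tendsto_diff)
  have l: "(\<lambda>k. 1 / real (Suc k)) \<longlonglongrightarrow> 0" using LIMSEQ_inverse_real_of_nat by (simp add: inverse_eq_divide)
  have lim2: "(\<lambda>n. m + 1 / real (Suc (k n))) \<longlonglongrightarrow> m + 0"
    using LIMSEQ_subseq_LIMSEQ[OF l k(1)] by (intro tendsto_add tendsto_const) (simp add: comp_def)
  have "L - \<psi>' u w \<le> m + 0"
    by (rule LIMSEQ_le[OF lim lim2]) (use v(2) in \<open>auto intro: less_imp_le\<close>)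
  then have wm: "linearized u w \<le> m" using k(5) by (simp add: linearized_def)
  have "linearized u w \<le> linearized u z" if "z \<in> X" for z
  proof (cases "z \<in> V")
    case True
    then have "m \<le> linearized u z" unfolding m_def using bdd by (intro cInf_lower) auto
    then show ?thesis using wm by simp
  next
    case False
    then have "0 < linearized u z" using that by (simp add: V_def)
    moreover have "m \<le> linearized u (\<lambda>t. 0)" unfolding m_def using bdd zV by (intro cInf_lower) auto
    ultimately show ?thesis using wm by (simp add: linearized_zero)
  qed
  then show ?thesis using k(2) by (auto simp: minimizer_def)
qed

lemma minimizer_unique:
  assumes u: "continuous_on {0..T} u" and "minimizer u k" "minimizer u k'"
  shows "k = k'"
proof (rule ccontr)
  assume ne: "k \<noteq> k'"
  have kX: "k \<in> X" "k' \<in> X" and le: "linearized u k \<le> linearized u k'" "linearized u k' \<le> linearized u k"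
    "linearized u k \<le> linearized u (\<lambda>t. (k t + k' t) / 2)"
    using assms(2,3) X_midpoint by (auto simp: minimizer_def)
  have "\<psi>' u (\<lambda>t. (k t + k' t) / 2) = (\<psi>' u k + \<psi>' u k') / 2"
    using \<psi>'_linear[OF u X_cont[OF kX(1)] X_cont[OF kX(2)], of "1/2" "1/2"] by (simp add: add_divide_distrib)
  then show False using \<Phi>_strict[OF kX ne] le by (simp add: linearized_def)
qed

definition K :: "(real \<Rightarrow> real) \<Rightarrow> real \<Rightarrow> real" where
  "K u = (SOME k. minimizer u k)"

lemma K_minimizer: "u \<in> X \<Longrightarrow> minimizer u (K u)"
  unfolding K_def using someI_ex[OF minimizer_exists[OF X_cont]] .

lemma K_eq: "u \<in> X \<Longrightarrow> minimizer u k \<Longrightarrow> K u = k"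
  using minimizer_unique[OF X_cont K_minimizer] by blast

lemma K_X: "u \<in> X \<Longrightarrow> K u \<in> X"
  using K_minimizer by (auto simp: minimizer_def)

lemma K_bound:
  assumes "u \<in> X" "\<And>t. t \<in> {0..T} \<Longrightarrow> \<bar>f t (u t)\<bar> \<le> B"
  shows "\<Phi> (K u) \<le> (T * B * \<kappa>) powr (1 / (1 - 1 / q))"
proof -
  have "linearized u (K u) \<le> linearized u (\<lambda>t. 0)" using K_minimizer[OF assms(1)] X_zero by (simp add: minimizer_def)
  then show ?thesis using linearized_coercive[OF assms(2) X_cont K_X] assms(1) by (simp add: linearized_zero)
qed

lemma K_odd:
  assumes "u \<in> X"
  shows "K (\<lambda>t. - u t) = (\<lambda>t. - K u t)"
proof (rule K_eq[OF X_uminus[OF assms]])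
  have *: "linearized (\<lambda>t. - u t) (\<lambda>t. - v t) = linearized u v" if "v \<in> X" for v
    using that by (simp add: linearized_def \<Phi>_even \<psi>'_uminus)
  show "minimizer (\<lambda>t. - u t) (\<lambda>t. - K u t)"
    unfolding minimizer_def
  proof (intro conjI ballI X_uminus K_X assms)
    fix v assume v: "v \<in> X"
    have "linearized u (K u) \<le> linearized u (\<lambda>t. - v t)"
      using K_minimizer[OF assms] X_uminus[OF v] by (simp add: minimizer_def)
    then show "linearized (\<lambda>t. - u t) (\<lambda>t. - K u t) \<le> linearized (\<lambda>t. - u t) v"
      using *[OF K_X[OF assms]] *[OF X_uminus[OF v]] by simp
  qed
qed

lemma LIMSEQ_if_subsequences:
  fixes x :: "nat \<Rightarrow> real"
  assumes "\<And>k. strict_mono (k :: nat \<Rightarrow> nat) \<Longrightarrow> \<exists>j. strict_mono (j :: nat \<Rightarrow> nat) \<and> (\<lambda>n. x (k (j n))) \<longlonglongrightarrow> l"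
  shows "x \<longlonglongrightarrow> l"
proof (rule ccontr)
  assume "\<not> x \<longlonglongrightarrow> l"
  then obtain e where e: "e > 0" "\<And>N. \<exists>n\<ge>N. \<not> dist (x n) l < e" by (auto simp: lim_sequentially)
  then have "infinite {n. \<not> dist (x n) l < e}" by (auto simp: infinite_nat_iff_unbounded_le)
  then obtain k :: "nat \<Rightarrow> nat" where k: "strict_mono k" "\<forall>n. k n \<in> {n. \<not> dist (x n) l < e}" using infinite_enumerate by blast
  obtain j where "strict_mono (j :: nat \<Rightarrow> nat)" "(\<lambda>n. x (k (j n))) \<longlonglongrightarrow> l" using assms[OF k(1)] by blast
  then obtain N where "\<forall>n\<ge>N. dist (x (k (j n))) l < e" using e(1) unfolding lim_sequentially by blast
  then show False using k(2) by auto
qed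

text \<open>Along subsequences the minimizers have limits by compactness, lower semicontinuity makes
  each limit a minimizer for \<open>U\<close>, and uniqueness identifies all of them.\<close>

lemma K_continuous:
  assumes u: "\<And>n. u n \<in> X" "U \<in> X" and lim: "\<And>t. t \<in> {0..T} \<Longrightarrow> (\<lambda>n. u n t) \<longlonglongrightarrow> U t"
    and R: "\<And>n t. t \<in> {0..T} \<Longrightarrow> \<bar>u n t\<bar> \<le> R"
  shows "(\<lambda>n. K (u n) t) \<longlonglongrightarrow> K U t"
proof (rule LIMSEQ_if_subsequences)
  fix k :: "nat \<Rightarrow> nat" assume k: "strict_mono k"
  obtain B where B: "\<And>t x. t \<in> {0..T} \<Longrightarrow> \<bar>x\<bar> \<le> R \<Longrightarrow> \<bar>f t x\<bar> \<le> B" using f_bounded[of R] by metis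
  define C where "C = (T * B * \<kappa>) powr (1 / (1 - 1 / q))"
  have KC: "\<Phi> (K (u n)) \<le> C" for n unfolding C_def by (intro K_bound u B R)
  have KX: "K (u n) \<in> X" for n by (intro K_X u)
  obtain j w L where j: "strict_mono (j :: nat \<Rightarrow> nat)" "w \<in> X" "\<And>t. (\<lambda>n. K (u (k (j n))) t) \<longlonglongrightarrow> w t"
     "(\<lambda>n. \<Phi> (K (u (k (j n))))) \<longlonglongrightarrow> L" "\<Phi> w \<le> L"
    using compact_limit[of "\<lambda>n. K (u (k n))" C] KX KC by blast
  have sub: "(\<lambda>n. u (k (j n)) t) \<longlonglongrightarrow> U t" if "t \<in> {0..T}" for t
    using LIMSEQ_subseq_LIMSEQ[OF lim[OF that] strict_mono_o[OF k j(1)]] by (simp add: comp_def)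
  have l1: "(\<lambda>n. linearized (u (k (j n))) (K (u (k (j n))))) \<longlonglongrightarrow> L - \<psi>' U w"
    unfolding linearized_def
    by (intro tendsto_diff j(4) \<psi>'_tendsto[where R = R and R' = "\<kappa> * C powr (1 / q)"] X_cont u KX j R X_bound_le KC sub)
  have "minimizer U w"
    unfolding minimizer_def
  proof (intro conjI ballI j(2))
    fix v assume v: "v \<in> X"
    have l2: "(\<lambda>n. linearized (u (k (j n))) v) \<longlonglongrightarrow> linearized U v"
      unfolding linearized_def
      by (intro tendsto_diff tendsto_const \<psi>'_tendsto[where R = R and R' = "\<kappa> * \<Phi> v powr (1 / q)"] X_cont u v R X_bound sub)
    have "linearized (u n) (K (u n)) \<le> linearized (u n) v" for n
      using K_minimizer[OF u(1)] v by (simp add: minimizer_def)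
    then have "L - \<psi>' U w \<le> linearized U v" by (intro LIMSEQ_le[OF l1 l2]) blast
    then show "linearized U w \<le> linearized U v" using j(5) by (simp add: linearized_def)
  qed
  then have "K U = w" by (rule K_eq[OF u(2)])
  then show "\<exists>j. strict_mono (j :: nat \<Rightarrow> nat) \<and> (\<lambda>n. K (u (k (j n))) t) \<longlonglongrightarrow> K U t" using j(1,3) by blast
qed

text \<open>Continuity refers to pointwise convergence of the values, with a common bound on
  \<open>\<Phi>\<close>. The class is stable under steps towards \<open>K\<close>, and evaluation at
  finitely many points, which is what Borsuk--Ulam is applied to, is continuous for it.\<close>

definition odd_maps :: "nat \<Rightarrow> ((nat \<Rightarrow> real) \<Rightarrow> real \<Rightarrow> real) set" where
  "odd_maps n = {h. (\<forall>x\<in>cube_sphere n. h x \<in> X) \<and> (\<forall>x\<in>cube_sphere n. h (\<lambda>i. - x i) = (\<lambda>t. - h x t)) \<and>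
     (\<exists>B. \<forall>x\<in>cube_sphere n. \<Phi> (h x) \<le> B) \<and>
     (\<forall>xs x. (\<forall>k. xs k \<in> cube_sphere n) \<longrightarrow> x \<in> cube_sphere n \<longrightarrow> (\<forall>j. (\<lambda>k. xs k j) \<longlonglongrightarrow> x j) \<longrightarrow>
        (\<forall>t. (\<lambda>k. h (xs k) t) \<longlonglongrightarrow> h x t))}"

lemma odd_maps_crossing:
  assumes h: "h \<in> odd_maps n"
  shows "\<exists>x\<in>cube_sphere n. \<forall>i<n. h x (T * real (Suc i) / real n) = 0"
proof (rule borsuk_ulam)
  show "h (\<lambda>j. - x j) (T * real (Suc i) / real n) = - h x (T * real (Suc i) / real n)" if "x \<in> cube_sphere n" for x i
    using h that by (simp add: odd_maps_def)
  show "(\<lambda>k. h (xs k) (T * real (Suc i) / real n)) \<longlonglongrightarrow> h x (T * real (Suc i) / real n)"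
    if "\<And>k. xs k \<in> cube_sphere n" "x \<in> cube_sphere n" "\<And>j. (\<lambda>k. xs k j) \<longlonglongrightarrow> x j" for xs x i
    using h that unfolding odd_maps_def by blast
qed

lemma odd_maps_deform:
  assumes h: "h \<in> odd_maps n" and s: "0 \<le> s" "s \<le> 1"
  shows "(\<lambda>x t. (1 - s) * h x t + s * K (h x) t) \<in> odd_maps n"
proof -
  obtain C where hX: "\<And>x. x \<in> cube_sphere n \<Longrightarrow> h x \<in> X" and hodd: "\<And>x. x \<in> cube_sphere n \<Longrightarrow> h (\<lambda>i. - x i) = (\<lambda>t. - h x t)"
    and C: "\<And>x. x \<in> cube_sphere n \<Longrightarrow> \<Phi> (h x) \<le> C"
    and hc: "\<And>xs x t. (\<And>k. xs k \<in> cube_sphere n) \<Longrightarrow> x \<in> cube_sphere n \<Longrightarrow> (\<And>j. (\<lambda>k. xs k j) \<longlonglongrightarrow> x j) \<Longrightarrow> (\<lambda>k. h (xs k) t) \<longlonglongrightarrow> h x t"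
    using h unfolding odd_maps_def by blast
  define R where "R = \<kappa> * C powr (1 / q)"
  have R: "\<bar>h x t\<bar> \<le> R" if "x \<in> cube_sphere n" for x t
    unfolding R_def by (intro X_bound_le hX C that)
  obtain B where B: "\<And>t x. t \<in> {0..T} \<Longrightarrow> \<bar>x\<bar> \<le> R \<Longrightarrow> \<bar>f t x\<bar> \<le> B" using f_bounded[of R] by metis
  define D where "D = (T * B * \<kappa>) powr (1 / (1 - 1 / q))"
  have KD: "\<Phi> (K (h x)) \<le> D" if "x \<in> cube_sphere n" for x
    unfolding D_def by (intro K_bound hX B R that)
  show ?thesis
    unfolding odd_maps_def mem_Collect_eq
  proof (intro conjI ballI allI impI exI)
    fix x assume x: "x \<in> cube_sphere n"
    show "(\<lambda>t. (1 - s) * h x t + s * K (h x) t) \<in> X" by (intro X_lincomb hX K_X x)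
    show "(\<lambda>t. (1 - s) * h (\<lambda>i. - x i) t + s * K (h (\<lambda>i. - x i)) t) = (\<lambda>t. - ((1 - s) * h x t + s * K (h x) t))"
      unfolding hodd[OF x] K_odd[OF hX[OF x]] by (simp add: algebra_simps)
    have "\<Phi> (\<lambda>t. (1 - s) * h x t + s * K (h x) t) \<le> (1 - s) * \<Phi> (h x) + s * \<Phi> (K (h x))"
      by (intro \<Phi>_convex hX K_X x s)
    also have "\<dots> \<le> (1 - s) * C + s * D" using s C[OF x] KD[OF x] by (intro add_mono mult_left_mono) auto
    finally show "\<Phi> (\<lambda>t. (1 - s) * h x t + s * K (h x) t) \<le> (1 - s) * C + s * D" .
  next
    fix xs x t assume xs: "\<forall>k. xs k \<in> cube_sphere n" "x \<in> cube_sphere n" "\<forall>j. (\<lambda>k. xs k j) \<longlonglongrightarrow> x j"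
    have hl: "(\<lambda>k. h (xs k) t) \<longlonglongrightarrow> h x t" for t by (rule hc) (use xs in auto)
    have "(\<lambda>k. K (h (xs k)) t) \<longlonglongrightarrow> K (h x) t"
      by (rule K_continuous[where R = R]) (use xs hX hl R in auto)
    then show "(\<lambda>k. (1 - s) * h (xs k) t + s * K (h (xs k)) t) \<longlonglongrightarrow> (1 - s) * h x t + s * K (h x) t"
      by (intro tendsto_intros hl)
  qed
qed

text \<open>Plays the role of the Palais--Smale condition in the usual deformation argument.\<close>

lemma gap_lower_bound:
  assumes c: "c < 0" and nocrit: "\<And>u. u \<in> X \<Longrightarrow> energy_fun u = c \<Longrightarrow> \<not> minimizer u u"
  obtains g e where "g > 0" "e > 0" "\<And>u. u \<in> X \<Longrightarrow> \<bar>energy_fun u - c\<bar> \<le> e \<Longrightarrow> g \<le> linearized u u - linearized u (K u)"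
proof (rule ccontr)
  assume "\<not> thesis"
  note neg = this
  obtain B where B: "\<And>u. u \<in> X \<Longrightarrow> energy_fun u \<le> 0 \<Longrightarrow> \<Phi> u \<le> B" using coercive by blast
  have "\<exists>u. u \<in> X \<and> \<bar>energy_fun u - c\<bar> \<le> min (1 / real (Suc n)) (- c) \<and> linearized u u - linearized u (K u) < 1 / real (Suc n)" for n
  proof (rule ccontr)
    assume "\<not> ?thesis"
    then have "1 / real (Suc n) \<le> linearized u u - linearized u (K u)"
      if "u \<in> X" "\<bar>energy_fun u - c\<bar> \<le> min (1 / real (Suc n)) (- c)" for u using that by (meson not_less)
    moreover have "1 / real (Suc n) > 0" "min (1 / real (Suc n)) (- c) > 0" using c by auto
    ultimately show False using that neg by blast
  qed
  then obtain u where u: "\<And>n. u n \<in> X" "\<And>n. \<bar>energy_fun (u n) - c\<bar> \<le> min (1 / real (Suc n)) (- c)"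
     "\<And>n. linearized (u n) (u n) - linearized (u n) (K (u n)) < 1 / real (Suc n)" by metis
  have uB: "\<Phi> (u n) \<le> B" for n using u(2)[of n] by (intro B u) auto
  obtain k U L where k: "strict_mono (k :: nat \<Rightarrow> nat)" "U \<in> X" "\<And>t. (\<lambda>n. u (k n) t) \<longlonglongrightarrow> U t"
     "(\<lambda>n. \<Phi> (u (k n))) \<longlonglongrightarrow> L" "\<Phi> U \<le> L"
    using compact_limit[of u B] u(1) uB by blast
  have l: "(\<lambda>k. 1 / real (Suc k)) \<longlonglongrightarrow> 0" using LIMSEQ_inverse_real_of_nat by (simp add: inverse_eq_divide)
  have lk: "(\<lambda>n. 1 / real (Suc (k n))) \<longlonglongrightarrow> 0" using LIMSEQ_subseq_LIMSEQ[OF l k(1)] by (simp add: comp_def)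
  let ?R = "\<kappa> * B powr (1 / q)"
  have ub: "\<bar>u n t\<bar> \<le> ?R" for n t by (intro X_bound_le u uB)
  have l1: "(\<lambda>n. linearized (u (k n)) (u (k n))) \<longlonglongrightarrow> L - \<psi>' U U"
    unfolding linearized_def by (intro tendsto_diff k(4) \<psi>'_tendsto[where R = ?R and R' = ?R] X_cont u k(2,3) ub)
  have key: "L - \<psi>' U U \<le> linearized U v" if v: "v \<in> X" for v
  proof -
    have l2: "(\<lambda>n. linearized (u (k n)) v) \<longlonglongrightarrow> linearized U v"
      unfolding linearized_def
      by (intro tendsto_diff tendsto_const \<psi>'_tendsto[where R = ?R and R' = "\<kappa> * \<Phi> v powr (1 / q)"] X_cont u v k(2,3) ub X_bound)
    have "linearized (u n) (u n) \<le> linearized (u n) v + 1 / real (Suc n)" for n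
      using K_minimizer[OF u(1)[of n]] v u(3)[of n] by (force simp: minimizer_def)
    then have "L - \<psi>' U U \<le> linearized U v + 0"
      by (intro LIMSEQ_le[OF l1 tendsto_add[OF l2 lk]]) blast
    then show ?thesis by simp
  qed
  \<comment> \<open>Comparison with \<open>U\<close> itself shows that no part of
    \<open>\<Phi>\<close> is lost in the limit, which upgrades pointwise convergence to convergence
    of the energy.\<close>
  have "L \<le> \<Phi> U" using key[OF k(2)] by (simp add: linearized_def)
  then have L: "L = \<Phi> U" using k(5) by simp
  have "minimizer U U" using key k(2) L by (auto simp: minimizer_def linearized_def)
  moreover have "energy_fun U = c"
  proof (rule LIMSEQ_unique)
    show "(\<lambda>n. energy_fun (u (k n))) \<longlonglongrightarrow> energy_fun U"
      unfolding energy_fun_def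
      using k(4) L by (intro tendsto_diff \<psi>_tendsto[where R = ?R] X_cont u k(2,3) ub) auto
    have "\<forall>n. norm (energy_fun (u (k n)) - c) \<le> 1 / real (Suc (k n))" using u(2) by simp
    then have "(\<lambda>n. energy_fun (u (k n)) - c) \<longlonglongrightarrow> 0" by (rule Lim_null_comparison[OF always_eventually lk])
    then show "(\<lambda>n. energy_fun (u (k n))) \<longlonglongrightarrow> c" by (simp add: LIM_zero_iff)
  qed
  ultimately show False using nocrit k(2) by blast
qed

text \<open>The critical value is the minimax level \<open>c\<close> over odd spheres of one fixed
  dimension \<open>n\<close>. The choice of \<open>n\<close> yields the lower bound
  \<open>- e\<close>, the assumption \<open>start\<close> makes \<open>c\<close> negative, and a
  single step towards \<open>K\<close> would lower a nearly optimal sphere below \<open>c\<close> if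
  \<open>c\<close> were not critical.\<close>

theorem critical_level:
  assumes e: "e > 0" and start: "\<And>n. \<exists>h\<in>odd_maps n. \<exists>\<rho>>0. \<forall>x\<in>cube_sphere n. energy_fun (h x) \<le> - \<rho>"
  shows "\<exists>u\<in>X. - e \<le> energy_fun u \<and> energy_fun u < 0 \<and> minimizer u u"
proof -
  obtain B where B: "\<And>u. u \<in> X \<Longrightarrow> energy_fun u \<le> 0 \<Longrightarrow> \<Phi> u \<le> B" using coercive by blast
  define D where "D = (\<integral>t. d t \<partial>M)"
  have D: "D \<ge> 0" using d_integral_nonneg by (simp add: D_def)
  \<comment> \<open>Chosen so that \<open>\<psi>\<close> is at most \<open>e\<close> on functions
    bounded by \<open>e'\<close>. The summand 1 avoids a division by zero.\<close>
  define e' where "e' = (e / (D + 1)) powr (1 / r)"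
  have e': "e' > 0" "D * e' powr r \<le> e"
  proof -
    show "e' > 0" using e D by (simp add: e'_def)
    have "e' powr r = e / (D + 1)" using e D r by (simp add: e'_def powr_powr)
    then have "D * e' powr r = e * (D / (D + 1))" by simp
    also have "\<dots> \<le> e * 1" using e D by (intro mult_left_mono) (auto simp: divide_le_eq)
    finally show "D * e' powr r \<le> e" by simp
  qed
  obtain n where n: "\<And>u. u \<in> X \<Longrightarrow> \<Phi> u \<le> B \<Longrightarrow> (\<forall>i<n. u (T * real (Suc i) / real n) = 0) \<Longrightarrow> (\<forall>t\<in>{0..T}. \<bar>u t\<bar> \<le> e')"
    using X_small[OF e'(1), of B] by blast
  \<comment> \<open>Every odd sphere contains a function with \<open>n\<close> equidistant zeros,
    and at such a function the energy cannot be far below 0.\<close>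
  have low: "\<exists>x\<in>cube_sphere n. - e \<le> energy_fun (h x)" if h: "h \<in> odd_maps n" for h
  proof -
    obtain x where x: "x \<in> cube_sphere n" "\<forall>i<n. h x (T * real (Suc i) / real n) = 0" using odd_maps_crossing[OF h] by blast
    have hX: "h x \<in> X" using h x(1) by (simp add: odd_maps_def)
    have "- e \<le> energy_fun (h x)"
    proof (cases "energy_fun (h x) \<le> 0")
      case True
      then have "\<bar>h x t\<bar> \<le> e'" if "t \<in> {0..T}" for t using n[OF hX B[OF hX True] x(2)] that by blast
      then have "\<psi> (h x) \<le> D * e' powr r" unfolding D_def by (intro \<psi>_growth X_cont hX)
      then show ?thesis using e'(2) \<Phi>_nonneg[OF hX] by (simp add: energy_fun_def)
    qed (use e in auto)
    then show ?thesis using x(1) by blast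
  qed
  \<comment> \<open>For pointwise convergence the energy is only lower semicontinuous, so upper
    bounds over a sphere take the place of maxima.\<close>
  define S where "S = {s. \<exists>h\<in>odd_maps n. \<forall>x\<in>cube_sphere n. energy_fun (h x) \<le> s}"
  have Slow: "- e \<le> s" if "s \<in> S" for s
  proof -
    obtain h where h: "h \<in> odd_maps n" "\<forall>x\<in>cube_sphere n. energy_fun (h x) \<le> s" using \<open>s \<in> S\<close> unfolding S_def by blast
    obtain x where "x \<in> cube_sphere n" "- e \<le> energy_fun (h x)" using low[OF h(1)] by blast
    then show ?thesis using h(2) by fastforce
  qed
  obtain \<rho> where \<rho>: "\<rho> > 0" "- \<rho> \<in> S" using start[of n] unfolding S_def by blast
  define c where "c = Inf S"
  have bdd: "bdd_below S" using Slow by (intro bdd_belowI)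
  have c: "- e \<le> c" "c \<le> - \<rho>" "c < 0"
  proof -
    show "- e \<le> c" unfolding c_def using \<rho>(2) Slow by (intro cInf_greatest) auto
    show "c \<le> - \<rho>" unfolding c_def using \<rho>(2) bdd by (intro cInf_lower)
    then show "c < 0" using \<rho>(1) by simp
  qed
  have "\<exists>u\<in>X. energy_fun u = c \<and> minimizer u u"
  proof (rule ccontr)
    assume "\<not> ?thesis"
    then obtain g e0 where g: "g > 0" "e0 > 0" "\<And>u. u \<in> X \<Longrightarrow> \<bar>energy_fun u - c\<bar> \<le> e0 \<Longrightarrow> g \<le> linearized u u - linearized u (K u)"
      using gap_lower_bound[OF c(3)] by blast
    define R1 where "R1 = \<kappa> * B powr (1 / q)"
    obtain B1 where B1: "\<And>t x. t \<in> {0..T} \<Longrightarrow> \<bar>x\<bar> \<le> R1 \<Longrightarrow> \<bar>f t x\<bar> \<le> B1" using f_bounded[of R1] by metis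
    define R2 where "R2 = \<kappa> * ((T * B1 * \<kappa>) powr (1 / (1 - 1 / q))) powr (1 / q)"
    define R where "R = max R1 R2 + 1"
    have "R1 \<ge> 0" using \<kappa> by (simp add: R1_def)
    then have R: "R > 0" by (auto simp: R_def max_def)
    have uR: "\<bar>u t\<bar> \<le> R" "\<bar>K u t\<bar> \<le> R" if "u \<in> X" "energy_fun u \<le> 0" for u t
    proof -
      have 1: "\<bar>u t\<bar> \<le> R1" for t unfolding R1_def using that by (intro X_bound_le B)
      have "\<Phi> (K u) \<le> (T * B1 * \<kappa>) powr (1 / (1 - 1 / q))" by (intro K_bound that B1 1)
      then have "\<bar>K u t\<bar> \<le> R2" unfolding R2_def by (intro X_bound_le K_X that)
      then show "\<bar>u t\<bar> \<le> R" "\<bar>K u t\<bar> \<le> R" using 1[of t] by (auto simp: R_def max_def)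
    qed
    define e1 where "e1 = min g e0 / 2"
    have e1: "e1 > 0" "e1 \<le> g / 2" "e1 \<le> e0 / 2" using g by (auto simp: e1_def)
    obtain \<delta> where \<delta>: "\<delta> > 0" "\<And>u v \<zeta>. continuous_on {0..T} u \<Longrightarrow> continuous_on {0..T} v \<Longrightarrow>
       (\<And>t. t \<in> {0..T} \<Longrightarrow> \<bar>u t\<bar> \<le> R) \<Longrightarrow> (\<And>t. t \<in> {0..T} \<Longrightarrow> \<bar>v t\<bar> \<le> R) \<Longrightarrow>
       (\<And>t. t \<in> {0..T} \<Longrightarrow> \<bar>v t - u t\<bar> \<le> \<zeta>) \<Longrightarrow> \<zeta> < \<delta> \<Longrightarrow> \<bar>\<psi> v - \<psi> u - \<psi>' u (\<lambda>t. v t - u t)\<bar> \<le> e1 / (2 * R) * \<zeta>"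
      by (rule \<psi>_expansion[of "e1 / (2 * R)" R]) (use e1 R in auto)
    define s where "s = min 1 (\<delta> / (4 * R))"
    have s: "0 < s" "s \<le> 1" "s * (2 * R) < \<delta>"
    proof -
      show "0 < s" "s \<le> 1" using \<delta>(1) R by (auto simp: s_def)
      have "s * (2 * R) \<le> \<delta> / (4 * R) * (2 * R)" using R by (intro mult_right_mono) (auto simp: s_def)
      also have "\<dots> = \<delta> / 2" using R by simp
      finally show "s * (2 * R) < \<delta>" using \<delta>(1) by simp
    qed
    \<comment> \<open>Convexity of \<open>\<Phi>\<close> and the expansion of \<open>\<psi>\<close>:
      along the segment the energy falls at the rate of the gap
      \<open>linearized u u - linearized u (K u)\<close>, up to the error \<open>e1\<close>.\<close>
    have step: "energy_fun (\<lambda>t. (1 - s) * u t + s * K u t) \<le> energy_fun u - s * (linearized u u - linearized u (K u)) + s * e1"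
      if u: "u \<in> X" "energy_fun u \<le> 0" for u
    proof -
      let ?v = "\<lambda>t. (1 - s) * u t + s * K u t"
      have KuX: "K u \<in> X" by (intro K_X u)
      have vX: "?v \<in> X" by (intro X_lincomb u KuX)
      have vu: "?v t - u t = s * (K u t - u t)" for t by (simp add: algebra_simps)
      have diff: "\<bar>?v t - u t\<bar> \<le> s * (2 * R)" for t
        unfolding vu abs_mult using uR[OF u, of t] s(1) by (intro mult_mono) auto
      have vR: "\<bar>?v t\<bar> \<le> R" for t
      proof -
        have "\<bar>?v t\<bar> \<le> (1 - s) * \<bar>u t\<bar> + s * \<bar>K u t\<bar>"
          using abs_triangle_ineq[of "(1 - s) * u t" "s * K u t"] s by (simp add: abs_mult)
        also have "\<dots> \<le> (1 - s) * R + s * R" using uR[OF u, of t] s by (intro add_mono mult_left_mono) auto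
        finally show ?thesis by (simp add: algebra_simps)
      qed
      have "\<bar>\<psi> ?v - \<psi> u - \<psi>' u (\<lambda>t. ?v t - u t)\<bar> \<le> e1 / (2 * R) * (s * (2 * R))"
        by (rule \<delta>(2)) (use X_cont u vX uR(1)[OF u] vR diff s(3) in auto)
      also have "\<dots> = s * e1" using R by simp
      finally have 1: "\<bar>\<psi> ?v - \<psi> u - \<psi>' u (\<lambda>t. ?v t - u t)\<bar> \<le> s * e1" .
      have 2: "\<psi>' u (\<lambda>t. ?v t - u t) = s * (\<psi>' u (K u) - \<psi>' u u)"
        unfolding vu using \<psi>'_linear[OF X_cont[OF u(1)] X_cont[OF KuX] X_cont[OF u(1)], of s "- s"] by (simp add: algebra_simps)
      have 3: "\<Phi> ?v \<le> (1 - s) * \<Phi> u + s * \<Phi> (K u)" using s by (intro \<Phi>_convex u KuX) auto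
      show ?thesis using 1 2 3 unfolding energy_fun_def linearized_def by (simp add: algebra_simps abs_le_iff)
    qed
    \<comment> \<open>Admissible excess of the sphere over \<open>c\<close>. Near the level
      \<open>c\<close> a step gains at least \<open>s * g / 2\<close>, half of which pays for
      \<open>\<theta>\<close>. The bounds \<open>e0\<close> and \<open>- c\<close> keep the points
      from above in the range of the gap estimate and at nonpositive energy.\<close>
    define \<theta> where "\<theta> = min (s * g / 4) (min e0 (- c))"
    have \<theta>: "\<theta> > 0" "\<theta> \<le> s * g / 4" "\<theta> \<le> e0" "\<theta> \<le> - c" using s g c by (auto simp: \<theta>_def)
    obtain s0 where s0: "s0 \<in> S" "s0 < c + \<theta>"
      using cInf_lessD[of S "c + \<theta>"] \<rho>(2) \<theta>(1) by (auto simp: c_def)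
    then obtain h where h: "h \<in> odd_maps n" "\<And>x. x \<in> cube_sphere n \<Longrightarrow> energy_fun (h x) \<le> s0" unfolding S_def by blast
    let ?h = "\<lambda>x t. (1 - s) * h x t + s * K (h x) t"
    have h': "?h \<in> odd_maps n" using s by (intro odd_maps_deform h) auto
    have "energy_fun (?h x) \<le> max (c - s * g / 4) (c - e0 / 2)" if x: "x \<in> cube_sphere n" for x
    proof -
      have hX: "h x \<in> X" using h(1) x by (simp add: odd_maps_def)
      have Ih: "energy_fun (h x) \<le> c + \<theta>" using h(2)[OF x] s0(2) by simp
      have Ih0: "energy_fun (h x) \<le> 0" using Ih \<theta>(4) by simp
      note st = step[OF hX Ih0]
      show ?thesis
      proof (cases "energy_fun (h x) \<ge> c - e0")
        case True
        then have "g \<le> linearized (h x) (h x) - linearized (h x) (K (h x))" using Ih \<theta>(3) by (intro g(3) hX) auto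
        then have "s * g \<le> s * (linearized (h x) (h x) - linearized (h x) (K (h x)))" using s by (intro mult_left_mono) auto
        moreover have "s * e1 \<le> s * (g / 2)" using s e1 by (intro mult_left_mono) auto
        ultimately have "energy_fun (?h x) \<le> c + \<theta> - s * g + s * (g / 2)" using st Ih by linarith
        also have "\<dots> \<le> c - s * g / 4" using \<theta>(2) by (simp add: field_simps)
        finally show ?thesis by simp
      next
        \<comment> \<open>Points well below \<open>c\<close> may gain nothing, but one step raises
          them by at most \<open>e0 / 2\<close>.\<close>
        case False
        have "linearized (h x) (K (h x)) \<le> linearized (h x) (h x)" using K_minimizer[OF hX] hX by (simp add: minimizer_def)
        then have "0 \<le> s * (linearized (h x) (h x) - linearized (h x) (K (h x)))" using s by simp
        moreover have "s * e1 \<le> 1 * (e0 / 2)" using s e1 g by (intro mult_mono) auto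
        ultimately have "energy_fun (?h x) \<le> c - e0 / 2" using st False by linarith
        then show ?thesis by simp
      qed
    qed
    then have "max (c - s * g / 4) (c - e0 / 2) \<in> S"
      unfolding S_def mem_Collect_eq by (intro bexI[OF _ h'] ballI)
    then have "c \<le> max (c - s * g / 4) (c - e0 / 2)" unfolding c_def using bdd by (intro cInf_lower)
    then have "c \<le> c - s * g / 4 \<or> c \<le> c - e0 / 2" by (simp only: le_max_iff_disj)
    moreover have "s * g > 0" using s g by simp
    ultimately show False using g(2) by linarith
  qed
  then obtain u where "u \<in> X" "energy_fun u = c" "minimizer u u" by blast
  then show ?thesis using c(1,3) by (intro bexI[of _ u]) simp_all
qed

end

section \<open>Bump functions\<close>

lemma tendsto_poly_exp_0: "((\<lambda>y :: real. poly P y * exp (- y)) \<longlongrightarrow> 0) at_top"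
proof -
  have "((\<lambda>y. \<Sum>i\<le>degree P. coeff P i * (y ^ i / exp y)) \<longlongrightarrow> (\<Sum>i\<le>degree P. coeff P i * 0)) at_top"
    by (intro tendsto_sum tendsto_mult tendsto_const tendsto_power_div_exp_0)
  moreover have "(\<Sum>i\<le>degree P. coeff P i * (y ^ i / exp y)) = poly P y * exp (- y)" for y
    by (simp add: poly_altdef sum_distrib_right exp_minus divide_inverse mult.assoc)
  ultimately show ?thesis by simp
qed

text \<open>The n-th derivative of \<open>exp (- 1 / x)\<close> is a polynomial in
  \<open>y = 1 / x\<close> times the function itself. The recursion is the product rule in the
  variable \<open>y\<close>, whose derivative is \<open>- y^2\<close>.\<close>

primrec flat_poly :: "nat \<Rightarrow> real poly" where
  "flat_poly 0 = 1"
| "flat_poly (Suc n) = [:0, 0, 1:] * (flat_poly n - pderiv (flat_poly n))"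

definition flat_exp :: "nat \<Rightarrow> real \<Rightarrow> real" where
  "flat_exp n x = (if x > 0 then poly (flat_poly n) (1 / x) * exp (- (1 / x)) else 0)"

lemma flat_exp_deriv: "(flat_exp n has_real_derivative flat_exp (Suc n) x) (at x)"
proof -
  consider "x > 0" | "x < 0" | "x = 0" by linarith
  then show ?thesis
  proof cases
    case 1
    have "((\<lambda>x. poly (flat_poly n) (1 / x) * exp (- (1 / x))) has_real_derivative flat_exp (Suc n) x) (at x)"
    proof -
      have i: "((\<lambda>x. 1 / x) has_real_derivative - (1 / x\<^sup>2)) (at x)"
        using 1 by (auto intro!: derivative_eq_intros simp: power2_eq_square)
      have p: "((\<lambda>x. poly (flat_poly n) (1 / x)) has_real_derivative poly (pderiv (flat_poly n)) (1 / x) * - (1 / x\<^sup>2)) (at x)"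
        by (rule DERIV_chain2[OF poly_DERIV i])
      have e: "((\<lambda>x. exp (- (1 / x))) has_real_derivative exp (- (1 / x)) * - (- (1 / x\<^sup>2))) (at x)"
        by (rule DERIV_chain2[OF DERIV_exp DERIV_minus[OF i]])
      show ?thesis
        by (rule DERIV_cong[OF DERIV_mult[OF p e]])
          (use 1 in \<open>simp add: flat_exp_def power2_eq_square algebra_simps\<close>)
    qed
    then show ?thesis
      by (rule has_field_derivative_transform_within_open[of _ _ _ "{0<..}"]) (use 1 in \<open>auto simp: flat_exp_def\<close>)
  next
    case 2
    have "((\<lambda>x. 0) has_real_derivative flat_exp (Suc n) x) (at x)" using 2 by (simp add: flat_exp_def)
    then show ?thesis
      by (rule has_field_derivative_transform_within_open[of _ _ _ "{..<0}"]) (use 2 in \<open>auto simp: flat_exp_def\<close>)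
  next
    case 3
    have "((\<lambda>h. flat_exp n h / h) \<longlongrightarrow> 0) (at_right 0)"
    proof -
      have "((\<lambda>h. poly ([:0, 1:] * flat_poly n) (inverse h) * exp (- inverse h)) \<longlongrightarrow> 0) (at_right (0::real))"
        by (rule filterlim_compose[OF tendsto_poly_exp_0 filterlim_inverse_at_top_right])
      moreover have "eventually (\<lambda>h. poly ([:0, 1:] * flat_poly n) (inverse h) * exp (- inverse h) = flat_exp n h / h) (at_right (0::real))"
        unfolding eventually_at_right_field
        by (intro exI[of _ 1]) (auto simp: flat_exp_def field_simps)
      ultimately show ?thesis by (rule Lim_transform_eventually)
    qed
    moreover have "((\<lambda>h. flat_exp n h / h) \<longlongrightarrow> 0) (at_left 0)"
    proof (rule Lim_transform_eventually[OF tendsto_const])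
      show "eventually (\<lambda>h. 0 = flat_exp n h / h) (at_left (0::real))"
        unfolding eventually_at_left_field by (intro exI[of _ "-1"]) (auto simp: flat_exp_def)
    qed
    ultimately have "((\<lambda>h. flat_exp n h / h) \<longlongrightarrow> 0) (at 0)" by (simp add: filterlim_split_at)
    then have "(flat_exp n has_real_derivative 0) (at 0)" by (simp add: DERIV_def flat_exp_def)
    then show ?thesis using 3 by (simp add: flat_exp_def)
  qed
qed

text \<open>A set closed under differentiation that contains the product. It provides all
  derivatives of a product without the Leibniz formula.\<close>

inductive_set product_span :: "(nat \<Rightarrow> real \<Rightarrow> real) \<Rightarrow> (nat \<Rightarrow> real \<Rightarrow> real) \<Rightarrow> (real \<Rightarrow> real) set"
  for f g :: "nat \<Rightarrow> real \<Rightarrow> real" where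
  prod: "(\<lambda>x. f i x * g j x) \<in> product_span f g"
| add: "u \<in> product_span f g \<Longrightarrow> v \<in> product_span f g \<Longrightarrow> (\<lambda>x. u x + v x) \<in> product_span f g"

lemma product_span_deriv:
  assumes f: "\<And>i x. (f i has_real_derivative f (Suc i) x) (at x)" and g: "\<And>i x. (g i has_real_derivative g (Suc i) x) (at x)"
    and "u \<in> product_span f g"
  shows "\<exists>v\<in>product_span f g. \<forall>x. (u has_real_derivative v x) (at x)"
  using assms(3)
proof induction
  case (prod i j)
  have "((\<lambda>x. f i x * g j x) has_real_derivative f (Suc i) x * g j x + f i x * g (Suc j) x) (at x)" for x
    by (rule DERIV_cong[OF DERIV_mult[OF f g]]) simp
  then show ?case
    by (intro bexI[of _ "\<lambda>x. f (Suc i) x * g j x + f i x * g (Suc j) x"] allI product_span.intros)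
next
  case (add u v)
  then obtain u' v' where "u' \<in> product_span f g" "\<And>x. (u has_real_derivative u' x) (at x)"
    "v' \<in> product_span f g" "\<And>x. (v has_real_derivative v' x) (at x)" by blast
  then show ?case by (intro bexI[of _ "\<lambda>x. u' x + v' x"] allI DERIV_add product_span.add)
qed

lemma smooth_product:
  fixes f g :: "nat \<Rightarrow> real \<Rightarrow> real"
  assumes f: "\<And>i x. (f i has_real_derivative f (Suc i) x) (at x)" and g: "\<And>i x. (g i has_real_derivative g (Suc i) x) (at x)"
  shows "\<exists>h. h 0 = (\<lambda>x. f 0 x * g 0 x) \<and> (\<forall>n x. (h n has_real_derivative h (Suc n) x) (at x))"
proof -
  have "\<exists>h. \<forall>n. (h n \<in> product_span f g \<and> (n = 0 \<longrightarrow> h n = (\<lambda>x. f 0 x * g 0 x))) \<and> (\<forall>x. (h n has_real_derivative h (Suc n) x) (at x))"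
    by (rule dependent_nat_choice) (use product_span_deriv[of f g, OF f g] product_span.prod[of f 0 g 0] in auto)
  then show ?thesis by blast
qed

definition bump :: "real \<Rightarrow> real \<Rightarrow> real \<Rightarrow> real" where
  "bump a b x = flat_exp 0 (x - a) * flat_exp 0 (b - x)"

lemma bump_pos: "a < x \<Longrightarrow> x < b \<Longrightarrow> bump a b x > 0"
  by (simp add: bump_def flat_exp_def)

lemma bump_zero: "\<not> (a < x \<and> x < b) \<Longrightarrow> bump a b x = 0"
  by (auto simp: bump_def flat_exp_def)

lemma bump_nonneg: "bump a b x \<ge> 0"
  by (auto simp: bump_def flat_exp_def)

lemma bump_C0_infinity:
  assumes "0 \<le> a" "b \<le> T"
  shows "bump a b \<in> C0_infinity T"
proof -
  have "((\<lambda>x. flat_exp i (x - a)) has_real_derivative flat_exp (Suc i) (x - a) * 1) (at x)" for i x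
    by (rule DERIV_chain2[OF flat_exp_deriv]) (auto intro!: derivative_eq_intros)
  moreover have "((\<lambda>x. (-1) ^ i * flat_exp i (b - x)) has_real_derivative (-1) ^ i * (flat_exp (Suc i) (b - x) * (-1))) (at x)" for i x
    by (intro DERIV_cmult DERIV_chain2[OF flat_exp_deriv]) (auto intro!: derivative_eq_intros)
  ultimately obtain h where h: "h 0 = (\<lambda>x. flat_exp 0 (x - a) * ((-1) ^ 0 * flat_exp 0 (b - x)))"
      "\<And>n x. (h n has_real_derivative h (Suc n) x) (at x)"
    using smooth_product[of "\<lambda>i x. flat_exp i (x - a)" "\<lambda>i x. (-1) ^ i * flat_exp i (b - x)"] by auto
  have "h 0 = bump a b" using h(1) by (auto simp: bump_def)
  then show ?thesis
    unfolding C0_infinity_def using h(2) assms bump_zero[of a 0 b] bump_zero[of a T b]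
    by (auto intro!: exI[of _ h] intro: has_field_derivative_at_within)
qed

section \<open>The Kirchhoff energy\<close>

locale kirchhoff_space = fractional_space +
  fixes a b :: real
  assumes a: "a > 0" and b: "b > 0"
begin

text \<open>The norm part of the energy as a function of the p-th power of the norm. The additive
  constant of the energy is included, which makes \<open>G 0 = 0\<close>.\<close>

definition G :: "real \<Rightarrow> real" where
  "G s = ((a + b * s) powr p - a powr p) / (b * p\<^sup>2)"

definition \<Phi> :: "(real \<Rightarrow> real) \<Rightarrow> real" where
  "\<Phi> u = G (Q u)"

lemma bp: "b * p\<^sup>2 > 0" using b p by simp

lemma G_0 [simp]: "G 0 = 0" by (simp add: G_def)

lemma G_strict_mono: "0 \<le> s \<Longrightarrow> s < t \<Longrightarrow> G s < G t"
  unfolding G_def using a b p bp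
  by (intro divide_strict_right_mono diff_strict_right_mono powr_less_mono2) (auto intro: add_nonneg_nonneg)

lemma G_mono: "0 \<le> s \<Longrightarrow> s \<le> t \<Longrightarrow> G s \<le> G t"
  using G_strict_mono[of s t] by (cases "s = t") auto

lemma G_nonneg: "0 \<le> s \<Longrightarrow> G s \<ge> 0"
  using G_mono[of 0 s] by simp

lemma G_convex:
  assumes "0 \<le> x" "0 \<le> y" "0 \<le> s" "s \<le> 1"
  shows "G ((1 - s) * x + s * y) \<le> (1 - s) * G x + s * G y"
proof -
  have pos: "0 \<le> a + b * z" if "0 \<le> z" for z using a b that by (intro add_nonneg_nonneg) auto
  have "0 \<le> (1 - s) * x + s * y" using assms by auto
  have "a + b * ((1 - s) * x + s * y) = (1 - s) * (a + b * x) + s * (a + b * y)" by (simp add: algebra_simps)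
  then have "(a + b * ((1 - s) * x + s * y)) powr p \<le> (1 - s) * (a + b * x) powr p + s * (a + b * y) powr p"
    using powr_abs_convex[OF p assms(3,4), of "a + b * x" "a + b * y"] pos[OF assms(1)] pos[OF assms(2)] pos[OF \<open>0 \<le> (1 - s) * x + s * y\<close>]
    by simp
  then have "G ((1 - s) * x + s * y) \<le> ((1 - s) * (a + b * x) powr p + s * (a + b * y) powr p - a powr p) / (b * p\<^sup>2)"
    unfolding G_def using bp by (intro divide_right_mono) auto
  also have "\<dots> = (1 - s) * G x + s * G y"
    unfolding G_def by (simp add: algebra_simps add_divide_distrib diff_divide_distrib)
  finally show ?thesis .
qed

text \<open>Superadditivity of the p-th power gives
  \<open>(b * s) powr p \<le> b * p^2 * G s\<close>. This is the source of the exponent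
  \<open>p^2\<close> in the coercivity of \<open>\<Phi>\<close>.\<close>

lemma G_lower:
  assumes "0 \<le> s"
  shows "s \<le> (b * p\<^sup>2 * G s) powr (1 / p) / b"
proof -
  have "a powr p + (b * s) powr p \<le> (a + b * s) powr p"
    using a b p assms by (intro powr_superadditive) auto
  moreover have "b * p\<^sup>2 * G s = (a + b * s) powr p - a powr p" unfolding G_def using b p by simp
  ultimately have "(b * s) powr p \<le> b * p\<^sup>2 * G s" by simp
  then have "((b * s) powr p) powr (1 / p) \<le> (b * p\<^sup>2 * G s) powr (1 / p)" using p by (intro powr_mono2) auto
  then have "b * s \<le> (b * p\<^sup>2 * G s) powr (1 / p)" using b p assms by (simp add: powr_powr)
  then show ?thesis using b by (simp add: le_divide_eq mult.commute)
qed

text \<open>A convex function with \<open>G 0 = 0\<close> lies below its chord. This shows that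
  \<open>\<Phi>\<close> is only of order \<open>\<rho> powr p\<close> on small spheres, although it
  grows with exponent \<open>p^2\<close> at infinity.\<close>

lemma G_linear_bound:
  assumes "0 \<le> s" "s \<le> S" "S > 0"
  shows "G s \<le> s * (G S / S)"
  using G_convex[of 0 S "s / S"] assms by simp

lemma G_deriv:
  assumes "0 \<le> s"
  obtains D where "D \<ge> 0" "(G has_real_derivative D) (at s)"
proof
  have "a + b * s > 0" using a b assms by (simp add: add_pos_nonneg)
  then have "((\<lambda>s. (a + b * s) powr p - a powr p) has_real_derivative p * (a + b * s) powr (p - 1) * b) (at s)"
    by (auto intro!: derivative_eq_intros simp: powr_diff)
  from DERIV_cdivide[OF this, of "b * p\<^sup>2"]
  show "(G has_real_derivative (p * (a + b * s) powr (p - 1) * b / (b * p\<^sup>2))) (at s)"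
    by (simp only: G_def[abs_def])
  show "p * (a + b * s) powr (p - 1) * b / (b * p\<^sup>2) \<ge> 0" using bp p b by simp
qed

lemma E_nonempty_zero: "(\<lambda>t. 0) \<in> E"
proof -
  have "(\<lambda>t. 0) \<in> C0_infinity T" by (auto simp: C0_infinity_def intro!: exI[of _ "\<lambda>n t. 0"])
  then have "is_deriv (\<lambda>t. 0) (D (\<lambda>t. 0))"
    unfolding is_deriv_iff using C0_infinityD
    by (auto intro!: exI[of _ "\<lambda>n t. 0"] simp: Lp_integral_def)
  then show ?thesis by (auto simp: E_space_def)
qed

lemma C0_infinity_E:
  assumes "\<phi> \<in> C0_infinity T" "\<And>t. t \<notin> {0..T} \<Longrightarrow> \<phi> t = 0"
  shows "\<phi> \<in> E"
proof -
  have "is_deriv \<phi> (D \<phi>)"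
    unfolding is_deriv_iff using C0_infinityD[OF assms(1)] assms(1)
    by (auto intro!: exI[of _ "\<lambda>n. \<phi>"] simp: Lp_integral_def)
  then show ?thesis using assms(2) C0_infinityD(4)[OF assms(1)] by (auto simp: E_space_def)
qed

lemma Q_zero: "Q (\<lambda>t. 0) = 0"
  using E_scale(2)[OF E_nonempty_zero, of 0] p by simp

lemma Q_minus: "u \<in> E \<Longrightarrow> Q (\<lambda>t. - u t) = Q u"
  using E_scale(2)[of u "-1"] by simp

lemma Q_sum_bound:
  assumes "u \<in> E" "v \<in> E"
  shows "Q (\<lambda>t. u t + v t) \<le> 2 powr p * (Q u + Q v)"
  using Q_lincomb[OF assms, of 1 1] Lp_add(2)[OF p frac_deriv_Lp[OF assms(1)] frac_deriv_Lp[OF assms(2)]]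
  by (simp add: Q_def)

lemma \<Phi>_bound_Q:
  assumes "\<Phi> u \<le> B"
  shows "Q u \<le> (b * p\<^sup>2 * B) powr (1 / p) / b"
proof -
  have "Q u \<le> (b * p\<^sup>2 * \<Phi> u) powr (1 / p) / b" unfolding \<Phi>_def by (rule G_lower) simp
  also have "\<dots> \<le> (b * p\<^sup>2 * B) powr (1 / p) / b"
    using assms bp b p G_nonneg[of "Q u"] unfolding \<Phi>_def
    by (intro divide_right_mono powr_mono2 mult_left_mono mult_nonneg_nonneg) auto
  finally show ?thesis .
qed

lemma E_pointwise_bound:
  obtains \<kappa> where "\<kappa> > 0" "\<And>u t. u \<in> E \<Longrightarrow> \<bar>u t\<bar> \<le> \<kappa> * \<Phi> u powr (1 / p\<^sup>2)"
proof -
  obtain C where C: "C > 0" "\<And>u t. u \<in> E \<Longrightarrow> \<bar>u t\<bar> \<le> C * Q u powr (1 / p)" using E_bound by blast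
  define \<kappa> where "\<kappa> = C * ((b * p\<^sup>2) powr (1 / p\<^sup>2) / b powr (1 / p))"
  have "\<bar>u t\<bar> \<le> \<kappa> * \<Phi> u powr (1 / p\<^sup>2)" if "u \<in> E" for u t
  proof -
    have "\<bar>u t\<bar> \<le> C * Q u powr (1 / p)" by (rule C(2)[OF that])
    also have "\<dots> \<le> C * ((b * p\<^sup>2 * \<Phi> u) powr (1 / p) / b) powr (1 / p)"
      using C(1) p \<Phi>_bound_Q[of u "\<Phi> u"] by (intro mult_left_mono powr_mono2) auto
    also have "\<dots> = \<kappa> * \<Phi> u powr (1 / p\<^sup>2)"
      using b p by (simp add: \<kappa>_def powr_divide powr_powr powr_mult power2_eq_square)
    finally show ?thesis .
  qed
  moreover have "\<kappa> > 0" using C(1) b p by (auto simp: \<kappa>_def intro!: divide_pos_pos mult_pos_pos)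
  ultimately show thesis using that by blast
qed

lemma \<Phi>_compact:
  assumes U: "\<And>n. U n \<in> E" "\<And>n. \<Phi> (U n) \<le> B"
  shows "\<exists>k u L. strict_mono (k :: nat \<Rightarrow> nat) \<and> u \<in> E \<and> (\<forall>t. (\<lambda>n. U (k n) t) \<longlonglongrightarrow> u t) \<and>
           (\<lambda>n. \<Phi> (U (k n))) \<longlonglongrightarrow> L \<and> \<Phi> u \<le> L"
proof -
  obtain k u L where k: "strict_mono (k :: nat \<Rightarrow> nat)" "u \<in> E" "\<And>t. (\<lambda>n. U (k n) t) \<longlonglongrightarrow> u t"
    "(\<lambda>n. Q (U (k n))) \<longlonglongrightarrow> L" "Q u \<le> L"
    by (rule E_compact[OF U(1) \<Phi>_bound_Q[OF U(2)]]) (rule that)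
  have L: "L \<ge> 0" using k(5) Q_nonneg[of u] by linarith
  obtain D where D: "(G has_real_derivative D) (at L)" using G_deriv[OF L] by blast
  have "(\<lambda>n. \<Phi> (U (k n))) \<longlonglongrightarrow> G L"
    unfolding \<Phi>_def by (rule isCont_tendsto_compose[OF DERIV_isCont[OF D] k(4)])
  moreover have "\<Phi> u \<le> G L" unfolding \<Phi>_def using k(5) by (intro G_mono) auto
  ultimately show ?thesis using k(1-3) by blast
qed

text \<open>Every point of the interval is within one grid width of a zero, and the Hoelder estimate
  turns this distance into a bound.\<close>

lemma \<Phi>_small:
  assumes e: "e > 0"
  shows "\<exists>n. \<forall>u\<in>E. \<Phi> u \<le> B \<longrightarrow> (\<forall>i<n. u (T * real (Suc i) / real n) = 0) \<longrightarrow> (\<forall>t\<in>{0..T}. \<bar>u t\<bar> \<le> e)"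
proof -
  obtain H where H: "H > 0" "\<And>u t t'. u \<in> E \<Longrightarrow> t \<in> {0..T} \<Longrightarrow> t' \<in> {0..T} \<Longrightarrow>
     \<bar>u t' - u t\<bar> \<le> H * \<bar>t' - t\<bar> powr (\<alpha> - 1 / p) * Q u powr (1 / p)" using E_Holder by blast
  define M where "M = (b * p\<^sup>2 * B) powr (1 / p) / b"
  define \<theta> where "\<theta> = \<alpha> - 1 / p"
  have \<theta>: "\<theta> > 0" using \<alpha>p by (simp add: \<theta>_def)
  have l: "(\<lambda>k. 1 / real (Suc k)) \<longlonglongrightarrow> 0" using LIMSEQ_inverse_real_of_nat by (simp add: inverse_eq_divide)
  have "(\<lambda>k. T * (1 / real (Suc k))) \<longlonglongrightarrow> 0" using tendsto_mult[OF tendsto_const[of T] l] by simp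
  then have "(\<lambda>k. (T * (1 / real (Suc k))) powr \<theta>) \<longlonglongrightarrow> 0 powr \<theta>"
    by (rule tendsto_powr'[OF _ tendsto_const]) (use \<theta> T in auto)
  from tendsto_mult[OF tendsto_mult[OF tendsto_const[of H] this] tendsto_const[of "M powr (1 / p)"]]
  have "(\<lambda>k. H * (T * (1 / real (Suc k))) powr \<theta> * M powr (1 / p)) \<longlonglongrightarrow> 0" by simp
  then have "eventually (\<lambda>k. H * (T * (1 / real (Suc k))) powr \<theta> * M powr (1 / p) < e) sequentially"
    using e by (intro order_tendstoD(2)) auto
  then obtain k where "H * (T * (1 / real (Suc k))) powr \<theta> * M powr (1 / p) < e" unfolding eventually_sequentially by blast
  then have k: "H * (T / real (Suc k)) powr \<theta> * M powr (1 / p) < e" by simp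
  have "\<bar>u t\<bar> \<le> e" if u: "u \<in> E" "\<Phi> u \<le> B" "\<forall>i<Suc k. u (T * real (Suc i) / real (Suc k)) = 0" and t: "t \<in> {0..T}" for u t
  proof -
    \<comment> \<open>The points \<open>T * (i + 1) / (k + 1)\<close> start after 0, so the zero to
      the right of \<open>t\<close> is used. At \<open>t = T\<close> the floor would give the index
      \<open>k + 1\<close>, which is out of range.\<close>
    obtain i where i: "i < Suc k" "\<bar>T * real (Suc i) / real (Suc k) - t\<bar> \<le> T / real (Suc k)"
    proof (cases "t = T")
      case True
      then show thesis using that[of k] T by simp
    next
      case False
      define i where "i = nat \<lfloor>t * real (Suc k) / T\<rfloor>"
      have x0: "0 \<le> t * real (Suc k) / T" using t T by simp
      have fl: "real i \<le> t * real (Suc k) / T" "t * real (Suc k) / T < real i + 1"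
        unfolding i_def using x0 by linarith+
      have "t * real (Suc k) / T < real (Suc k)" using t False T by (simp add: divide_less_eq mult.commute)
      then have "i < Suc k" using fl(1) by (metis le_less_trans of_nat_less_iff)
      moreover have "T * real i \<le> t * real (Suc k)" "t * real (Suc k) < T * (real i + 1)"
        using fl T by (simp_all add: field_simps)
      then have "T * real i / real (Suc k) \<le> t" "t < T * real (Suc i) / real (Suc k)"
        by (simp_all add: divide_le_eq less_divide_eq add.commute)
      moreover have "T * real (Suc i) / real (Suc k) = T * real i / real (Suc k) + T / real (Suc k)"
        by (simp add: distrib_left add_divide_distrib)
      ultimately show thesis using that[of i] by simp
    qed
    let ?s = "T * real (Suc i) / real (Suc k)"
    have "T * real (Suc i) \<le> T * real (Suc k)" using T i(1) by (intro mult_left_mono) auto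
    then have s: "?s \<in> {0..T}" using T by (simp add: divide_le_eq)
    have "\<bar>u t\<bar> = \<bar>u ?s - u t\<bar>" using u(3) i(1) by simp
    also have "\<dots> \<le> H * \<bar>?s - t\<bar> powr \<theta> * Q u powr (1 / p)" unfolding \<theta>_def by (rule H(2)[OF u(1) t s])
    also have "\<dots> \<le> H * (T / real (Suc k)) powr \<theta> * M powr (1 / p)"
      using H(1) i(2) \<theta> p \<Phi>_bound_Q[OF u(2)] by (intro mult_mono mult_nonneg_nonneg powr_mono2) (auto simp: M_def)
    finally show ?thesis using k by linarith
  qed
  then show ?thesis by blast
qed

lemma \<Phi>_convex:
  assumes "u \<in> E" "v \<in> E" "0 \<le> s" "s \<le> 1"
  shows "\<Phi> (\<lambda>t. (1 - s) * u t + s * v t) \<le> (1 - s) * \<Phi> u + s * \<Phi> v"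
proof -
  have "\<Phi> (\<lambda>t. (1 - s) * u t + s * v t) \<le> G ((1 - s) * Q u + s * Q v)"
    unfolding \<Phi>_def by (intro G_mono Q_convex assms) simp
  also have "\<dots> \<le> (1 - s) * \<Phi> u + s * \<Phi> v" unfolding \<Phi>_def by (intro G_convex assms) auto
  finally show ?thesis .
qed

lemma \<Phi>_strict:
  assumes "u \<in> E" "v \<in> E" "u \<noteq> v"
  shows "\<Phi> (\<lambda>t. (u t + v t) / 2) < (\<Phi> u + \<Phi> v) / 2"
proof -
  have "\<Phi> (\<lambda>t. (u t + v t) / 2) < G ((Q u + Q v) / 2)"
    unfolding \<Phi>_def by (intro G_strict_mono Q_midpoint_strict assms) simp
  also have "\<dots> \<le> (\<Phi> u + \<Phi> v) / 2"
    unfolding \<Phi>_def using G_convex[of "Q u" "Q v" "1/2"] by (simp add: add_divide_distrib)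
  finally show ?thesis .
qed

text \<open>Substitute for the derivative of \<open>\<Phi>\<close>. Expanding \<open>G\<close> at
  \<open>Q u\<close> reduces the claim to second differences of \<open>Q\<close>, which uniform
  smoothness of the p-th power controls. An upper bound is enough, because at a fixed point of
  \<open>K\<close> a supporting affine function gives the lower one.\<close>

lemma \<Phi>_smooth:
  assumes u: "u \<in> E" and \<epsilon>: "\<epsilon> > 0"
  obtains \<delta> where "\<delta> > 0" "\<And>v. v \<in> E \<Longrightarrow> E_norm T \<alpha> p v < \<delta> \<Longrightarrow>
    \<Phi> (\<lambda>t. u t + v t) + \<Phi> (\<lambda>t. u t - v t) - 2 * \<Phi> u \<le> \<epsilon> * E_norm T \<alpha> p v"
proof -
  let ?N = "E_norm T \<alpha> p"
  let ?w = "frac_deriv T \<alpha> p"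
  define A where "A = Q u powr ((p - 1) / p)"
  have A: "A \<ge> 0" by (simp add: A_def)
  define C1 where "C1 = p * 2 powr (p - 1)"
  have C1: "C1 \<ge> 0" using p by (simp add: C1_def)
  obtain D where D: "D \<ge> 0" "(G has_real_derivative D) (at (Q u))" using G_deriv[of "Q u"] by auto
  define C2 where "C2 = C1 * (A + 1) + 1"
  have C2: "C2 > 0" using C1 A by (simp add: C2_def add_nonneg_pos)
  \<comment> \<open>The total error is split into thirds: \<open>2 * e2 * C2\<close> from expanding
    \<open>G\<close> at the two points, then \<open>D * A * e3\<close> and the term with
    \<open>C3\<close> from the second differences of \<open>Q\<close>.\<close>
  define e2 where "e2 = \<epsilon> / (6 * C2)"
  have e2: "e2 > 0" using \<epsilon> C2 by (simp add: e2_def)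
  have "((\<lambda>h. (G (Q u + h) - G (Q u)) / h - D) \<longlongrightarrow> 0) (at 0)"
    using D(2) by (simp add: DERIV_def LIM_zero_iff)
  from tendstoD[OF this e2] obtain \<delta>2 where
    \<delta>2: "\<delta>2 > 0" "\<And>h. h \<noteq> 0 \<Longrightarrow> \<bar>h\<bar> < \<delta>2 \<Longrightarrow> \<bar>(G (Q u + h) - G (Q u)) / h - D\<bar> < e2"
    unfolding eventually_at dist_real_def by auto
  have Gexp: "G s - G (Q u) \<le> D * (s - Q u) + e2 * \<bar>s - Q u\<bar>" if "\<bar>s - Q u\<bar> < \<delta>2" for s
  proof (cases "s = Q u")
    case False
    define h where "h = s - Q u"
    have h: "h \<noteq> 0" "\<bar>h\<bar> < \<delta>2" using False that by (auto simp: h_def)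
    have "G (Q u + h) - G (Q u) - D * h = ((G (Q u + h) - G (Q u)) / h - D) * h" using h(1) by (simp add: field_simps)
    then have "\<bar>G (Q u + h) - G (Q u) - D * h\<bar> = \<bar>(G (Q u + h) - G (Q u)) / h - D\<bar> * \<bar>h\<bar>" by (simp only: abs_mult)
    also have "\<dots> \<le> e2 * \<bar>h\<bar>" using \<delta>2(2)[OF h] by (intro mult_right_mono) auto
    finally show ?thesis by (simp add: h_def)
  qed simp
  have cancel3: "z * (\<epsilon> / (3 * z)) = \<epsilon> / 3" if "z > 0" for z using that by simp
  define e3 where "e3 = \<epsilon> / (3 * (D * A + 1))"
  have e3: "e3 > 0" using \<epsilon> D A by (simp add: e3_def add_nonneg_pos)
  obtain C3 where C3: "C3 \<ge> 0" "\<And>f g. f \<in> Lp T p \<Longrightarrow> g \<in> Lp T p \<Longrightarrow>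
    Lp_integral T p (\<lambda>t. f t + g t) + Lp_integral T p (\<lambda>t. f t - g t) - 2 * Lp_integral T p f
      \<le> e3 * (Lp_integral T p f powr ((p - 1) / p) * Lp_norm T p g) + C3 * Lp_integral T p g"
    by (rule Lp_integral_uniformly_smooth[OF p e3, of T]) (rule that)
  \<comment> \<open>Since \<open>Q v\<close> is the norm times its power \<open>p - 1\<close>,
    smallness of that power makes the term with \<open>C3\<close> at most a third of
    \<open>\<epsilon>\<close> times the norm.\<close>
  define \<eta> where "\<eta> = (\<epsilon> / (3 * (D * C3 + 1))) powr (1 / (p - 1))"
  have "D * C3 + 1 > 0" using D C3(1) by (simp add: add_nonneg_pos)
  then have "\<epsilon> / (3 * (D * C3 + 1)) > 0" using \<epsilon> by (intro divide_pos_pos) auto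
  then have \<eta>: "\<eta> > 0" by (simp only: \<eta>_def powr_gt_zero)
  define \<delta> where "\<delta> = min (min 1 (\<delta>2 / C2)) \<eta>"
  have "\<delta> > 0" using \<delta>2 C2 \<eta> by (simp add: \<delta>_def)
  moreover have "\<Phi> (\<lambda>t. u t + v t) + \<Phi> (\<lambda>t. u t - v t) - 2 * \<Phi> u \<le> \<epsilon> * ?N v"
    if v: "v \<in> E" and N: "?N v < \<delta>" for v
  proof -
    have N0: "?N v \<ge> 0" by (simp add: E_norm_powr)
    have N1: "?N v \<le> 1" "?N v < \<delta>2 / C2" "?N v \<le> \<eta>" using N by (auto simp: \<delta>_def)
    have Qv: "Q v = ?N v powr p" by (rule E_norm_powr(1)[symmetric])
    have Np: "?N v powr p = ?N v * ?N v powr (p - 1)"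
      using p N0 by (cases "?N v = 0") (auto simp: powr_diff)
    have "?N v powr (p - 1) \<le> 1" using N1 N0 p powr_mono2[of "p - 1" "?N v" 1] by simp
    then have QvN: "Q v \<le> ?N v" unfolding Qv Np using N0 by (simp add: mult_left_le)
    note wL = frac_deriv_Lp[OF u] frac_deriv_Lp[OF v]
    have wmL: "(\<lambda>t. - ?w v t) \<in> Lp T p" using Lp_scale(1)[OF wL(2), of "-1"] by simp
    have LN: "Lp_norm T p (?w v) = ?N v" "Lp_norm T p (\<lambda>t. - ?w v t) = ?N v"
      by (simp_all add: E_norm_def Lp_norm_def)
    have LI: "Lp_integral T p (?w v) = Q v" "Lp_integral T p (\<lambda>t. - ?w v t) = Q v" "Lp_integral T p (?w u) = Q u"
      by (simp_all add: Q_def Lp_integral_def)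
    have Qp: "Q (\<lambda>t. u t + v t) = Lp_integral T p (\<lambda>t. ?w u t + ?w v t)" using Q_lincomb[OF u v, of 1 1] by simp
    have Qm: "Q (\<lambda>t. u t - v t) = Lp_integral T p (\<lambda>t. ?w u t - ?w v t)" using Q_lincomb[OF u v, of 1 "-1"] by simp
    have lip: "C1 * (A * ?N v + Q v) \<le> C2 * ?N v"
    proof -
      have "C1 * (A * ?N v + Q v) \<le> C1 * (A * ?N v + ?N v)" using C1 QvN by (intro mult_left_mono) auto
      also have "\<dots> = C1 * (A + 1) * ?N v" by (simp add: algebra_simps)
      also have "\<dots> \<le> C2 * ?N v" using N0 by (intro mult_right_mono) (auto simp: C2_def)
      finally show ?thesis .
    qed
    have d1: "\<bar>Q (\<lambda>t. u t + v t) - Q u\<bar> \<le> C2 * ?N v"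
      using Lp_integral_diff_le[OF p wL] lip unfolding Qp LI LN A_def C1_def by linarith
    have d2: "\<bar>Q (\<lambda>t. u t - v t) - Q u\<bar> \<le> C2 * ?N v"
      using Lp_integral_diff_le[OF p wL(1) wmL] lip unfolding Qm LI LN A_def C1_def by simp
    have small: "C2 * ?N v < \<delta>2" using N1(2) C2 by (simp add: less_divide_eq mult.commute)
    have s1: "\<Phi> (\<lambda>t. u t + v t) - \<Phi> u \<le> D * (Q (\<lambda>t. u t + v t) - Q u) + e2 * (C2 * ?N v)"
      unfolding \<Phi>_def using Gexp[of "Q (\<lambda>t. u t + v t)"] d1 small mult_left_mono[OF d1, of e2] e2 by linarith
    have s2: "\<Phi> (\<lambda>t. u t - v t) - \<Phi> u \<le> D * (Q (\<lambda>t. u t - v t) - Q u) + e2 * (C2 * ?N v)"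
      unfolding \<Phi>_def using Gexp[of "Q (\<lambda>t. u t - v t)"] d2 small mult_left_mono[OF d2, of e2] e2 by linarith
    have sm: "Q (\<lambda>t. u t + v t) + Q (\<lambda>t. u t - v t) - 2 * Q u \<le> e3 * (A * ?N v) + C3 * Q v"
      using C3(2)[OF wL] unfolding Qp Qm LI LN A_def .
    have t1: "e2 * (C2 * ?N v) = \<epsilon> / 6 * ?N v" using C2 by (simp add: e2_def)
    have t2: "D * (e3 * (A * ?N v)) \<le> \<epsilon> / 3 * ?N v"
    proof -
      have "D * (e3 * (A * ?N v)) = (D * A) * e3 * ?N v" by simp
      also have "\<dots> \<le> (D * A + 1) * e3 * ?N v" using e3 N0 by (intro mult_right_mono) auto
      also have "(D * A + 1) * e3 = \<epsilon> / 3"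
      proof -
        have "D * A + 1 > 0" using D A by (simp add: add_nonneg_pos)
        then show ?thesis unfolding e3_def by (rule cancel3)
      qed
      finally show ?thesis .
    qed
    have t3: "D * (C3 * Q v) \<le> \<epsilon> / 3 * ?N v"
    proof -
      have pos: "D * C3 + 1 > 0" using D C3(1) by (simp add: add_nonneg_pos)
      have "?N v powr (p - 1) \<le> \<eta> powr (p - 1)" using N0 N1(3) p by (intro powr_mono2) auto
      also have "\<dots> = \<epsilon> / (3 * (D * C3 + 1))" 
      proof -
        have "0 < \<epsilon> / (3 * (D * C3 + 1))" using \<epsilon> pos by (intro divide_pos_pos) auto
        moreover have "(z powr (1 / (p - 1))) powr (p - 1) = z" if "z > 0" for z using that p by (simp add: powr_powr)
        ultimately show ?thesis unfolding \<eta>_def by blast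
      qed
      finally have "(D * C3 + 1) * ?N v powr (p - 1) \<le> (D * C3 + 1) * (\<epsilon> / (3 * (D * C3 + 1)))"
        using pos by (intro mult_left_mono) auto
      also have "\<dots> = \<epsilon> / 3" by (rule cancel3[OF pos])
      finally have *: "(D * C3 + 1) * ?N v powr (p - 1) \<le> \<epsilon> / 3" .
      have "D * C3 * ?N v powr (p - 1) \<le> (D * C3 + 1) * ?N v powr (p - 1)" by (intro mult_right_mono) auto
      with * have "D * C3 * ?N v powr (p - 1) \<le> \<epsilon> / 3" by linarith
      from mult_right_mono[OF this N0] show ?thesis unfolding Qv Np by (simp add: mult_ac)
    qed
    have "D * (Q (\<lambda>t. u t + v t) + Q (\<lambda>t. u t - v t) - 2 * Q u) \<le> D * (e3 * (A * ?N v) + C3 * Q v)"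
      using sm D(1) by (intro mult_left_mono)
    then have "D * (Q (\<lambda>t. u t + v t) - Q u) + D * (Q (\<lambda>t. u t - v t) - Q u) \<le> D * (e3 * (A * ?N v)) + D * (C3 * Q v)"
      by (simp add: algebra_simps)
    then show ?thesis using s1 s2 t1 t2 t3 by linarith
  qed
  ultimately show thesis using that by blast
qed

lemma bump_E:
  assumes "0 \<le> l" "m \<le> T"
  shows "bump l m \<in> E"
  using assms by (intro C0_infinity_E bump_C0_infinity) (auto intro: bump_zero)

lemma E_sum:
  fixes k :: nat
  assumes "\<And>i. i < k \<Longrightarrow> \<phi> i \<in> E"
  shows "(\<lambda>t. \<Sum>i<k. x i * \<phi> i t) \<in> E"
  using assms
proof (induction k)
  case (Suc k)
  then show ?case using E_lincomb(1)[of "\<lambda>t. \<Sum>i<k. x i * \<phi> i t" "\<phi> k" 1 "x k"] by simp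
qed (simp add: E_nonempty_zero)

lemma Q_sum_bounded:
  fixes k :: nat
  assumes "\<And>i. i < k \<Longrightarrow> \<phi> i \<in> E"
  shows "\<exists>M\<ge>0. \<forall>x :: nat \<Rightarrow> real. (\<forall>i<k. \<bar>x i\<bar> \<le> 1) \<longrightarrow> Q (\<lambda>t. \<Sum>i<k. x i * \<phi> i t) \<le> M"
  using assms
proof (induction k)
  case (Suc k)
  then obtain M where M: "M \<ge> 0" "\<And>x :: nat \<Rightarrow> real. (\<forall>i<k. \<bar>x i\<bar> \<le> 1) \<Longrightarrow> Q (\<lambda>t. \<Sum>i<k. x i * \<phi> i t) \<le> M" by auto
  have "Q (\<lambda>t. \<Sum>i<Suc k. x i * \<phi> i t) \<le> 2 powr p * (M + Q (\<phi> k))" if "\<forall>i<Suc k. \<bar>x i\<bar> \<le> 1" for x :: "nat \<Rightarrow> real"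
  proof -
    have "Q (\<lambda>t. \<Sum>i<Suc k. x i * \<phi> i t) = Q (\<lambda>t. (\<Sum>i<k. x i * \<phi> i t) + x k * \<phi> k t)" by simp
    also have "\<dots> \<le> 2 powr p * (Q (\<lambda>t. \<Sum>i<k. x i * \<phi> i t) + Q (\<lambda>t. x k * \<phi> k t))"
      using Suc.prems by (intro Q_sum_bound E_sum E_scale(1)) auto
    also have "\<dots> \<le> 2 powr p * (M + Q (\<phi> k))"
    proof (intro mult_left_mono add_mono)
      show "Q (\<lambda>t. \<Sum>i<k. x i * \<phi> i t) \<le> M" using that by (intro M) auto
      have "\<bar>x k\<bar> powr p \<le> 1 powr p" using that p by (intro powr_mono2) auto
      then show "Q (\<lambda>t. x k * \<phi> k t) \<le> Q (\<phi> k)" using E_scale(2)[of "\<phi> k" "x k"] Suc.prems by (simp add: mult_left_le_one_le)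
    qed simp
    finally show ?thesis .
  qed
  then show ?case using M(1) by (intro exI[of _ "2 powr p * (M + Q (\<phi> k))"]) auto
qed (auto simp: Q_zero)

end

lemma bump_powr_integral_pos:
  assumes "0 \<le> l" "l < m" "m \<le> T" "r > 0"
  shows "(\<integral>t. bump l m t powr r \<partial>lebesgue_on {0..T}) > 0"
    "integrable (lebesgue_on {0..T}) (\<lambda>t. bump l m t powr r)"
proof -
  let ?M = "lebesgue_on {0..T}"
  have "isCont (bump l m) x" for x
    unfolding bump_def[abs_def]
    by (intro continuous_mult isCont_o2[OF _ DERIV_isCont[OF flat_exp_deriv]]) (auto intro!: continuous_intros)
  then have "continuous_on {0..T} (bump l m)" by (intro continuous_at_imp_continuous_on) blast
  then have "continuous_on {0..T} (\<lambda>t. bump l m t powr r)"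
    using assms(4) by (intro continuous_on_powr') (auto simp: bump_nonneg)
  then show int: "integrable ?M (\<lambda>t. bump l m t powr r)" by (rule continuous_imp_integrable_real)
  have "(\<integral>t. bump l m t powr r \<partial>?M) \<noteq> 0"
  proof
    assume "(\<integral>t. bump l m t powr r \<partial>?M) = 0"
    then have "AE t in ?M. bump l m t powr r = 0"
      using integral_nonneg_eq_0_iff_AE[OF int] by simp
    then have "AE t in ?M. t \<notin> {l<..<m}" by eventually_elim (use bump_pos in force)
    then have "AE t in lebesgue. t \<in> {0..T} \<longrightarrow> t \<notin> {l<..<m}" by (subst (asm) AE_restrict_space_iff) auto
    then have "AE t in lebesgue. t \<notin> {l<..<m}" by eventually_elim (use assms in auto)
    then have "emeasure lebesgue {l<..<m} = 0" by (subst (asm) AE_iff_measurable[where N = "{l<..<m}"]) auto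
    then show False using assms(2) by simp
  qed
  moreover have "(\<integral>t. bump l m t powr r \<partial>?M) \<ge> 0" by simp
  ultimately show "(\<integral>t. bump l m t powr r \<partial>?M) > 0" by linarith
qed

section \<open>Weak solutions of the Kirchhoff problem\<close>

locale kirchhoff_problem = kirchhoff_space T \<alpha> p a b + nonlinearity T f d r for T \<alpha> p a b f d r +
  assumes r_less: "r < p\<^sup>2"
begin

lemma energy_eq: "energy T a b p \<alpha> f u = \<Phi> u - \<psi> u"
proof -
  have "(LINT t:{0..T}|lebesgue. F t (u t)) = \<psi> u"
    by (simp add: \<psi>_def set_lebesgue_integral_def integral_restrict_space)
  then show ?thesis by (simp add: energy_def \<Phi>_def G_def E_norm_powr(1) diff_divide_distrib)
qed

text \<open>Minimality at \<open>u + v\<close> and at \<open>u - v\<close> bounds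
  \<open>\<Phi>\<close> from below by an affine function with slope \<open>\<psi>' u\<close>. With
  \<open>\<Phi>_smooth\<close> the bound at \<open>u - v\<close> becomes an upper bound at
  \<open>u + v\<close>, so \<open>\<psi>' u\<close> is the derivative of \<open>\<Phi>\<close> at
  \<open>u\<close> and cancels against that of \<open>\<psi>\<close>.\<close>

lemma minimizer_critical:
  assumes u: "u \<in> E" and min: "\<And>v. v \<in> E \<Longrightarrow> \<Phi> u - \<psi>' u u \<le> \<Phi> v - \<psi>' u v"
  shows "weak_solution T a b p \<alpha> f u"
  unfolding weak_solution_def critical_point_def
proof (intro conjI allI impI)
  show "u \<in> E" by (rule u)
  fix \<epsilon> :: real assume \<epsilon>: "\<epsilon> > 0"
  let ?N = "E_norm T \<alpha> p"
  obtain C where C: "C > 0" "\<And>u t. u \<in> E \<Longrightarrow> \<bar>u t\<bar> \<le> C * ?N u" unfolding E_norm_powr(2) using E_bound by blast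
  define R where "R = C * (?N u + 1)"
  have "\<epsilon> / (2 * C) > 0" using \<epsilon> C by simp
  then obtain \<delta>1 where \<delta>1: "\<delta>1 > 0" "\<And>u v \<zeta>. continuous_on {0..T} u \<Longrightarrow> continuous_on {0..T} v \<Longrightarrow>
    (\<And>t. t \<in> {0..T} \<Longrightarrow> \<bar>u t\<bar> \<le> R) \<Longrightarrow> (\<And>t. t \<in> {0..T} \<Longrightarrow> \<bar>v t\<bar> \<le> R) \<Longrightarrow>
    (\<And>t. t \<in> {0..T} \<Longrightarrow> \<bar>v t - u t\<bar> \<le> \<zeta>) \<Longrightarrow> \<zeta> < \<delta>1 \<Longrightarrow> \<bar>\<psi> v - \<psi> u - \<psi>' u (\<lambda>t. v t - u t)\<bar> \<le> \<epsilon> / (2 * C) * \<zeta>"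
    by (rule \<psi>_expansion[where R = R]) (rule that, assumption, blast)
  have "\<epsilon> / 2 > 0" using \<epsilon> by simp
  then obtain \<delta>2 where \<delta>2: "\<delta>2 > 0" "\<And>v. v \<in> E \<Longrightarrow> ?N v < \<delta>2 \<Longrightarrow>
    \<Phi> (\<lambda>t. u t + v t) + \<Phi> (\<lambda>t. u t - v t) - 2 * \<Phi> u \<le> \<epsilon> / 2 * ?N v"
    by (rule \<Phi>_smooth[OF u]) (rule that)
  define \<delta> where "\<delta> = min 1 (min (\<delta>1 / C) \<delta>2)"
  have "\<delta> > 0" using \<delta>1(1) \<delta>2(1) C(1) by (simp add: \<delta>_def)
  moreover have "\<bar>energy T a b p \<alpha> f (\<lambda>t. u t + v t) - energy T a b p \<alpha> f u\<bar> \<le> \<epsilon> * ?N v" if v: "v \<in> E" and N: "?N v < \<delta>" for v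
  proof -
    have N': "?N v < 1" "?N v < \<delta>1 / C" "?N v < \<delta>2" using N by (auto simp: \<delta>_def)
    have uv: "(\<lambda>t. u t + v t) \<in> E" "(\<lambda>t. u t - v t) \<in> E"
      using E_lincomb(1)[OF u v, of 1 1] E_lincomb(1)[OF u v, of 1 "-1"] by simp_all
    note uc = E_spaceD(1)[OF u] and vc = E_spaceD(1)[OF v]
    have lin: "\<psi>' u (\<lambda>t. u t + v t) = \<psi>' u u + \<psi>' u v" "\<psi>' u (\<lambda>t. u t - v t) = \<psi>' u u - \<psi>' u v"
      using \<psi>'_linear[OF uc uc vc, of 1 1] \<psi>'_linear[OF uc uc vc, of 1 "-1"] by simp_all
    have up: "\<Phi> u + \<psi>' u v \<le> \<Phi> (\<lambda>t. u t + v t)" "\<Phi> u - \<psi>' u v \<le> \<Phi> (\<lambda>t. u t - v t)"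
      using min[OF uv(1)] min[OF uv(2)] lin by linarith+
    have down: "\<Phi> (\<lambda>t. u t + v t) \<le> \<Phi> u + \<psi>' u v + \<epsilon> / 2 * ?N v" using \<delta>2(2)[OF v N'(3)] up(2) by linarith
    have CR: "C * ?N u + C * ?N v \<le> R"
      using mult_left_mono[of "?N v" 1 C] N'(1) C(1) by (simp add: R_def algebra_simps)
    have N0: "0 \<le> C * ?N v" using C(1) by (simp add: E_norm_powr(2))
    have b1: "\<bar>u t\<bar> \<le> R" for t using C(2)[OF u, of t] CR N0 by linarith
    have b2: "\<bar>u t + v t\<bar> \<le> R" for t using C(2)[OF u, of t] C(2)[OF v, of t] CR by linarith
    have "\<bar>\<psi> (\<lambda>t. u t + v t) - \<psi> u - \<psi>' u (\<lambda>t. (u t + v t) - u t)\<bar> \<le> \<epsilon> / (2 * C) * (C * ?N v)"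
      using C(2)[OF v] N'(2) C(1) b1 b2
      by (intro \<delta>1(2) uc E_spaceD(1)[OF uv(1)]) (auto simp: less_divide_eq mult.commute)
    then have "\<bar>\<psi> (\<lambda>t. u t + v t) - \<psi> u - \<psi>' u v\<bar> \<le> \<epsilon> / 2 * ?N v" using C(1) by simp
    then show ?thesis unfolding energy_eq abs_le_iff using up(1) down by linarith
  qed
  ultimately show "\<exists>\<delta>>0. \<forall>v\<in>E. ?N v < \<delta> \<longrightarrow> \<bar>energy T a b p \<alpha> f (\<lambda>t. u t + v t) - energy T a b p \<alpha> f u\<bar> \<le> \<epsilon> * ?N v"
    by blast
qed

text \<open>On a small sphere of radius \<open>\<rho>\<close> spanned by \<open>n + 1\<close>
  disjoint bumps, \<open>\<Phi>\<close> is at most of order \<open>\<rho> powr p\<close> and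
  \<open>\<psi>\<close> at least of order \<open>\<rho> powr r2\<close>. Because of
  \<open>r2 < p\<close> the second dominates.\<close>

lemma negative_sphere:
  assumes interval: "0 \<le> l" "l < m" "m \<le> T" and \<eta>: "\<eta> > 0" and \<delta>: "\<delta> > 0" and r2: "1 < r2" "r2 < p"
    and lower: "\<forall>t\<in>{l<..<m}. \<forall>x\<in>{-\<delta>..\<delta>}. F t x \<ge> \<eta> * \<bar>x\<bar> powr r2"
  shows "\<exists>(h :: (nat \<Rightarrow> real) \<Rightarrow> real \<Rightarrow> real) \<rho> B. \<rho> > 0 \<and> (\<forall>x\<in>cube_sphere n. h x \<in> E) \<and>
    (\<forall>x. h (\<lambda>i. - x i) = (\<lambda>t. - h x t)) \<and> (\<forall>x\<in>cube_sphere n. \<Phi> (h x) \<le> B) \<and>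
    (\<forall>xs x t. (\<forall>j. (\<lambda>k. xs k j) \<longlonglongrightarrow> x j) \<longrightarrow> (\<lambda>k. h (xs k) t) \<longlonglongrightarrow> h x t) \<and>
    (\<forall>x\<in>cube_sphere n. \<Phi> (h x) - \<psi> (h x) \<le> - \<rho>)"
proof -
  define pt where "pt i = l + (m - l) * (real i / real (Suc n))" for i :: nat
  define \<phi> where "\<phi> i = bump (pt i) (pt (Suc i))" for i
  define S where "S x t = (\<Sum>i<Suc n. x i * \<phi> i t)" for x :: "nat \<Rightarrow> real" and t
  have pt_mono: "pt i \<le> pt j" if "i \<le> j" for i j
    unfolding pt_def using that interval by (intro add_left_mono mult_left_mono divide_right_mono) auto
  have pt_less: "pt i < pt (Suc i)" for i
    unfolding pt_def using interval by (intro add_strict_left_mono mult_strict_left_mono divide_strict_right_mono) auto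
  have pt_0: "pt 0 = l" and pt_n: "pt (Suc n) = m" by (simp_all add: pt_def)
  have pt_range: "l \<le> pt i" "pt (Suc i) \<le> m" if "i < Suc n" for i
    using pt_mono[of 0 i] pt_mono[of "Suc i" "Suc n"] that by (simp_all add: pt_0 pt_n)
  have \<phi>E: "\<phi> i \<in> E" if "i < Suc n" for i
    unfolding \<phi>_def using pt_range[OF that] interval by (intro bump_E) auto
  have \<phi>_out: "\<phi> i t = 0" if "\<not> (pt i < t \<and> t < pt (Suc i))" for i t
    unfolding \<phi>_def by (rule bump_zero[OF that])
  have S_in: "S x t = x i * \<phi> i t" if i: "i < Suc n" and t: "pt i < t" "t < pt (Suc i)" for x i t
  proof -
    have "x j * \<phi> j t = 0" if "j \<in> {..<Suc n} - {i}" for j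
    proof -
      consider "Suc j \<le> i" | "Suc i \<le> j" using \<open>j \<in> {..<Suc n} - {i}\<close> by fastforce
      then have "\<not> (pt j < t \<and> t < pt (Suc j))"
        by cases (use t pt_mono[of "Suc j" i] pt_mono[of "Suc i" j] in linarith)+
      then show ?thesis by (simp add: \<phi>_out)
    qed
    then have "(\<Sum>j\<in>{..<Suc n} - {i}. x j * \<phi> j t) = 0" by (intro sum.neutral ballI)
    moreover have "S x t = x i * \<phi> i t + (\<Sum>j\<in>{..<Suc n} - {i}. x j * \<phi> j t)"
      unfolding S_def using i by (intro sum.remove) auto
    ultimately show ?thesis by simp
  qed
  have S_out: "S x t = 0" if "t \<notin> {l<..<m}" for x t
    unfolding S_def
  proof (intro sum.neutral ballI)
    fix i assume "i \<in> {..<Suc n}"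
    then show "x i * \<phi> i t = 0" using pt_range[of i] that by (auto intro!: \<phi>_out)
  qed
  have SE: "S x \<in> E" for x unfolding S_def[abs_def] by (intro E_sum \<phi>E)
  have "\<exists>M\<ge>0. \<forall>x :: nat \<Rightarrow> real. (\<forall>i<Suc n. \<bar>x i\<bar> \<le> 1) \<longrightarrow> Q (S x) \<le> M"
    unfolding S_def[abs_def] by (rule Q_sum_bounded) (rule \<phi>E)
  then obtain M0 where M0: "M0 \<ge> 0" "\<And>x :: nat \<Rightarrow> real. (\<forall>i<Suc n. \<bar>x i\<bar> \<le> 1) \<Longrightarrow> Q (S x) \<le> M0" by blast
  define M1 where "M1 = M0 + 1"
  have "M1 > 0" using M0(1) by (simp add: M1_def)
  moreover have "Q (S x) \<le> M1" if "x \<in> cube_sphere n" for x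
  proof -
    have "Q (S x) \<le> M0" using that by (intro M0(2)) (simp add: cube_sphere_def)
    then show ?thesis by (simp add: M1_def)
  qed
  ultimately have M1: "M1 > 0" "\<And>x. x \<in> cube_sphere n \<Longrightarrow> Q (S x) \<le> M1" by blast+
  obtain C where C: "C > 0" "\<And>u t. u \<in> E \<Longrightarrow> \<bar>u t\<bar> \<le> C * Q u powr (1 / p)" using E_bound by blast
  define Bd where "Bd = C * M1 powr (1 / p)"
  have Bd: "Bd > 0" using C(1) M1(1) by (simp add: Bd_def)
  have SB: "\<bar>S x t\<bar> \<le> Bd" if "x \<in> cube_sphere n" for x t
  proof -
    have "\<bar>S x t\<bar> \<le> C * Q (S x) powr (1 / p)" by (rule C(2)[OF SE])
    also have "\<dots> \<le> Bd" unfolding Bd_def using C(1) p M1(2)[OF that] by (intro mult_left_mono powr_mono2) auto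
    finally show ?thesis .
  qed
  define c where "c = Min ((\<lambda>i. \<integral>t. \<phi> i t powr r2 \<partial>M) ` {..<Suc n})"
  have c_le: "c \<le> (\<integral>t. \<phi> i t powr r2 \<partial>M)" if "i < Suc n" for i
    unfolding c_def using that by (intro Min_le) auto
  have \<phi>_int: "(\<integral>t. \<phi> i t powr r2 \<partial>M) > 0" "integrable M (\<lambda>t. \<phi> i t powr r2)" if "i < Suc n" for i
    unfolding \<phi>_def using pt_range[OF that] pt_less[of i] interval r2
    by (intro bump_powr_integral_pos; simp)+
  have "c \<in> (\<lambda>i. \<integral>t. \<phi> i t powr r2 \<partial>M) ` {..<Suc n}" unfolding c_def by (intro Min_in) auto
  then have c: "c > 0" using \<phi>_int(1) by auto
  have GM: "G M1 > 0" using G_strict_mono[of 0 M1] M1(1) by simp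
  define A where "A = \<eta> * c / (2 * G M1)"
  have A: "A > 0" using \<eta> c GM by (simp add: A_def)
  \<comment> \<open>The three bounds in turn: the chord estimate for \<open>G\<close> applies, all
    values stay in \<open>{-\<delta>..\<delta>}\<close>, and \<open>\<Phi>\<close> is at most half
    of the lower bound for \<open>\<psi>\<close>, which is how \<open>A\<close> was chosen.\<close>
  define \<rho> where "\<rho> = min 1 (min (\<delta> / Bd) (A powr (1 / (p - r2))))"
  have \<rho>: "\<rho> > 0" "\<rho> \<le> 1" "\<rho> \<le> \<delta> / Bd" "\<rho> \<le> A powr (1 / (p - r2))"
    using \<delta> Bd A by (auto simp: \<rho>_def)
  have \<rho>B: "\<rho> * Bd \<le> \<delta>" using \<rho>(3) Bd by (simp add: le_divide_eq)
  have \<rho>p: "\<rho> powr p * G M1 \<le> \<rho> powr r2 * (\<eta> * c) / 2"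
  proof -
    have "\<rho> powr (p - r2) \<le> (A powr (1 / (p - r2))) powr (p - r2)" using \<rho> r2 by (intro powr_mono2) auto
    also have "\<dots> = A" using A r2 by (simp add: powr_powr)
    finally have "\<rho> powr r2 * \<rho> powr (p - r2) \<le> \<rho> powr r2 * A" by (intro mult_left_mono) auto
    moreover have "\<rho> powr r2 * \<rho> powr (p - r2) = \<rho> powr p" by (simp add: powr_add[symmetric])
    ultimately have "\<rho> powr p * G M1 \<le> \<rho> powr r2 * A * G M1" using GM by (intro mult_right_mono) auto
    also have "\<dots> = \<rho> powr r2 * (\<eta> * c) / 2" using GM by (simp add: A_def)
    finally show ?thesis .
  qed
  define h where "h x t = \<rho> * S x t" for x t
  have hE: "h x \<in> E" for x unfolding h_def[abs_def] by (intro E_scale SE)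
  have \<Phi>h: "\<Phi> (h x) \<le> \<rho> powr p * G M1" if x: "x \<in> cube_sphere n" for x
  proof -
    have "Q (h x) = \<rho> powr p * Q (S x)" unfolding h_def[abs_def] using E_scale(2)[OF SE] \<rho>(1) by simp
    also have "\<dots> \<le> \<rho> powr p * M1" using M1(2)[OF x] by (intro mult_left_mono) auto
    finally have "\<Phi> (h x) \<le> G (\<rho> powr p * M1)" unfolding \<Phi>_def by (intro G_mono) auto
    also have "\<rho> powr p \<le> 1 powr p" using \<rho> p by (intro powr_mono2) auto
    then have "G (\<rho> powr p * M1) \<le> (\<rho> powr p * M1) * (G M1 / M1)"
      using M1(1) by (intro G_linear_bound) (auto simp: mult_le_cancel_right1)
    also have "\<dots> = \<rho> powr p * G M1" using M1(1) by simp
    finally show ?thesis .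
  qed
  have \<psi>h: "\<psi> (h x) \<ge> \<rho> powr r2 * (\<eta> * c)" if x: "x \<in> cube_sphere n" for x
  proof -
    \<comment> \<open>On the cube sphere some coordinate has modulus 1. Its bump alone gives a lower
      bound that does not depend on \<open>x\<close>, since \<open>F t (h x t)\<close> is
      nonnegative elsewhere.\<close>
    obtain i where i: "i < Suc n" "\<bar>x i\<bar> = 1" using x by (auto simp: cube_sphere_def less_Suc_eq_le)
    have pw: "\<eta> * \<rho> powr r2 * \<phi> i t powr r2 \<le> F t (h x t)" if "t \<in> {0..T}" for t
    proof (cases "t \<in> {l<..<m}")
      case True
      have "\<bar>h x t\<bar> \<le> \<rho> * Bd" unfolding h_def abs_mult using SB[OF x, of t] \<rho>(1) by (simp add: mult_left_mono)
      then have "\<bar>h x t\<bar> \<le> \<delta>" using \<rho>B by linarith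
      then have low: "F t (h x t) \<ge> \<eta> * \<bar>h x t\<bar> powr r2" using True lower by (simp add: abs_le_iff)
      show ?thesis
      proof (cases "pt i < t \<and> t < pt (Suc i)")
        case True
        then have "\<bar>h x t\<bar> = \<rho> * \<phi> i t"
          using S_in[OF i(1), of t x] i(2) \<rho>(1) bump_nonneg[of "pt i" "pt (Suc i)" t] by (simp add: h_def abs_mult \<phi>_def)
        then show ?thesis using low \<rho>(1) bump_nonneg[of "pt i" "pt (Suc i)" t] by (simp add: powr_mult \<phi>_def mult.assoc)
      next
        case False
        have "0 \<le> \<eta> * \<bar>h x t\<bar> powr r2" using \<eta> by simp
        then show ?thesis using low by (simp add: \<phi>_out[OF False])
      qed
    next
      case False
      then have "\<phi> i t = 0" using pt_range[OF i(1)] by (intro \<phi>_out) auto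
      moreover have "h x t = 0" by (simp add: h_def S_out[OF False])
      ultimately show ?thesis by (simp add: F_zero)
    qed
    have "\<rho> powr r2 * (\<eta> * c) \<le> \<rho> powr r2 * (\<eta> * (\<integral>t. \<phi> i t powr r2 \<partial>M))"
      using c_le[OF i(1)] \<eta> by (intro mult_left_mono) auto
    also have "\<dots> = (\<integral>t. \<eta> * \<rho> powr r2 * \<phi> i t powr r2 \<partial>M)" by (simp add: mult_ac)
    also have "\<dots> \<le> \<psi> (h x)"
      unfolding \<psi>_def using pw space_M \<phi>_int(2)[OF i(1)] integrable_F[OF E_spaceD(1)[OF hE]]
      by (intro integral_mono) auto
    finally show ?thesis .
  qed
  show ?thesis
  proof (rule exI[of _ h], rule exI[of _ "\<rho> powr r2 * (\<eta> * c) / 2"], rule exI[of _ "\<rho> powr p * G M1"], intro conjI ballI allI impI)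
    show "\<rho> powr r2 * (\<eta> * c) / 2 > 0" using \<rho>(1) \<eta> c by simp
    show "h x \<in> E" for x by (rule hE)
    show "h (\<lambda>i. - x i) = (\<lambda>t. - h x t)" for x by (simp add: h_def S_def sum_negf fun_eq_iff del: sum.lessThan_Suc)
    show "\<Phi> (h x) \<le> \<rho> powr p * G M1" if "x \<in> cube_sphere n" for x by (rule \<Phi>h[OF that])
    show "(\<lambda>k. h (xs k) t) \<longlonglongrightarrow> h x t" if "\<forall>j. (\<lambda>k. xs k j) \<longlonglongrightarrow> x j" for xs x t
      unfolding h_def S_def by (intro tendsto_mult tendsto_const tendsto_sum that[rule_format])
    show "\<Phi> (h x) - \<psi> (h x) \<le> - (\<rho> powr r2 * (\<eta> * c) / 2)" if "x \<in> cube_sphere n" for x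
      using \<Phi>h[OF that] \<psi>h[OF that] \<rho>p by linarith
  qed
qed

lemma infinite_solutions:
  assumes interval: "0 \<le> l" "l < m" "m \<le> T" and \<eta>: "\<eta> > 0" and \<delta>: "\<delta> > 0" and r2: "1 < r2" "r2 < p"
    and lower: "\<forall>t\<in>{l<..<m}. \<forall>x\<in>{-\<delta>..\<delta>}. F t x \<ge> \<eta> * \<bar>x\<bar> powr r2"
  shows "infinite {u. weak_solution T a b p \<alpha> f u \<and> u \<noteq> (\<lambda>t. 0)}" (is "infinite ?S")
proof
  assume fin: "finite ?S"
  obtain \<kappa> where \<kappa>: "\<kappa> > 0" "\<And>u t. u \<in> E \<Longrightarrow> \<bar>u t\<bar> \<le> \<kappa> * \<Phi> u powr (1 / p\<^sup>2)" by (rule E_pointwise_bound) (rule that)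
  interpret minimax T f d r E \<Phi> \<kappa> "p\<^sup>2"
  proof unfold_locales
    show "(\<lambda>t. 0) \<in> E" by (rule E_nonempty_zero)
    show "(\<lambda>t. a * u t + b * v t) \<in> E" if "u \<in> E" "v \<in> E" for u v a b by (rule E_lincomb(1)[OF that])
    show "continuous_on {0..T} u" if "u \<in> E" for u by (rule E_spaceD(1)[OF that])
    show "\<Phi> u \<ge> 0" for u by (simp add: \<Phi>_def G_nonneg)
    show "\<Phi> (\<lambda>t. 0) = 0" by (simp add: \<Phi>_def Q_zero)
    show "\<Phi> (\<lambda>t. - u t) = \<Phi> u" if "u \<in> E" for u by (simp add: \<Phi>_def Q_minus that)
  qed (fact \<Phi>_convex \<Phi>_strict \<kappa> r_less \<Phi>_compact \<Phi>_small)+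
  \<comment> \<open>Half of the least distance to 0 among the finitely many negative solution
    energies, so a solution with energy in \<open>[-e, 0)\<close> is a new one. The inserted 1 keeps
    the set nonempty if there is no such energy.\<close>
  define e where "e = Min (insert 1 ((\<lambda>u. - energy_fun u) ` {u \<in> ?S. energy_fun u < 0})) / 2"
  have "finite {u \<in> ?S. energy_fun u < 0}" by (rule finite_subset[OF _ fin]) auto
  then have fin': "finite (insert 1 ((\<lambda>u. - energy_fun u) ` {u \<in> ?S. energy_fun u < 0}))" by (intro finite.insertI finite_imageI)
  have e: "e > 0" unfolding e_def using fin' by (subst half_gt_zero_iff, subst Min_gr_iff) auto
  have "\<exists>u\<in>E. - e \<le> energy_fun u \<and> energy_fun u < 0 \<and> minimizer u u"
  proof (rule critical_level[OF e])
    fix n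
    obtain h :: "(nat \<Rightarrow> real) \<Rightarrow> real \<Rightarrow> real" and \<rho> B where h: "\<rho> > 0" "\<forall>x\<in>cube_sphere n. h x \<in> E"
      "\<forall>x. h (\<lambda>i. - x i) = (\<lambda>t. - h x t)" "\<forall>x\<in>cube_sphere n. \<Phi> (h x) \<le> B"
      "\<forall>xs x t. (\<forall>j. (\<lambda>k. xs k j) \<longlonglongrightarrow> x j) \<longrightarrow> (\<lambda>k. h (xs k) t) \<longlonglongrightarrow> h x t"
      "\<forall>x\<in>cube_sphere n. \<Phi> (h x) - \<psi> (h x) \<le> - \<rho>"
      using negative_sphere[OF interval \<eta> \<delta> r2 lower, of n] by (elim exE conjE) (rule that)
    have "h \<in> odd_maps n" unfolding odd_maps_def mem_Collect_eq
    proof (intro conjI exI[of _ B] ballI allI impI)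
      show "(\<lambda>k. h (xs k) t) \<longlonglongrightarrow> h x t" if "\<forall>j. (\<lambda>k. xs k j) \<longlonglongrightarrow> x j" for xs x t
        using h(5)[rule_format, OF that[rule_format]] .
    qed (use h in simp_all)
    then show "\<exists>h\<in>odd_maps n. \<exists>\<rho>>0. \<forall>x\<in>cube_sphere n. energy_fun (h x) \<le> - \<rho>"
      using h(1) h(6) unfolding energy_fun_def by (intro bexI[of _ h] exI[of _ \<rho>]) auto
  qed
  then obtain u where u: "u \<in> E" "- e \<le> energy_fun u" "energy_fun u < 0" "minimizer u u" by blast
  have "weak_solution T a b p \<alpha> f u"
    using u(4) by (intro minimizer_critical u(1)) (auto simp: minimizer_def linearized_def)
  moreover have "u \<noteq> (\<lambda>t. 0)" using u(3) \<Phi>_zero \<psi>_zero by (auto simp: energy_fun_def)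
  ultimately have "- energy_fun u \<in> insert 1 ((\<lambda>u. - energy_fun u) ` {u \<in> ?S. energy_fun u < 0})" using u(3) by auto
  from Min_le[OF fin' this] have "2 * e \<le> - energy_fun u" by (simp add: e_def)
  then show False using u(2) e by linarith
qed

end

theorem theorem1p3:
  fixes T a b p \<alpha> r1 r2 \<eta> \<delta> l m :: real
    and f :: "real \<Rightarrow> real \<Rightarrow> real"
    and d :: "real \<Rightarrow> real"
  assumes "T > 0" and "a > 0" and "b > 0" and "p > 1"
    and "1 / p < \<alpha>" and "\<alpha> \<le> 1"
    and f_cont: "continuous_on ({0..T} \<times> UNIV) (\<lambda>(t, x). f t x)"
    and r1: "1 < r1" "r1 < p\<^sup>2"
    and d_L1: "d absolutely_integrable_on {0..T}"
    and d_nonneg: "\<forall>t\<in>{0..T}. d t \<ge> 0"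
    and growth: "\<forall>t\<in>{0..T}. \<forall>x. \<bar>f t x\<bar> \<le> r1 * d t * \<bar>x\<bar> powr (r1 - 1)"
    and interval: "0 \<le> l" "l < m" "m \<le> T"
    and "\<eta> > 0" and "\<delta> > 0"
    and r2: "1 < r2" "r2 < p"
    and lower: "\<forall>t\<in>{l<..<m}. \<forall>x\<in>{-\<delta>..\<delta>}. primitive f t x \<ge> \<eta> * \<bar>x\<bar> powr r2"
    and odd: "\<forall>t\<in>{0..T}. \<forall>x. f t x = - f t (- x)"
  shows "infinite {u. weak_solution T a b p \<alpha> f u \<and> u \<noteq> (\<lambda>t. 0)}"
proof -
  have "integrable (lebesgue_on {0..T}) d"
    using d_L1 unfolding set_integrable_def by (subst integrable_restrict_space) auto
  then have d: "integrable (lebesgue_on {0..T}) (\<lambda>t. r1 * d t)" by simp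
  \<comment> \<open>The factor \<open>r1\<close> of the growth condition is absorbed into the
    weight.\<close>
  interpret kirchhoff_problem T \<alpha> p a b f "\<lambda>t. r1 * d t" r1
  proof unfold_locales
    show "f t (- x) = - f t x" if "t \<in> {0..T}" for t x
      using odd[rule_format, OF that, of "- x"] by (simp only: minus_minus)
    show "0 \<le> r1 * d t" if "t \<in> {0..T}" for t using d_nonneg that r1(1) by simp
    show "\<bar>f t x\<bar> \<le> r1 * d t * \<bar>x\<bar> powr (r1 - 1)" if "t \<in> {0..T}" for t x using growth that by simp
  qed (fact assms d)+
  show ?thesis
    by (rule infinite_solutions[OF interval \<open>\<eta> > 0\<close> \<open>\<delta> > 0\<close> r2 lower])
qed

end
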